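(* Let $m\ge2$ and $a,b\ge2$. The affine semigroup $L(a,b)$ is isomorphic to the affine semigroup of admissible weightings of $\mathbf{W}_m(a,b)$ (under entry-wise addition).
   Context: Weights. $\Lambda$ is the semigroup of dominant weights of $\mathrm{SL}_m(\mathbb{C})$: weakly decreasing $(m-1)$-tuples of non-negative integers, with fundamental weights $\omega_1,\dots,\omega_{m-1}$, $\omega_i=(1^i,0^{m-1-i})$. $V(\lambda)$ is the irreducible representation of highest weight $\lambda$. $\lambda\mapsto\lambda^*$ is the additive involution exchanging $\omega_i$ and $\omega_{m-i}$. Put $\Lambda_B=\Lambda$, $\Lambda_P=\{r\omega_1\}_{r\ge0}$, $\Lambda_{P^*}=\{s\omega_{m-1}\}_{s\ge0}$. $L(a,b)$. $L(P_1,P_2,P_3)$ is the semigroup of all $(\lambda_1,\lambda_2,\lambda_3)$ with $\lambda_i\in\Lambda_{P_i}$ and $(V(\lambda_1)\otimes V(\lambda_2)\otimes V(\lambda_3))^{\mathrm{SL}_m(\mathbb{C})}\neq0$. With $n=a+b$, let $L_1=L(P,P,B)$; $L_i=L(B,P,B)$ for $2\le i\le a-1$; $L_i=L(B,P^*,B)$ for $a\le i\le n-3$; $L_{n-2}=L(B,P^*,P^* )$. $L(a,b)\subset L_1\times\cdots\times L_{n-2}$ is the subsemigroup of tuples $((\alpha_i,\beta_i,\gamma_i))_i$ with $\gamma_i=\alpha_{i+1}^*$ for $1\le i\le n-3$. Weightings. A dominant $\mathrm{GL}_m(\mathbb{C})$ weight is a weakly decreasing $m$-tuple of integers. $\eta\prec\lambda$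 means $\lambda_i\ge\eta_i$ for $1\le i\le m$ and $\eta_i\ge\lambda_{i+1}$ for $1\le i\le m-1$. $\mathbf{W}_m(a,b)$ is the diagram with $a+b-1$ rows of $m$ entries, reading $\lambda^a,\dots,\lambda^2,\lambda^1=\eta^1,\eta^2,\dots,\eta^b$ from top to bottom. An admissible weighting (with no level condition) is a choice of dominant $\mathrm{GL}_m(\mathbb{C})$ weights $\lambda^1\prec\cdots\prec\lambda^a$, $\eta^1\prec\cdots\prec\eta^b$ with $\lambda^1=\eta^1$, $\lambda^1_m=\eta^1_m=0$, $\lambda^a_1=\cdots=\lambda^a_{m-1}$ and $\eta^b_1=\cdots=\eta^b_{m-1}$. *)

theory Defs
  imports
    "Jordan_Normal_Form.Determinant"
    "Jordan_Normal_Form.VS_Connect"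
    "HOL-Library.Function_Algebras"
    "HOL-Library.Product_Plus"
begin

text \<open>
  Tuples $(x_1,\dots,x_k)$ are functions on \<open>nat\<close> that vanish outside $\{1,\dots,k\}$, so that
  entry-wise addition is the pointwise addition of functions. Matrices in
  \<^typ>\<open>complex mat\<close> are indexed from $0$.
\<close>

section \<open>Weights of the special linear group\<close>

definition weights :: "nat \<Rightarrow> (nat \<Rightarrow> nat) set"
  where "weights m = {\<mu>. (\<forall>i j. 1 \<le> i \<and> i \<le> j \<and> j \<le> m - 1 \<longrightarrow> \<mu> j \<le> \<mu> i)
                        \<and> (\<forall>i. i \<notin> {1..m - 1} \<longrightarrow> \<mu> i = 0)}"

definition fundamental_weight :: "nat \<Rightarrow> nat \<Rightarrow> nat"
  where "fundamental_weight i = (\<lambda>j. if 1 \<le> j \<and> j \<le> i then 1 else 0)"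

text \<open>Every \<open>\<mu> \<in> weights m\<close> equals
  $\sum_{i=1}^{m-1} (\mu_i - \mu_{i+1})\,\omega_i$ (with $\mu_m = 0$).
  The involution is the additive extension of $\omega_i \mapsto \omega_{m-i}$.\<close>

definition dual_weight :: "nat \<Rightarrow> (nat \<Rightarrow> nat) \<Rightarrow> nat \<Rightarrow> nat"
  where "dual_weight m \<mu> =
    (\<lambda>j. \<Sum>i = 1..m - 1. (\<mu> i - \<mu> (i + 1)) * fundamental_weight (m - i) j)"

lemma dual_weight_fundamental:
  assumes "1 \<le> i" "i \<le> m - 1"
  shows "dual_weight m (fundamental_weight i) = fundamental_weight (m - i)"
proof
  fix j
  have "(fundamental_weight i k - fundamental_weight i (k + 1)) = (if k = i then 1 else 0)"
    if "k \<in> {1..m - 1}" for k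
    using that assms by (auto simp: fundamental_weight_def)
  then have "dual_weight m (fundamental_weight i) j =
      (\<Sum>k = 1..m - 1. if k = i then fundamental_weight (m - i) j else 0)"
    unfolding dual_weight_def by (intro sum.cong) auto
  then show "dual_weight m (fundamental_weight i) j = fundamental_weight (m - i) j"
    using assms by auto
qed

lemma weights_step:
  assumes "\<mu> \<in> weights m" "1 \<le> k"
  shows "\<mu> (k + 1) \<le> \<mu> k"
proof (cases "k + 1 \<le> m - 1")
  case True
  have "\<forall>i j. 1 \<le> i \<and> i \<le> j \<and> j \<le> m - 1 \<longrightarrow> \<mu> j \<le> \<mu> i"
    using assms(1) unfolding weights_def by blast
  from this[rule_format, of k "k + 1"] True assms(2) show ?thesis by linarith
next
  case False
  have "\<forall>i. i \<notin> {1..m - 1} \<longrightarrow> \<mu> i = 0"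
    using assms(1) unfolding weights_def by blast
  from this[rule_format, of "k + 1"] False show ?thesis by simp
qed

lemma dual_weight_add:
  assumes "\<mu> \<in> weights m" "\<nu> \<in> weights m"
  shows "dual_weight m (\<mu> + \<nu>) = dual_weight m \<mu> + dual_weight m \<nu>"
proof
  fix j
  have diff: "(\<mu> + \<nu>) k - (\<mu> + \<nu>) (k + 1) = (\<mu> k - \<mu> (k + 1)) + (\<nu> k - \<nu> (k + 1))"
    if "k \<in> {1..m - 1}" for k
    using weights_step[OF assms(1), of k] weights_step[OF assms(2), of k] that by simp
  have "dual_weight m (\<mu> + \<nu>) j =
    (\<Sum>k = 1..m - 1. (\<mu> k - \<mu> (k + 1)) * fundamental_weight (m - k) j +
                    (\<nu> k - \<nu> (k + 1)) * fundamental_weight (m - k) j)"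
    unfolding dual_weight_def by (intro sum.cong refl) (simp only: diff add_mult_distrib)
  then show "dual_weight m (\<mu> + \<nu>) j = (dual_weight m \<mu> + dual_weight m \<nu>) j"
    by (simp only: dual_weight_def sum.distrib plus_fun_apply)
qed

definition weights_P :: "(nat \<Rightarrow> nat) set"
  where "weights_P = {\<lambda>j. r * fundamental_weight 1 j | r. True}"

definition weights_P_dual :: "nat \<Rightarrow> (nat \<Rightarrow> nat) set"
  where "weights_P_dual m = {\<lambda>j. s * fundamental_weight (m - 1) j | s. True}"

section \<open>Irreducible rational representations\<close>

definition SL :: "nat \<Rightarrow> complex mat set"
  where "SL m = {g \<in> carrier_mat m m. det g = 1}"

inductive_set polynomial_functions :: "nat \<Rightarrow> (complex mat \<Rightarrow> complex) set" for m :: nat where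
  const: "(\<lambda>g. c) \<in> polynomial_functions m"
| entry: "i < m \<Longrightarrow> j < m \<Longrightarrow> (\<lambda>g. g $$ (i, j)) \<in> polynomial_functions m"
| add: "p \<in> polynomial_functions m \<Longrightarrow> q \<in> polynomial_functions m
          \<Longrightarrow> (\<lambda>g. p g + q g) \<in> polynomial_functions m"
| mult: "p \<in> polynomial_functions m \<Longrightarrow> q \<in> polynomial_functions m
          \<Longrightarrow> (\<lambda>g. p g * q g) \<in> polynomial_functions m"

text \<open>A rational representation on $\mathbb{C}^d$: since the determinant is $1$ on
  \<open>SL m\<close>, the regular functions on this group are the restrictions of polynomials in
  the matrix entries.\<close>

definition rational_rep :: "nat \<Rightarrow> nat \<Rightarrow> (complex mat \<Rightarrow> complex mat) \<Rightarrow> bool"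
  where "rational_rep m d \<rho> \<longleftrightarrow>
    (\<forall>g \<in> SL m. \<rho> g \<in> carrier_mat d d) \<and>
    \<rho> (1\<^sub>m m) = 1\<^sub>m d \<and>
    (\<forall>g \<in> SL m. \<forall>h \<in> SL m. \<rho> (g * h) = \<rho> g * \<rho> h) \<and>
    (\<forall>i < d. \<forall>j < d. \<exists>p \<in> polynomial_functions m. \<forall>g \<in> SL m. \<rho> g $$ (i, j) = p g)"

definition irreducible_rep :: "nat \<Rightarrow> nat \<Rightarrow> (complex mat \<Rightarrow> complex mat) \<Rightarrow> bool"
  where "irreducible_rep m d \<rho> \<longleftrightarrow> d > 0 \<and>
    (\<forall>U. subspace class_ring U (module_vec TYPE(complex) d) \<and>
         (\<forall>g \<in> SL m. \<forall>u \<in> U. \<rho> g *\<^sub>v u \<in> U)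
       \<longrightarrow> U = {0\<^sub>v d} \<or> U = carrier_vec d)"

text \<open>A highest weight vector is an eigenvector of the upper triangular Borel subgroup; the
  weight $\mu$ is the character
  $b \mapsto b_{11}^{\mu_1} \cdots b_{m-1,m-1}^{\mu_{m-1}}$.\<close>

definition has_highest_weight ::
    "nat \<Rightarrow> nat \<Rightarrow> (complex mat \<Rightarrow> complex mat) \<Rightarrow> (nat \<Rightarrow> nat) \<Rightarrow> bool"
  where "has_highest_weight m d \<rho> \<mu> \<longleftrightarrow>
    (\<exists>v \<in> carrier_vec d. v \<noteq> 0\<^sub>v d \<and>
      (\<forall>b \<in> SL m. upper_triangular b \<longrightarrow>
         \<rho> b *\<^sub>v v = (\<Prod>i = 1..m - 1. b $$ (i - 1, i - 1) ^ \<mu> i) \<cdot>\<^sub>v v))"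

definition is_V :: "nat \<Rightarrow> (nat \<Rightarrow> nat) \<Rightarrow> nat \<Rightarrow> (complex mat \<Rightarrow> complex mat) \<Rightarrow> bool"
  where "is_V m \<mu> d \<rho> \<longleftrightarrow>
    rational_rep m d \<rho> \<and> irreducible_rep m d \<rho> \<and> has_highest_weight m d \<rho> \<mu>"

text \<open>The Kronecker product is the matrix of $A \otimes B$ in the basis
  $e_i \otimes f_k$, numbered $i \cdot \dim + k$.\<close>

definition kronecker :: "complex mat \<Rightarrow> complex mat \<Rightarrow> complex mat"
  where "kronecker A B = mat (dim_row A * dim_row B) (dim_col A * dim_col B)
    (\<lambda>(i, j). A $$ (i div dim_row B, j div dim_col B) * B $$ (i mod dim_row B, j mod dim_col B))"

definition invariants :: "nat \<Rightarrow> nat \<Rightarrow> (complex mat \<Rightarrow> complex mat) \<Rightarrow> complex vec set"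
  where "invariants m d \<rho> = {v \<in> carrier_vec d. \<forall>g \<in> SL m. \<rho> g *\<^sub>v v = v}"

text \<open>$(V(\mu_1) \otimes V(\mu_2) \otimes V(\mu_3))^{SL_m} \neq 0$. As
  $V(\mu)$ exists and is unique up to isomorphism, it does not matter which
  models are taken.\<close>

definition has_triple_invariant ::
    "nat \<Rightarrow> (nat \<Rightarrow> nat) \<Rightarrow> (nat \<Rightarrow> nat) \<Rightarrow> (nat \<Rightarrow> nat) \<Rightarrow> bool"
  where "has_triple_invariant m \<mu>1 \<mu>2 \<mu>3 \<longleftrightarrow>
    (\<exists>d1 \<rho>1 d2 \<rho>2 d3 \<rho>3. is_V m \<mu>1 d1 \<rho>1 \<and> is_V m \<mu>2 d2 \<rho>2 \<and> is_V m \<mu>3 d3 \<rho>3 \<and>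
       invariants m (d1 * d2 * d3) (\<lambda>g. kronecker (kronecker (\<rho>1 g) (\<rho>2 g)) (\<rho>3 g))
         \<noteq> {0\<^sub>v (d1 * d2 * d3)})"

section \<open>The semigroup \<open>L(a,b)\<close>\<close>

type_synonym weight_triple = "(nat \<Rightarrow> nat) \<times> (nat \<Rightarrow> nat) \<times> (nat \<Rightarrow> nat)"

text \<open>The arguments are the weight sets $\Lambda_{P_1}, \Lambda_{P_2}, \Lambda_{P_3}$.\<close>

definition L3 ::
    "nat \<Rightarrow> (nat \<Rightarrow> nat) set \<Rightarrow> (nat \<Rightarrow> nat) set \<Rightarrow> (nat \<Rightarrow> nat) set \<Rightarrow> weight_triple set"
  where "L3 m \<Lambda>1 \<Lambda>2 \<Lambda>3 = {(\<mu>1, \<mu>2, \<mu>3).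
    \<mu>1 \<in> \<Lambda>1 \<and> \<mu>2 \<in> \<Lambda>2 \<and> \<mu>3 \<in> \<Lambda>3 \<and> has_triple_invariant m \<mu>1 \<mu>2 \<mu>3}"

definition L_factor :: "nat \<Rightarrow> nat \<Rightarrow> nat \<Rightarrow> nat \<Rightarrow> weight_triple set"
  where "L_factor m a b i =
    (if i = 1 then L3 m weights_P weights_P (weights m)
     else if i \<le> a - 1 then L3 m (weights m) weights_P (weights m)
     else if i \<le> a + b - 3 then L3 m (weights m) (weights_P_dual m) (weights m)
     else L3 m (weights m) (weights_P_dual m) (weights_P_dual m))"

definition L_ab :: "nat \<Rightarrow> nat \<Rightarrow> nat \<Rightarrow> (nat \<Rightarrow> weight_triple) set"
  where "L_ab m a b = {t.
    (\<forall>i \<in> {1..a + b - 2}. t i \<in> L_factor m a b i) \<and>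
    (\<forall>i. i \<notin> {1..a + b - 2} \<longrightarrow> t i = 0) \<and>
    (\<forall>i \<in> {1..a + b - 3}. snd (snd (t i)) = dual_weight m (fst (t (i + 1))))}"

section \<open>Admissible weightings\<close>

definition GL_weights :: "nat \<Rightarrow> (nat \<Rightarrow> int) set"
  where "GL_weights m = {\<mu>. (\<forall>i j. 1 \<le> i \<and> i \<le> j \<and> j \<le> m \<longrightarrow> \<mu> j \<le> \<mu> i)
                           \<and> (\<forall>i. i \<notin> {1..m} \<longrightarrow> \<mu> i = 0)}"

definition interlaces :: "nat \<Rightarrow> (nat \<Rightarrow> int) \<Rightarrow> (nat \<Rightarrow> int) \<Rightarrow> bool"
  where "interlaces m \<eta> \<xi> \<longleftrightarrow>
    (\<forall>i \<in> {1..m}. \<eta> i \<le> \<xi> i) \<and> (\<forall>i \<in> {1..m - 1}. \<xi> (i + 1) \<le> \<eta> i)"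

definition GL_chains :: "nat \<Rightarrow> nat \<Rightarrow> (nat \<Rightarrow> nat \<Rightarrow> int) set"
  where "GL_chains m a = {\<xi>.
    (\<forall>k \<in> {1..a}. \<xi> k \<in> GL_weights m) \<and>
    (\<forall>k. k \<notin> {1..a} \<longrightarrow> \<xi> k = 0) \<and>
    (\<forall>k \<in> {1..a - 1}. interlaces m (\<xi> k) (\<xi> (k + 1)))}"

text \<open>The common row $\xi^1 = \eta^1$ of the diagram is stored in both chains.\<close>

definition admissible_weightings ::
    "nat \<Rightarrow> nat \<Rightarrow> nat \<Rightarrow> ((nat \<Rightarrow> nat \<Rightarrow> int) \<times> (nat \<Rightarrow> nat \<Rightarrow> int)) set"
  where "admissible_weightings m a b = {(\<xi>, \<eta>).
    \<xi> \<in> GL_chains m a \<and> \<eta> \<in> GL_chains m b \<and>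
    \<xi> 1 = \<eta> 1 \<and> \<xi> 1 m = 0 \<and> \<eta> 1 m = 0 \<and>
    (\<forall>i \<in> {1..m - 1}. \<xi> a i = \<xi> a 1) \<and>
    (\<forall>i \<in> {1..m - 1}. \<eta> b i = \<eta> b 1)}"

section \<open>Affine semigroups\<close>

definition additive_monoid :: "'a::comm_monoid_add set \<Rightarrow> 'a monoid"
  where "additive_monoid S = \<lparr>carrier = S, mult = (+), one = 0\<rparr>"

text \<open>A finitely generated commutative monoid that embeds into some $\mathbb{Z}^N$.\<close>

definition affine_semigroup :: "('a, 'b) monoid_scheme \<Rightarrow> bool"
  where "affine_semigroup M \<longleftrightarrow>
    comm_monoid M \<and>
    (\<exists>F. finite F \<and> F \<subseteq> carrier M \<and> (\<forall>H. submonoid H M \<and> F \<subseteq> H \<longrightarrow> H = carrier M)) \<and>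
    (\<exists>N. \<exists>f \<in> hom M (additive_monoid {x :: nat \<Rightarrow> int. \<forall>i. i \<notin> {1..N} \<longrightarrow> x i = 0}).
       inj_on f (carrier M))"

end

theory Submission
  imports Defs "HOL-Library.FuncSet"
begin

text \<open>
  Under the duality convention, consecutive triples of a tuple in $L(a,b)$ share a weight, so the
  tuple is a sequence of weights $\nu_0, \dots, \nu_{a+b-2}$ together with the sizes of the middle
  weights. By the Pieri rule, the invariant of the $i$-th triple exists if and only if, after a
  shift of $\nu_i$ relative to $\nu_{i-1}$ by a constant determined by the size of the middle
  weight, the two weights interlace. Normalising the last entry of the common row to be $0$ turns
  these relative shifts into absolute ones, so the tuple becomes an admissible weighting, and
  conversely.

  For the necessity of the Pieri condition, contract an invariant tensor with a lowest weight
  functional on $V(\alpha)$ and a highest weight functional on $V(\gamma)$. This gives a torus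
  weight vector in $V(r\omega_1)$, a monomial of degree \<open>r\<close>, whose exponents are non-negative and
  bounded because the growth of one-parameter unipotent subgroups on the functional on $V(\alpha)$
  is bounded by $\alpha_i - \alpha_{i+1}$. For the sufficiency, the determinants of the columns of
  the rectangle multiply to an invariant of a tensor power of $\mathbb{C}^m$; its projection to the
  submodules generated by products of minors is nonzero, since pairing it with suitable translates
  of the highest weight vectors gives a sum of non-negative terms which do not all vanish.

  The weightings are the lattice points of a rational cone, hence finitely generated by Gordan's
  lemma.
\<close>

section \<open>The big cell of the special linear group\<close>

text \<open>The predicate \<open>has_triple_invariant\<close> asks for some models of the three
  modules. Necessity must therefore treat arbitrary models, while sufficiency must also construct
  the modules. For arbitrary models the substitute for structure theory is the density of the
  products of lower and upper triangular matrices in the group: matrix coefficients are polynomial,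
  so the vanishing of one need only be checked on such products, where highest weight vectors and
  lowest weight functionals merely scale. For the construction, the action on a tensor power of C^m
  takes conjugate transposes to conjugate transposes, so orthogonal projections replace complete
  reducibility.

  The Pieri rule is proved for multiples of \<omega>_1 only. The factors with multiples of
  \<omega>_{m-1} are reduced to it by twisting all three modules with the inverse transpose. This
  exchanges the smaller and the larger weight, which is why the rows of the diagram shrink down to
  the common row and grow after it.\<close>

lemma mult_mat_index:
  assumes "A \<in> carrier_mat n k" "B \<in> carrier_mat k p" "i < n" "j < p"
  shows "(A * B) $$ (i, j) = (\<Sum>l<k. A $$ (i, l) * B $$ (l, j))"
  using assms by (auto simp: scalar_prod_def lessThan_atLeast0 intro!: sum.cong)

lemma mult_mat_vec_index:
  assumes "A \<in> carrier_mat n k" "v \<in> carrier_vec k" "i < n"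
  shows "(A *\<^sub>v v) $ i = (\<Sum>l<k. A $$ (i, l) * v $ l)"
  using assms by (auto simp: scalar_prod_def lessThan_atLeast0 intro!: sum.cong)

definition diagm :: "nat \<Rightarrow> (nat \<Rightarrow> complex) \<Rightarrow> complex mat"
  where "diagm m t = mat m m (\<lambda>(i, j). if i = j then t i else 0)"

lemma diagm_carrier [simp]: "diagm m t \<in> carrier_mat m m"
  by (simp add: diagm_def)

lemma diagm_dim [simp]: "dim_row (diagm m t) = m" "dim_col (diagm m t) = m"
  by (simp_all add: diagm_def)

lemma diagm_index: "i < m \<Longrightarrow> j < m \<Longrightarrow> diagm m t $$ (i, j) = (if i = j then t i else 0)"
  by (simp add: diagm_def)

lemma mult_diagm_index:
  assumes "A \<in> carrier_mat n m" "i < n" "j < m"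
  shows "(A * diagm m t) $$ (i, j) = A $$ (i, j) * t j"
proof -
  have "(A * diagm m t) $$ (i, j) = (\<Sum>l<m. if l = j then A $$ (i, l) * t j else 0)"
    unfolding mult_mat_index[OF assms(1) diagm_carrier assms(2,3)]
    by (intro sum.cong) (use assms in \<open>auto simp: diagm_index\<close>)
  then show ?thesis using assms by simp
qed

lemma diagm_mult_index:
  assumes "A \<in> carrier_mat m n" "i < m" "j < n"
  shows "(diagm m t * A) $$ (i, j) = t i * A $$ (i, j)"
proof -
  have "(diagm m t * A) $$ (i, j) = (\<Sum>l<m. if l = i then t i * A $$ (l, j) else 0)"
    unfolding mult_mat_index[OF diagm_carrier assms]
    by (intro sum.cong) (use assms in \<open>auto simp: diagm_index\<close>)
  then show ?thesis using assms by simp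
qed

section \<open>Triangular determinants and limits of polynomial functions\<close>

lemma det_upper:
  fixes A :: "complex mat"
  assumes "A \<in> carrier_mat n n" "\<And>i j. i < n \<Longrightarrow> j < i \<Longrightarrow> A $$ (i, j) = 0"
  shows "det A = (\<Prod>i<n. A $$ (i, i))"
proof -
  have "upper_triangular A" using assms by auto
  then have "det A = prod_list (diag_mat A)" using det_upper_triangular assms by blast
  then show ?thesis using assms by (simp add: prod_list_diag_prod lessThan_atLeast0)
qed

lemma det_lower:
  fixes A :: "complex mat"
  assumes "A \<in> carrier_mat n n" "\<And>i j. i < n \<Longrightarrow> j < n \<Longrightarrow> i < j \<Longrightarrow> A $$ (i, j) = 0"
  shows "det A = (\<Prod>i<n. A $$ (i, i))"
proof -
  have "det A = prod_list (diag_mat A)"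
    using det_lower_triangular[of n A] assms by auto
  then show ?thesis using assms by (simp add: prod_list_diag_prod lessThan_atLeast0)
qed

lemma det_diagm: "det (diagm m t) = (\<Prod>i<m. t i)"
  by (subst det_upper[of _ m]) (auto simp: diagm_index intro!: prod.cong)

lemma det_tendsto:
  fixes X :: "'x \<Rightarrow> complex mat"
  assumes "\<And>n. X n \<in> carrier_mat m m" "A \<in> carrier_mat m m"
    "\<And>i j. i < m \<Longrightarrow> j < m \<Longrightarrow> ((\<lambda>n. X n $$ (i, j)) \<longlongrightarrow> A $$ (i, j)) F"
  shows "((\<lambda>n. det (X n)) \<longlongrightarrow> det A) F"
proof -
  have "((\<lambda>n. \<Sum>p\<in>{p. p permutes {0..<m}}. signof p * (\<Prod>i = 0..<m. X n $$ (i, p i)))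
      \<longlongrightarrow> (\<Sum>p\<in>{p. p permutes {0..<m}}. signof p * (\<Prod>i = 0..<m. A $$ (i, p i)))) F"
  proof (rule tendsto_sum, rule tendsto_mult[OF tendsto_const], rule tendsto_prod)
    fix p i assume "p \<in> {p. p permutes {0..<m}}" "i \<in> {0..<m}"
    then have "i < m" "p i < m" using permutes_in_image[of p "{0..<m}" i] by auto
    then show "((\<lambda>n. X n $$ (i, p i)) \<longlongrightarrow> A $$ (i, p i)) F" by (rule assms(3))
  qed
  then show ?thesis using det_def'[OF assms(1)] det_def'[OF assms(2)] by simp
qed

lemma polynomial_functions_tendsto:
  assumes "p \<in> polynomial_functions m"
    "\<And>i j. i < m \<Longrightarrow> j < m \<Longrightarrow> ((\<lambda>n. X n $$ (i, j)) \<longlongrightarrow> A $$ (i, j)) F"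
  shows "((\<lambda>n. p (X n)) \<longlongrightarrow> p A) F"
  using assms by (induction rule: polynomial_functions.induct) (auto intro!: tendsto_intros)

section \<open>Triangular subgroups and the density of their product\<close>

definition SL_upper :: "nat \<Rightarrow> complex mat set"
  where "SL_upper m = {b \<in> SL m. \<forall>i<m. \<forall>j<i. b $$ (i, j) = 0}"

definition SL_lower :: "nat \<Rightarrow> complex mat set"
  where "SL_lower m = {b \<in> SL m. \<forall>i<m. \<forall>j<m. i < j \<longrightarrow> b $$ (i, j) = 0}"

lemma SL_carrier: "g \<in> SL m \<Longrightarrow> g \<in> carrier_mat m m"
  by (simp add: SL_def)

lemma SL_upperD: "b \<in> SL_upper m \<Longrightarrow> b \<in> SL m" "b \<in> SL_upper m \<Longrightarrow> i < m \<Longrightarrow> j < i \<Longrightarrow> b $$ (i, j) = 0"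
  by (auto simp: SL_upper_def)

lemma SL_lowerD: "b \<in> SL_lower m \<Longrightarrow> b \<in> SL m"
  "b \<in> SL_lower m \<Longrightarrow> i < j \<Longrightarrow> j < m \<Longrightarrow> b $$ (i, j) = 0"
  by (auto simp: SL_lower_def)

lemma SL_mult: "g \<in> SL m \<Longrightarrow> h \<in> SL m \<Longrightarrow> g * h \<in> SL m"
  by (auto simp: SL_def det_mult)

lemma SL_one: "1\<^sub>m m \<in> SL m"
  by (auto simp: SL_def)

lemma SL_inverse:
  assumes "g \<in> SL m"
  obtains h where "h \<in> SL m" "g * h = 1\<^sub>m m" "h * g = 1\<^sub>m m"
proof -
  from assms have g: "g \<in> carrier_mat m m" "det g = 1" by (auto simp: SL_def)
  have a: "adj_mat g \<in> carrier_mat m m" "g * adj_mat g = 1\<^sub>m m" "adj_mat g * g = 1\<^sub>m m"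
    using adj_mat[OF g(1)] g(2) by auto
  have "det g * det (adj_mat g) = 1"
    using det_mult[OF g(1) a(1)] a(2) by simp
  then have "det (adj_mat g) = 1" using g(2) by simp
  then show ?thesis using a that by (auto simp: SL_def)
qed

lemma diagm_SL: "(\<Prod>i<m. t i) = 1 \<Longrightarrow> diagm m t \<in> SL m"
  by (auto simp: SL_def det_diagm)

lemma diagm_SL_upper: "(\<Prod>i<m. t i) = 1 \<Longrightarrow> diagm m t \<in> SL_upper m"
  by (auto simp: SL_upper_def diagm_SL diagm_index)

lemma diagm_SL_lower: "(\<Prod>i<m. t i) = 1 \<Longrightarrow> diagm m t \<in> SL_lower m"
  by (auto simp: SL_lower_def diagm_SL diagm_index)

text \<open>When the corner entry is $0$ it is perturbed, and then the Schur complement is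
  factorised.\<close>

lemma LU_approx:
  fixes A :: "complex mat"
  assumes "A \<in> carrier_mat n n" "\<epsilon> > 0"
  shows "\<exists>L U. L \<in> carrier_mat n n \<and> U \<in> carrier_mat n n \<and>
    (\<forall>i<n. L $$ (i, i) = 1) \<and> (\<forall>i<n. \<forall>j<n. i < j \<longrightarrow> L $$ (i, j) = 0) \<and>
    (\<forall>i<n. \<forall>j<i. U $$ (i, j) = 0) \<and>
    (\<forall>i<n. \<forall>j<n. cmod ((L * U) $$ (i, j) - A $$ (i, j)) < \<epsilon>)"
  using assms(1)
proof (induction n arbitrary: A)
  case 0
  show ?case by (intro exI[of _ "mat 0 0 (\<lambda>_. 0)"]) auto
next
  case (Suc n)
  define a where "a = (if A $$ (0, 0) = 0 then of_real (\<epsilon> / 2) else A $$ (0, 0))"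
  have a: "a \<noteq> 0" "cmod (a - A $$ (0, 0)) < \<epsilon>" using assms(2) by (auto simp: a_def)
  define S where "S = mat n n (\<lambda>(i, j). A $$ (Suc i, Suc j) - A $$ (Suc i, 0) * A $$ (0, Suc j) / a)"
  obtain L' U' where LU: "L' \<in> carrier_mat n n" "U' \<in> carrier_mat n n"
    "\<forall>i<n. L' $$ (i, i) = 1" "\<forall>i<n. \<forall>j<n. i < j \<longrightarrow> L' $$ (i, j) = 0"
    "\<forall>i<n. \<forall>j<i. U' $$ (i, j) = 0"
    "\<forall>i<n. \<forall>j<n. cmod ((L' * U') $$ (i, j) - S $$ (i, j)) < \<epsilon>"
    using Suc.IH[of S] by (auto simp: S_def)
  define L where "L = mat (Suc n) (Suc n) (\<lambda>(i, j). if j = 0 then (if i = 0 then 1 else A $$ (i, 0) / a)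
     else if i = 0 then 0 else L' $$ (i - 1, j - 1))"
  define U where "U = mat (Suc n) (Suc n) (\<lambda>(i, j). if i = 0 then (if j = 0 then a else A $$ (0, j))
     else if j = 0 then 0 else U' $$ (i - 1, j - 1))"
  have c: "L \<in> carrier_mat (Suc n) (Suc n)" "U \<in> carrier_mat (Suc n) (Suc n)"
    by (auto simp: L_def U_def)
  have "cmod ((L * U) $$ (i, j) - A $$ (i, j)) < \<epsilon>" if ij: "i < Suc n" "j < Suc n" for i j
  proof -
    have e: "(L * U) $$ (i, j) = L $$ (i, 0) * U $$ (0, j) + (\<Sum>l<n. L $$ (i, Suc l) * U $$ (Suc l, j))"
      unfolding mult_mat_index[OF c ij] by (rule sum.lessThan_Suc_shift)
    show ?thesis
    proof (cases "i = 0 \<or> j = 0")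
      case True
      then have "(\<Sum>l<n. L $$ (i, Suc l) * U $$ (Suc l, j)) = 0"
        using ij by (auto intro!: sum.neutral simp: L_def U_def)
      with e show ?thesis using True a ij assms(2) by (auto simp: L_def U_def)
    next
      case False
      then obtain i' j' where ij': "i = Suc i'" "j = Suc j'" by (metis not0_implies_Suc)
      have "(\<Sum>l<n. L $$ (i, Suc l) * U $$ (Suc l, j)) = (\<Sum>l<n. L' $$ (i', l) * U' $$ (l, j'))"
        using ij ij' by (intro sum.cong) (auto simp: L_def U_def)
      also have "\<dots> = (L' * U') $$ (i', j')"
        using mult_mat_index[OF LU(1,2), of i' j'] ij ij' by auto
      finally have "(L * U) $$ (i, j) - A $$ (i, j) = (L' * U') $$ (i', j') - S $$ (i', j')"
        unfolding e using ij ij' by (auto simp: L_def U_def S_def)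
      then show ?thesis using LU(6) ij ij' by auto
    qed
  qed
  moreover have "\<forall>i<Suc n. L $$ (i, i) = 1" "\<forall>i<Suc n. \<forall>j<Suc n. i < j \<longrightarrow> L $$ (i, j) = 0"
    "\<forall>i<Suc n. \<forall>j<i. U $$ (i, j) = 0"
    using LU(3-5) by (auto simp: L_def U_def)
  ultimately show ?case using c by (intro exI[of _ L] exI[of _ U] conjI) simp_all
qed

text \<open>The products from \<open>LU_approx\<close> converge to \<open>g\<close>, but their
  determinants \<open>\<delta> n\<close> only tend to 1. Dividing the first column by
  \<open>\<delta> n\<close> corrects the determinant without changing the limit; being a right
  multiplication by a diagonal matrix, it is absorbed into the upper triangular factor.\<close>

lemma big_cell_dense:
  assumes g: "g \<in> SL m" and m: "m \<ge> 1"
  obtains X where "\<And>i j. i < m \<Longrightarrow> j < m \<Longrightarrow> (\<lambda>n. X n $$ (i, j)) \<longlonglongrightarrow> g $$ (i, j)"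
    "\<forall>\<^sub>F n in sequentially. \<exists>l \<in> SL_lower m. \<exists>u \<in> SL_upper m. X n = l * u"
proof -
  have gc: "g \<in> carrier_mat m m" and dg: "det g = 1" using g by (auto simp: SL_def)
  define Q where "Q n L U \<longleftrightarrow> L \<in> carrier_mat m m \<and> U \<in> carrier_mat m m \<and>
    (\<forall>i<m. L $$ (i, i) = 1) \<and> (\<forall>i<m. \<forall>j<m. i < j \<longrightarrow> L $$ (i, j) = 0) \<and>
    (\<forall>i<m. \<forall>j<i. U $$ (i, j) = 0) \<and>
    (\<forall>i<m. \<forall>j<m. cmod ((L * U) $$ (i, j) - g $$ (i, j)) < inverse (real (Suc n)))" for n L U
  have "\<forall>n. \<exists>L U. Q n L U"
    unfolding Q_def using LU_approx[OF gc] by auto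
  then obtain L U where LU: "\<And>n. Q n (L n) (U n)" by metis
  then have c: "\<And>n. L n \<in> carrier_mat m m" "\<And>n. U n \<in> carrier_mat m m"
    by (auto simp: Q_def)
  have lim: "(\<lambda>n. (L n * U n) $$ (i, j)) \<longlonglongrightarrow> g $$ (i, j)" if "i < m" "j < m" for i j
  proof (rule LIM_zero_cancel, rule tendsto_0_le[where K = 1])
    show "(\<lambda>n. inverse (real (Suc n))) \<longlonglongrightarrow> 0" by (rule LIMSEQ_inverse_real_of_nat)
    show "\<forall>\<^sub>F n in sequentially. norm ((L n * U n) $$ (i, j) - g $$ (i, j)) \<le> norm (inverse (real (Suc n))) * 1"
      using LU that by (intro always_eventually allI) (auto simp: Q_def less_imp_le)
  qed
  define \<delta> where "\<delta> n = det (L n * U n)" for n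
  have \<delta>lim: "\<delta> \<longlonglongrightarrow> 1"
    unfolding \<delta>_def using det_tendsto[of "\<lambda>n. L n * U n" m g sequentially] lim gc mult_carrier_mat[OF c] dg
    by (auto simp del: index_mult_mat(1))
  define t where "t n i = (if i = (0::nat) then inverse (\<delta> n) else 1)" for n i
  define X where "X n = (L n * U n) * diagm m (t n)" for n
  have tlim: "(\<lambda>n. t n i) \<longlonglongrightarrow> 1" for i
    using tendsto_inverse[OF \<delta>lim] by (cases "i = 0") (auto simp: t_def)
  have "(\<lambda>n. X n $$ (i, j)) \<longlonglongrightarrow> g $$ (i, j)" if "i < m" "j < m" for i j
  proof -
    have "X n $$ (i, j) = (L n * U n) $$ (i, j) * t n j" for n
      unfolding X_def by (rule mult_diagm_index[OF mult_carrier_mat[OF c] that])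
    then show ?thesis using tendsto_mult[OF lim[OF that] tlim[of j]] by simp
  qed
  moreover have "\<forall>\<^sub>F n in sequentially. \<exists>l \<in> SL_lower m. \<exists>u \<in> SL_upper m. X n = l * u"
  proof -
    have "\<forall>\<^sub>F n in sequentially. \<delta> n \<noteq> 0"
      using tendsto_imp_eventually_ne[OF \<delta>lim] by simp
    then show ?thesis
    proof eventually_elim
      case (elim n)
      have dL: "det (L n) = 1"
        using LU[of n] by (subst det_lower[of _ m]) (auto simp: Q_def)
      then have dU: "det (U n) = \<delta> n"
        unfolding \<delta>_def using det_mult[OF c(1) c(2)] by simp
      have "(\<Prod>i<m. t n i) = inverse (\<delta> n)"
        using m by (simp add: t_def prod.delta)
      then have "U n * diagm m (t n) \<in> SL_upper m"
        using dU elim LU[of n] c mult_carrier_mat[OF c(2) diagm_carrier] by (auto simp: SL_upper_def SL_def det_mult[of _ m] det_diagm mult_diagm_index[of _ m m] Q_def simp del: index_mult_mat(1))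
      moreover have "L n \<in> SL_lower m"
        using dL LU[of n] by (auto simp: SL_lower_def SL_def Q_def)
      moreover have "X n = L n * (U n * diagm m (t n))"
        unfolding X_def by (rule assoc_mult_mat[OF c diagm_carrier])
      ultimately show ?case by blast
    qed
  qed
  ultimately show ?thesis using that by blast
qed

text \<open>The identity principle behind all later arguments with matrix coefficients: a polynomial
  function is continuous in the entries, so its zero set contains the limits of products from the
  big cell.\<close>

lemma polynomial_zero_of_big_cell:
  assumes "p \<in> polynomial_functions m" "m \<ge> 1" "g \<in> SL m"
    "\<And>l u. l \<in> SL_lower m \<Longrightarrow> u \<in> SL_upper m \<Longrightarrow> p (l * u) = 0"
  shows "p g = 0"
proof -
  obtain X where X: "\<And>i j. i < m \<Longrightarrow> j < m \<Longrightarrow> (\<lambda>n. X n $$ (i, j)) \<longlonglongrightarrow> g $$ (i, j)"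
    "\<forall>\<^sub>F n in sequentially. \<exists>l \<in> SL_lower m. \<exists>u \<in> SL_upper m. X n = l * u"
    using big_cell_dense[OF assms(3,2)] by blast
  have "(\<lambda>n. p (X n)) \<longlonglongrightarrow> p g"
    using polynomial_functions_tendsto[OF assms(1), of X g] X(1) by blast
  moreover have "\<forall>\<^sub>F n in sequentially. p (X n) = 0"
    using X(2) by eventually_elim (use assms(4) in auto)
  ultimately show ?thesis
    using tendsto_unique[OF _ _ tendsto_eventually] by (metis sequentially_bot)
qed

section \<open>Subspaces and orthonormal bases\<close>

lemma nonzero_vec_entry:
  assumes "w \<in> carrier_vec d" "w \<noteq> 0\<^sub>v d"
  obtains l where "l < d" "w $ l \<noteq> 0"
proof -
  have "w = 0\<^sub>v d" if "\<forall>l<d. w $ l = 0" using that assms(1) by (intro eq_vecI) auto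
  then show thesis using assms(2) that by blast
qed

text \<open>An elementary form of \<open>subspace\<close> for \<open>module_vec\<close>;
  \<open>csubspace_iff\<close> links the two, so that later arguments need not unfold the module
  records.\<close>

definition csubspace :: "nat \<Rightarrow> complex vec set \<Rightarrow> bool"
  where "csubspace d U \<longleftrightarrow> U \<subseteq> carrier_vec d \<and> 0\<^sub>v d \<in> U \<and>
    (\<forall>u\<in>U. \<forall>w\<in>U. u + w \<in> U) \<and> (\<forall>c. \<forall>u\<in>U. c \<cdot>\<^sub>v u \<in> U)"

lemma csubspaceI:
  assumes "U \<subseteq> carrier_vec d" "0\<^sub>v d \<in> U" "\<And>u w. u \<in> U \<Longrightarrow> w \<in> U \<Longrightarrow> u + w \<in> U"
    "\<And>c u. u \<in> U \<Longrightarrow> c \<cdot>\<^sub>v u \<in> U"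
  shows "csubspace d U"
  using assms unfolding csubspace_def by blast

lemma csubspaceD:
  assumes "csubspace d U"
  shows "U \<subseteq> carrier_vec d" "0\<^sub>v d \<in> U" "u \<in> U \<Longrightarrow> w \<in> U \<Longrightarrow> u + w \<in> U" "u \<in> U \<Longrightarrow> c \<cdot>\<^sub>v u \<in> U"
  using assms unfolding csubspace_def by auto

lemma csubspace_diff:
  assumes "csubspace d U" "u \<in> U" "w \<in> U"
  shows "u - w \<in> U"
proof -
  have c: "u \<in> carrier_vec d" "w \<in> carrier_vec d" using csubspaceD(1)[OF assms(1)] assms(2,3) by auto
  then have "u - w = u + (-1) \<cdot>\<^sub>v w" by auto
  then show ?thesis using csubspaceD[OF assms(1)] assms(2,3) by simp
qed

lemma csubspace_iff: "csubspace d U \<longleftrightarrow> subspace class_ring U (module_vec TYPE(complex) d)"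
proof -
  have v: "vectorspace class_ring (module_vec TYPE(complex) d)" by (rule vec_vs)
  then have m: "module class_ring (module_vec TYPE(complex) d)" by (simp add: vectorspace_def)
  show ?thesis
    unfolding subspace_def submodule_def csubspace_def using v m
    by (auto simp: module_vec_simps class_ring_simps)
qed

section \<open>Conjugate transposes, isometries and annihilators\<close>

definition dagger :: "complex mat \<Rightarrow> complex mat"
  where "dagger A = mat (dim_col A) (dim_row A) (\<lambda>(i, j). cnj (A $$ (j, i)))"

lemma dagger_carrier [simp]: "dagger A \<in> carrier_mat n k \<longleftrightarrow> A \<in> carrier_mat k n"
  unfolding carrier_mat_def dagger_def mem_Collect_eq dim_row_mat dim_col_mat by blast

lemma dagger_dim [simp]: "dim_row (dagger A) = dim_col A" "dim_col (dagger A) = dim_row A"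
  by (auto simp: dagger_def)

lemma dagger_index [simp]: "i < dim_col A \<Longrightarrow> j < dim_row A \<Longrightarrow> dagger A $$ (i, j) = cnj (A $$ (j, i))"
  by (auto simp: dagger_def)

lemma dagger_dagger [simp]: "dagger (dagger A) = A"
  by (intro eq_matI) auto

lemma dagger_mult:
  assumes "A \<in> carrier_mat n k" "B \<in> carrier_mat k p"
  shows "dagger (A * B) = dagger B * dagger A"
proof (intro eq_matI)
  fix i j assume "i < dim_row (dagger B * dagger A)" "j < dim_col (dagger B * dagger A)"
  then have ij: "i < p" "j < n" using assms by auto
  have "(dagger B * dagger A) $$ (i, j) = (\<Sum>l<k. dagger B $$ (i, l) * dagger A $$ (l, j))"
    using assms ij by (intro mult_mat_index[of _ p k _ n]) auto
  also have "\<dots> = cnj (\<Sum>l<k. A $$ (j, l) * B $$ (l, i))"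
    using assms ij by (auto simp: mult.commute intro!: sum.cong)
  also have "\<dots> = dagger (A * B) $$ (i, j)"
    using assms ij mult_mat_index[OF assms ij(2,1)] by simp
  finally show "dagger (A * B) $$ (i, j) = (dagger B * dagger A) $$ (i, j)" by simp
qed (use assms in auto)

text \<open>If \<open>d < k\<close>, padding \<open>K\<close> with zero rows gives a square matrix
  with left inverse \<open>dagger K'\<close>. This is then also a right inverse, which the zero row
  of index \<open>d\<close> forbids.\<close>

lemma isometry_dim:
  assumes K: "K \<in> carrier_mat d k" "dagger K * K = 1\<^sub>m k"
  shows "k \<le> d"
proof (rule ccontr)
  assume "\<not> k \<le> d"
  then have kd: "d < k" by simp
  define K' where "K' = mat k k (\<lambda>(i, j). if i < d then K $$ (i, j) else 0)"
  have c: "K' \<in> carrier_mat k k" "dagger K' \<in> carrier_mat k k" by (auto simp: K'_def)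
  have "dagger K' * K' = 1\<^sub>m k"
  proof (intro eq_matI)
    fix i j assume "i < dim_row (1\<^sub>m k)" "j < dim_col (1\<^sub>m k)"
    then have ij: "i < k" "j < k" by auto
    have "(dagger K' * K') $$ (i, j) = (\<Sum>l<k. cnj (K' $$ (l, i)) * K' $$ (l, j))"
      unfolding mult_mat_index[OF c(2,1) ij] using ij c by (intro sum.cong) auto
    also have "\<dots> = (\<Sum>l<d. cnj (K $$ (l, i)) * K $$ (l, j))"
      using kd ij by (intro sum.mono_neutral_cong_right) (auto simp: K'_def)
    also have "\<dots> = (dagger K * K) $$ (i, j)"
      using mult_mat_index[of "dagger K" k d K k i j] K(1) ij by auto
    finally show "(dagger K' * K') $$ (i, j) = 1\<^sub>m k $$ (i, j)" using K by simp
  qed (auto simp: K'_def)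
  then have "K' * dagger K' = 1\<^sub>m k" by (rule mat_mult_left_right_inverse[OF c(2,1)])
  then have "1 = (K' * dagger K') $$ (d, d)" using kd by simp
  also have "\<dots> = (\<Sum>l<k. K' $$ (d, l) * dagger K' $$ (l, d))" by (rule mult_mat_index[OF c kd kd])
  also have "\<dots> = 0" using kd by (intro sum.neutral) (auto simp: K'_def)
  finally show False by simp
qed

text \<open>Take an isometry into \<open>U\<close> with the largest number of columns, which
  \<open>isometry_dim\<close> bounds. If some \<open>u\<close> in \<open>U\<close> were not fixed by
  \<open>K * dagger K\<close>, its normalised residual could be added as a further column.\<close>

lemma exists_orthonormal_basis:
  assumes U: "csubspace d U"
  obtains K k where "K \<in> carrier_mat d k" "dagger K * K = 1\<^sub>m k"
    "\<forall>x \<in> carrier_vec k. K *\<^sub>v x \<in> U" "\<forall>u \<in> U. K *\<^sub>v (dagger K *\<^sub>v u) = u"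
proof -
  define P where "P k \<longleftrightarrow> (\<exists>K. K \<in> carrier_mat d k \<and> dagger K * K = 1\<^sub>m k \<and>
    (\<forall>x \<in> carrier_vec k. K *\<^sub>v x \<in> U))" for k
  have z: "(mat d 0 (\<lambda>_. 0) :: complex mat) *\<^sub>v x = 0\<^sub>v d" if "x \<in> carrier_vec 0" for x
    using that by (intro eq_vecI) (auto simp: scalar_prod_def)
  have "P 0" unfolding P_def
    by (intro exI[of _ "mat d 0 (\<lambda>_. 0)"] conjI ballI)
       (use csubspaceD(2)[OF U] in \<open>auto simp: z\<close>)
  moreover have bound: "\<forall>k. P k \<longrightarrow> k \<le> d" unfolding P_def using isometry_dim by blast
  ultimately obtain k where k: "P k" "\<And>k'. P k' \<Longrightarrow> k' \<le> k"
    using Greatest_le_nat[of P _ d] GreatestI_nat[of P 0 d] by blast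
  then obtain K where K: "K \<in> carrier_mat d k" "dagger K * K = 1\<^sub>m k"
    "\<And>x. x \<in> carrier_vec k \<Longrightarrow> K *\<^sub>v x \<in> U" unfolding P_def by blast
  have dK: "dagger K \<in> carrier_mat k d" using K by simp
  have K4: "K *\<^sub>v (dagger K *\<^sub>v u) = u" if uU: "u \<in> U" for u
  proof (rule ccontr)
    assume ne: "K *\<^sub>v (dagger K *\<^sub>v u) \<noteq> u"
    have u: "u \<in> carrier_vec d" using uU csubspaceD(1)[OF U] by auto
    have Ku: "dagger K *\<^sub>v u \<in> carrier_vec k" using dK u by auto
    define w where "w = u - K *\<^sub>v (dagger K *\<^sub>v u)"
    have wU: "w \<in> U" unfolding w_def by (intro csubspace_diff[OF U] uU K(3) Ku)
    have w: "w \<in> carrier_vec d" using wU csubspaceD(1)[OF U] by auto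
    have "dagger K *\<^sub>v w = dagger K *\<^sub>v u - dagger K *\<^sub>v (K *\<^sub>v (dagger K *\<^sub>v u))"
      unfolding w_def by (rule mult_minus_distrib_mat_vec[OF dK u]) (use K Ku in auto)
    moreover have "dagger K *\<^sub>v (K *\<^sub>v (dagger K *\<^sub>v u)) = dagger K *\<^sub>v u"
      using assoc_mult_mat_vec[OF dK K(1) Ku] K(2) Ku by simp
    ultimately have Kw: "dagger K *\<^sub>v w = 0\<^sub>v k" using Ku by auto
    define N where "N = (\<Sum>l<d. (cmod (w $ l))\<^sup>2)"
    have "\<exists>l<d. w $ l \<noteq> 0"
    proof (rule ccontr)
      assume "\<not> ?thesis"
      then have "w = 0\<^sub>v d" using w by (intro eq_vecI) auto
      then have "\<And>i. i < d \<Longrightarrow> (u - K *\<^sub>v (dagger K *\<^sub>v u)) $ i = 0" unfolding w_def by simp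
      then have "K *\<^sub>v (dagger K *\<^sub>v u) = u"
        using u K(1) by (intro eq_vecI) (auto simp del: index_mult_mat_vec)
      with ne show False by simp
    qed
    then obtain l where l: "l < d" "w $ l \<noteq> 0" by blast
    have "(cmod (w $ l))\<^sup>2 \<le> N" unfolding N_def
      using l by (intro member_le_sum) auto
    then have N: "N > 0" using l by (smt (verit) zero_less_norm_iff zero_less_power)
    define c where "c = complex_of_real (inverse (sqrt N))"
    have cc: "cnj c * c * of_real N = 1"
      using N by (simp add: c_def field_simps flip: of_real_mult)
    have NN: "(\<Sum>l<d. cnj (w $ l) * w $ l) = of_real N"
      unfolding N_def by (simp add: complex_norm_square mult.commute del: of_real_power)
    define w' where "w' = c \<cdot>\<^sub>v w"
    have w': "w' \<in> carrier_vec d" "w' \<in> U" using w wU csubspaceD(4)[OF U] by (auto simp: w'_def)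
    define K' where "K' = mat d (Suc k) (\<lambda>(i, j). if j < k then K $$ (i, j) else w' $ i)"
    have cK: "K' \<in> carrier_mat d (Suc k)" by (auto simp: K'_def)
    have orth: "(\<Sum>l<d. cnj (K $$ (l, i)) * w $ l) = 0" if "i < k" for i
    proof -
      have "(\<Sum>l<d. cnj (K $$ (l, i)) * w $ l) = (dagger K *\<^sub>v w) $ i"
        unfolding mult_mat_vec_index[OF dK w that] using K that by (intro sum.cong) auto
      then show ?thesis using Kw that by simp
    qed
    have "dagger K' * K' = 1\<^sub>m (Suc k)"
    proof (intro eq_matI)
      fix i j assume "i < dim_row (1\<^sub>m (Suc k))" "j < dim_col (1\<^sub>m (Suc k))"
      then have ij: "i < Suc k" "j < Suc k" by auto
      have e: "(dagger K' * K') $$ (i, j) = (\<Sum>l<d. cnj (K' $$ (l, i)) * K' $$ (l, j))"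
        using ij cK by (subst mult_mat_index[of _ "Suc k" d _ "Suc k"]) (auto intro!: sum.cong)
      consider "i < k" "j < k" | "i < k" "j = k" | "i = k" "j < k" | "i = k" "j = k"
        using ij by linarith
      then show "(dagger K' * K') $$ (i, j) = 1\<^sub>m (Suc k) $$ (i, j)"
      proof cases
        case 1
        have "(dagger K * K) $$ (i, j) = (\<Sum>l<d. cnj (K $$ (l, i)) * K $$ (l, j))"
          using 1 K(1) by (subst mult_mat_index[of _ k d _ k]) (auto intro!: sum.cong)
        also have "\<dots> = (dagger K' * K') $$ (i, j)"
          unfolding e using 1 by (intro sum.cong) (auto simp: K'_def)
        finally show ?thesis using K(2) 1 by simp
      next
        case 2
        have "(dagger K' * K') $$ (i, j) = (\<Sum>l<d. c * (cnj (K $$ (l, i)) * w $ l))"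
          unfolding e using 2 w by (intro sum.cong) (auto simp: K'_def w'_def)
        then show ?thesis using 2 orth by (simp flip: sum_distrib_left)
      next
        case 3
        have "(dagger K' * K') $$ (i, j) = (\<Sum>l<d. cnj c * cnj (cnj (K $$ (l, j)) * w $ l))"
          unfolding e using 3 w by (intro sum.cong) (auto simp: K'_def w'_def)
        also have "\<dots> = cnj c * cnj (\<Sum>l<d. cnj (K $$ (l, j)) * w $ l)"
          by (simp add: sum_distrib_left)
        finally show ?thesis using 3 orth by simp
      next
        case 4
        have "(dagger K' * K') $$ (i, j) = (\<Sum>l<d. cnj c * c * (cnj (w $ l) * w $ l))"
          unfolding e using 4 w by (intro sum.cong) (auto simp: K'_def w'_def)
        also have "\<dots> = cnj c * c * of_real N" unfolding NN[symmetric] by (simp add: sum_distrib_left)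
        finally show ?thesis using 4 cc by simp
      qed
    qed (auto simp: K'_def)
    moreover have "K' *\<^sub>v x \<in> U" if x: "x \<in> carrier_vec (Suc k)" for x
    proof -
      define y where "y = vec k (\<lambda>i. x $ i)"
      have y: "y \<in> carrier_vec k" by (simp add: y_def)
      have "K' *\<^sub>v x = K *\<^sub>v y + x $ k \<cdot>\<^sub>v w'"
      proof (intro eq_vecI)
        fix i assume "i < dim_vec (K *\<^sub>v y + x $ k \<cdot>\<^sub>v w')"
        then have i: "i < d" using w' by simp
        have "(K' *\<^sub>v x) $ i = (\<Sum>l<k. K' $$ (i, l) * x $ l) + K' $$ (i, k) * x $ k"
          unfolding mult_mat_vec_index[OF cK x i] by simp
        also have "(\<Sum>l<k. K' $$ (i, l) * x $ l) = (K *\<^sub>v y) $ i"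
          unfolding mult_mat_vec_index[OF K(1) y i] using i by (intro sum.cong) (auto simp: K'_def y_def)
        finally show "(K' *\<^sub>v x) $ i = (K *\<^sub>v y + x $ k \<cdot>\<^sub>v w') $ i"
          using i w' K by (simp add: K'_def mult.commute del: index_mult_mat_vec)
      qed (use w' in \<open>auto simp: K'_def\<close>)
      then show ?thesis using K(3)[OF y] w' csubspaceD[OF U] by simp
    qed
    ultimately have "P (Suc k)" unfolding P_def using cK by (intro exI[of _ K'] conjI) auto
    then show False using k(2)[of "Suc k"] by simp
  qed
  show thesis by (rule that[OF K(1,2)]) (use K(3) K4 in auto)
qed

text \<open>The pairing \<open>\<bullet>\<close> is bilinear and not Hermitian. Hence the entries of
  the residual \<open>w\<close>, which is orthogonal to \<open>U\<close>, are conjugated to obtain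
  the annihilating functional \<open>y\<close>.\<close>

lemma exists_annihilator:
  assumes U: "csubspace d U" "U \<noteq> carrier_vec d"
  obtains y where "y \<in> carrier_vec d" "y \<noteq> 0\<^sub>v d" "\<forall>u \<in> U. y \<bullet> u = 0"
proof -
  obtain K k where K: "K \<in> carrier_mat d k" "dagger K * K = 1\<^sub>m k"
    "\<forall>x \<in> carrier_vec k. K *\<^sub>v x \<in> U" "\<forall>u \<in> U. K *\<^sub>v (dagger K *\<^sub>v u) = u"
    by (rule exists_orthonormal_basis[OF U(1)])
  have dK: "dagger K \<in> carrier_mat k d" using K by simp
  obtain x where x: "x \<in> carrier_vec d" "x \<notin> U" using U csubspaceD(1)[OF U(1)] by auto
  have Kx: "dagger K *\<^sub>v x \<in> carrier_vec k" using dK x by auto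
  define w where "w = x - K *\<^sub>v (dagger K *\<^sub>v x)"
  have w: "w \<in> carrier_vec d" using x K by (auto simp: w_def)
  have "w \<noteq> 0\<^sub>v d"
  proof
    assume "w = 0\<^sub>v d"
    then have "\<And>i. i < d \<Longrightarrow> (x - K *\<^sub>v (dagger K *\<^sub>v x)) $ i = 0" unfolding w_def by simp
    then have "K *\<^sub>v (dagger K *\<^sub>v x) = x"
      using x K(1) by (intro eq_vecI) (auto simp del: index_mult_mat_vec)
    then show False using bspec[OF K(3) Kx] x by simp
  qed
  then obtain l where l: "l < d" "w $ l \<noteq> 0" by (rule nonzero_vec_entry[OF w])
  have "dagger K *\<^sub>v w = dagger K *\<^sub>v x - dagger K *\<^sub>v (K *\<^sub>v (dagger K *\<^sub>v x))"
    unfolding w_def by (rule mult_minus_distrib_mat_vec[OF dK x(1)]) (use K Kx in auto)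
  moreover have "dagger K *\<^sub>v (K *\<^sub>v (dagger K *\<^sub>v x)) = dagger K *\<^sub>v x"
    using assoc_mult_mat_vec[OF dK K(1) Kx] K(2) Kx by simp
  ultimately have Kw: "dagger K *\<^sub>v w = 0\<^sub>v k" using Kx by auto
  define y where "y = vec d (\<lambda>i. cnj (w $ i))"
  have y: "y \<in> carrier_vec d" by (simp add: y_def)
  have "y \<bullet> u = 0" if "u \<in> U" for u
  proof -
    define z where "z = dagger K *\<^sub>v u"
    have u: "u \<in> carrier_vec d" using that csubspaceD(1)[OF U(1)] by auto
    have z: "z \<in> carrier_vec k" using u dK by (auto simp: z_def)
    have uz: "u = K *\<^sub>v z" using K(4) that by (simp add: z_def)
    have "y \<bullet> u = (\<Sum>i<d. y $ i * u $ i)"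
      using u by (simp add: scalar_prod_def lessThan_atLeast0)
    also have "\<dots> = (\<Sum>i<d. cnj (w $ i) * (\<Sum>l<k. K $$ (i, l) * z $ l))"
    proof (rule sum.cong[OF refl])
      fix i assume "i \<in> {..<d}"
      then have i: "i < d" by simp
      show "y $ i * u $ i = cnj (w $ i) * (\<Sum>l<k. K $$ (i, l) * z $ l)"
        unfolding uz mult_mat_vec_index[OF K(1) z i] using i by (simp add: y_def)
    qed
    also have "\<dots> = (\<Sum>i<d. \<Sum>l<k. cnj (w $ i) * K $$ (i, l) * z $ l)"
      by (simp add: sum_distrib_left mult.assoc)
    also have "\<dots> = (\<Sum>l<k. \<Sum>i<d. cnj (w $ i) * K $$ (i, l) * z $ l)" by (rule sum.swap)
    also have "\<dots> = (\<Sum>l<k. cnj (\<Sum>i<d. cnj (K $$ (i, l)) * w $ i) * z $ l)"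
      by (simp add: sum_distrib_left mult.commute)
    also have "\<dots> = (\<Sum>l<k. cnj ((dagger K *\<^sub>v w) $ l) * z $ l)"
    proof (rule sum.cong[OF refl])
      fix l assume "l \<in> {..<k}"
      then have "(dagger K *\<^sub>v w) $ l = (\<Sum>i<d. cnj (K $$ (i, l)) * w $ i)"
        using mult_mat_vec_index[OF dK w, of l] K(1) by simp
      then show "cnj (\<Sum>i<d. cnj (K $$ (i, l)) * w $ i) * z $ l = cnj ((dagger K *\<^sub>v w) $ l) * z $ l"
        by (simp only:)
    qed
    also have "\<dots> = 0" by (simp add: Kw)
    finally show ?thesis .
  qed
  moreover have "y \<noteq> 0\<^sub>v d"
  proof
    assume "y = 0\<^sub>v d"
    then have "y $ l = 0" using l by simp
    then show False using l by (simp add: y_def)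
  qed
  ultimately show thesis using that y by blast
qed

section \<open>Models of irreducible representations\<close>

definition hw_char :: "nat \<Rightarrow> (nat \<Rightarrow> nat) \<Rightarrow> complex mat \<Rightarrow> complex"
  where "hw_char m \<mu> b = (\<Prod>i = 1..m - 1. b $$ (i - 1, i - 1) ^ \<mu> i)"

lemma hw_char_diag_cong:
  assumes "\<And>i. i < m \<Longrightarrow> b $$ (i, i) = b' $$ (i, i)"
  shows "hw_char m \<mu> b = hw_char m \<mu> b'"
  unfolding hw_char_def using assms by (intro prod.cong) auto

lemma hw_char_mult:
  assumes "\<And>i. i < m \<Longrightarrow> b $$ (i, i) = b' $$ (i, i) * b'' $$ (i, i)"
  shows "hw_char m \<mu> b = hw_char m \<mu> b' * hw_char m \<mu> b''"
  unfolding hw_char_def prod.distrib[symmetric] using assms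
  by (intro prod.cong) (auto simp: power_mult_distrib)

lemma SL_lower_mult_diag:
  assumes "b \<in> SL_lower m" "b' \<in> SL_lower m" "i < m"
  shows "(b * b') $$ (i, i) = b $$ (i, i) * b' $$ (i, i)"
proof -
  have "(b * b') $$ (i, i) = (\<Sum>l<m. b $$ (i, l) * b' $$ (l, i))"
    using assms by (intro mult_mat_index[of _ m m _ m]) (auto simp: SL_lower_def SL_def)
  also have "\<dots> = (\<Sum>l<m. if l = i then b $$ (i, i) * b' $$ (i, i) else 0)"
  proof (intro sum.cong refl)
    fix l assume "l \<in> {..<m}"
    then show "b $$ (i, l) * b' $$ (l, i) = (if l = i then b $$ (i, i) * b' $$ (i, i) else 0)"
      using assms by (cases l i rule: linorder_cases) (auto simp: SL_lower_def)
  qed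
  finally show ?thesis using assms by simp
qed

lemma SL_lower_mult:
  assumes "b \<in> SL_lower m" "b' \<in> SL_lower m"
  shows "b * b' \<in> SL_lower m"
proof -
  have "(b * b') $$ (i, j) = 0" if "i < m" "j < m" "i < j" for i j
  proof -
    have "(b * b') $$ (i, j) = (\<Sum>l<m. b $$ (i, l) * b' $$ (l, j))"
      using assms that by (intro mult_mat_index[of _ m m _ m]) (auto simp: SL_lower_def SL_def)
    also have "\<dots> = 0"
    proof (intro sum.neutral ballI)
      fix l assume "l \<in> {..<m}"
      then show "b $$ (i, l) * b' $$ (l, j) = 0"
        using assms that by (cases "l < j") (auto simp: SL_lower_def)
    qed
    finally show ?thesis .
  qed
  then show ?thesis using assms SL_mult by (auto simp: SL_lower_def simp del: index_mult_mat(1))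
qed

section \<open>Matrix coefficients as polynomial functions\<close>

lemma polynomial_functions_sum:
  assumes "\<And>i. i \<in> I \<Longrightarrow> p i \<in> polynomial_functions m"
  shows "(\<lambda>g. \<Sum>i\<in>I. p i g) \<in> polynomial_functions m"
  using assms
proof (induction I rule: infinite_finite_induct)
  case (insert i I)
  then have "(\<lambda>g. p i g + (\<Sum>i\<in>I. p i g)) \<in> polynomial_functions m"
    by (intro polynomial_functions.add) auto
  then show ?case using insert by simp
qed (auto intro: polynomial_functions.const)

lemma polynomial_functions_prod:
  assumes "\<And>i. i \<in> I \<Longrightarrow> p i \<in> polynomial_functions m"
  shows "(\<lambda>g. \<Prod>i\<in>I. p i g) \<in> polynomial_functions m"
  using assms
proof (induction I rule: infinite_finite_induct)
  case (insert i I)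
  then have "(\<lambda>g. p i g * (\<Prod>i\<in>I. p i g)) \<in> polynomial_functions m"
    by (intro polynomial_functions.mult) auto
  then show ?case using insert by simp
qed (auto intro: polynomial_functions.const)

lemma scalar_prod_sum:
  assumes "u \<in> carrier_vec d"
  shows "y \<bullet> u = (\<Sum>i<d. y $ i * u $ i)"
  using assms by (simp add: scalar_prod_def lessThan_atLeast0)

lemma mat_mult_unit_vec_index:
  assumes "A \<in> carrier_mat n d" "i < n" "j < d"
  shows "(A *\<^sub>v unit_vec d j) $ i = (A $$ (i, j) :: complex)"
proof -
  have "(A *\<^sub>v unit_vec d j) $ i = (\<Sum>l<d. if l = j then A $$ (i, j) else 0)"
    unfolding mult_mat_vec_index[OF assms(1) unit_vec_carrier assms(2)]
    using assms by (intro sum.cong) (auto simp: index_unit_vec)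
  then show ?thesis using assms by simp
qed

lemma mat_mult_zero_vec: "(A :: complex mat) \<in> carrier_mat n d \<Longrightarrow> A *\<^sub>v 0\<^sub>v d = 0\<^sub>v n"
  by (intro eq_vecI) (auto simp: scalar_prod_def)

locale rational_representation =
  fixes m d :: nat and \<rho> :: "complex mat \<Rightarrow> complex mat"
  assumes rational: "rational_rep m d \<rho>" and m2: "2 \<le> m"
begin

lemma rep_carrier: "g \<in> SL m \<Longrightarrow> \<rho> g \<in> carrier_mat d d"
  using rational by (auto simp: rational_rep_def)

lemma rep_one: "\<rho> (1\<^sub>m m) = 1\<^sub>m d"
  using rational by (auto simp: rational_rep_def)

lemma rep_mult: "g \<in> SL m \<Longrightarrow> h \<in> SL m \<Longrightarrow> \<rho> (g * h) = \<rho> g * \<rho> h"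
  using rational by (auto simp: rational_rep_def)

lemma rep_vec: "g \<in> SL m \<Longrightarrow> u \<in> carrier_vec d \<Longrightarrow> \<rho> g *\<^sub>v u \<in> carrier_vec d"
  using rep_carrier by (meson mult_mat_vec_carrier)

lemma rep_mult_vec:
  "g \<in> SL m \<Longrightarrow> h \<in> SL m \<Longrightarrow> u \<in> carrier_vec d \<Longrightarrow> \<rho> (g * h) *\<^sub>v u = \<rho> g *\<^sub>v (\<rho> h *\<^sub>v u)"
  using rep_mult rep_carrier by (simp add: assoc_mult_mat_vec[of _ d d _ d])

lemma rep_one_vec: "u \<in> carrier_vec d \<Longrightarrow> \<rho> (1\<^sub>m m) *\<^sub>v u = u"
  by (simp add: rep_one)

lemma rep_add: "g \<in> SL m \<Longrightarrow> u \<in> carrier_vec d \<Longrightarrow> w \<in> carrier_vec d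
    \<Longrightarrow> \<rho> g *\<^sub>v (u + w) = \<rho> g *\<^sub>v u + \<rho> g *\<^sub>v w"
  by (rule mult_add_distrib_mat_vec[OF rep_carrier])

lemma rep_smult: "g \<in> SL m \<Longrightarrow> u \<in> carrier_vec d \<Longrightarrow> \<rho> g *\<^sub>v (c \<cdot>\<^sub>v u) = c \<cdot>\<^sub>v (\<rho> g *\<^sub>v u)"
  by (rule mult_mat_vec[OF rep_carrier])

lemma rep_dim: "g \<in> SL m \<Longrightarrow> dim_vec (\<rho> g *\<^sub>v u) = d"
  using rep_carrier by auto

lemma rep_add_entry: "g \<in> SL m \<Longrightarrow> u \<in> carrier_vec d \<Longrightarrow> w \<in> carrier_vec d \<Longrightarrow> k < d
    \<Longrightarrow> (\<rho> g *\<^sub>v (u + w)) $ k = (\<rho> g *\<^sub>v u) $ k + (\<rho> g *\<^sub>v w) $ k"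
  by (subst rep_add, assumption+, rule index_add_vec(1)) (simp only: rep_dim)

lemma rep_smult_entry: "g \<in> SL m \<Longrightarrow> u \<in> carrier_vec d \<Longrightarrow> k < d
    \<Longrightarrow> (\<rho> g *\<^sub>v (c \<cdot>\<^sub>v u)) $ k = c * (\<rho> g *\<^sub>v u) $ k"
  by (subst rep_smult, assumption+, rule index_smult_vec(1)) (simp only: rep_dim)

lemma entry_polynomial:
  assumes "x \<in> carrier_vec d" "k < d"
  shows "\<exists>p \<in> polynomial_functions m. \<forall>g \<in> SL m. (\<rho> g *\<^sub>v x) $ k = p g"
proof -
  have "\<forall>j\<in>{..<d}. \<exists>p. p \<in> polynomial_functions m \<and> (\<forall>g \<in> SL m. \<rho> g $$ (k, j) = p g)"
    using rational assms(2) unfolding rational_rep_def by (simp add: Bex_def)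
  from bchoice[OF this] obtain p where
    p0: "\<forall>j\<in>{..<d}. p j \<in> polynomial_functions m \<and> (\<forall>g \<in> SL m. \<rho> g $$ (k, j) = p j g)" ..
  then have p: "\<And>j. j < d \<Longrightarrow> p j \<in> polynomial_functions m"
    "\<And>j g. j < d \<Longrightarrow> g \<in> SL m \<Longrightarrow> \<rho> g $$ (k, j) = p j g" by simp_all
  have "(\<lambda>g. \<Sum>j<d. p j g * x $ j) \<in> polynomial_functions m"
  proof (rule polynomial_functions_sum)
    fix j assume "j \<in> {..<d}"
    then have "p j \<in> polynomial_functions m" using p by simp
    then show "(\<lambda>g. p j g * x $ j) \<in> polynomial_functions m"
      by (rule polynomial_functions.mult[OF _ polynomial_functions.const])
  qed
  moreover have "(\<rho> g *\<^sub>v x) $ k = (\<Sum>j<d. p j g * x $ j)" if "g \<in> SL m" for g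
    unfolding mult_mat_vec_index[OF rep_carrier[OF that] assms] using p that by (intro sum.cong) auto
  ultimately show ?thesis by (intro bexI[of _ "\<lambda>g. \<Sum>j<d. p j g * x $ j"] ballI)
qed

lemma coefficient_polynomial:
  assumes "x \<in> carrier_vec d"
  shows "\<exists>p \<in> polynomial_functions m. \<forall>g \<in> SL m. y \<bullet> (\<rho> g *\<^sub>v x) = p g"
proof -
  have "\<forall>k\<in>{..<d}. \<exists>p. p \<in> polynomial_functions m \<and> (\<forall>g \<in> SL m. (\<rho> g *\<^sub>v x) $ k = p g)"
    using entry_polynomial[OF assms] by (simp add: Bex_def)
  from bchoice[OF this] obtain p where
    p0: "\<forall>k\<in>{..<d}. p k \<in> polynomial_functions m \<and> (\<forall>g \<in> SL m. (\<rho> g *\<^sub>v x) $ k = p k g)" ..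
  then have p: "\<And>k. k < d \<Longrightarrow> p k \<in> polynomial_functions m"
    "\<And>k g. k < d \<Longrightarrow> g \<in> SL m \<Longrightarrow> (\<rho> g *\<^sub>v x) $ k = p k g" by simp_all
  have "(\<lambda>g. \<Sum>k<d. y $ k * p k g) \<in> polynomial_functions m"
  proof (rule polynomial_functions_sum)
    fix k assume "k \<in> {..<d}"
    then have "p k \<in> polynomial_functions m" using p by simp
    then show "(\<lambda>g. y $ k * p k g) \<in> polynomial_functions m"
      by (rule polynomial_functions.mult[OF polynomial_functions.const])
  qed
  moreover have "y \<bullet> (\<rho> g *\<^sub>v x) = (\<Sum>k<d. y $ k * p k g)" if "g \<in> SL m" for g
    unfolding scalar_prod_sum[OF rep_vec[OF that assms]] using p that by (intro sum.cong) auto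
  ultimately show ?thesis by (intro bexI[of _ "\<lambda>g. \<Sum>k<d. y $ k * p k g"] ballI)
qed

lemma coefficient_zero_of_big_cell:
  assumes "x \<in> carrier_vec d" "g \<in> SL m"
    "\<And>l u. l \<in> SL_lower m \<Longrightarrow> u \<in> SL_upper m \<Longrightarrow> y \<bullet> (\<rho> (l * u) *\<^sub>v x) = 0"
  shows "y \<bullet> (\<rho> g *\<^sub>v x) = 0"
proof -
  obtain p where p: "p \<in> polynomial_functions m" "\<And>g. g \<in> SL m \<Longrightarrow> y \<bullet> (\<rho> g *\<^sub>v x) = p g"
    using coefficient_polynomial[OF assms(1)] by blast
  have "p (l * u) = 0" if "l \<in> SL_lower m" "u \<in> SL_upper m" for l u
    using p(2)[of "l * u"] assms(3)[OF that] that by (auto intro: SL_mult dest: SL_lowerD SL_upperD)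
  then show ?thesis
    using polynomial_zero_of_big_cell[OF p(1) _ assms(2)] m2 p(2)[OF assms(2)] by simp
qed

lemma annihilator_subspace:
  "csubspace d {u \<in> carrier_vec d. \<forall>g \<in> SL m. y \<bullet> (\<rho> g *\<^sub>v u) = 0}" if y: "y \<in> carrier_vec d"
proof (rule csubspaceI)
  fix u w assume "u \<in> {u \<in> carrier_vec d. \<forall>g \<in> SL m. y \<bullet> (\<rho> g *\<^sub>v u) = 0}"
    "w \<in> {u \<in> carrier_vec d. \<forall>g \<in> SL m. y \<bullet> (\<rho> g *\<^sub>v u) = 0}"
  then show "u + w \<in> {u \<in> carrier_vec d. \<forall>g \<in> SL m. y \<bullet> (\<rho> g *\<^sub>v u) = 0}"
    using y rep_carrier rep_vec
    by (auto simp: mult_add_distrib_mat_vec[of _ d d] scalar_prod_add_distrib[of _ d])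
next
  fix c u assume "u \<in> {u \<in> carrier_vec d. \<forall>g \<in> SL m. y \<bullet> (\<rho> g *\<^sub>v u) = 0}"
  then show "c \<cdot>\<^sub>v u \<in> {u \<in> carrier_vec d. \<forall>g \<in> SL m. y \<bullet> (\<rho> g *\<^sub>v u) = 0}"
    using y rep_carrier rep_vec
    by (auto simp: mult_mat_vec[of _ d d])
qed (use y in \<open>auto simp: mat_mult_zero_vec[OF rep_carrier]\<close>)

end

section \<open>Irreducible modules with a highest weight vector\<close>

locale highest_weight_model = rational_representation +
  fixes \<mu> :: "nat \<Rightarrow> nat" and v :: "complex vec"
  assumes irreducible: "irreducible_rep m d \<rho>"
    and v_carrier: "v \<in> carrier_vec d" and v_nonzero: "v \<noteq> 0\<^sub>v d"
    and v_upper: "b \<in> SL_upper m \<Longrightarrow> \<rho> b *\<^sub>v v = hw_char m \<mu> b \<cdot>\<^sub>v v"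
begin

lemma stable_subspace:
  assumes "csubspace d U" "\<And>g u. g \<in> SL m \<Longrightarrow> u \<in> U \<Longrightarrow> \<rho> g *\<^sub>v u \<in> U"
  shows "U = {0\<^sub>v d} \<or> U = carrier_vec d"
proof -
  have "subspace class_ring U (module_vec TYPE(complex) d) \<and> (\<forall>g \<in> SL m. \<forall>u \<in> U. \<rho> g *\<^sub>v u \<in> U)"
    using assms csubspace_iff by simp
  with irreducible show ?thesis unfolding irreducible_rep_def by simp
qed

text \<open>The vectors whose whole orbit is killed by \<open>y\<close> form an invariant subspace.
  This is the means by which vectors are shown to be zero: a nonzero functional cannot kill the
  orbit of a nonzero vector.\<close>

lemma annihilator_cases:
  assumes y: "y \<in> carrier_vec d"
  shows "{u \<in> carrier_vec d. \<forall>g \<in> SL m. y \<bullet> (\<rho> g *\<^sub>v u) = 0} = {0\<^sub>v d} \<or> y = 0\<^sub>v d"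
proof -
  let ?U = "{u \<in> carrier_vec d. \<forall>g \<in> SL m. y \<bullet> (\<rho> g *\<^sub>v u) = 0}"
  have "?U = {0\<^sub>v d} \<or> ?U = carrier_vec d"
    by (rule stable_subspace[OF annihilator_subspace[OF y]])
       (auto simp: rep_vec SL_mult simp flip: rep_mult_vec)
  moreover have "y = 0\<^sub>v d" if "?U = carrier_vec d"
  proof -
    have "y \<bullet> unit_vec d i = 0" if "i < d" for i
    proof -
      have "unit_vec d i \<in> ?U" using \<open>?U = carrier_vec d\<close> by simp
      then have "y \<bullet> (\<rho> (1\<^sub>m m) *\<^sub>v unit_vec d i) = 0" using SL_one by blast
      then show ?thesis by (simp add: rep_one)
    qed
    then show ?thesis using y by (intro eq_vecI) auto
  qed
  ultimately show ?thesis by blast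
qed

text \<open>An upper triangular matrix only scales \<open>v\<close>, so the translates of
  \<open>v\<close> under the big cell are multiples of its lower triangular translates. A functional
  vanishing on the latter vanishes on the whole orbit by density.\<close>

lemma cyclic:
  assumes S: "csubspace d S" and b: "\<And>b. b \<in> SL_lower m \<Longrightarrow> \<rho> b *\<^sub>v v \<in> S"
  shows "S = carrier_vec d"
proof (rule ccontr)
  assume "S \<noteq> carrier_vec d"
  then obtain y where y: "y \<in> carrier_vec d" "y \<noteq> 0\<^sub>v d" "\<forall>u \<in> S. y \<bullet> u = 0"
    by (rule exists_annihilator[OF S])
  have "y \<bullet> (\<rho> (l * u) *\<^sub>v v) = 0" if "l \<in> SL_lower m" "u \<in> SL_upper m" for l u
  proof -
    have lu: "l \<in> SL m" "u \<in> SL m" using that by (auto simp: SL_lower_def SL_upper_def)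
    have "\<rho> (l * u) *\<^sub>v v = hw_char m \<mu> u \<cdot>\<^sub>v (\<rho> l *\<^sub>v v)"
      using rep_mult_vec[OF lu v_carrier] v_upper[OF that(2)] rep_carrier[OF lu(1)] v_carrier
      by (simp add: mult_mat_vec)
    then show ?thesis
      using bspec[OF y(3) csubspaceD(4)[OF S b[OF that(1)]]] by simp
  qed
  then have "y \<bullet> (\<rho> g *\<^sub>v v) = 0" if "g \<in> SL m" for g
    using coefficient_zero_of_big_cell[OF v_carrier that] by blast
  then have "v \<in> {u \<in> carrier_vec d. \<forall>g \<in> SL m. y \<bullet> (\<rho> g *\<^sub>v u) = 0}" using v_carrier by blast
  with annihilator_cases[OF y(1)] y(2) v_nonzero show False by auto
qed

end

text \<open>The exponents $m - 1 - 2i$ sum to $0$ and decrease strictly, so conjugation by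
  these tori contracts the lower unipotent matrices.\<close>

definition contracting_torus :: "nat \<Rightarrow> nat \<Rightarrow> nat \<Rightarrow> complex"
  where "contracting_torus m n i = of_nat (Suc n) ^ (m - 1 - i) / of_nat (Suc n) ^ i"

lemma contracting_torus_nonzero [simp]: "contracting_torus m n i \<noteq> 0"
proof -
  have "(of_nat (Suc n) :: complex) \<noteq> 0" by (rule of_nat_neq_0)
  then show ?thesis unfolding contracting_torus_def by (simp del: of_nat_Suc)
qed

lemma prod_contracting_torus: "(\<Prod>i<m. contracting_torus m n i) = 1"
proof -
  have "(\<Prod>i<m. (of_nat (Suc n) :: complex) ^ (m - Suc i)) = (\<Prod>i<m. of_nat (Suc n) ^ i)"
    by (rule prod.nat_diff_reindex)
  moreover have "(\<Prod>i<m. (of_nat (Suc n) :: complex) ^ i) \<noteq> 0"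
    by (simp del: of_nat_Suc)
  ultimately show ?thesis
    unfolding contracting_torus_def prod_dividef by (simp del: of_nat_Suc)
qed

text \<open>The ratio has absolute value (n + 1)^(-2(i - j)).\<close>

lemma contracting_torus_ratio:
  assumes "j < i" "i < m"
  shows "(\<lambda>n. contracting_torus m n i / contracting_torus m n j) \<longlonglongrightarrow> 0"
proof (rule tendsto_0_le[where K = 1])
  show "(\<lambda>n. inverse (real (Suc n))) \<longlonglongrightarrow> 0" by (rule LIMSEQ_inverse_real_of_nat)
  have "norm (contracting_torus m n i / contracting_torus m n j) \<le> norm (inverse (real (Suc n))) * 1" for n
  proof -
    define z where "z = real (Suc n)"
    have z: "z \<ge> 1" by (simp add: z_def)
    have "norm (contracting_torus m n i / contracting_torus m n j)
        = (z ^ (m - 1 - i) / z ^ i) / (z ^ (m - 1 - j) / z ^ j)"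
          unfolding contracting_torus_def z_def norm_divide norm_power norm_of_nat by (rule refl)
    also have "z ^ (m - 1 - j) = z ^ (m - 1 - i) * z ^ (i - j)"
      using assms by (simp flip: power_add)
    also have "z ^ i = z ^ (i - j) * z ^ j" using assms by (simp flip: power_add)
    also have "(z ^ (m - 1 - i) / (z ^ (i - j) * z ^ j)) / (z ^ (m - 1 - i) * z ^ (i - j) / z ^ j)
        = inverse (z ^ (i - j) * z ^ (i - j))" using z by (simp add: field_simps)
    also have "\<dots> \<le> inverse z"
    proof (rule le_imp_inverse_le)
      have "z * 1 \<le> z ^ (i - j) * z ^ (i - j)"
        using z assms by (intro mult_mono one_le_power self_le_power) auto
      then show "z \<le> z ^ (i - j) * z ^ (i - j)" by simp
    qed (use z in auto)
    finally show ?thesis using z by (simp add: z_def)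
  qed
  then show "\<forall>\<^sub>F n in sequentially. norm (contracting_torus m n i / contracting_torus m n j)
      \<le> norm (inverse (real (Suc n))) * 1"
    by (intro always_eventually allI)
qed

lemma hw_char_diagm_nonzero: "(\<And>i. i < m \<Longrightarrow> t i \<noteq> 0) \<Longrightarrow> hw_char m \<mu> (diagm m t) \<noteq> 0"
  unfolding hw_char_def by (auto simp: diagm_index)

section \<open>Lowest weight functionals\<close>

context highest_weight_model
begin

text \<open>The functional is the limit of the rescaled torus action, read off in one coordinate.\<close>

lemma exists_lowest_functional:
  obtains f where "f \<in> carrier_vec d" "f \<bullet> v = 1"
    "\<forall>b \<in> SL_lower m. \<forall>u \<in> carrier_vec d. f \<bullet> (\<rho> b *\<^sub>v u) = hw_char m \<mu> b * (f \<bullet> u)"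
proof -
  define \<tau> where "\<tau> n = diagm m (contracting_torus m n)" for n
  have \<tau>U: "\<tau> n \<in> SL_upper m" for n unfolding \<tau>_def by (rule diagm_SL_upper[OF prod_contracting_torus])
  have \<tau>: "\<tau> n \<in> SL m" for n using SL_upperD(1)[OF \<tau>U] .
  define c where "c n = hw_char m \<mu> (\<tau> n)" for n
  have c: "c n \<noteq> 0" for n unfolding c_def \<tau>_def by (rule hw_char_diagm_nonzero) simp
  \<comment> \<open>The factor \<open>inverse (c n)\<close> makes the rescaled torus fix
    \<open>v\<close>. On a lower triangular translate of \<open>v\<close>, conjugation by the torus
    drives the entries below the diagonal to 0, so the limit is the multiple of \<open>v\<close>
    given by the diagonal; by \<open>cyclic\<close> a limit then exists for every vector.\<close>
  define lim_at where "lim_at u a \<longleftrightarrow> (\<forall>k<d. (\<lambda>n. inverse (c n) * (\<rho> (\<tau> n) *\<^sub>v u) $ k) \<longlonglongrightarrow> a * v $ k)" for u a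
  have lower: "lim_at (\<rho> b *\<^sub>v v) (hw_char m \<mu> b)" if b: "b \<in> SL_lower m" for b
    unfolding lim_at_def
  proof (intro allI impI)
    fix k assume k: "k < d"
    have bS: "b \<in> SL m" and bc: "b \<in> carrier_mat m m" using b by (auto simp: SL_lower_def SL_def)
    define \<tau>' where "\<tau>' n = diagm m (\<lambda>i. inverse (contracting_torus m n i))" for n
    have \<tau>': "\<tau>' n \<in> SL m" for n
      unfolding \<tau>'_def
      by (rule diagm_SL) (use prod_inversef[of "contracting_torus m n" "{..<m}"] in \<open>simp add: o_def prod_contracting_torus\<close>)
    define X where "X n = \<tau> n * b * \<tau>' n" for n
    have XS: "X n \<in> SL m" for n unfolding X_def by (intro SL_mult \<tau> \<tau>' bS)
    have Xij: "X n $$ (i, j) = b $$ (i, j) * (contracting_torus m n i / contracting_torus m n j)"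
      if "i < m" "j < m" for n i j
    proof -
      have "\<tau> n * b \<in> carrier_mat m m" unfolding \<tau>_def by (rule mult_carrier_mat[OF diagm_carrier bc])
      then have "X n $$ (i, j) = (\<tau> n * b) $$ (i, j) * inverse (contracting_torus m n j)"
        unfolding X_def \<tau>'_def using that by (rule mult_diagm_index)
      also have "(\<tau> n * b) $$ (i, j) = contracting_torus m n i * b $$ (i, j)"
        unfolding \<tau>_def using bc that by (rule diagm_mult_index)
      finally show ?thesis by (simp add: divide_inverse)
    qed
    have "\<tau>' n * \<tau> n = 1\<^sub>m m" for n
      by (rule eq_matI) (auto simp: \<tau>'_def \<tau>_def mult_diagm_index[of _ m m] diagm_index simp del: index_mult_mat(1))
    then have X\<tau>: "X n * \<tau> n = \<tau> n * b" for n
      unfolding X_def using assoc_mult_mat[of "\<tau> n * b" m m "\<tau>' n" m "\<tau> n" m] SL_carrier[OF \<tau>] SL_carrier[OF \<tau>'] bc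
      by simp
    then have eq: "\<rho> (\<tau> n) *\<^sub>v (\<rho> b *\<^sub>v v) = c n \<cdot>\<^sub>v (\<rho> (X n) *\<^sub>v v)" for n
    proof -
      have "\<rho> (\<tau> n) *\<^sub>v (\<rho> b *\<^sub>v v) = \<rho> (X n * \<tau> n) *\<^sub>v v"
        using rep_mult_vec[OF \<tau>[of n] bS v_carrier] X\<tau>[of n] by simp
      also have "\<dots> = \<rho> (X n) *\<^sub>v (c n \<cdot>\<^sub>v v)"
        using rep_mult_vec[OF XS[of n] \<tau>[of n] v_carrier] v_upper[OF \<tau>U[of n]] by (simp add: c_def)
      also have "\<dots> = c n \<cdot>\<^sub>v (\<rho> (X n) *\<^sub>v v)"
        by (rule mult_mat_vec[OF rep_carrier[OF XS] v_carrier])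
      finally show ?thesis .
    qed
    have pd: "(\<Prod>i<m. b $$ (i, i)) = 1"
      using det_lower[OF bc] SL_lowerD(2)[OF b] bS by (auto simp: SL_def)
    define D where "D = diagm m (\<lambda>i. b $$ (i, i))"
    have DU: "D \<in> SL_upper m" unfolding D_def by (rule diagm_SL_upper[OF pd])
    have XD: "(\<lambda>n. X n $$ (i, j)) \<longlonglongrightarrow> D $$ (i, j)" if "i < m" "j < m" for i j
    proof (cases i j rule: linorder_cases)
      case less
      then show ?thesis using SL_lowerD(2)[OF b] that by (simp add: Xij D_def diagm_index)
    next
      case equal
      then show ?thesis using that by (simp add: Xij D_def diagm_index)
    next
      case greater
      then have "(\<lambda>n. b $$ (i, j) * (contracting_torus m n i / contracting_torus m n j)) \<longlonglongrightarrow> b $$ (i, j) * 0"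
        using that by (intro tendsto_mult tendsto_const contracting_torus_ratio)
      then show ?thesis using greater that by (simp add: Xij D_def diagm_index)
    qed
    obtain p where p: "p \<in> polynomial_functions m" "\<And>g. g \<in> SL m \<Longrightarrow> (\<rho> g *\<^sub>v v) $ k = p g"
      using entry_polynomial[OF v_carrier k] by blast
    have "(\<lambda>n. p (X n)) \<longlonglongrightarrow> p D" by (rule polynomial_functions_tendsto[OF p(1) XD])
    moreover have "p D = hw_char m \<mu> b * v $ k"
    proof -
      have "p D = (\<rho> D *\<^sub>v v) $ k" using p(2) SL_upperD(1)[OF DU] by simp
      also have "\<dots> = hw_char m \<mu> D * v $ k" using v_upper[OF DU] k v_carrier by simp
      also have "hw_char m \<mu> D = hw_char m \<mu> b" by (rule hw_char_diag_cong) (simp add: D_def diagm_index)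
      finally show ?thesis .
    qed
    moreover have "inverse (c n) * (\<rho> (\<tau> n) *\<^sub>v (\<rho> b *\<^sub>v v)) $ k = p (X n)" for n
    proof -
      have "(c n \<cdot>\<^sub>v (\<rho> (X n) *\<^sub>v v)) $ k = c n * (\<rho> (X n) *\<^sub>v v) $ k"
        by (rule index_smult_vec(1)) (simp only: rep_dim[OF XS] k)
      then show ?thesis unfolding eq p(2)[OF XS] using c[of n] by simp
    qed
    ultimately show "(\<lambda>n. inverse (c n) * (\<rho> (\<tau> n) *\<^sub>v (\<rho> b *\<^sub>v v)) $ k) \<longlonglongrightarrow> hw_char m \<mu> b * v $ k"
      by simp
  qed
  have lin_add: "lim_at (u + w) (a + a')" if "lim_at u a" "lim_at w a'" "u \<in> carrier_vec d" "w \<in> carrier_vec d" for u w a a'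
    unfolding lim_at_def
  proof (intro allI impI)
    fix k assume k: "k < d"
    have "(\<lambda>n. inverse (c n) * (\<rho> (\<tau> n) *\<^sub>v u) $ k + inverse (c n) * (\<rho> (\<tau> n) *\<^sub>v w) $ k) \<longlonglongrightarrow> a * v $ k + a' * v $ k"
      using that k by (intro tendsto_add) (auto simp: lim_at_def)
    then show "(\<lambda>n. inverse (c n) * (\<rho> (\<tau> n) *\<^sub>v (u + w)) $ k) \<longlonglongrightarrow> (a + a') * v $ k"
      unfolding rep_add_entry[OF \<tau> that(3,4) k] distrib_left distrib_right .
  qed
  have lin_smult: "lim_at (e \<cdot>\<^sub>v u) (e * a)" if "lim_at u a" "u \<in> carrier_vec d" for u a e
    unfolding lim_at_def
  proof (intro allI impI)
    fix k assume k: "k < d"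
    have "(\<lambda>n. inverse (c n) * (\<rho> (\<tau> n) *\<^sub>v u) $ k) \<longlonglongrightarrow> a * v $ k"
      using that k by (auto simp: lim_at_def)
    then have "(\<lambda>n. e * (inverse (c n) * (\<rho> (\<tau> n) *\<^sub>v u) $ k)) \<longlonglongrightarrow> e * (a * v $ k)"
      by (rule tendsto_mult[OF tendsto_const])
    then show "(\<lambda>n. inverse (c n) * (\<rho> (\<tau> n) *\<^sub>v (e \<cdot>\<^sub>v u)) $ k) \<longlonglongrightarrow> (e * a) * v $ k"
      unfolding rep_smult_entry[OF \<tau> that(2) k] by (simp only: mult.left_commute mult.assoc)
  qed
  have "{u \<in> carrier_vec d. \<exists>a. lim_at u a} = carrier_vec d"
  proof (rule cyclic)
    show "csubspace d {u \<in> carrier_vec d. \<exists>a. lim_at u a}"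
    proof (rule csubspaceI)
      have "lim_at (0 \<cdot>\<^sub>v (\<rho> (1\<^sub>m m) *\<^sub>v v)) (0 * hw_char m \<mu> (1\<^sub>m m))"
        using lower[of "1\<^sub>m m"] SL_one by (intro lin_smult) (auto simp: SL_lower_def rep_one v_carrier)
      moreover have "0 \<cdot>\<^sub>v (\<rho> (1\<^sub>m m) *\<^sub>v v) = 0\<^sub>v d" using rep_one v_carrier by auto
      ultimately have "lim_at (0\<^sub>v d) (0 * hw_char m \<mu> (1\<^sub>m m))" by simp
      then show "0\<^sub>v d \<in> {u \<in> carrier_vec d. \<exists>a. lim_at u a}" using zero_carrier_vec by (auto simp del: mult_zero_left)
    next
      fix u w assume "u \<in> {u \<in> carrier_vec d. \<exists>a. lim_at u a}" "w \<in> {u \<in> carrier_vec d. \<exists>a. lim_at u a}"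
      then show "u + w \<in> {u \<in> carrier_vec d. \<exists>a. lim_at u a}" using lin_add[of u _ w] by auto
    next
      fix e u assume "u \<in> {u \<in> carrier_vec d. \<exists>a. lim_at u a}"
      then show "e \<cdot>\<^sub>v u \<in> {u \<in> carrier_vec d. \<exists>a. lim_at u a}" using lin_smult[of u _ e] by auto
    qed auto
  next
    fix b assume b: "b \<in> SL_lower m"
    then show "\<rho> b *\<^sub>v v \<in> {u \<in> carrier_vec d. \<exists>a. lim_at u a}"
      using lower[OF b] rep_vec[OF SL_lowerD(1)[OF b] v_carrier] by blast
  qed
  then have all: "\<exists>a. lim_at u a" if "u \<in> carrier_vec d" for u using that by blast
  obtain k0 where k0: "k0 < d" "v $ k0 \<noteq> 0"
    by (rule nonzero_vec_entry[OF v_carrier v_nonzero])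
  \<comment> \<open>A coordinate in which \<open>v\<close> does not vanish recovers the scalar
    \<open>a\<close> from the limit vector.\<close>
  define f where "f = vec d (\<lambda>j. lim (\<lambda>n. inverse (c n) * \<rho> (\<tau> n) $$ (k0, j)) / v $ k0)"
  have fc: "f \<in> carrier_vec d" by (simp add: f_def)
  have fj: "(\<lambda>n. inverse (c n) * \<rho> (\<tau> n) $$ (k0, j)) \<longlonglongrightarrow> f $ j * v $ k0" if j: "j < d" for j
  proof -
    obtain a where "lim_at (unit_vec d j) a" using all[OF unit_vec_carrier] by blast
    then have "(\<lambda>n. inverse (c n) * (\<rho> (\<tau> n) *\<^sub>v unit_vec d j) $ k0) \<longlonglongrightarrow> a * v $ k0"
      using k0 by (auto simp: lim_at_def)
    then have "(\<lambda>n. inverse (c n) * \<rho> (\<tau> n) $$ (k0, j)) \<longlonglongrightarrow> a * v $ k0"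
      using mat_mult_unit_vec_index[OF rep_carrier[OF \<tau>] k0(1) j] by (simp del: index_mult_mat_vec)
    then show ?thesis using limI[of _ "a * v $ k0"] k0 j by (simp add: f_def)
  qed
  have fu: "f \<bullet> u = a" if "lim_at u a" "u \<in> carrier_vec d" for u a
  proof -
    have "(\<lambda>n. \<Sum>j<d. (inverse (c n) * \<rho> (\<tau> n) $$ (k0, j)) * u $ j) \<longlonglongrightarrow> (\<Sum>j<d. (f $ j * v $ k0) * u $ j)"
      by (intro tendsto_sum tendsto_mult tendsto_const fj) auto
    moreover have "(\<Sum>j<d. (f $ j * v $ k0) * u $ j) = (f \<bullet> u) * v $ k0"
      unfolding scalar_prod_sum[OF that(2)] sum_distrib_right by (intro sum.cong) (simp_all only: mult_ac)
    moreover have "(\<Sum>j<d. (inverse (c n) * \<rho> (\<tau> n) $$ (k0, j)) * u $ j) = inverse (c n) * (\<rho> (\<tau> n) *\<^sub>v u) $ k0" for n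
      unfolding mult_mat_vec_index[OF rep_carrier[OF \<tau>] that(2) k0(1)] by (simp add: sum_distrib_left mult.assoc)
    moreover have "(\<lambda>n. inverse (c n) * (\<rho> (\<tau> n) *\<^sub>v u) $ k0) \<longlonglongrightarrow> a * v $ k0"
      using that k0 by (auto simp: lim_at_def)
    ultimately have "(f \<bullet> u) * v $ k0 = a * v $ k0" using LIMSEQ_unique by (simp only:)
    then show ?thesis using k0 by simp
  qed
  have fb: "f \<bullet> (\<rho> b *\<^sub>v v) = hw_char m \<mu> b" if "b \<in> SL_lower m" for b
    using fu[OF lower[OF that] rep_vec[OF SL_lowerD(1)[OF that] v_carrier]] .
  \<comment> \<open>The eigenvalue equation is linear in \<open>u\<close>, and on the lower
    triangular translates of \<open>v\<close> it follows from the multiplicativity of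
    \<open>hw_char\<close>. So \<open>cyclic\<close> applies a second time.\<close>
  have "{u \<in> carrier_vec d. \<forall>b \<in> SL_lower m. f \<bullet> (\<rho> b *\<^sub>v u) = hw_char m \<mu> b * (f \<bullet> u)} = carrier_vec d"
  proof (rule cyclic)
    have "\<rho> b \<in> carrier_mat d d" "u \<in> carrier_vec d \<Longrightarrow> \<rho> b *\<^sub>v u \<in> carrier_vec d" if "b \<in> SL_lower m" for b u
      using rep_carrier rep_vec SL_lowerD(1)[OF that] by auto
    then show "csubspace d {u \<in> carrier_vec d. \<forall>b \<in> SL_lower m. f \<bullet> (\<rho> b *\<^sub>v u) = hw_char m \<mu> b * (f \<bullet> u)}"
      using fc mat_mult_zero_vec[OF rep_carrier[OF SL_lowerD(1)]]
      by (intro csubspaceI) (simp_all add: mult_add_distrib_mat_vec[of _ d d] mult_mat_vec[of _ d d]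
          scalar_prod_add_distrib[of _ d] distrib_left subset_iff)
  next
    fix b' assume b': "b' \<in> SL_lower m"
    have "f \<bullet> (\<rho> b *\<^sub>v (\<rho> b' *\<^sub>v v)) = hw_char m \<mu> b * (f \<bullet> (\<rho> b' *\<^sub>v v))" if b: "b \<in> SL_lower m" for b
    proof -
      have "f \<bullet> (\<rho> b *\<^sub>v (\<rho> b' *\<^sub>v v)) = hw_char m \<mu> (b * b')"
        using fb[OF SL_lower_mult[OF b b']] rep_mult_vec[OF SL_lowerD(1)[OF b] SL_lowerD(1)[OF b'] v_carrier] by simp
      also have "\<dots> = hw_char m \<mu> b * hw_char m \<mu> b'"
        by (rule hw_char_mult) (rule SL_lower_mult_diag[OF b b'])
      finally show ?thesis using fb[OF b'] by simp
    qed
    then show "\<rho> b' *\<^sub>v v \<in> {u \<in> carrier_vec d. \<forall>b \<in> SL_lower m. f \<bullet> (\<rho> b *\<^sub>v u) = hw_char m \<mu> b * (f \<bullet> u)}"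
      using rep_vec[OF SL_lowerD(1)[OF b'] v_carrier] by blast
  qed
  then have low: "f \<bullet> (\<rho> b *\<^sub>v u) = hw_char m \<mu> b * (f \<bullet> u)" if "b \<in> SL_lower m" "u \<in> carrier_vec d" for b u
    using that by blast
  have "f \<bullet> v = 1"
  proof -
    have "f \<bullet> (\<rho> (1\<^sub>m m) *\<^sub>v v) = hw_char m \<mu> (1\<^sub>m m)" by (rule fb) (auto simp: SL_lower_def SL_one)
    moreover have "hw_char m \<mu> (1\<^sub>m m) = 1"
      unfolding hw_char_def by (intro prod.neutral) auto
    ultimately show ?thesis by (simp add: rep_one v_carrier)
  qed
  then show thesis by (rule that[OF fc]) (use low in auto)
qed

end

lemma is_V_model:
  assumes "is_V m \<mu> d \<rho>" "2 \<le> m"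
  obtains v where "highest_weight_model m d \<rho> \<mu> v"
proof -
  obtain v where v: "v \<in> carrier_vec d" "v \<noteq> 0\<^sub>v d"
    "\<And>b. b \<in> SL m \<Longrightarrow> upper_triangular b \<Longrightarrow> \<rho> b *\<^sub>v v = hw_char m \<mu> b \<cdot>\<^sub>v v"
    using assms(1) by (auto simp: is_V_def has_highest_weight_def hw_char_def)
  have "highest_weight_model m d \<rho> \<mu> v"
  proof unfold_locales
    fix b assume "b \<in> SL_upper m"
    then show "\<rho> b *\<^sub>v v = hw_char m \<mu> b \<cdot>\<^sub>v v"
      by (intro v(3)) (auto simp: SL_upper_def SL_def)
  qed (use assms v in \<open>simp_all add: is_V_def\<close>)
  then show thesis using that by blast
qed

lemma is_V_intro:
  assumes "rational_rep m d \<rho>" "irreducible_rep m d \<rho>" "v \<in> carrier_vec d" "v \<noteq> 0\<^sub>v d"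
    "\<And>b. b \<in> SL_upper m \<Longrightarrow> \<rho> b *\<^sub>v v = hw_char m \<mu> b \<cdot>\<^sub>v v"
  shows "is_V m \<mu> d \<rho>"
proof -
  have "b \<in> SL_upper m" if "b \<in> SL m" "upper_triangular b" for b
    using that by (auto simp: SL_upper_def SL_def)
  then show ?thesis
    using assms unfolding is_V_def has_highest_weight_def hw_char_def by auto
qed

section \<open>Symmetric powers\<close>

definition row_map :: "nat \<Rightarrow> complex mat \<Rightarrow> (nat \<Rightarrow> complex) \<Rightarrow> nat \<Rightarrow> complex"
  where "row_map m h x = (\<lambda>j. if j < m then \<Sum>k<m. x k * h $$ (k, j) else 0)"

text \<open>The coefficients of a lowest weight functional on V(r \<omega>_1) depend on
  \<open>g\<close> only through this row (\<open>exists_form\<close>), which realises the module as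
  a space of forms of degree \<open>r\<close>.\<close>

definition first_row :: "nat \<Rightarrow> complex mat \<Rightarrow> nat \<Rightarrow> complex"
  where "first_row m g = (\<lambda>j. if j < m then g $$ (0, j) else 0)"

definition ones :: "nat \<Rightarrow> nat \<Rightarrow> complex"
  where "ones m = (\<lambda>j. if j < m then 1 else 0)"

lemma first_row_mult:
  assumes "g \<in> carrier_mat m m" "h \<in> carrier_mat m m" "m > 0"
  shows "first_row m (g * h) = row_map m h (first_row m g)"
  using mult_mat_index[OF assms(1,2)] assms(3)
  by (auto simp: first_row_def row_map_def simp del: index_mult_mat(1) intro!: ext sum.cong)

text \<open>Polynomial functions that are homogeneous of degree \<open>r\<close>; of polynomiality only the
  restriction to lines is recorded.\<close>

definition forms :: "nat \<Rightarrow> ((nat \<Rightarrow> complex) \<Rightarrow> complex) set"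
  where "forms r = {P. (\<forall>x y. \<exists>q. \<forall>s. P (\<lambda>j. x j + s * y j) = poly q s) \<and>
                       (\<forall>c x. P (\<lambda>j. c * x j) = c ^ r * P x)}"

lemma formsI:
  assumes "\<And>x y. \<exists>q. \<forall>s. P (\<lambda>j. x j + s * y j) = poly q s"
    "\<And>c x. P (\<lambda>j. c * x j) = c ^ r * P x"
  shows "P \<in> forms r"
  using assms by (simp add: forms_def)

lemma forms_line:
  assumes "P \<in> forms r"
  obtains q where "\<forall>s. P (\<lambda>j. x j + s * y j) = poly q s"
proof -
  from assms have "\<exists>q. \<forall>s. P (\<lambda>j. x j + s * y j) = poly q s" by (simp add: forms_def)
  then show thesis using that by auto
qed

lemma forms_scale: "P \<in> forms r \<Longrightarrow> P (\<lambda>j. c * x j) = c ^ r * P x"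
  by (simp add: forms_def)

lemma forms_zero: "(\<lambda>_. 0) \<in> forms r"
  by (rule formsI) (auto intro: exI[of _ 0])

lemma forms_add:
  assumes "P \<in> forms r" "Q \<in> forms r"
  shows "(\<lambda>x. P x + Q x) \<in> forms r"
proof (rule formsI)
  fix x y
  obtain p where "\<forall>s. P (\<lambda>j. x j + s * y j) = poly p s" by (rule forms_line[OF assms(1)])
  moreover obtain q where "\<forall>s. Q (\<lambda>j. x j + s * y j) = poly q s" by (rule forms_line[OF assms(2)])
  ultimately show "\<exists>q. \<forall>s. P (\<lambda>j. x j + s * y j) + Q (\<lambda>j. x j + s * y j) = poly q s"
    by (intro exI[of _ "p + q"]) simp
qed (use assms in \<open>simp add: forms_scale distrib_left\<close>)

lemma forms_smult:
  assumes "P \<in> forms r"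
  shows "(\<lambda>x. c * P x) \<in> forms r"
proof (rule formsI)
  fix x y
  obtain p where "\<forall>s. P (\<lambda>j. x j + s * y j) = poly p s" by (rule forms_line[OF assms(1)])
  then show "\<exists>q. \<forall>s. c * P (\<lambda>j. x j + s * y j) = poly q s"
    by (intro exI[of _ "[:c:] * p"]) simp
qed (use assms in \<open>simp add: forms_scale\<close>)

lemma forms_row_map:
  assumes "P \<in> forms r"
  shows "(\<lambda>x. P (row_map m h x)) \<in> forms r"
proof (rule formsI)
  fix x y
  have "row_map m h (\<lambda>j. x j + s * y j) = (\<lambda>j. row_map m h x j + s * row_map m h y j)" for s
    by (auto simp: row_map_def algebra_simps sum.distrib sum_distrib_left)
  moreover obtain p where "\<forall>s. P (\<lambda>j. row_map m h x j + s * row_map m h y j) = poly p s"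
    by (rule forms_line[OF assms(1)])
  ultimately show "\<exists>q. \<forall>s. P (row_map m h (\<lambda>j. x j + s * y j)) = poly q s"
    by (intro exI[of _ p]) simp
next
  fix c x
  have "row_map m h (\<lambda>j. c * x j) = (\<lambda>j. c * row_map m h x j)"
    by (auto simp: row_map_def algebra_simps sum_distrib_left)
  then show "P (row_map m h (\<lambda>j. c * x j)) = c ^ r * P (row_map m h x)"
    using forms_scale[OF assms] by simp
qed

lemma forms_power: "(\<lambda>x. x 0 ^ r) \<in> forms r"
proof (rule formsI)
  fix x y :: "nat \<Rightarrow> complex"
  show "\<exists>q. \<forall>s. (x 0 + s * y 0) ^ r = poly q s"
    by (intro exI[of _ "[:x 0, y 0:] ^ r"]) (simp add: poly_power)
qed (simp add: power_mult_distrib)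

section \<open>Roots and polynomial identities over the complex numbers\<close>

lemma complex_root_exists:
  assumes "m > 0"
  obtains z :: complex where "z ^ m = c"
proof
  have "rcis (root m (cmod c)) (Arg c / real m) ^ m = rcis (root m (cmod c) ^ m) (real m * (Arg c / real m))"
    by (rule DeMoivre2)
  also have "\<dots> = c" using assms by (simp add: rcis_cmod_Arg)
  finally show "rcis (root m (cmod c)) (Arg c / real m) ^ m = c" .
qed

lemma poly_eq_of_infinite:
  fixes p q :: "complex poly"
  assumes "infinite S" "\<And>s. s \<in> S \<Longrightarrow> poly p s = poly q s"
  shows "p = q"
proof (rule ccontr)
  assume "p \<noteq> q"
  then have "finite {s. poly (p - q) s = 0}" by (intro poly_roots_finite) simp
  moreover have "S \<subseteq> {s. poly (p - q) s = 0}" using assms(2) by auto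
  ultimately show False using assms(1) finite_subset by blast
qed

lemma infinite_nonzero_complex: "infinite (UNIV - {0 :: complex})"
  by (simp add: infinite_UNIV_char_0)

text \<open>If \<open>N\<close> were negative, clearing the denominator would give a polynomial
  identity that fails at 0. Otherwise the composition of \<open>q\<close> with the
  \<open>m\<close>-th power is a monomial, and comparing degrees shows that \<open>m\<close> divides
  \<open>N\<close>. The \<open>m\<close>-th powers arise because only diagonal matrices of
  determinant 1 are available.\<close>

lemma monomial_of_power_int:
  fixes q :: "complex poly"
  assumes q: "\<And>z. z \<noteq> 0 \<Longrightarrow> poly q (z ^ m) = (z powi N) * c" and c: "c \<noteq> 0" and m: "m > 0"
  obtains e :: nat where "N = int m * int e" "\<And>y. poly q y = y ^ e * c"
proof -
  define Q where "Q = pcompose q (monom 1 m)"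
  have Q: "poly Q z = poly q (z ^ m)" for z by (simp add: Q_def poly_pcompose poly_monom)
  have "N \<ge> 0"
  proof (rule ccontr)
    assume N: "\<not> N \<ge> 0"
    define k where "k = nat (- N)"
    have k: "N = - int k" "k > 0" using N by (auto simp: k_def)
    have "monom 1 k * Q = [:c:]"
    proof (rule poly_eq_of_infinite[OF infinite_nonzero_complex])
      fix z :: complex assume "z \<in> UNIV - {0}"
      then show "poly (monom 1 k * Q) z = poly [:c:] z"
        using q[of z] k by (simp add: Q poly_monom power_int_minus)
    qed
    then have "poly (monom 1 k * Q) 0 = c" by simp
    then show False using k c by (simp add: poly_monom zero_power)
  qed
  define n where "n = nat N"
  have n: "N = int n" using \<open>N \<ge> 0\<close> by (simp add: n_def)
  have Qm: "Q = monom c n"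
  proof (rule poly_eq_of_infinite[OF infinite_nonzero_complex])
    fix z :: complex assume "z \<in> UNIV - {0}"
    then show "poly Q z = poly (monom c n) z"
      using q[of z] n by (simp add: Q poly_monom)
  qed
  have "degree Q = degree q * m" unfolding Q_def by (simp add: degree_pcompose degree_monom_eq)
  moreover have "degree Q = n" using Qm c by (simp add: degree_monom_eq)
  ultimately have e: "n = m * degree q" by simp
  have "poly q y = y ^ degree q * c" for y
  proof -
    obtain z where z: "z ^ m = y" by (rule complex_root_exists[OF m])
    have "poly q y = poly Q z" using Q z by simp
    also have "\<dots> = c * (z ^ m) ^ degree q" by (simp add: Qm poly_monom e power_mult)
    finally show ?thesis using z by simp
  qed
  then show thesis using that[of "degree q"] n e by simp
qed

lemma prod_power_int:
  assumes "z \<noteq> (0 :: complex)"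
  shows "(\<Prod>j\<in>A. z powi (a j)) = z powi (\<Sum>j\<in>A. a j)"
  by (induction A rule: infinite_finite_induct) (auto simp: power_int_add assms)

text \<open>An upper triangular completion of the row, in which the diagonal entry
  \<open>inverse (x 0)\<close> of the second row corrects the determinant.\<close>

lemma exists_SL_first_row:
  assumes "2 \<le> m" "x 0 \<noteq> 0" "\<And>j. j \<ge> m \<Longrightarrow> x j = 0"
  obtains g where "g \<in> SL m" "first_row m g = x"
proof -
  define g where "g = mat m m (\<lambda>(i, j). if i = 0 then x j else if i = j then (if i = 1 then inverse (x 0) else 1) else 0)"
  have c: "g \<in> carrier_mat m m" by (simp add: g_def)
  have "det g = (\<Prod>i<m. g $$ (i, i))" using c by (rule det_upper) (auto simp: g_def)
  also have "\<dots> = (\<Prod>i<m. if i = 0 then x 0 else if i = 1 then inverse (x 0) else 1)"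
    by (intro prod.cong) (auto simp: g_def)
  also have "\<dots> = (\<Prod>i\<in>{0, 1 :: nat}. if i = 0 then x 0 else if i = 1 then inverse (x 0) else 1)"
    using assms(1) by (intro prod.mono_neutral_right) auto
  finally have "det g = 1" using assms by simp
  moreover have "first_row m g = x"
    using assms by (auto simp: first_row_def g_def intro!: ext)
  ultimately show thesis using c that by (simp add: SL_def)
qed

locale symmetric_power_model = highest_weight_model m d \<rho> "\<lambda>j. r * fundamental_weight 1 j" v
  for m d \<rho> r v +
  fixes f
  assumes f_carrier: "f \<in> carrier_vec d" and f_v: "f \<bullet> v = 1"
    and f_lower: "\<And>b u. b \<in> SL_lower m \<Longrightarrow> u \<in> carrier_vec d
      \<Longrightarrow> f \<bullet> (\<rho> b *\<^sub>v u) = hw_char m (\<lambda>j. r * fundamental_weight 1 j) b * (f \<bullet> u)"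
begin

lemma hw_char_first: "hw_char m (\<lambda>j. r * fundamental_weight 1 j) b = b $$ (0, 0) ^ r"
proof -
  have "hw_char m (\<lambda>j. r * fundamental_weight 1 j) b = (\<Prod>i = 1..m - 1. if i = 1 then b $$ (0, 0) ^ r else 1)"
    unfolding hw_char_def by (intro prod.cong) (auto simp: fundamental_weight_def)
  then show ?thesis using m2 by (simp add: prod.delta)
qed

text \<open>Both sides scale in the same way under lower triangular matrices from the left and upper
  triangular ones from the right, and they agree at the unit matrix. Hence they agree on the big
  cell.\<close>

lemma coefficient_first:
  assumes g: "g \<in> SL m"
  shows "f \<bullet> (\<rho> g *\<^sub>v v) = g $$ (0, 0) ^ r"
proof -
  obtain p where p: "p \<in> polynomial_functions m" "\<forall>g \<in> SL m. f \<bullet> (\<rho> g *\<^sub>v v) = p g"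
    using coefficient_polynomial[OF v_carrier] by auto
  \<comment> \<open>The power is written as a product because \<open>polynomial_functions\<close> is
    closed under products.\<close>
  have "(\<lambda>g. p g + (-1) * (\<Prod>i<r. g $$ (0, 0))) \<in> polynomial_functions m"
    using m2 by (intro polynomial_functions.add p polynomial_functions.mult polynomial_functions.const
        polynomial_functions_prod polynomial_functions.entry) auto
  then have "p g + (-1) * (\<Prod>i<r. g $$ (0, 0)) = 0"
  proof (rule polynomial_zero_of_big_cell[OF _ _ g])
    fix l u assume lu: "l \<in> SL_lower m" "u \<in> SL_upper m"
    then have S: "l \<in> SL m" "u \<in> SL m" by (auto dest: SL_lowerD SL_upperD)
    have "p (l * u) = f \<bullet> (\<rho> (l * u) *\<^sub>v v)" using p(2) SL_mult[OF S] by simp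
    also have "\<dots> = l $$ (0, 0) ^ r * (f \<bullet> (\<rho> u *\<^sub>v v))"
      using rep_mult_vec[OF S v_carrier] f_lower[OF lu(1) rep_vec[OF S(2) v_carrier]] hw_char_first by simp
    also have "\<dots> = (l $$ (0, 0) * u $$ (0, 0)) ^ r"
      using v_upper[OF lu(2)] hw_char_first f_v f_carrier v_carrier by (simp add: power_mult_distrib)
    also have "l $$ (0, 0) * u $$ (0, 0) = (l * u) $$ (0, 0)"
    proof -
      have "(l * u) $$ (0, 0) = (\<Sum>k<m. l $$ (0, k) * u $$ (k, 0))"
        using m2 by (intro mult_mat_index[OF SL_carrier[OF S(1)] SL_carrier[OF S(2)]]) auto
      also have "\<dots> = (\<Sum>k<m. if k = 0 then l $$ (0, 0) * u $$ (0, 0) else 0)"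
        using SL_lowerD(2)[OF lu(1), of 0] by (intro sum.cong) auto
      finally have "(l * u) $$ (0, 0) = (\<Sum>k<m. if k = 0 then l $$ (0, 0) * u $$ (0, 0) else 0)" .
      then show ?thesis using m2 by simp
    qed
    finally show "p (l * u) + (-1) * (\<Prod>i<r. (l * u) $$ (0, 0)) = 0" by simp
  qed (use m2 in simp)
  then show ?thesis using p(2) g by simp
qed

text \<open>The vectors with such a coefficient function form an invariant subspace, since right
  multiplication acts through \<open>row_map\<close>, which carries forms to forms. It contains
  \<open>v\<close>, whose form is the \<open>r\<close>-th power of the first coordinate, so
  irreducibility gives the whole module.\<close>

lemma exists_form:
  assumes "w \<in> carrier_vec d"
  obtains P where "P \<in> forms r" "\<forall>g \<in> SL m. f \<bullet> (\<rho> g *\<^sub>v w) = P (first_row m g)"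
proof -
  define U where "U = {w \<in> carrier_vec d. \<exists>P \<in> forms r. \<forall>g \<in> SL m. f \<bullet> (\<rho> g *\<^sub>v w) = P (first_row m g)}"
  have "csubspace d U"
  proof (rule csubspaceI)
    show "0\<^sub>v d \<in> U" unfolding U_def
      using forms_zero f_carrier by (auto simp: mat_mult_zero_vec[OF rep_carrier] intro!: bexI[of _ "\<lambda>_. 0"])
  next
    fix u w assume "u \<in> U" "w \<in> U"
    then obtain P Q where PQ: "u \<in> carrier_vec d" "w \<in> carrier_vec d" "P \<in> forms r" "Q \<in> forms r"
      "\<forall>g \<in> SL m. f \<bullet> (\<rho> g *\<^sub>v u) = P (first_row m g)" "\<forall>g \<in> SL m. f \<bullet> (\<rho> g *\<^sub>v w) = Q (first_row m g)"
      unfolding U_def by auto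
    have "f \<bullet> (\<rho> g *\<^sub>v (u + w)) = P (first_row m g) + Q (first_row m g)" if "g \<in> SL m" for g
      using rep_add[OF that PQ(1,2)] scalar_prod_add_distrib[OF f_carrier rep_vec[OF that PQ(1)] rep_vec[OF that PQ(2)]]
        PQ(5,6) that by simp
    then show "u + w \<in> U" unfolding U_def
      using PQ(1,2) forms_add[OF PQ(3,4)] by (auto intro!: bexI[of _ "\<lambda>x. P x + Q x"])
  next
    fix c u assume "u \<in> U"
    then obtain P where P: "u \<in> carrier_vec d" "P \<in> forms r"
      "\<forall>g \<in> SL m. f \<bullet> (\<rho> g *\<^sub>v u) = P (first_row m g)" unfolding U_def by auto
    have "f \<bullet> (\<rho> g *\<^sub>v (c \<cdot>\<^sub>v u)) = c * P (first_row m g)" if "g \<in> SL m" for g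
      using rep_smult[OF that P(1)] scalar_prod_smult_distrib[OF f_carrier rep_vec[OF that P(1)]] P(3) that by simp
    then show "c \<cdot>\<^sub>v u \<in> U" unfolding U_def
      using P(1) forms_smult[OF P(2)] by (auto intro!: bexI[of _ "\<lambda>x. c * P x"])
  qed (auto simp: U_def)
  then have "U = {0\<^sub>v d} \<or> U = carrier_vec d"
  proof (rule stable_subspace)
    fix h u assume h: "h \<in> SL m" and "u \<in> U"
    then obtain P where P: "u \<in> carrier_vec d" "P \<in> forms r"
      "\<forall>g \<in> SL m. f \<bullet> (\<rho> g *\<^sub>v u) = P (first_row m g)" unfolding U_def by auto
    have "f \<bullet> (\<rho> g *\<^sub>v (\<rho> h *\<^sub>v u)) = P (row_map m h (first_row m g))" if "g \<in> SL m" for g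
      using rep_mult_vec[OF that h P(1)] bspec[OF P(3) SL_mult[OF that h]]
        first_row_mult[OF SL_carrier[OF that] SL_carrier[OF h]] m2 by simp
    then show "\<rho> h *\<^sub>v u \<in> U" unfolding U_def
      using rep_vec[OF h P(1)] forms_row_map[OF P(2)] by (auto intro!: bexI[of _ "\<lambda>x. P (row_map m h x)"])
  qed
  moreover have "v \<in> U" unfolding U_def
    using v_carrier forms_power coefficient_first m2
    by (auto simp: first_row_def intro!: bexI[of _ "\<lambda>x. x 0 ^ r"])
  ultimately have "U = carrier_vec d" using v_nonzero by auto
  then have "\<exists>P \<in> forms r. \<forall>g \<in> SL m. f \<bullet> (\<rho> g *\<^sub>v w) = P (first_row m g)"
    using assms unfolding U_def by auto
  then show thesis using that by auto
qed

lemma f_nonzero: "f \<noteq> 0\<^sub>v d"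
  using f_v v_carrier by auto

text \<open>A torus weight vector corresponds to a monomial, whose exponents are non-negative.\<close>

lemma weight_exponents:
  assumes w: "w \<in> carrier_vec d" "w \<noteq> 0\<^sub>v d"
    and weight: "\<And>t. (\<Prod>i<m. t i) = 1 \<Longrightarrow> \<rho> (diagm m t) *\<^sub>v w = (\<Prod>i<m. t i powi \<kappa> i) \<cdot>\<^sub>v w"
  obtains P e where "\<forall>g \<in> SL m. f \<bullet> (\<rho> g *\<^sub>v w) = P (first_row m g)" "P (ones m) \<noteq> 0"
    "\<forall>i<m. int m * int (e i) = int r - (\<Sum>j<m. \<kappa> j) + int m * \<kappa> i"
    "\<forall>i<m. \<forall>s. P (\<lambda>j. if j = i then s else ones m j) = s ^ e i * P (ones m)"
proof -
  obtain P where P: "P \<in> forms r" "\<forall>g \<in> SL m. f \<bullet> (\<rho> g *\<^sub>v w) = P (first_row m g)"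
    by (rule exists_form[OF w(1)])
  \<comment> \<open>A diagonal matrix on the right rescales the columns, hence the entries of the
    first row. The condition on \<open>x 0\<close> makes \<open>x\<close> the first row of some
    matrix in \<open>SL m\<close>.\<close>
  have torus: "P (\<lambda>j. x j * t j) = (\<Prod>i<m. t i powi \<kappa> i) * P x"
    if t: "(\<Prod>i<m. t i) = 1" and x: "x 0 \<noteq> 0" "\<And>j. j \<ge> m \<Longrightarrow> x j = 0" for x t
  proof -
    have "\<exists>g. g \<in> SL m \<and> first_row m g = x"
      by (rule exists_SL_first_row[of m x]) (use m2 x in auto)
    then obtain g where g: "g \<in> SL m" "first_row m g = x" by auto
    have "first_row m (g * diagm m t) = (\<lambda>j. x j * t j)"
      using g x mult_diagm_index[OF SL_carrier[OF g(1)], of 0 _ t] m2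
      by (auto simp: first_row_def simp del: index_mult_mat(1) intro!: ext)
    then have "P (\<lambda>j. x j * t j) = f \<bullet> (\<rho> (g * diagm m t) *\<^sub>v w)"
      using P(2) SL_mult[OF g(1) diagm_SL[OF t]] by simp
    also have "\<dots> = f \<bullet> (\<rho> g *\<^sub>v ((\<Prod>i<m. t i powi \<kappa> i) \<cdot>\<^sub>v w))"
      using rep_mult_vec[OF g(1) diagm_SL[OF t] w(1)] weight[OF t] by simp
    also have "\<dots> = (\<Prod>i<m. t i powi \<kappa> i) * (f \<bullet> (\<rho> g *\<^sub>v w))"
      using rep_smult[OF g(1) w(1)] scalar_prod_smult_distrib[OF f_carrier rep_vec[OF g(1) w(1)]] by simp
    finally show ?thesis using P(2) g by simp
  qed
  have ones0: "ones m 0 \<noteq> 0" "\<And>j. j \<ge> m \<Longrightarrow> ones m j = 0" using m2 by (auto simp: ones_def)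
  \<comment> \<open>Scaling and the torus together carry \<open>ones m\<close> to every row without
    zero entries. If \<open>P\<close> vanished at \<open>ones m\<close>, it would vanish at all
    these rows, then at all rows by polynomiality along lines, and \<open>w\<close> would be
    0.\<close>
  have "P (ones m) \<noteq> 0"
  proof
    assume P0: "P (ones m) = 0"
    have nz: "P x = 0" if x: "\<And>j. j < m \<Longrightarrow> x j \<noteq> 0" "\<And>j. j \<ge> m \<Longrightarrow> x j = 0" for x
    proof -
      \<comment> \<open>Dividing by an \<open>m\<close>-th root of the product of the entries leaves
        a diagonal matrix of determinant 1.\<close>
      obtain z where z: "z ^ m = (\<Prod>j<m. x j)" using complex_root_exists[of m] m2 by auto
      have "(\<Prod>j<m. x j) \<noteq> 0" using x(1) by simp
      then have z0: "z \<noteq> 0" using z m2 by (auto simp: zero_power)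
      define t where "t j = x j / z" for j
      have t: "(\<Prod>j<m. t j) = 1" using z z0 x(1) by (simp add: t_def prod_dividef)
      have "x = (\<lambda>j. z * (ones m j * t j))" using z0 x(2) by (auto simp: t_def ones_def intro!: ext)
      then have "P x = z ^ r * P (\<lambda>j. ones m j * t j)" using forms_scale[OF P(1)] by metis
      also have "P (\<lambda>j. ones m j * t j) = 0" using torus[OF t, of "ones m"] ones0 P0 by simp
      finally show ?thesis by simp
    qed
    have all0: "P y = 0" if y: "\<And>j. j \<ge> m \<Longrightarrow> y j = 0" for y
    proof -
      obtain q where q: "\<forall>s. P (\<lambda>j. y j + s * (ones m j - y j)) = poly q s"
        by (rule forms_line[OF P(1)])
      \<comment> \<open>The finitely many parameters at which the line through \<open>y\<close> and
        \<open>ones m\<close> meets a coordinate hyperplane, together with none from coordinates in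
        which \<open>y\<close> is 1.\<close>
      define B where "B = (\<Union>j<m. {s. y j + s * (1 - y j) = 0})"
      have "finite {s. y j + s * (1 - y j) = 0}" for j
      proof (cases "y j = 1")
        case False
        then have "{s. y j + s * (1 - y j) = 0} \<subseteq> {- y j / (1 - y j)}"
          by (auto simp: field_simps add_eq_0_iff)
        then show ?thesis using finite_subset by blast
      qed simp
      then have "finite B" by (simp add: B_def)
      then have "infinite (UNIV - B)" using infinite_UNIV_char_0 by (intro Diff_infinite_finite) auto
      then have "q = 0"
      proof (rule poly_eq_of_infinite)
        fix s assume "s \<in> UNIV - B"
        then have "P (\<lambda>j. y j + s * (ones m j - y j)) = 0"
          using y by (intro nz) (auto simp: ones_def B_def)
        then show "poly q s = poly 0 s" using q by simp
      qed
      then have "P (\<lambda>j. y j + 0 * (ones m j - y j)) = 0" using q by (metis poly_0)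
      then show ?thesis by simp
    qed
    have "\<forall>g \<in> SL m. f \<bullet> (\<rho> g *\<^sub>v w) = 0"
      using P(2) all0[of "first_row m _"] by (auto simp: first_row_def)
    then have "w \<in> {u \<in> carrier_vec d. \<forall>g \<in> SL m. f \<bullet> (\<rho> g *\<^sub>v u) = 0}" using w by simp
    then show False using annihilator_cases[OF f_carrier] f_nonzero w by auto
  qed
  have ex: "\<exists>e. int m * int e = int r - (\<Sum>j<m. \<kappa> j) + int m * \<kappa> i \<and>
      (\<forall>s. P (\<lambda>j. if j = i then s else ones m j) = s ^ e * P (ones m))" if i: "i < m" for i
  proof -
    obtain q where q: "\<forall>s. P (\<lambda>j. (if j = i then 0 else ones m j) + s * (if j = i then 1 else 0)) = poly q s"
      by (rule forms_line[OF P(1)])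
    have q: "P (\<lambda>j. if j = i then s else ones m j) = poly q s" for s
    proof -
      have "(\<lambda>j. if j = i then s else ones m j) = (\<lambda>j. (if j = i then 0 else ones m j) + s * (if j = i then 1 else 0))"
        by auto
      then show ?thesis using q by simp
    qed
    have "poly q (z ^ m) = (z powi (int r - (\<Sum>j<m. \<kappa> j) + int m * \<kappa> i)) * P (ones m)" if z: "z \<noteq> 0" for z
    proof -
      \<comment> \<open>The diagonal matrix with these powers of \<open>z\<close> has determinant 1;
        followed by scaling with \<open>z\<close>, it changes only coordinate \<open>i\<close>, from
        1 to \<open>z ^ m\<close>.\<close>
      define a where "a j = (if j = i then int m - 1 else -1)" for j
      define t where "t j = z powi (a j)" for j
      have sa: "(\<Sum>j<m. a j) = 0" using i by (simp add: a_def sum.remove[of _ i] of_nat_diff)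
      have t: "(\<Prod>j<m. t j) = 1" unfolding t_def prod_power_int[OF z] sa by simp
      have "(\<lambda>j. if j = i then z ^ m else ones m j) = (\<lambda>j. z * (ones m j * t j))"
        using z i m2 by (auto simp: t_def a_def ones_def power_int_minus power_int_diff intro!: ext)
      then have "poly q (z ^ m) = z ^ r * P (\<lambda>j. ones m j * t j)"
        using q[of "z ^ m"] forms_scale[OF P(1), of z "\<lambda>j. ones m j * t j"] by simp
      also have "P (\<lambda>j. ones m j * t j) = (\<Prod>j<m. t j powi \<kappa> j) * P (ones m)"
        using torus[OF t, of "ones m"] ones0 by simp
      also have "(\<Prod>j<m. t j powi \<kappa> j) = z powi (\<Sum>j<m. a j * \<kappa> j)"
        unfolding t_def prod_power_int[OF z, symmetric] by (simp add: power_int_mult)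
      also have "(\<Sum>j<m. a j * \<kappa> j) = int m * \<kappa> i - (\<Sum>j<m. \<kappa> j)"
        using i by (simp add: a_def sum.remove[of _ i] sum_negf algebra_simps)
      finally show ?thesis using z by (simp add: power_int_add power_int_diff algebra_simps)
    qed
    then obtain e :: nat where e: "int r - (\<Sum>j<m. \<kappa> j) + int m * \<kappa> i = int m * int e"
      "\<And>y. poly q y = y ^ e * P (ones m)"
      using monomial_of_power_int[of q m _ "P (ones m)"] \<open>P (ones m) \<noteq> 0\<close> m2 by (metis gr0I not_numeral_le_zero)
    then show ?thesis using q by auto
  qed
  then have "\<forall>i\<in>{..<m}. \<exists>e. int m * int e = int r - (\<Sum>j<m. \<kappa> j) + int m * \<kappa> i \<and>
      (\<forall>s. P (\<lambda>j. if j = i then s else ones m j) = s ^ e * P (ones m))" by simp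
  from bchoice[OF this] obtain e where e: "\<forall>i\<in>{..<m}. int m * int (e i) = int r - (\<Sum>j<m. \<kappa> j) + int m * \<kappa> i \<and>
      (\<forall>s. P (\<lambda>j. if j = i then s else ones m j) = s ^ e i * P (ones m))" ..
  show thesis
    by (rule that[of P e]) (use P(2) \<open>P (ones m) \<noteq> 0\<close> e in auto)
qed

end

section \<open>Invariants of triple tensor products\<close>

lemma sum_lessThan_mult:
  "(\<Sum>x<n * k. F x) = (\<Sum>i<n. \<Sum>j<k. F (i * k + j))" for n k :: nat
proof (induction n)
  case (Suc n)
  have "(\<Sum>x<Suc n * k. F x) = (\<Sum>x<n * k. F x) + (\<Sum>x=n * k..<Suc n * k. F x)"
    using sum.atLeastLessThan_concat[of 0 "n * k" "Suc n * k" F] by (simp add: lessThan_atLeast0)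
  also have "(\<Sum>x=n * k..<Suc n * k. F x) = (\<Sum>j<k. F (n * k + j))"
    using sum.shift_bounds_nat_ivl[of F 0 "n * k" k] by (simp add: lessThan_atLeast0 add.commute)
  finally show ?case using Suc by simp
qed simp

lemma index_pair_less: "i < n \<Longrightarrow> j < k \<Longrightarrow> i * k + j < n * k" for i j k n :: nat
proof -
  assume "i < n" "j < k"
  then have "i * k + j < Suc i * k" by simp
  also have "\<dots> \<le> n * k" using \<open>i < n\<close> by (intro mult_le_mono1) auto
  finally show ?thesis .
qed

lemma kronecker_carrier:
  "A \<in> carrier_mat n n' \<Longrightarrow> B \<in> carrier_mat k k' \<Longrightarrow> kronecker A B \<in> carrier_mat (n * k) (n' * k')"
  by (auto simp: kronecker_def)

lemma kronecker_index:
  assumes "A \<in> carrier_mat n n'" "B \<in> carrier_mat k k'" "i < n" "j < k" "i' < n'" "j' < k'"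
  shows "kronecker A B $$ (i * k + j, i' * k' + j') = A $$ (i, i') * B $$ (j, j')"
  using assms index_pair_less[OF assms(3,4)] index_pair_less[OF assms(5,6)]
  by (auto simp: kronecker_def)

definition triple_index :: "nat \<Rightarrow> nat \<Rightarrow> nat \<Rightarrow> nat \<Rightarrow> nat \<Rightarrow> nat"
  where "triple_index d2 d3 i j k = (i * d2 + j) * d3 + k"

lemma triple_index_less:
  "i < d1 \<Longrightarrow> j < d2 \<Longrightarrow> k < d3 \<Longrightarrow> triple_index d2 d3 i j k < d1 * d2 * d3"
  unfolding triple_index_def by (intro index_pair_less)

lemma triple_index_cases:
  assumes "x < d1 * d2 * d3"
  obtains i j k where "i < d1" "j < d2" "k < d3" "x = triple_index d2 d3 i j k"
proof -
  have pos: "d3 > 0" "d2 > 0" using assms by (auto intro!: Nat.gr0I)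
  have "x div d3 < d1 * d2" using assms by (simp add: less_mult_imp_div_less)
  then have "x div d3 div d2 < d1" by (simp add: less_mult_imp_div_less)
  moreover have "x div d3 mod d2 < d2" "x mod d3 < d3" using pos by simp_all
  moreover have "x = triple_index d2 d3 (x div d3 div d2) (x div d3 mod d2) (x mod d3)"
    unfolding triple_index_def by simp
  ultimately show thesis by (rule that)
qed

lemma kronecker3_vec_index:
  assumes A: "A \<in> carrier_mat d1 e1" and B: "B \<in> carrier_mat d2 e2" and C: "C \<in> carrier_mat d3 e3"
    and x: "x \<in> carrier_vec (e1 * e2 * e3)" and ijk: "i < d1" "j < d2" "k < d3"
  shows "(kronecker (kronecker A B) C *\<^sub>v x) $ triple_index d2 d3 i j k =
    (\<Sum>i'<e1. \<Sum>j'<e2. \<Sum>k'<e3. A $$ (i, i') * B $$ (j, j') * C $$ (k, k') * x $ triple_index e2 e3 i' j' k')"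
proof -
  have AB: "kronecker A B \<in> carrier_mat (d1 * d2) (e1 * e2)" by (rule kronecker_carrier[OF A B])
  have ABC: "kronecker (kronecker A B) C \<in> carrier_mat (d1 * d2 * d3) (e1 * e2 * e3)"
    by (rule kronecker_carrier[OF AB C])
  have "(kronecker (kronecker A B) C *\<^sub>v x) $ triple_index d2 d3 i j k =
    (\<Sum>l<e1 * e2 * e3. kronecker (kronecker A B) C $$ (triple_index d2 d3 i j k, l) * x $ l)"
    by (rule mult_mat_vec_index[OF ABC x triple_index_less[OF ijk]])
  also have "\<dots> = (\<Sum>i'<e1. \<Sum>j'<e2. \<Sum>k'<e3. kronecker (kronecker A B) C $$ (triple_index d2 d3 i j k, triple_index e2 e3 i' j' k') * x $ triple_index e2 e3 i' j' k')"
    unfolding sum_lessThan_mult triple_index_def ..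
  also have "\<dots> = (\<Sum>i'<e1. \<Sum>j'<e2. \<Sum>k'<e3. A $$ (i, i') * B $$ (j, j') * C $$ (k, k') * x $ triple_index e2 e3 i' j' k')"
  proof (intro sum.cong refl)
    fix i' j' k' assume "i' \<in> {..<e1}" "j' \<in> {..<e2}" "k' \<in> {..<e3}"
    then have l: "i' < e1" "j' < e2" "k' < e3" by auto
    show "kronecker (kronecker A B) C $$ (triple_index d2 d3 i j k, triple_index e2 e3 i' j' k') * x $ triple_index e2 e3 i' j' k'
      = A $$ (i, i') * B $$ (j, j') * C $$ (k, k') * x $ triple_index e2 e3 i' j' k'"
      unfolding triple_index_def
        kronecker_index[OF AB C index_pair_less[OF ijk(1,2)] ijk(3) index_pair_less[OF l(1,2)] l(3)]
        kronecker_index[OF A B ijk(1,2) l(1,2)] ..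
  qed
  finally show ?thesis .
qed

text \<open>Put \<open>\<alpha>\<close> and \<open>\<gamma>\<close> in opposite corners of an $m \times c$ rectangle: the remaining boxes form
  a horizontal strip of size \<open>r\<close>.\<close>

definition pieri_condition :: "nat \<Rightarrow> (nat \<Rightarrow> nat) \<Rightarrow> nat \<Rightarrow> (nat \<Rightarrow> nat) \<Rightarrow> bool"
  where "pieri_condition m \<alpha> r \<gamma> \<longleftrightarrow> (\<exists>c. (\<forall>i\<in>{1..m}. \<alpha> i + \<gamma> (m + 1 - i) \<le> c) \<and>
    (\<forall>i\<in>{1..m - 1}. c \<le> \<alpha> i + \<gamma> (m - i)) \<and>
    m * c = r + (\<Sum>i = 1..m. \<alpha> i) + (\<Sum>i = 1..m. \<gamma> i))"

subsection \<open>Rank one elements\<close>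

text \<open>The 2 by 2 matrices embedded in rows and columns \<open>i\<close> and
  \<open>Suc i\<close>, that is, in the rank one subgroup of a simple root.\<close>

definition block_mat :: "nat \<Rightarrow> nat \<Rightarrow> complex \<Rightarrow> complex \<Rightarrow> complex \<Rightarrow> complex \<Rightarrow> complex mat"
  where "block_mat m i a b c d = mat m m (\<lambda>(p, q).
    if p = i then (if q = i then a else if q = Suc i then b else 0)
    else if p = Suc i then (if q = i then c else if q = Suc i then d else 0)
    else if p = q then 1 else 0)"

lemma block_mat_carrier [simp]: "block_mat m i a b c d \<in> carrier_mat m m"
  by (simp add: block_mat_def)

lemma block_mat_index:
  "p < m \<Longrightarrow> q < m \<Longrightarrow> block_mat m i a b c d $$ (p, q) =
    (if p = i then (if q = i then a else if q = Suc i then b else 0)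
    else if p = Suc i then (if q = i then c else if q = Suc i then d else 0)
    else if p = q then 1 else 0)"
  by (simp add: block_mat_def)

lemma block_mat_mult:
  assumes i: "Suc i < m"
  shows "block_mat m i a b c d * block_mat m i a' b' c' d' =
    block_mat m i (a * a' + b * c') (a * b' + b * d') (c * a' + d * c') (c * b' + d * d')"
    (is "?A * ?B = ?C")
proof (intro eq_matI)
  fix p q assume "p < dim_row ?C" "q < dim_col ?C"
  then have pq: "p < m" "q < m" by (auto simp: block_mat_def)
  have e: "(?A * ?B) $$ (p, q) = (\<Sum>l<m. ?A $$ (p, l) * ?B $$ (l, q))"
    by (rule mult_mat_index[OF block_mat_carrier block_mat_carrier pq])
  show "(?A * ?B) $$ (p, q) = ?C $$ (p, q)"
  proof (cases "p = i \<or> p = Suc i")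
    case True
    have "(\<Sum>l<m. ?A $$ (p, l) * ?B $$ (l, q)) = (\<Sum>l\<in>{i, Suc i}. ?A $$ (p, l) * ?B $$ (l, q))"
      using True pq i by (intro sum.mono_neutral_right) (auto simp: block_mat_index)
    then show ?thesis using e True pq i by (auto simp: block_mat_index)
  next
    case False
    have "(\<Sum>l<m. ?A $$ (p, l) * ?B $$ (l, q)) = (\<Sum>l\<in>{p}. ?A $$ (p, l) * ?B $$ (l, q))"
      using False pq i by (intro sum.mono_neutral_right) (auto simp: block_mat_index)
    then show ?thesis using e False pq i by (auto simp: block_mat_index)
  qed
qed (auto simp: block_mat_def)

lemma block_mat_upper:
  assumes i: "Suc i < m" and ad: "a * d = 1"
  shows "block_mat m i a b 0 d \<in> SL_upper m"
proof -
  have "det (block_mat m i a b 0 d) = (\<Prod>p<m. block_mat m i a b 0 d $$ (p, p))"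
    by (rule det_upper) (auto simp: block_mat_index)
  also have "\<dots> = (\<Prod>p\<in>{i, Suc i}. block_mat m i a b 0 d $$ (p, p))"
    using i by (intro prod.mono_neutral_right) (auto simp: block_mat_index)
  also have "\<dots> = 1" using i ad by (simp add: block_mat_index)
  finally show ?thesis using i by (auto simp: SL_upper_def SL_def block_mat_index)
qed

lemma block_mat_lower:
  assumes i: "Suc i < m" and ad: "a * d = 1"
  shows "block_mat m i a 0 c d \<in> SL_lower m"
proof -
  have "det (block_mat m i a 0 c d) = (\<Prod>p<m. block_mat m i a 0 c d $$ (p, p))"
    by (rule det_lower) (auto simp: block_mat_index)
  also have "\<dots> = (\<Prod>p\<in>{i, Suc i}. block_mat m i a 0 c d $$ (p, p))"
    using i by (intro prod.mono_neutral_right) (auto simp: block_mat_index)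
  also have "\<dots> = 1" using i ad by (simp add: block_mat_index)
  finally show ?thesis using i by (auto simp: SL_lower_def SL_def block_mat_index)
qed

text \<open>Being a product of three unipotent matrices, it needs no computation of a
  determinant.\<close>

lemma block_mat_reflection:
  assumes i: "Suc i < m"
  shows "block_mat m i 0 1 (-1) 0 \<in> SL m"
proof -
  have "block_mat m i 0 1 (-1) 0 = block_mat m i 1 1 0 1 * block_mat m i 1 0 (-1) 1 * block_mat m i 1 1 0 1"
    by (simp add: block_mat_mult[OF i])
  then show ?thesis
    using SL_upperD(1)[OF block_mat_upper[OF i, of 1 1 1]] SL_lowerD(1)[OF block_mat_lower[OF i, of 1 1 "-1"]]
    by (auto intro!: SL_mult)
qed

definition antidiag :: "nat \<Rightarrow> (nat \<Rightarrow> complex) \<Rightarrow> complex mat"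
  where "antidiag m c = mat m m (\<lambda>(i, j). if i + j = m - 1 then c i else 0)"

lemma antidiag_carrier [simp]: "antidiag m c \<in> carrier_mat m m"
  by (simp add: antidiag_def)

lemma antidiag_mult_index:
  assumes "A \<in> carrier_mat m n" "i < m" "j < n"
  shows "(antidiag m c * A) $$ (i, j) = c i * A $$ (m - 1 - i, j)"
proof -
  have "(antidiag m c * A) $$ (i, j) = (\<Sum>l<m. antidiag m c $$ (i, l) * A $$ (l, j))"
    by (rule mult_mat_index[OF antidiag_carrier assms])
  also have "\<dots> = (\<Sum>l\<in>{m - 1 - i}. antidiag m c $$ (i, l) * A $$ (l, j))"
    using assms by (intro sum.mono_neutral_right) (auto simp: antidiag_def)
  finally show ?thesis using assms by (simp add: antidiag_def)
qed

lemma mult_antidiag_index: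
  assumes "A \<in> carrier_mat n m" "i < n" "j < m"
  shows "(A * antidiag m c) $$ (i, j) = A $$ (i, m - 1 - j) * c (m - 1 - j)"
proof -
  have "(A * antidiag m c) $$ (i, j) = (\<Sum>l<m. A $$ (i, l) * antidiag m c $$ (l, j))"
    by (rule mult_mat_index[OF assms(1) antidiag_carrier assms(2,3)])
  also have "\<dots> = (\<Sum>l\<in>{m - 1 - j}. A $$ (i, l) * antidiag m c $$ (l, j))"
    using assms by (intro sum.mono_neutral_right) (auto simp: antidiag_def)
  finally show ?thesis using assms by (simp add: antidiag_def)
qed

lemma antidiag_mult: "antidiag m c * antidiag m c' = diagm m (\<lambda>i. c i * c' (m - 1 - i))"
proof (intro eq_matI)
  fix i j assume "i < dim_row (diagm m (\<lambda>i. c i * c' (m - 1 - i)))" "j < dim_col (diagm m (\<lambda>i. c i * c' (m - 1 - i)))"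
  then have ij: "i < m" "j < m" by auto
  then show "(antidiag m c * antidiag m c') $$ (i, j) = diagm m (\<lambda>i. c i * c' (m - 1 - i)) $$ (i, j)"
    unfolding antidiag_mult_index[OF antidiag_carrier ij] by (auto simp: diagm_index antidiag_def)
qed (auto simp: antidiag_def)

text \<open>The longest Weyl group element, with a sign making the determinant $1$.\<close>

lemma exists_longest:
  assumes "m > 0"
  obtains c :: "nat \<Rightarrow> complex" where "\<forall>i. c i * c i = 1" "\<forall>i. i \<noteq> 0 \<longrightarrow> c i = 1" "antidiag m c \<in> SL m"
    "antidiag m (\<lambda>i. c (m - 1 - i)) \<in> SL m"
    "antidiag m c * antidiag m (\<lambda>i. c (m - 1 - i)) = 1\<^sub>m m"
    "antidiag m (\<lambda>i. c (m - 1 - i)) * antidiag m c = 1\<^sub>m m"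
proof -
  define \<delta> where "\<delta> = det (antidiag m (\<lambda>_. 1))"
  have one: "diagm m (\<lambda>i. 1) = 1\<^sub>m m" by (intro eq_matI) (auto simp: diagm_index)
  have "antidiag m (\<lambda>_. 1) * antidiag m (\<lambda>_. 1) = 1\<^sub>m m"
    unfolding antidiag_mult using one by simp
  then have \<delta>: "\<delta> * \<delta> = 1" unfolding \<delta>_def using det_mult[of "antidiag m (\<lambda>_. 1)" m "antidiag m (\<lambda>_. 1)"] by simp
  define c where "c i = (if i = (0::nat) then \<delta> else 1)" for i
  have cc: "c i * c i = 1" for i using \<delta> by (simp add: c_def)
  have "antidiag m c = diagm m c * antidiag m (\<lambda>_. 1)"
    by (intro eq_matI) (auto simp: diagm_mult_index[of _ m m] antidiag_def simp del: index_mult_mat(1))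
  then have "det (antidiag m c) = det (diagm m c) * \<delta>"
    unfolding \<delta>_def using det_mult[of "diagm m c" m "antidiag m (\<lambda>_. 1)"] by simp
  also have "det (diagm m c) = \<delta>" using assms by (simp add: det_diagm c_def prod.delta)
  finally have d: "det (antidiag m c) = 1" using \<delta> by simp
  have e: "antidiag m c * antidiag m (\<lambda>i. c (m - 1 - i)) = 1\<^sub>m m"
    unfolding antidiag_mult by (intro eq_matI) (auto simp: diagm_index cc)
  have e': "antidiag m (\<lambda>i. c (m - 1 - i)) * antidiag m c = 1\<^sub>m m"
    unfolding antidiag_mult by (intro eq_matI) (auto simp: diagm_index cc)
  have "det (antidiag m (\<lambda>i. c (m - 1 - i))) = 1"
    using det_mult[of "antidiag m c" m "antidiag m (\<lambda>i. c (m - 1 - i))"] d e by simp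
  then show thesis using that[of c] cc d e e' by (simp add: SL_def c_def)
qed

lemma hw_char_weight:
  assumes "\<alpha> m = 0" "m > 0"
  shows "hw_char m \<alpha> b = (\<Prod>i<m. b $$ (i, i) ^ \<alpha> (Suc i))"
proof -
  obtain n where n: "m = Suc n" using assms(2) by (cases m) auto
  have "hw_char m \<alpha> b = (\<Prod>i<n. b $$ (i, i) ^ \<alpha> (Suc i))"
    unfolding hw_char_def n by (simp add: prod.atLeast1_atMost_eq)
  then show ?thesis using assms(1) by (simp add: n)
qed

lemma vec_eq_of_scalar:
  assumes "y \<in> carrier_vec d" "z \<in> carrier_vec d" "\<And>u. u \<in> carrier_vec d \<Longrightarrow> y \<bullet> u = (z \<bullet> u :: complex)"
  shows "y = z"
proof (intro eq_vecI)
  fix i assume "i < dim_vec z"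
  then have i: "i < d" using assms by simp
  then show "y $ i = z $ i" using assms(3)[of "unit_vec d i"] assms(1,2) by simp
qed (use assms in auto)

section \<open>The transposed action and highest weight functionals\<close>

context rational_representation
begin

text \<open>Functionals are acted on by precomposition with \<open>\<rho> g\<close>. No inverse is
  taken, so this is a right action and \<open>dual_act_mult\<close> reverses the order.\<close>

definition dual_act :: "complex mat \<Rightarrow> complex vec \<Rightarrow> complex vec"
  where "dual_act g y = transpose_mat (\<rho> g) *\<^sub>v y"

lemma dual_act_carrier: "g \<in> SL m \<Longrightarrow> dual_act g y \<in> carrier_vec d"
  unfolding dual_act_def using rep_carrier[of g] by (auto intro!: carrier_vecI)

lemma dual_act_scalar:
  "g \<in> SL m \<Longrightarrow> y \<in> carrier_vec d \<Longrightarrow> u \<in> carrier_vec d \<Longrightarrow> dual_act g y \<bullet> u = y \<bullet> (\<rho> g *\<^sub>v u)"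
  unfolding dual_act_def by (rule transpose_vec_mult_scalar[OF rep_carrier])

lemma dual_act_mult:
  assumes "g \<in> SL m" "h \<in> SL m" "y \<in> carrier_vec d"
  shows "dual_act (g * h) y = dual_act h (dual_act g y)"
proof (rule vec_eq_of_scalar)
  fix u :: "complex vec" assume u: "u \<in> carrier_vec d"
  show "dual_act (g * h) y \<bullet> u = dual_act h (dual_act g y) \<bullet> u"
    using assms u by (simp add: dual_act_scalar SL_mult dual_act_carrier rep_mult_vec rep_vec)
qed (use assms in \<open>auto intro: dual_act_carrier SL_mult\<close>)

lemma dual_act_one: "y \<in> carrier_vec d \<Longrightarrow> dual_act (1\<^sub>m m) y = y"
  by (simp add: dual_act_def rep_one)

lemma dual_act_smult: "g \<in> SL m \<Longrightarrow> y \<in> carrier_vec d \<Longrightarrow> dual_act g (c \<cdot>\<^sub>v y) = c \<cdot>\<^sub>v dual_act g y"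
  unfolding dual_act_def using rep_carrier[of g] by (intro mult_mat_vec[of _ d d]) auto

lemma dual_act_eigen:
  assumes "g \<in> SL m" "y \<in> carrier_vec d" "\<And>u. u \<in> carrier_vec d \<Longrightarrow> y \<bullet> (\<rho> g *\<^sub>v u) = c * (y \<bullet> u)"
  shows "dual_act g y = c \<cdot>\<^sub>v y"
proof (rule vec_eq_of_scalar[OF dual_act_carrier[OF assms(1)]])
  fix u :: "complex vec" assume u: "u \<in> carrier_vec d"
  show "dual_act g y \<bullet> u = (c \<cdot>\<^sub>v y) \<bullet> u" using assms u by (simp add: dual_act_scalar)
qed (use assms in auto)

end

context highest_weight_model
begin

text \<open>Translate the lowest weight functional by the longest Weyl group element. Conjugation by
  it turns upper into lower triangular matrices and reverses the diagonal, hence the exponents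
  \<open>\<mu> (m - i)\<close>.\<close>

lemma exists_highest_functional:
  assumes \<mu>: "\<mu> m = 0"
  obtains f where "f \<in> carrier_vec d" "f \<noteq> 0\<^sub>v d"
    "\<forall>b \<in> SL_upper m. dual_act b f = (\<Prod>i<m. b $$ (i, i) ^ \<mu> (m - i)) \<cdot>\<^sub>v f"
proof -
  obtain f0 where f0: "f0 \<in> carrier_vec d" "f0 \<bullet> v = 1"
    "\<forall>b \<in> SL_lower m. \<forall>u \<in> carrier_vec d. f0 \<bullet> (\<rho> b *\<^sub>v u) = hw_char m \<mu> b * (f0 \<bullet> u)"
    by (rule exists_lowest_functional)
  have m0: "m > 0" using m2 by simp
  obtain c :: "nat \<Rightarrow> complex" where c: "\<forall>i. c i * c i = 1" "\<forall>i. i \<noteq> 0 \<longrightarrow> c i = 1" "antidiag m c \<in> SL m"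
    "antidiag m (\<lambda>i. c (m - 1 - i)) \<in> SL m"
    "antidiag m c * antidiag m (\<lambda>i. c (m - 1 - i)) = 1\<^sub>m m"
    "antidiag m (\<lambda>i. c (m - 1 - i)) * antidiag m c = 1\<^sub>m m"
    by (rule exists_longest[OF m0])
  define W where "W = antidiag m c"
  define W' where "W' = antidiag m (\<lambda>i. c (m - 1 - i))"
  have W: "W \<in> SL m" "W' \<in> SL m" "W * W' = 1\<^sub>m m" using c by (auto simp: W_def W'_def)
  have Wc: "W \<in> carrier_mat m m" "W' \<in> carrier_mat m m" by (auto simp: W_def W'_def)
  define f where "f = dual_act W' f0"
  have fc: "f \<in> carrier_vec d" unfolding f_def by (rule dual_act_carrier[OF W(2)])
  have "f \<noteq> 0\<^sub>v d"
  proof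
    assume "f = 0\<^sub>v d"
    then have "f \<bullet> (\<rho> W *\<^sub>v v) = 0" using rep_vec[OF W(1) v_carrier] by simp
    moreover have "f \<bullet> (\<rho> W *\<^sub>v v) = f0 \<bullet> (\<rho> (W' * W) *\<^sub>v v)"
      unfolding f_def using dual_act_scalar[OF W(2) f0(1) rep_vec[OF W(1) v_carrier]] rep_mult_vec[OF W(2,1) v_carrier] by simp
    moreover have "W' * W = 1\<^sub>m m" using c by (simp add: W_def W'_def)
    ultimately show False using f0(2) rep_one_vec[OF v_carrier] by simp
  qed
  moreover have "dual_act b f = (\<Prod>i<m. b $$ (i, i) ^ \<mu> (m - i)) \<cdot>\<^sub>v f" if b: "b \<in> SL_upper m" for b
  proof -
    have bS: "b \<in> SL m" and bc: "b \<in> carrier_mat m m" using b by (auto simp: SL_upper_def SL_def)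
    define B where "B = W' * b * W"
    have BS: "B \<in> SL m" unfolding B_def by (intro SL_mult W bS)
    have Bij: "B $$ (i, j) = c (m - 1 - i) * b $$ (m - 1 - i, m - 1 - j) * c (m - 1 - j)" if ij: "i < m" "j < m" for i j
    proof -
      have "B $$ (i, j) = (W' * b) $$ (i, m - 1 - j) * c (m - 1 - j)"
        unfolding B_def W_def using ij Wc bc by (intro mult_antidiag_index[of _ m]) auto
      also have "(W' * b) $$ (i, m - 1 - j) = c (m - 1 - i) * b $$ (m - 1 - i, m - 1 - j)"
        unfolding W'_def using ij bc by (intro antidiag_mult_index) auto
      finally show ?thesis .
    qed
    have BL: "B \<in> SL_lower m"
      using BS SL_upperD(2)[OF b] by (auto simp: SL_lower_def Bij)
    have "W' * b = B * W'"
    proof -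
      have "B * W' = W' * b * (W * W')"
        unfolding B_def using assoc_mult_mat[of "W' * b" m m W m W' m] Wc bc by simp
      then show ?thesis using W(3) Wc bc by simp
    qed
    then have "dual_act b f = dual_act (B * W') f0"
      unfolding f_def using dual_act_mult[OF W(2) bS f0(1)] by simp
    also have "\<dots> = dual_act W' (hw_char m \<mu> B \<cdot>\<^sub>v f0)"
      using dual_act_mult[OF BS W(2) f0(1)] dual_act_eigen[OF BS f0(1) f0(3)[rule_format, OF BL]] by simp
    also have "\<dots> = hw_char m \<mu> B \<cdot>\<^sub>v f" unfolding f_def by (rule dual_act_smult[OF W(2) f0(1)])
    also have "hw_char m \<mu> B = (\<Prod>i<m. B $$ (i, i) ^ \<mu> (Suc i))" by (rule hw_char_weight[of \<mu> m]) (use \<mu> m2 in auto)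
    also have "\<dots> = (\<Prod>i<m. b $$ (m - Suc i, m - Suc i) ^ \<mu> (m - (m - Suc i)))"
    proof (intro prod.cong refl)
      fix i assume "i \<in> {..<m}"
      then have i: "i < m" by simp
      \<comment> \<open>On the diagonal each sign occurs twice and cancels.\<close>
      have "c (m - 1 - i) * x * c (m - 1 - i) = c (m - 1 - i) * c (m - 1 - i) * x" for x
        by (simp only: mult_ac)
      then have "B $$ (i, i) = b $$ (m - 1 - i, m - 1 - i)" unfolding Bij[OF i i] using c(1) by simp
      moreover have "m - (m - Suc i) = Suc i" using i by simp
      ultimately show "B $$ (i, i) ^ \<mu> (Suc i) = b $$ (m - Suc i, m - Suc i) ^ \<mu> (m - (m - Suc i))"
        by simp
    qed
    also have "\<dots> = (\<Prod>i<m. b $$ (i, i) ^ \<mu> (m - i))"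
      by (rule prod.nat_diff_reindex[of "\<lambda>i. b $$ (i, i) ^ \<mu> (m - i)"])
    finally show ?thesis .
  qed
  ultimately show thesis using that fc by simp
qed

end

section \<open>Trilinear forms of invariant tensors\<close>

lemma sum3_swap:
  fixes F :: "'a \<Rightarrow> 'b \<Rightarrow> 'c \<Rightarrow> 'd \<Rightarrow> 'e \<Rightarrow> 'f \<Rightarrow> 'g :: comm_monoid_add"
  shows "(\<Sum>i\<in>A. \<Sum>j\<in>B. \<Sum>k\<in>C. \<Sum>i'\<in>A'. \<Sum>j'\<in>B'. \<Sum>k'\<in>C'. F i j k i' j' k') =
    (\<Sum>i'\<in>A'. \<Sum>j'\<in>B'. \<Sum>k'\<in>C'. \<Sum>i\<in>A. \<Sum>j\<in>B. \<Sum>k\<in>C. F i j k i' j' k')"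
proof -
  define G where "G x x' = F (fst x) (fst (snd x)) (snd (snd x)) (fst x') (fst (snd x')) (snd (snd x'))" for x x'
  have "(\<Sum>x\<in>A \<times> B \<times> C. \<Sum>x'\<in>A' \<times> B' \<times> C'. G x x') = (\<Sum>x'\<in>A' \<times> B' \<times> C'. \<Sum>x\<in>A \<times> B \<times> C. G x x')"
    by (rule sum.swap)
  then show ?thesis by (simp add: sum.cartesian_product' G_def)
qed

lemma sum_product3:
  fixes t :: complex
  shows "(\<Sum>i\<in>A. a i) * (\<Sum>j\<in>B. b j) * (\<Sum>k\<in>C. c k) * t = (\<Sum>i\<in>A. \<Sum>j\<in>B. \<Sum>k\<in>C. a i * b j * c k * t)"
proof -
  have "(\<Sum>k\<in>C. x * c k * t) = x * (\<Sum>k\<in>C. c k) * t" for x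
    by (simp add: sum_distrib_left sum_distrib_right)
  moreover have "(\<Sum>j\<in>B. x * b j * y * t) = x * (\<Sum>j\<in>B. b j) * y * t" for x y
    by (simp add: sum_distrib_left sum_distrib_right)
  moreover have "(\<Sum>i\<in>A. a i * x * y * t) = (\<Sum>i\<in>A. a i) * x * y * t" for x y
    by (simp add: sum_distrib_right)
  ultimately show ?thesis by simp
qed

locale invariant_tensor =
  V1: rational_representation m d1 \<rho>1 + V2: rational_representation m d2 \<rho>2 + V3: rational_representation m d3 \<rho>3
  for m d1 \<rho>1 d2 \<rho>2 d3 \<rho>3 +
  fixes T :: "nat \<Rightarrow> nat \<Rightarrow> nat \<Rightarrow> complex"
  assumes invariant: "g \<in> SL m \<Longrightarrow> i < d1 \<Longrightarrow> j < d2 \<Longrightarrow> k < d3 \<Longrightarrow>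
    (\<Sum>i'<d1. \<Sum>j'<d2. \<Sum>k'<d3. \<rho>1 g $$ (i, i') * \<rho>2 g $$ (j, j') * \<rho>3 g $$ (k, k') * T i' j' k') = T i j k"
begin

text \<open>\<open>T\<close> is read as a trilinear form on functionals; contracting two of its
  arguments gives the vectors \<open>slot1\<close>, \<open>slot2\<close> and \<open>slot3\<close> of
  the remaining module.\<close>

definition form :: "complex vec \<Rightarrow> complex vec \<Rightarrow> complex vec \<Rightarrow> complex"
  where "form x y z = (\<Sum>i<d1. \<Sum>j<d2. \<Sum>k<d3. x $ i * y $ j * z $ k * T i j k)"

definition slot1 :: "complex vec \<Rightarrow> complex vec \<Rightarrow> complex vec"
  where "slot1 y z = vec d1 (\<lambda>i. \<Sum>j<d2. \<Sum>k<d3. y $ j * z $ k * T i j k)"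

definition slot2 :: "complex vec \<Rightarrow> complex vec \<Rightarrow> complex vec"
  where "slot2 x z = vec d2 (\<lambda>j. \<Sum>i<d1. \<Sum>k<d3. x $ i * z $ k * T i j k)"

definition slot3 :: "complex vec \<Rightarrow> complex vec \<Rightarrow> complex vec"
  where "slot3 x y = vec d3 (\<lambda>k. \<Sum>i<d1. \<Sum>j<d2. x $ i * y $ j * T i j k)"

lemma slot_carrier: "slot1 y z \<in> carrier_vec d1" "slot2 x z \<in> carrier_vec d2" "slot3 x y \<in> carrier_vec d3"
  by (auto simp: slot1_def slot2_def slot3_def)

lemma scalar_slot1: "x \<bullet> slot1 y z = form x y z"
  unfolding scalar_prod_sum[OF slot_carrier(1)] form_def
  by (intro sum.cong) (auto simp: slot1_def sum_distrib_left mult.assoc)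

lemma scalar_slot2: "y \<bullet> slot2 x z = form x y z"
proof -
  have "y \<bullet> slot2 x z = (\<Sum>j<d2. \<Sum>i<d1. \<Sum>k<d3. x $ i * y $ j * z $ k * T i j k)"
    unfolding scalar_prod_sum[OF slot_carrier(2)]
    by (intro sum.cong) (auto simp: slot2_def sum_distrib_left mult_ac)
  also have "\<dots> = form x y z" unfolding form_def by (rule sum.swap)
  finally show ?thesis .
qed

lemma scalar_slot3: "z \<bullet> slot3 x y = form x y z"
proof -
  have "z \<bullet> slot3 x y = (\<Sum>k<d3. \<Sum>i<d1. \<Sum>j<d2. x $ i * y $ j * z $ k * T i j k)"
    unfolding scalar_prod_sum[OF slot_carrier(3)]
    by (intro sum.cong) (auto simp: slot3_def sum_distrib_left mult_ac)
  also have "\<dots> = (\<Sum>i<d1. \<Sum>k<d3. \<Sum>j<d2. x $ i * y $ j * z $ k * T i j k)" by (rule sum.swap)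
  also have "\<dots> = form x y z" unfolding form_def by (intro sum.cong refl sum.swap)
  finally show ?thesis .
qed

text \<open>The transposed matrices move from the three functionals onto \<open>T\<close>, which
  absorbs them.\<close>

lemma form_dual_act:
  assumes g: "g \<in> SL m" and y: "x \<in> carrier_vec d1" "y \<in> carrier_vec d2" "z \<in> carrier_vec d3"
  shows "form (V1.dual_act g x) (V2.dual_act g y) (V3.dual_act g z) = form x y z"
proof -
  have e1: "V1.dual_act g x $ i' = (\<Sum>i<d1. \<rho>1 g $$ (i, i') * x $ i)" if "i' < d1" for i'
    unfolding V1.dual_act_def using V1.rep_carrier[OF g] y(1) that
    by (subst mult_mat_vec_index[of _ d1 d1]) (auto intro!: sum.cong)
  have e2: "V2.dual_act g y $ j' = (\<Sum>j<d2. \<rho>2 g $$ (j, j') * y $ j)" if "j' < d2" for j'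
    unfolding V2.dual_act_def using V2.rep_carrier[OF g] y(2) that
    by (subst mult_mat_vec_index[of _ d2 d2]) (auto intro!: sum.cong)
  have e3: "V3.dual_act g z $ k' = (\<Sum>k<d3. \<rho>3 g $$ (k, k') * z $ k)" if "k' < d3" for k'
    unfolding V3.dual_act_def using V3.rep_carrier[OF g] y(3) that
    by (subst mult_mat_vec_index[of _ d3 d3]) (auto intro!: sum.cong)
  define F where "F i j k i' j' k' = (\<rho>1 g $$ (i, i') * x $ i) * (\<rho>2 g $$ (j, j') * y $ j) * (\<rho>3 g $$ (k, k') * z $ k) * T i' j' k'"
    for i j k i' j' k'
  have "form (V1.dual_act g x) (V2.dual_act g y) (V3.dual_act g z)
    = (\<Sum>i'<d1. \<Sum>j'<d2. \<Sum>k'<d3. \<Sum>i<d1. \<Sum>j<d2. \<Sum>k<d3. F i j k i' j' k')"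
    unfolding form_def
  proof (intro sum.cong refl)
    fix i' j' k' assume "i' \<in> {..<d1}" "j' \<in> {..<d2}" "k' \<in> {..<d3}"
    then have l: "i' < d1" "j' < d2" "k' < d3" by auto
    show "V1.dual_act g x $ i' * V2.dual_act g y $ j' * V3.dual_act g z $ k' * T i' j' k' = (\<Sum>i<d1. \<Sum>j<d2. \<Sum>k<d3. F i j k i' j' k')"
      unfolding e1[OF l(1)] e2[OF l(2)] e3[OF l(3)] F_def
      by (rule sum_product3)
  qed
  also have "\<dots> = (\<Sum>i<d1. \<Sum>j<d2. \<Sum>k<d3. \<Sum>i'<d1. \<Sum>j'<d2. \<Sum>k'<d3. F i j k i' j' k')"
    by (rule sum3_swap[symmetric])
  also have "\<dots> = form x y z"
    unfolding form_def
  proof (intro sum.cong refl)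
    fix i j k assume "i \<in> {..<d1}" "j \<in> {..<d2}" "k \<in> {..<d3}"
    then have l: "i < d1" "j < d2" "k < d3" by auto
    show "(\<Sum>i'<d1. \<Sum>j'<d2. \<Sum>k'<d3. F i j k i' j' k') = x $ i * y $ j * z $ k * T i j k"
      unfolding invariant[OF g l, symmetric] sum_distrib_left F_def
      by (intro sum.cong refl) (simp only: mult_ac)
  qed
  finally show ?thesis .
qed

lemma form_smult1: "x \<in> carrier_vec d1 \<Longrightarrow> form (c \<cdot>\<^sub>v x) y z = c * form x y z"
  unfolding scalar_slot1[symmetric] using slot_carrier by simp

lemma form_smult3: "z \<in> carrier_vec d3 \<Longrightarrow> form x y (c \<cdot>\<^sub>v z) = c * form x y z"
  unfolding scalar_slot3[symmetric] using slot_carrier by simp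

end

section \<open>Necessity of the Pieri condition\<close>

lemma weights_at_rank: "\<mu> \<in> weights m \<Longrightarrow> m > 0 \<Longrightarrow> \<mu> m = 0"
  by (auto simp: weights_def)

lemma weights_antimono:
  assumes "\<mu> \<in> weights m" "1 \<le> i"
  shows "\<mu> (Suc i) \<le> \<mu> i"
  using weights_step[OF assms] by simp

lemma sum_shift1: "(\<Sum>i<m. f (Suc i)) = (\<Sum>i = 1..m. f i)" for f :: "nat \<Rightarrow> 'a :: comm_monoid_add"
  by (simp add: sum.atLeast1_atMost_eq)

lemma sum_reflect: "(\<Sum>i<m. f (m - i)) = (\<Sum>i = 1..m. f i)" for f :: "nat \<Rightarrow> 'a :: comm_monoid_add"
proof -
  have "(\<Sum>i<m. f (m - i)) = (\<Sum>i<m. f (Suc (m - Suc i)))" by (intro sum.cong) (auto simp: Suc_diff_Suc)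
  also have "\<dots> = (\<Sum>i<m. f (Suc i))" by (rule sum.nat_diff_reindex)
  finally show ?thesis by (simp add: sum_shift1)
qed

text \<open>The absolute values grow like n^(e - k), while a convergent sequence is bounded.\<close>

lemma exponent_le_of_convergent:
  fixes p :: complex
  assumes p: "p \<noteq> 0"
    and lim: "(\<lambda>n. (- of_nat n) ^ e * p / of_nat (Suc n) ^ k) \<longlonglongrightarrow> L"
  shows "e \<le> k"
proof (rule ccontr)
  assume "\<not> e \<le> k"
  then have ek: "Suc k \<le> e" by simp
  obtain M where M: "M > 0" "\<And>n. norm ((- of_nat n) ^ e * p / of_nat (Suc n) ^ k) \<le> M"
    using convergent_imp_Bseq[OF convergentI[OF lim]] by (auto simp: Bseq_def)
  \<comment> \<open>The factor \<open>2 ^ k\<close> bounds the quotient of \<open>Suc n ^ k\<close>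
    by \<open>n ^ k\<close>.\<close>
  define n where "n = Suc (nat \<lceil>M * 2 ^ k / norm p\<rceil>)"
  have n1: "1 \<le> real n" by (simp add: n_def)
  have "M * 2 ^ k / norm p < real n" unfolding n_def by linarith
  then have big: "M * 2 ^ k < real n * norm p" using p by (simp add: field_simps)
  have "real n ^ Suc k * norm p \<le> real n ^ e * norm p"
    using n1 ek by (intro mult_right_mono power_increasing) auto
  also have "\<dots> = norm ((- of_nat n) ^ e * p / of_nat (Suc n) ^ k) * real (Suc n) ^ k"
    by (simp add: norm_divide norm_mult norm_power norm_of_nat del: of_nat_Suc)
  also have "\<dots> \<le> M * real (Suc n) ^ k" using M(2)[of n] by (intro mult_right_mono) auto
  also have "\<dots> \<le> M * (2 * real n) ^ k" using M(1) n1 by (intro mult_left_mono power_mono) auto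
  finally have "real n ^ k * (real n * norm p) \<le> real n ^ k * (M * 2 ^ k)"
    by (simp add: power_mult_distrib algebra_simps)
  then have "real n * norm p \<le> M * 2 ^ k" using n1 by (simp add: mult_le_cancel_left_pos)
  then show False using big by simp
qed

lemma pieri_condition_of_invariant:
  assumes V: "is_V m \<alpha> d1 \<rho>1" "is_V m (\<lambda>j. r * fundamental_weight 1 j) d2 \<rho>2" "is_V m \<gamma> d3 \<rho>3"
    and w: "\<alpha> \<in> weights m" "\<gamma> \<in> weights m" and m: "2 \<le> m"
    and inv: "\<And>g i j k. g \<in> SL m \<Longrightarrow> i < d1 \<Longrightarrow> j < d2 \<Longrightarrow> k < d3 \<Longrightarrow>
      (\<Sum>i'<d1. \<Sum>j'<d2. \<Sum>k'<d3. \<rho>1 g $$ (i, i') * \<rho>2 g $$ (j, j') * \<rho>3 g $$ (k, k') * T i' j' k') = T i j k"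
    and nz: "i0 < d1" "j0 < d2" "k0 < d3" "T i0 j0 k0 \<noteq> 0"
  shows "pieri_condition m \<alpha> r \<gamma>"
proof -
  obtain v1 where "highest_weight_model m d1 \<rho>1 \<alpha> v1" by (rule is_V_model[OF V(1) m])
  then interpret V1: highest_weight_model m d1 \<rho>1 \<alpha> v1 .
  obtain v2 where "highest_weight_model m d2 \<rho>2 (\<lambda>j. r * fundamental_weight 1 j) v2" by (rule is_V_model[OF V(2) m])
  then interpret V2: highest_weight_model m d2 \<rho>2 "\<lambda>j. r * fundamental_weight 1 j" v2 .
  obtain v3 where "highest_weight_model m d3 \<rho>3 \<gamma> v3" by (rule is_V_model[OF V(3) m])
  then interpret V3: highest_weight_model m d3 \<rho>3 \<gamma> v3 .
  interpret invariant_tensor m d1 \<rho>1 d2 \<rho>2 d3 \<rho>3 T by unfold_locales (rule inv)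
  have \<alpha>m: "\<alpha> m = 0" and \<gamma>m: "\<gamma> m = 0" using weights_at_rank w m by auto
  obtain f1 where f1: "f1 \<in> carrier_vec d1" "f1 \<bullet> v1 = 1"
    "\<forall>b \<in> SL_lower m. \<forall>u \<in> carrier_vec d1. f1 \<bullet> (\<rho>1 b *\<^sub>v u) = hw_char m \<alpha> b * (f1 \<bullet> u)"
    by (rule V1.exists_lowest_functional)
  obtain f2 where f2: "f2 \<in> carrier_vec d2" "f2 \<bullet> v2 = 1"
    "\<forall>b \<in> SL_lower m. \<forall>u \<in> carrier_vec d2. f2 \<bullet> (\<rho>2 b *\<^sub>v u) = hw_char m (\<lambda>j. r * fundamental_weight 1 j) b * (f2 \<bullet> u)"
    by (rule V2.exists_lowest_functional)
  interpret V2: symmetric_power_model m d2 \<rho>2 r v2 f2 by unfold_locales (use f2 in auto)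
  define \<chi>1 where "\<chi>1 b = (\<Prod>i<m. b $$ (i, i) ^ \<alpha> (Suc i))" for b :: "complex mat"
  define \<chi>3 where "\<chi>3 b = (\<Prod>i<m. b $$ (i, i) ^ \<gamma> (m - i))" for b :: "complex mat"
  obtain f3 where f3: "f3 \<in> carrier_vec d3" "f3 \<noteq> 0\<^sub>v d3"
    "\<forall>b \<in> SL_upper m. V3.dual_act b f3 = (\<Prod>i<m. b $$ (i, i) ^ \<gamma> (m - i)) \<cdot>\<^sub>v f3"
    by (rule V3.exists_highest_functional[OF \<gamma>m])
  have f10: "f1 \<noteq> 0\<^sub>v d1" using f1(2) V1.v_carrier by auto
  have e1: "V1.dual_act b f1 = \<chi>1 b \<cdot>\<^sub>v f1" if b: "b \<in> SL_lower m" for b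
    using V1.dual_act_eigen[OF SL_lowerD(1)[OF b] f1(1), of "hw_char m \<alpha> b"] f1(3) b
      hw_char_weight[of \<alpha> m b] \<alpha>m m by (simp add: \<chi>1_def)
  have e3: "V3.dual_act b f3 = \<chi>3 b \<cdot>\<^sub>v f3" if b: "b \<in> SL_upper m" for b
    using f3(3) b by (simp add: \<chi>3_def)
  have \<chi>3nz: "\<chi>3 b \<noteq> 0" if b: "b \<in> SL_upper m" for b
  proof -
    have "(\<Prod>i<m. b $$ (i, i)) = 1"
      using det_upper[OF SL_carrier[OF SL_upperD(1)[OF b]]] SL_upperD[OF b] by (simp add: SL_def)
    then have "b $$ (i, i) \<noteq> 0" if "i < m" for i
      using prod_zero[of "{..<m}" "\<lambda>i. b $$ (i, i)"] that by force
    then show ?thesis by (simp add: \<chi>3_def)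
  qed
  \<comment> \<open>Suppose the contraction with \<open>f1\<close> and \<open>f3\<close> vanishes.
    On the big cell a lower triangular matrix only scales \<open>f1\<close>, and an upper triangular
    one can be moved by invariance to the other arguments, where it scales \<open>f3\<close>. So no
    translate of \<open>f1\<close> sees \<open>slot1 y f3\<close>, which is therefore 0. Translating
    \<open>f3\<close> in the same way then gives \<open>T = 0\<close>.\<close>
  have nondeg: "\<exists>y \<in> carrier_vec d2. form f1 y f3 \<noteq> 0"
  proof (rule ccontr)
    assume "\<not> ?thesis"
    then have z: "form f1 y f3 = 0" if "y \<in> carrier_vec d2" for y using that by blast
    have A: "slot1 y f3 = 0\<^sub>v d1" if y: "y \<in> carrier_vec d2" for y
    proof -
      have "f1 \<bullet> (\<rho>1 g *\<^sub>v slot1 y f3) = 0" if g: "g \<in> SL m" for g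
      proof (rule V1.coefficient_zero_of_big_cell[OF slot_carrier(1) g])
        fix l u assume l: "l \<in> SL_lower m" and u: "u \<in> SL_upper m"
        have lS: "l \<in> SL m" and uS: "u \<in> SL m" using l u by (auto dest: SL_lowerD SL_upperD)
        obtain u' where u': "u' \<in> SL m" "u * u' = 1\<^sub>m m" "u' * u = 1\<^sub>m m" by (rule SL_inverse[OF uS])
        have yu: "V2.dual_act u (V2.dual_act u' y) = y"
          using V2.dual_act_mult[OF u'(1) uS y] u'(3) V2.dual_act_one[OF y] by simp
        have "f1 \<bullet> (\<rho>1 (l * u) *\<^sub>v slot1 y f3) = form (V1.dual_act (l * u) f1) y f3"
          unfolding scalar_slot1[symmetric] by (rule V1.dual_act_scalar[OF SL_mult[OF lS uS] f1(1) slot_carrier(1), symmetric])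
        also have "V1.dual_act (l * u) f1 = \<chi>1 l \<cdot>\<^sub>v V1.dual_act u f1"
          using V1.dual_act_mult[OF lS uS f1(1)] e1[OF l] V1.dual_act_smult[OF uS f1(1)] by simp
        also have "form (\<chi>1 l \<cdot>\<^sub>v V1.dual_act u f1) y f3 = \<chi>1 l * form (V1.dual_act u f1) y f3"
          by (rule form_smult1[OF V1.dual_act_carrier[OF uS]])
        also have "form (V1.dual_act u f1) y f3 = 0"
        proof -
          have "\<chi>3 u * form (V1.dual_act u f1) y f3 = form (V1.dual_act u f1) (V2.dual_act u (V2.dual_act u' y)) (V3.dual_act u f3)"
            unfolding yu e3[OF u] by (rule form_smult3[OF f3(1), symmetric])
          also have "\<dots> = form f1 (V2.dual_act u' y) f3"
            by (rule form_dual_act[OF uS f1(1) V2.dual_act_carrier[OF u'(1)] f3(1)])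
          also have "\<dots> = 0" by (rule z[OF V2.dual_act_carrier[OF u'(1)]])
          finally show ?thesis using \<chi>3nz[OF u] by simp
        qed
        finally show "f1 \<bullet> (\<rho>1 (l * u) *\<^sub>v slot1 y f3) = 0" by simp
      qed
      then have "slot1 y f3 \<in> {u \<in> carrier_vec d1. \<forall>g \<in> SL m. f1 \<bullet> (\<rho>1 g *\<^sub>v u) = 0}"
        using slot_carrier(1) by simp
      then show ?thesis using V1.annihilator_cases[OF f1(1)] f10 by auto
    qed
    have A': "form x y f3 = 0" if "x \<in> carrier_vec d1" "y \<in> carrier_vec d2" for x y
      using scalar_slot1[of x y f3] A[OF that(2)] that(1) by simp
    have B: "slot3 x y = 0\<^sub>v d3" if x: "x \<in> carrier_vec d1" and y: "y \<in> carrier_vec d2" for x y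
    proof -
      have "f3 \<bullet> (\<rho>3 g *\<^sub>v slot3 x y) = 0" if g: "g \<in> SL m" for g
      proof -
        obtain h where h: "h \<in> SL m" "g * h = 1\<^sub>m m" "h * g = 1\<^sub>m m" by (rule SL_inverse[OF g])
        have xg: "V1.dual_act g (V1.dual_act h x) = x"
          using V1.dual_act_mult[OF h(1) g x] h(3) V1.dual_act_one[OF x] by simp
        have yg: "V2.dual_act g (V2.dual_act h y) = y"
          using V2.dual_act_mult[OF h(1) g y] h(3) V2.dual_act_one[OF y] by simp
        have "f3 \<bullet> (\<rho>3 g *\<^sub>v slot3 x y) = form x y (V3.dual_act g f3)"
          unfolding scalar_slot3[symmetric] by (rule V3.dual_act_scalar[OF g f3(1) slot_carrier(3), symmetric])
        also have "\<dots> = form (V1.dual_act g (V1.dual_act h x)) (V2.dual_act g (V2.dual_act h y)) (V3.dual_act g f3)"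
          unfolding xg yg ..
        also have "\<dots> = form (V1.dual_act h x) (V2.dual_act h y) f3"
          by (rule form_dual_act[OF g V1.dual_act_carrier[OF h(1)] V2.dual_act_carrier[OF h(1)] f3(1)])
        also have "\<dots> = 0" by (rule A'[OF V1.dual_act_carrier[OF h(1)] V2.dual_act_carrier[OF h(1)]])
        finally show ?thesis .
      qed
      then have "slot3 x y \<in> {u \<in> carrier_vec d3. \<forall>g \<in> SL m. f3 \<bullet> (\<rho>3 g *\<^sub>v u) = 0}"
        using slot_carrier(3) by simp
      then show ?thesis using V3.annihilator_cases[OF f3(1)] f3(2) by auto
    qed
    have "T i0 j0 k0 = slot3 (unit_vec d1 i0) (unit_vec d2 j0) $ k0"
    proof -
      have "(\<Sum>j<d2. unit_vec d1 i0 $ i * unit_vec d2 j0 $ j * T i j k0) = (if i = i0 then T i0 j0 k0 else 0)"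
        if "i < d1" for i
      proof -
        have "(\<Sum>j<d2. unit_vec d1 i0 $ i * unit_vec d2 j0 $ j * T i j k0) =
          (\<Sum>j<d2. if j = j0 then (if i = i0 then T i0 j0 k0 else 0) else 0)"
          using that nz by (intro sum.cong) auto
        then show ?thesis using nz by simp
      qed
      then have "slot3 (unit_vec d1 i0) (unit_vec d2 j0) $ k0 = (\<Sum>i<d1. if i = i0 then T i0 j0 k0 else 0)"
        unfolding slot3_def using nz(3) by simp
      then show ?thesis using nz by simp
    qed
    then show False using B[of "unit_vec d1 i0" "unit_vec d2 j0"] nz by simp
  qed
  define w where "w = slot2 f1 f3"
  have wc: "w \<in> carrier_vec d2" unfolding w_def by (rule slot_carrier(2))
  have sw: "y \<bullet> w = form f1 y f3" for y unfolding w_def by (rule scalar_slot2)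
  obtain y0 where y0: "y0 \<in> carrier_vec d2" "form f1 y0 f3 \<noteq> 0" using nondeg by auto
  have w0: "w \<noteq> 0\<^sub>v d2"
  proof
    assume "w = 0\<^sub>v d2"
    then have "y0 \<bullet> w = 0" using y0(1) by simp
    then show False using sw[of y0] y0(2) by simp
  qed
  \<comment> \<open>By invariance the torus acts on \<open>w\<close> inversely to its eigenvalues on
    \<open>f1\<close> and \<open>f3\<close>, hence the sign.\<close>
  define \<kappa> where "\<kappa> i = - (int (\<alpha> (Suc i)) + int (\<gamma> (m - i)))" for i
  have weight: "\<rho>2 (diagm m t) *\<^sub>v w = (\<Prod>i<m. t i powi \<kappa> i) \<cdot>\<^sub>v w" if t: "(\<Prod>i<m. t i) = 1" for t
  proof (rule vec_eq_of_scalar)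
    let ?D = "diagm m t"
    have D: "?D \<in> SL m" by (rule diagm_SL[OF t])
    have t0: "t i \<noteq> 0" if "i < m" for i
      using prod_zero[of "{..<m}" t] t that by force
    have c: "(\<Prod>i<m. t i powi \<kappa> i) * (\<chi>1 ?D * \<chi>3 ?D) = 1"
    proof -
      have "(\<Prod>i<m. t i powi \<kappa> i) * (\<chi>1 ?D * \<chi>3 ?D) = (\<Prod>i<m. t i powi \<kappa> i * (t i ^ \<alpha> (Suc i) * t i ^ \<gamma> (m - i)))"
        unfolding prod.distrib by (simp add: \<chi>1_def \<chi>3_def diagm_index)
      also have "\<dots> = 1"
      proof (intro prod.neutral ballI)
        fix i assume "i \<in> {..<m}"
        then have ti: "t i \<noteq> 0" using t0 by simp
        have "t i powi \<kappa> i * (t i ^ \<alpha> (Suc i) * t i ^ \<gamma> (m - i)) =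
          t i powi \<kappa> i * (t i powi int (\<alpha> (Suc i)) * t i powi int (\<gamma> (m - i)))" by simp
        also have "\<dots> = t i powi (\<kappa> i + (int (\<alpha> (Suc i)) + int (\<gamma> (m - i))))"
          unfolding power_int_add[OF disjI1[OF ti]] by (rule refl)
        also have "\<kappa> i + (int (\<alpha> (Suc i)) + int (\<gamma> (m - i))) = 0" by (simp add: \<kappa>_def)
        finally show "t i powi \<kappa> i * (t i ^ \<alpha> (Suc i) * t i ^ \<gamma> (m - i)) = 1" by simp
      qed
      finally show ?thesis .
    qed
    fix y :: "complex vec" assume y: "y \<in> carrier_vec d2"
    have "y \<bullet> w = form (V1.dual_act ?D f1) (V2.dual_act ?D y) (V3.dual_act ?D f3)"
      unfolding sw by (rule form_dual_act[OF D f1(1) y f3(1), symmetric])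
    also have "\<dots> = \<chi>1 ?D * (\<chi>3 ?D * form f1 (V2.dual_act ?D y) f3)"
      unfolding e1[OF diagm_SL_lower[OF t]] e3[OF diagm_SL_upper[OF t]]
      by (simp add: form_smult1[OF f1(1)] form_smult3[OF f3(1)])
    also have "form f1 (V2.dual_act ?D y) f3 = y \<bullet> (\<rho>2 ?D *\<^sub>v w)"
      unfolding sw[symmetric] by (rule V2.dual_act_scalar[OF D y wc])
    finally have "y \<bullet> (\<rho>2 ?D *\<^sub>v w) = (\<Prod>i<m. t i powi \<kappa> i) * (y \<bullet> w)"
      using c by (simp add: algebra_simps)
    then show "(\<rho>2 ?D *\<^sub>v w) \<bullet> y = ((\<Prod>i<m. t i powi \<kappa> i) \<cdot>\<^sub>v w) \<bullet> y"
      using comm_scalar_prod[OF y V2.rep_vec[OF D wc]] comm_scalar_prod[OF y wc] y wc by simp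
  qed (use wc V2.rep_vec diagm_SL t in auto)
  obtain P e where P: "\<forall>g \<in> SL m. f2 \<bullet> (\<rho>2 g *\<^sub>v w) = P (first_row m g)" "P (ones m) \<noteq> 0"
    and e: "\<forall>i<m. int m * int (e i) = int r - (\<Sum>j<m. \<kappa> j) + int m * \<kappa> i"
    and mono: "\<forall>i<m. \<forall>s. P (\<lambda>j. if j = i then s else ones m j) = s ^ e i * P (ones m)"
    by (rule V2.weight_exponents[OF wc w0 weight])
  \<comment> \<open>The value of \<open>f2\<close> at a translate of \<open>w\<close> is computed
    twice along the unipotent one-parameter group in rows \<open>i\<close> and \<open>Suc i\<close>.
    As a monomial it is a multiple of \<open>(1 - t) ^ e (Suc i)\<close>. Moved onto
    \<open>f1\<close> by invariance, it is \<open>t ^ (a - b)\<close> times a factor that converges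
    as \<open>t\<close> tends to infinity. Comparing growth gives the inequality.\<close>
  have bound: "e (Suc i) \<le> \<alpha> (Suc i) - \<alpha> (Suc (Suc i))" if i: "Suc i < m" for i
  proof -
    define a where "a = \<alpha> (Suc i)"
    define b where "b = \<alpha> (Suc (Suc i))"
    have ab: "b \<le> a" unfolding a_def b_def using weights_antimono[OF w(1), of "Suc i"] by simp
    have "\<exists>g. g \<in> SL m \<and> first_row m g = ones m"
      by (rule exists_SL_first_row[of m "ones m"]) (use m in \<open>auto simp: ones_def\<close>)
    then obtain g0 where g0: "g0 \<in> SL m" "first_row m g0 = ones m" by auto
    define y where "y = V2.dual_act g0 f2"
    have y: "y \<in> carrier_vec d2" unfolding y_def by (rule V2.dual_act_carrier[OF g0(1)])
    define x where "x = slot1 y f3"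
    have x: "x \<in> carrier_vec d1" unfolding x_def by (rule slot_carrier(1))
    obtain p where p: "p \<in> polynomial_functions m" "\<forall>g \<in> SL m. f1 \<bullet> (\<rho>1 g *\<^sub>v x) = p g"
      using V1.coefficient_polynomial[OF x] by auto
    \<comment> \<open>The unipotent \<open>u\<close> factors as a lower triangular \<open>l\<close>
      with diagonal entries \<open>t\<close> and \<open>inverse t\<close>, on which
      \<open>f1\<close> scales, times \<open>N (inverse t)\<close>, which converges to a
      reflection.\<close>
    define N where "N s = block_mat m i s 1 (-1) 0" for s
    have main: "(1 - t) ^ e (Suc i) * P (ones m) = t ^ (a - b) * p (N (inverse t))" if t: "t \<noteq> 0" for t
    proof -
      define u where "u = block_mat m i 1 t 0 1"
      define u' where "u' = block_mat m i 1 (- t) 0 1"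
      have uU: "u \<in> SL_upper m" "u' \<in> SL_upper m" unfolding u_def u'_def by (simp_all add: block_mat_upper[OF i])
      have uS: "u \<in> SL m" "u' \<in> SL m" using uU by (auto dest: SL_upperD)
      have one: "block_mat m i 1 0 0 1 = 1\<^sub>m m" by (intro eq_matI) (auto simp: block_mat_def)
      have uu: "u' * u = 1\<^sub>m m" unfolding u_def u'_def block_mat_mult[OF i] using one by simp
      have yu: "V2.dual_act u (V2.dual_act u' y) = y"
        using V2.dual_act_mult[OF uS(2,1) y] uu V2.dual_act_one[OF y] by simp
      have "\<chi>3 u = 1" unfolding \<chi>3_def u_def by (intro prod.neutral) (auto simp: block_mat_index)
      then have f3u: "V3.dual_act u f3 = f3" using e3[OF uU(1)] by simp
      have "first_row m (g0 * u') = (\<lambda>j. if j = Suc i then 1 - t else ones m j)"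
      proof
        fix j
        show "first_row m (g0 * u') j = (if j = Suc i then 1 - t else ones m j)"
        proof (cases "j < m")
          case True
          have "first_row m (g0 * u') j = (\<Sum>k<m. first_row m g0 k * u' $$ (k, j))"
            using first_row_mult[OF SL_carrier[OF g0(1)] SL_carrier[OF uS(2)]] True by (simp add: row_map_def)
          also have "\<dots> = (\<Sum>k<m. u' $$ (k, j))"
            unfolding g0(2) by (intro sum.cong) (auto simp: ones_def)
          also have "\<dots> = (\<Sum>k\<in>{j} \<union> (if j = Suc i then {i} else {}). u' $$ (k, j))"
            using True i by (intro sum.mono_neutral_right) (auto simp: u'_def block_mat_index split: if_splits)
          also have "\<dots> = (if j = Suc i then 1 - t else ones m j)"
            using True i by (auto simp: u'_def block_mat_index ones_def)
          finally show ?thesis .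
        qed (use i in \<open>auto simp: first_row_def ones_def\<close>)
      qed
      then have "(1 - t) ^ e (Suc i) * P (ones m) = f2 \<bullet> (\<rho>2 (g0 * u') *\<^sub>v w)"
        using mono i P(1) SL_mult[OF g0(1) uS(2)] by simp
      also have "\<dots> = y \<bullet> (\<rho>2 u' *\<^sub>v w)"
        unfolding y_def using V2.rep_mult_vec[OF g0(1) uS(2) wc] V2.dual_act_scalar[OF g0(1) f2(1) V2.rep_vec[OF uS(2) wc]] by simp
      also have "\<dots> = form f1 (V2.dual_act u' y) f3"
        using V2.dual_act_scalar[OF uS(2) y wc] sw by simp
      also have "\<dots> = form (V1.dual_act u f1) (V2.dual_act u (V2.dual_act u' y)) (V3.dual_act u f3)"
        by (rule form_dual_act[OF uS(1) f1(1) V2.dual_act_carrier[OF uS(2)] f3(1), symmetric])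
      also have "\<dots> = V1.dual_act u f1 \<bullet> x" unfolding yu f3u x_def by (rule scalar_slot1[symmetric])
      also have "\<dots> = f1 \<bullet> (\<rho>1 u *\<^sub>v x)" by (rule V1.dual_act_scalar[OF uS(1) f1(1) x])
      also have "\<dots> = \<chi>1 (block_mat m i t 0 1 (inverse t)) * p (N (inverse t))"
      proof -
        define l where "l = block_mat m i t 0 1 (inverse t)"
        have lL: "l \<in> SL_lower m" unfolding l_def by (rule block_mat_lower[OF i]) (use t in simp)
        have lS: "l \<in> SL m" using SL_lowerD(1)[OF lL] .
        have NS: "N (inverse t) \<in> SL m"
        proof -
          have "N (inverse t) = block_mat m i 0 1 (-1) 0 * block_mat m i 1 0 (inverse t) 1"
            unfolding N_def block_mat_mult[OF i] by simp
          then show ?thesis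
            using SL_mult[OF block_mat_reflection[OF i] SL_lowerD(1)[OF block_mat_lower[OF i, of 1 1 "inverse t"]]] by simp
        qed
        have "u = l * N (inverse t)" unfolding u_def l_def N_def block_mat_mult[OF i] using t by simp
        then have "f1 \<bullet> (\<rho>1 u *\<^sub>v x) = f1 \<bullet> (\<rho>1 l *\<^sub>v (\<rho>1 (N (inverse t)) *\<^sub>v x))"
          using V1.rep_mult_vec[OF lS NS x] by simp
        also have "\<dots> = hw_char m \<alpha> l * p (N (inverse t))"
          using f1(3) lL V1.rep_vec[OF NS x] p(2) NS by simp
        also have "hw_char m \<alpha> l = \<chi>1 l" unfolding \<chi>1_def by (rule hw_char_weight[of \<alpha> m]) (use \<alpha>m m in auto)
        finally show ?thesis unfolding l_def .
      qed
      also have "\<chi>1 (block_mat m i t 0 1 (inverse t)) = t ^ (a - b)"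
      proof -
        have "\<chi>1 (block_mat m i t 0 1 (inverse t)) = (\<Prod>k\<in>{i, Suc i}. block_mat m i t 0 1 (inverse t) $$ (k, k) ^ \<alpha> (Suc k))"
          unfolding \<chi>1_def using i by (intro prod.mono_neutral_right) (auto simp: block_mat_index)
        also have "\<dots> = t ^ a * inverse t ^ b" using i by (simp add: block_mat_index a_def b_def)
        also have "\<dots> = t ^ (a - b)" using t ab by (simp add: power_diff divide_inverse power_inverse)
        finally show ?thesis .
      qed
      finally show ?thesis .
    qed
    have "(\<lambda>n. p (N (inverse (of_nat (Suc n))))) \<longlonglongrightarrow> p (N 0)"
    proof (rule polynomial_functions_tendsto[OF p(1)])
      fix k l assume kl: "k < m" "l < m"
      have "(\<lambda>n. inverse (of_nat (Suc n)) :: complex) \<longlonglongrightarrow> 0" by (rule LIMSEQ_Suc[OF lim_inverse_n])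
      then show "(\<lambda>n. N (inverse (of_nat (Suc n))) $$ (k, l)) \<longlonglongrightarrow> N 0 $$ (k, l)"
        using kl by (auto simp: N_def block_mat_index simp del: of_nat_Suc)
    qed
    moreover have "p (N (inverse (of_nat (Suc n)))) = (- of_nat n) ^ e (Suc i) * P (ones m) / of_nat (Suc n) ^ (a - b)" for n
    proof -
      have t: "(of_nat (Suc n) :: complex) \<noteq> 0" by (rule of_nat_neq_0)
      have "(1 - of_nat (Suc n) :: complex) = - of_nat n" by simp
      then have "of_nat (Suc n) ^ (a - b) * p (N (inverse (of_nat (Suc n)))) = (- of_nat n) ^ e (Suc i) * P (ones m)"
        using main[OF t] by simp
      moreover have "(of_nat (Suc n) :: complex) ^ (a - b) \<noteq> 0" using t by simp
      ultimately show ?thesis by (metis nonzero_mult_div_cancel_left)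
    qed
    ultimately have "(\<lambda>n. (- of_nat n) ^ e (Suc i) * P (ones m) / of_nat (Suc n) ^ (a - b)) \<longlonglongrightarrow> p (N 0)" by simp
    then show ?thesis using exponent_le_of_convergent[OF P(2)] unfolding a_def b_def by blast
  qed
  have S\<kappa>: "(\<Sum>j<m. \<kappa> j) = - (int (\<Sum>i = 1..m. \<alpha> i) + int (\<Sum>i = 1..m. \<gamma> i))"
    unfolding \<kappa>_def using sum_shift1[of \<alpha> m] sum_reflect[of \<gamma> m]
    by (simp add: sum_negf sum_subtractf flip: of_nat_sum)
  \<comment> \<open>The width of the rectangle. By the formula for the exponents,
    \<open>e i + \<alpha> (Suc i) + \<gamma> (m - i)\<close> does not depend on \<open>i\<close>;
    here it is read at \<open>i = 0\<close>.\<close>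
  define c where "c = e 0 + \<alpha> 1 + \<gamma> m"
  have mc: "int m * int c = int r + int (\<Sum>i = 1..m. \<alpha> i) + int (\<Sum>i = 1..m. \<gamma> i)"
    using e[rule_format, of 0] m unfolding S\<kappa> c_def by (simp add: \<kappa>_def algebra_simps)
  have ec: "e i + \<alpha> (Suc i) + \<gamma> (m - i) = c" if "i < m" for i
  proof -
    have "int m * (int (e i) + int (\<alpha> (Suc i)) + int (\<gamma> (m - i))) = int m * int c"
      using e[rule_format, OF that] unfolding mc S\<kappa> by (simp add: \<kappa>_def algebra_simps)
    then have "int (e i) + int (\<alpha> (Suc i)) + int (\<gamma> (m - i)) = int c" using m by simp
    then show ?thesis by linarith
  qed
  show ?thesis unfolding pieri_condition_def
  proof (intro exI[of _ c] conjI ballI)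
    fix i assume "i \<in> {1..m}"
    then show "\<alpha> i + \<gamma> (m + 1 - i) \<le> c" using ec[of "i - 1"] by (cases i) auto
  next
    fix i assume "i \<in> {1..m - 1}"
    then obtain j where j: "i = Suc j" "Suc j < m" by (cases i) auto
    have "\<alpha> (Suc (Suc j)) \<le> \<alpha> (Suc j)" using weights_antimono[OF w(1), of "Suc j"] by simp
    then show "c \<le> \<alpha> i + \<gamma> (m - i)" using ec[of "Suc j"] bound[of j] j by simp
  next
    show "m * c = r + sum \<alpha> {1..m} + sum \<gamma> {1..m}" 
    proof -
      have "int (m * c) = int (r + sum \<alpha> {1..m} + sum \<gamma> {1..m})" using mc by simp
      then show ?thesis by (simp only: of_nat_eq_iff)
    qed
  qed
qed

section \<open>Unitary representations\<close>

text \<open>With it, \<open>cvec z \<bullet> x\<close> is the Hermitian product, linear in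
  \<open>x\<close>.\<close>

definition cvec :: "complex vec \<Rightarrow> complex vec"
  where "cvec z = vec (dim_vec z) (\<lambda>i. cnj (z $ i))"

lemma cvec_carrier [simp]: "cvec z \<in> carrier_vec n \<longleftrightarrow> z \<in> carrier_vec n"
  unfolding cvec_def carrier_vec_def mem_Collect_eq dim_vec by blast

lemma cvec_index: "z \<in> carrier_vec n \<Longrightarrow> i < n \<Longrightarrow> cvec z $ i = cnj (z $ i)"
  by (simp add: cvec_def)

lemma cvec_scalar_self_zero:
  assumes z: "z \<in> carrier_vec n" and eq: "cvec z \<bullet> z = 0"
  shows "z = 0\<^sub>v n"
proof -
  have "cvec z \<bullet> z = complex_of_real (\<Sum>i<n. (cmod (z $ i))\<^sup>2)"
    unfolding scalar_prod_sum[OF z] using z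
    by (simp add: cvec_index complex_norm_square mult.commute del: of_real_power)
  then have "(\<Sum>i<n. (cmod (z $ i))\<^sup>2) = 0" using eq by (metis of_real_eq_0_iff)
  then have "\<forall>i<n. z $ i = 0" by (simp add: sum_nonneg_eq_0_iff)
  then show ?thesis using z by (intro eq_vecI) auto
qed

lemma cvec_adjoint:
  assumes A: "A \<in> carrier_mat n k" and z: "z \<in> carrier_vec n" and x: "x \<in> carrier_vec k"
  shows "cvec z \<bullet> (A *\<^sub>v x) = cvec (dagger A *\<^sub>v z) \<bullet> x"
proof -
  have Ax: "A *\<^sub>v x \<in> carrier_vec n" using A x by auto
  have dA: "dagger A \<in> carrier_mat k n" using A by simp
  have dz: "dagger A *\<^sub>v z \<in> carrier_vec k" by (rule mult_mat_vec_carrier[OF dA z])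
  have "cvec z \<bullet> (A *\<^sub>v x) = (\<Sum>i<n. \<Sum>l<k. cnj (z $ i) * (A $$ (i, l) * x $ l))"
    unfolding scalar_prod_sum[OF Ax]
  proof (rule sum.cong[OF refl])
    fix i assume "i \<in> {..<n}"
    then have i: "i < n" by simp
    show "cvec z $ i * (A *\<^sub>v x) $ i = (\<Sum>l<k. cnj (z $ i) * (A $$ (i, l) * x $ l))"
      unfolding mult_mat_vec_index[OF A x i] cvec_index[OF z i] by (rule sum_distrib_left)
  qed
  also have "\<dots> = (\<Sum>l<k. \<Sum>i<n. cnj (z $ i) * (A $$ (i, l) * x $ l))" by (rule sum.swap)
  also have "\<dots> = (\<Sum>l<k. cvec (dagger A *\<^sub>v z) $ l * x $ l)"
  proof (rule sum.cong[OF refl])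
    fix l assume "l \<in> {..<k}"
    then have l: "l < k" by simp
    have "cvec (dagger A *\<^sub>v z) $ l = (\<Sum>i<n. A $$ (i, l) * cnj (z $ i))"
      unfolding cvec_index[OF dz l] mult_mat_vec_index[OF dA z l] using A l by simp
    then show "(\<Sum>i<n. cnj (z $ i) * (A $$ (i, l) * x $ l)) = cvec (dagger A *\<^sub>v z) $ l * x $ l"
      by (simp add: sum_distrib_left mult_ac)
  qed
  also have "\<dots> = cvec (dagger A *\<^sub>v z) \<bullet> x" by (rule scalar_prod_sum[OF x, symmetric])
  finally show ?thesis .
qed

lemma mat_eq_of_vec:
  fixes A B :: "complex mat"
  assumes A: "A \<in> carrier_mat n k" and B: "B \<in> carrier_mat n k"
    and eq: "\<And>x. x \<in> carrier_vec k \<Longrightarrow> A *\<^sub>v x = B *\<^sub>v x"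
  shows "A = B"
proof (intro eq_matI)
  fix i j assume "i < dim_row B" "j < dim_col B"
  then have ij: "i < n" "j < k" using B by auto
  show "A $$ (i, j) = B $$ (i, j)"
    using mat_mult_unit_vec_index[OF A ij] mat_mult_unit_vec_index[OF B ij] eq[OF unit_vec_carrier] by metis
qed (use A B in auto)

lemma det_dagger:
  assumes A: "A \<in> carrier_mat n n"
  shows "det (dagger A) = cnj (det A)"
proof -
  interpret comm_ring_hom cnj by unfold_locales auto
  have "dagger A = transpose_mat (map_mat cnj A)" using A by (intro eq_matI) auto
  then show ?thesis using A by (simp add: det_transpose)
qed

lemma dagger_SL: "g \<in> SL m \<Longrightarrow> dagger g \<in> SL m"
  by (auto simp: SL_def det_dagger)

lemma dagger_SL_lower:
  assumes b: "b \<in> SL_lower m"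
  shows "dagger b \<in> SL_upper m"
  using b dagger_SL[OF SL_lowerD(1)[OF b]] by (auto simp: SL_upper_def SL_lower_def SL_def)

lemma hw_char_dagger:
  assumes b: "b \<in> carrier_mat m m"
  shows "hw_char m \<mu> (dagger b) = cnj (hw_char m \<mu> b)"
proof -
  have "b $$ (i - 1, i - 1) = cnj (dagger b $$ (i - 1, i - 1))" if "i \<in> {1..m - 1}" for i
    using that b by auto
  then show ?thesis unfolding hw_char_def using b by (auto intro!: prod.cong)
qed

text \<open>The complement of an invariant subspace is invariant, so a submodule generated by a highest
  weight vector is irreducible: the orthogonal projection of this vector to an invariant subspace
  is again an eigenvector of the Borel subgroup with the same character, hence a multiple of it.\<close>

locale unitary_highest_weight = rational_representation m D R for m D R +
  fixes \<mu> :: "nat \<Rightarrow> nat" and v :: "complex vec"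
  assumes unitary: "g \<in> SL m \<Longrightarrow> R (dagger g) = dagger (R g)"
    and v_carrier: "v \<in> carrier_vec D" and v_nonzero: "v \<noteq> 0\<^sub>v D"
    and v_upper: "b \<in> SL_upper m \<Longrightarrow> R b *\<^sub>v v = hw_char m \<mu> b \<cdot>\<^sub>v v"
begin

text \<open>The span of the orbit of \<open>v\<close>, written as a double annihilator: closure
  under the vector operations is then immediate, and a functional that kills the orbit kills
  \<open>generated\<close> by definition.\<close>

definition generated :: "complex vec set"
  where "generated = {x \<in> carrier_vec D. \<forall>y \<in> carrier_vec D. (\<forall>g \<in> SL m. y \<bullet> (R g *\<^sub>v v) = 0) \<longrightarrow> y \<bullet> x = 0}"

lemma generated_subspace: "csubspace D generated"
  by (rule csubspaceI) (auto simp: generated_def scalar_prod_add_distrib[of _ D])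

lemma orbit_generated: "g \<in> SL m \<Longrightarrow> R g *\<^sub>v v \<in> generated"
  using rep_vec[OF _ v_carrier] by (simp add: generated_def)

lemma generated_stable:
  assumes g: "g \<in> SL m" and x: "x \<in> generated"
  shows "R g *\<^sub>v x \<in> generated"
proof -
  have xc: "x \<in> carrier_vec D" using x by (simp add: generated_def)
  have "y \<bullet> (R g *\<^sub>v x) = 0" if y: "y \<in> carrier_vec D" "\<forall>h \<in> SL m. y \<bullet> (R h *\<^sub>v v) = 0" for y
  proof -
    have "dual_act g y \<bullet> (R h *\<^sub>v v) = 0" if h: "h \<in> SL m" for h
      using dual_act_scalar[OF g y(1) rep_vec[OF h v_carrier]] rep_mult_vec[OF g h v_carrier] bspec[OF y(2) SL_mult[OF g h]] by simp
    then have "dual_act g y \<bullet> x = 0" using x dual_act_carrier[OF g] by (simp add: generated_def)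
    then show ?thesis using dual_act_scalar[OF g y(1) xc] by simp
  qed
  then show ?thesis using rep_vec[OF g xc] by (simp add: generated_def)
qed

text \<open>The columns of \<open>J\<close> are an orthonormal basis of \<open>generated\<close>,
  and \<open>\<rho>\<close> is the action on its coordinates. The intertwining map
  \<open>dagger J\<close> will carry an invariant tensor into the irreducible modules; the last
  clause says that \<open>J\<close> recovers the orbit of \<open>v\<close> from its
  coordinates.\<close>

lemma exists_irreducible:
  obtains d \<rho> J where "is_V m \<mu> d \<rho>" "J \<in> carrier_mat D d"
    "\<forall>g \<in> SL m. \<rho> g \<in> carrier_mat d d \<and> \<rho> g * dagger J = dagger J * R g"
    "\<forall>g \<in> SL m. J *\<^sub>v (dagger J *\<^sub>v (R g *\<^sub>v v)) = R g *\<^sub>v v"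
proof -
  obtain J d where J: "J \<in> carrier_mat D d" "dagger J * J = 1\<^sub>m d"
    "\<forall>x \<in> carrier_vec d. J *\<^sub>v x \<in> generated" "\<forall>u \<in> generated. J *\<^sub>v (dagger J *\<^sub>v u) = u"
    by (rule exists_orthonormal_basis[OF generated_subspace])
  have dJ: "dagger J \<in> carrier_mat d D" using J(1) by simp
  have JJ: "dagger J *\<^sub>v (J *\<^sub>v x) = x" if "x \<in> carrier_vec d" for x
    using assoc_mult_mat_vec[OF dJ J(1) that] J(2) that by simp
  have Jc: "J *\<^sub>v x \<in> carrier_vec D" if "x \<in> carrier_vec d" for x by (rule mult_mat_vec_carrier[OF J(1) that])
  have dJc: "dagger J *\<^sub>v x \<in> carrier_vec d" if "x \<in> carrier_vec D" for x by (rule mult_mat_vec_carrier[OF dJ that])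
  define \<rho> where "\<rho> g = dagger J * (R g * J)" for g
  have RJ: "R g * J \<in> carrier_mat D d" if "g \<in> SL m" for g
    by (rule mult_carrier_mat[OF rep_carrier[OF that] J(1)])
  have \<rho>c: "\<rho> g \<in> carrier_mat d d" if "g \<in> SL m" for g
    unfolding \<rho>_def by (rule mult_carrier_mat[OF dJ RJ[OF that]])
  have \<rho>v: "\<rho> g *\<^sub>v x = dagger J *\<^sub>v (R g *\<^sub>v (J *\<^sub>v x))" if "g \<in> SL m" "x \<in> carrier_vec d" for g x
    unfolding \<rho>_def using assoc_mult_mat_vec[OF dJ RJ[OF that(1)] that(2)]
      assoc_mult_mat_vec[OF rep_carrier[OF that(1)] J(1) that(2)] by simp
  have J\<rho>v: "J *\<^sub>v (\<rho> g *\<^sub>v x) = R g *\<^sub>v (J *\<^sub>v x)" if "g \<in> SL m" "x \<in> carrier_vec d" for g x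
    using \<rho>v[OF that] J(3,4) that generated_stable by simp
  have J\<rho>: "J * \<rho> g = R g * J" if g: "g \<in> SL m" for g
  proof (rule mat_eq_of_vec[OF mult_carrier_mat[OF J(1) \<rho>c[OF g]] RJ[OF g]])
    fix x :: "complex vec" assume x: "x \<in> carrier_vec d"
    show "J * \<rho> g *\<^sub>v x = R g * J *\<^sub>v x"
      using assoc_mult_mat_vec[OF J(1) \<rho>c[OF g] x] assoc_mult_mat_vec[OF rep_carrier[OF g] J(1) x] J\<rho>v[OF g x] by simp
  qed
  have d\<rho>: "dagger (\<rho> g) = \<rho> (dagger g)" if g: "g \<in> SL m" for g
  proof -
    have "dagger (\<rho> g) = dagger (R g * J) * dagger (dagger J)"
      unfolding \<rho>_def by (rule dagger_mult[OF dJ RJ[OF g]])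
    also have "\<dots> = dagger J * dagger (R g) * J" by (simp add: dagger_mult[OF rep_carrier[OF g] J(1)])
    also have "\<dots> = \<rho> (dagger g)"
      unfolding \<rho>_def unitary[OF g] using rep_carrier[OF g] by (intro assoc_mult_mat[OF dJ _ J(1)]) simp
    finally show ?thesis .
  qed
  have \<rho>dJ: "\<rho> g * dagger J = dagger J * R g" if g: "g \<in> SL m" for g
  proof -
    have h: "dagger g \<in> SL m" by (rule dagger_SL[OF g])
    have "dagger (J * \<rho> (dagger g)) = dagger (R (dagger g) * J)" using J\<rho>[OF h] by simp
    then show ?thesis
      using dagger_mult[OF J(1) \<rho>c[OF h]] dagger_mult[OF rep_carrier[OF h] J(1)] d\<rho>[OF h] unitary[OF h] by simp
  qed
  have rat: "rational_rep m d \<rho>"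
    unfolding rational_rep_def
  proof (intro conjI ballI allI impI)
    show "\<rho> (1\<^sub>m m) = 1\<^sub>m d" unfolding \<rho>_def rep_one using J by simp
    show "\<rho> (g * h) = \<rho> g * \<rho> h" if g: "g \<in> SL m" and h: "h \<in> SL m" for g h
    proof -
      have "\<rho> g * \<rho> h = dagger J * (R g * J) * \<rho> h" by (simp add: \<rho>_def)
      also have "\<dots> = dagger J * (R g * J * \<rho> h)" by (rule assoc_mult_mat[OF dJ RJ[OF g] \<rho>c[OF h]])
      also have "R g * J * \<rho> h = R g * (J * \<rho> h)" by (rule assoc_mult_mat[OF rep_carrier[OF g] J(1) \<rho>c[OF h]])
      also have "\<dots> = R g * R h * J"
        unfolding J\<rho>[OF h] by (rule assoc_mult_mat[OF rep_carrier[OF g] rep_carrier[OF h] J(1), symmetric])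
      finally show ?thesis unfolding \<rho>_def rep_mult[OF g h] by simp
    qed
    fix i j assume ij: "i < d" "j < d"
    define y where "y = vec D (\<lambda>l. dagger J $$ (i, l))"
    define x where "x = J *\<^sub>v unit_vec d j"
    have x: "x \<in> carrier_vec D" unfolding x_def by (rule Jc) simp
    have "\<rho> g $$ (i, j) = y \<bullet> (R g *\<^sub>v x)" if g: "g \<in> SL m" for g
    proof -
      have "\<rho> g $$ (i, j) = (dagger J *\<^sub>v (R g *\<^sub>v x)) $ i"
        using mat_mult_unit_vec_index[OF \<rho>c[OF g] ij] \<rho>v[OF g, of "unit_vec d j"] by (simp add: x_def del: index_mult_mat_vec)
      also have "\<dots> = y \<bullet> (R g *\<^sub>v x)"
        unfolding mult_mat_vec_index[OF dJ rep_vec[OF g x] ij(1)] scalar_prod_sum[OF rep_vec[OF g x]] by (simp add: y_def)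
      finally show ?thesis .
    qed
    then show "\<exists>p\<in>polynomial_functions m. \<forall>g\<in>SL m. \<rho> g $$ (i, j) = p g"
      using coefficient_polynomial[OF x, of y] by simp
  qed (rule \<rho>c)
  then interpret V: rational_representation m d \<rho> using m2 by unfold_locales
  define w where "w = dagger J *\<^sub>v v"
  have wc: "w \<in> carrier_vec d" unfolding w_def by (rule dJc[OF v_carrier])
  have Jw: "J *\<^sub>v w = v"
    using J(4) orbit_generated[OF SL_one] rep_one_vec[OF v_carrier] by (simp add: w_def)
  have w0: "w \<noteq> 0\<^sub>v d"
  proof
    assume "w = 0\<^sub>v d"
    then have "v = 0\<^sub>v D" using Jw mat_mult_zero_vec[OF J(1)] by simp
    then show False using v_nonzero by simp
  qed
  have wU: "\<rho> b *\<^sub>v w = hw_char m \<mu> b \<cdot>\<^sub>v w" if b: "b \<in> SL_upper m" for b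
    using \<rho>v[OF SL_upperD(1)[OF b] wc] v_upper[OF b] mult_mat_vec[OF dJ v_carrier] by (simp add: Jw flip: w_def)
  have adj: "cvec z \<bullet> (\<rho> g *\<^sub>v x) = cvec (\<rho> (dagger g) *\<^sub>v z) \<bullet> x"
    if "g \<in> SL m" "z \<in> carrier_vec d" "x \<in> carrier_vec d" for g x z
    using cvec_adjoint[OF \<rho>c[OF that(1)] that(2,3)] d\<rho>[OF that(1)] by simp
  \<comment> \<open>The functional \<open>cvec (J *\<^sub>v z)\<close> kills the orbit of
    \<open>v\<close>, hence all of \<open>generated\<close>, and in particular
    \<open>J *\<^sub>v z\<close> itself.\<close>
  have sep: "z = 0\<^sub>v d" if z: "z \<in> carrier_vec d" and orth: "\<And>g. g \<in> SL m \<Longrightarrow> cvec z \<bullet> (\<rho> g *\<^sub>v w) = 0" for z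
  proof -
    have Jz: "J *\<^sub>v z \<in> carrier_vec D" by (rule Jc[OF z])
    have "cvec (J *\<^sub>v z) \<bullet> (R g *\<^sub>v v) = 0" if g: "g \<in> SL m" for g
    proof -
      have "cvec (J *\<^sub>v z) \<bullet> (R g *\<^sub>v v) = cvec (J *\<^sub>v z) \<bullet> (J *\<^sub>v (\<rho> g *\<^sub>v w))"
        using J\<rho>v[OF g wc] Jw by simp
      also have "\<dots> = cvec (dagger J *\<^sub>v (J *\<^sub>v z)) \<bullet> (\<rho> g *\<^sub>v w)"
        by (rule cvec_adjoint[OF J(1) Jz V.rep_vec[OF g wc]])
      also have "\<dots> = 0" unfolding JJ[OF z] by (rule orth[OF g])
      finally show ?thesis .
    qed
    then have "cvec (J *\<^sub>v z) \<bullet> (J *\<^sub>v z) = 0"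
      using J(3) z Jz by (simp add: generated_def)
    then have "J *\<^sub>v z = 0\<^sub>v D" by (rule cvec_scalar_self_zero[OF Jz])
    then show ?thesis using JJ[OF z] mat_mult_zero_vec[OF dJ] by simp
  qed
  \<comment> \<open>The component \<open>z\<close> of \<open>y\<close> orthogonal to
    \<open>w\<close> is again an eigenvector of the upper triangular matrices. By adjunction
    \<open>cvec w\<close> is an eigenfunctional of the lower triangular ones, so the coefficient of
    \<open>z\<close> against \<open>cvec w\<close> vanishes on the big cell. Thus \<open>z\<close>
    is orthogonal to the orbit of \<open>w\<close> and \<open>sep\<close> applies.\<close>
  have eigen: "\<exists>c. y = c \<cdot>\<^sub>v w" if y: "y \<in> carrier_vec d"
    and yU: "\<And>b. b \<in> SL_upper m \<Longrightarrow> \<rho> b *\<^sub>v y = hw_char m \<mu> b \<cdot>\<^sub>v y" for y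
  proof -
    have ww: "cvec w \<bullet> w \<noteq> 0" using cvec_scalar_self_zero[OF wc] w0 by blast
    define c where "c = (cvec w \<bullet> y) / (cvec w \<bullet> w)"
    define z where "z = y - c \<cdot>\<^sub>v w"
    have z: "z \<in> carrier_vec d" using y wc by (simp add: z_def)
    have zc: "cvec w \<bullet> z = 0"
      unfolding z_def using y wc ww by (simp add: scalar_prod_minus_distrib[of _ d] c_def)
    have zU: "\<rho> b *\<^sub>v z = hw_char m \<mu> b \<cdot>\<^sub>v z" if b: "b \<in> SL_upper m" for b
    proof -
      have "\<rho> b *\<^sub>v z = \<rho> b *\<^sub>v y - \<rho> b *\<^sub>v (c \<cdot>\<^sub>v w)"
        unfolding z_def using wc by (intro mult_minus_distrib_mat_vec[OF \<rho>c[OF SL_upperD(1)[OF b]] y]) simp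
      also have "\<rho> b *\<^sub>v (c \<cdot>\<^sub>v w) = c \<cdot>\<^sub>v (hw_char m \<mu> b \<cdot>\<^sub>v w)"
        using V.rep_smult[OF SL_upperD(1)[OF b] wc] wU[OF b] by simp
      also have "\<rho> b *\<^sub>v y - c \<cdot>\<^sub>v (hw_char m \<mu> b \<cdot>\<^sub>v w) = hw_char m \<mu> b \<cdot>\<^sub>v z"
        unfolding yU[OF b] z_def using y wc by (intro eq_vecI) (auto simp: algebra_simps)
      finally show ?thesis .
    qed
    have low: "cvec w \<bullet> (\<rho> b *\<^sub>v x) = hw_char m \<mu> b * (cvec w \<bullet> x)" if b: "b \<in> SL_lower m" and x: "x \<in> carrier_vec d" for b x
    proof -
      have "cvec w \<bullet> (\<rho> b *\<^sub>v x) = cvec (hw_char m \<mu> (dagger b) \<cdot>\<^sub>v w) \<bullet> x"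
        using adj[OF SL_lowerD(1)[OF b] wc x] wU[OF dagger_SL_lower[OF b]] by simp
      also have "cvec (hw_char m \<mu> (dagger b) \<cdot>\<^sub>v w) = hw_char m \<mu> b \<cdot>\<^sub>v cvec w"
        unfolding hw_char_dagger[OF SL_carrier[OF SL_lowerD(1)[OF b]]] by (intro eq_vecI) (auto simp: cvec_def)
      finally show ?thesis using wc x by simp
    qed
    have "cvec w \<bullet> (\<rho> g *\<^sub>v z) = 0" if g: "g \<in> SL m" for g
    proof (rule V.coefficient_zero_of_big_cell[OF z g])
      fix l u assume l: "l \<in> SL_lower m" and u: "u \<in> SL_upper m"
      have lS: "l \<in> SL m" and uS: "u \<in> SL m" using l u by (auto dest: SL_lowerD SL_upperD)
      show "cvec w \<bullet> (\<rho> (l * u) *\<^sub>v z) = 0"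
        using V.rep_mult_vec[OF lS uS z] low[OF l V.rep_vec[OF uS z]] zU[OF u] zc z wc by simp
    qed
    then have orth: "cvec (\<rho> (dagger g) *\<^sub>v w) \<bullet> z = 0" if "g \<in> SL m" for g
      using adj[OF that wc z] that by simp
    have "cvec z \<bullet> (\<rho> g *\<^sub>v w) = 0" if g: "g \<in> SL m" for g
    proof -
      have gw: "\<rho> g *\<^sub>v w \<in> carrier_vec d" by (rule V.rep_vec[OF g wc])
      have "cvec z \<bullet> (\<rho> g *\<^sub>v w) = cnj (cvec (\<rho> g *\<^sub>v w) \<bullet> z)"
        unfolding scalar_prod_sum[OF gw] scalar_prod_sum[OF z] cnj_sum
        by (intro sum.cong) (auto simp: cvec_index[OF z] cvec_index[OF gw] mult.commute simp del: index_mult_mat_vec)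
      also have "cvec (\<rho> g *\<^sub>v w) \<bullet> z = 0" using orth[OF dagger_SL[OF g]] by simp
      finally show ?thesis by simp
    qed
    then have "z = 0\<^sub>v d" by (rule sep[OF z])
    then have "y = c \<cdot>\<^sub>v w"
    proof -
      have "y $ i = (c \<cdot>\<^sub>v w) $ i" if "i < d" for i
      proof -
        have "z $ i = 0" using \<open>z = 0\<^sub>v d\<close> that by simp
        then show ?thesis using y wc that by (simp add: z_def)
      qed
      then show ?thesis using y wc by (intro eq_vecI) auto
    qed
    then show ?thesis by blast
  qed
  have irr: "irreducible_rep m d \<rho>"
    unfolding irreducible_rep_def
  proof (intro conjI allI impI)
    have "d \<noteq> 0"
    proof
      assume "d = 0"
      then have "w = 0\<^sub>v d" using wc by auto
      then show False using w0 by simp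
    qed
    then show "0 < d" by simp
  next
    fix U assume "subspace class_ring U (module_vec TYPE(complex) d) \<and> (\<forall>g\<in>SL m. \<forall>u\<in>U. \<rho> g *\<^sub>v u \<in> U)"
    then have U: "csubspace d U" and stable: "\<And>g u. g \<in> SL m \<Longrightarrow> u \<in> U \<Longrightarrow> \<rho> g *\<^sub>v u \<in> U"
      by (auto simp: csubspace_iff)
    obtain K k where K: "K \<in> carrier_mat d k" "dagger K * K = 1\<^sub>m k"
      "\<forall>x \<in> carrier_vec k. K *\<^sub>v x \<in> U" "\<forall>u \<in> U. K *\<^sub>v (dagger K *\<^sub>v u) = u"
      by (rule exists_orthonormal_basis[OF U])
    have dK: "dagger K \<in> carrier_mat k d" using K(1) by simp
    \<comment> \<open>The orthogonal projection onto the invariant subspace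
      \<open>U\<close>.\<close>
    define \<pi> where "\<pi> = K * dagger K"
    have \<pi>c: "\<pi> \<in> carrier_mat d d" unfolding \<pi>_def by (rule mult_carrier_mat[OF K(1) dK])
    have \<pi>v: "\<pi> *\<^sub>v x = K *\<^sub>v (dagger K *\<^sub>v x)" if "x \<in> carrier_vec d" for x
      unfolding \<pi>_def by (rule assoc_mult_mat_vec[OF K(1) dK that])
    have \<pi>U: "\<pi> *\<^sub>v x \<in> U" if "x \<in> carrier_vec d" for x
      unfolding \<pi>v[OF that] using K(3) mult_mat_vec_carrier[OF dK that] by blast
    have \<pi>id: "\<pi> *\<^sub>v u = u" if "u \<in> U" for u
      using \<pi>v K(4) that csubspaceD(1)[OF U] by auto
    have d\<pi>: "dagger \<pi> = \<pi>" unfolding \<pi>_def using dagger_mult[OF K(1) dK] by simp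
    have \<pi>sym: "cvec z \<bullet> (\<pi> *\<^sub>v x) = cvec (\<pi> *\<^sub>v z) \<bullet> x" if "z \<in> carrier_vec d" "x \<in> carrier_vec d" for z x
      using cvec_adjoint[OF \<pi>c that] d\<pi> by simp
    have \<pi>\<rho>\<pi>: "\<pi> * (\<rho> g * \<pi>) = \<rho> g * \<pi>" if g: "g \<in> SL m" for g
    proof (rule mat_eq_of_vec[of _ d d])
      fix x :: "complex vec" assume x: "x \<in> carrier_vec d"
      have "\<pi> *\<^sub>v (\<rho> g *\<^sub>v (\<pi> *\<^sub>v x)) = \<rho> g *\<^sub>v (\<pi> *\<^sub>v x)"
        by (rule \<pi>id[OF stable[OF g \<pi>U[OF x]]])
      then show "\<pi> * (\<rho> g * \<pi>) *\<^sub>v x = \<rho> g * \<pi> *\<^sub>v x"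
        using assoc_mult_mat_vec[OF \<pi>c mult_carrier_mat[OF \<rho>c[OF g] \<pi>c] x] assoc_mult_mat_vec[OF \<rho>c[OF g] \<pi>c x] by simp
    qed (use \<rho>c[OF g] \<pi>c in auto)
    \<comment> \<open>Stability of \<open>U\<close> gives
      \<open>\<pi> * (\<rho> g * \<pi>) = \<rho> g * \<pi>\<close>. The adjoint of this equation for
      \<open>dagger g\<close> has the projections on the other side, and together they yield
      commutation.\<close>
    have comm: "\<pi> * \<rho> g = \<rho> g * \<pi>" if g: "g \<in> SL m" for g
    proof -
      have h: "dagger g \<in> SL m" by (rule dagger_SL[OF g])
      have \<rho>\<pi>: "\<rho> (dagger g) * \<pi> \<in> carrier_mat d d" by (rule mult_carrier_mat[OF \<rho>c[OF h] \<pi>c])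
      have "dagger (\<rho> (dagger g) * \<pi>) = \<pi> * \<rho> g"
        using dagger_mult[OF \<rho>c[OF h] \<pi>c] d\<rho>[OF h] d\<pi> by simp
      moreover have "dagger (\<pi> * (\<rho> (dagger g) * \<pi>)) = \<pi> * \<rho> g * \<pi>"
        using dagger_mult[OF \<pi>c \<rho>\<pi>] dagger_mult[OF \<rho>c[OF h] \<pi>c] d\<rho>[OF h] d\<pi> by simp
      ultimately have "\<pi> * \<rho> g = \<pi> * \<rho> g * \<pi>" using \<pi>\<rho>\<pi>[OF h] by simp
      also have "\<dots> = \<rho> g * \<pi>" using \<pi>\<rho>\<pi>[OF g] assoc_mult_mat[OF \<pi>c \<rho>c[OF g] \<pi>c] by simp
      finally show ?thesis .
    qed
    have commv: "\<pi> *\<^sub>v (\<rho> g *\<^sub>v x) = \<rho> g *\<^sub>v (\<pi> *\<^sub>v x)" if "g \<in> SL m" "x \<in> carrier_vec d" for g x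
      using assoc_mult_mat_vec[OF \<pi>c \<rho>c[OF that(1)] that(2)] assoc_mult_mat_vec[OF \<rho>c[OF that(1)] \<pi>c that(2)] comm[OF that(1)] by simp
    have \<pi>w: "\<pi> *\<^sub>v w \<in> carrier_vec d" by (rule mult_mat_vec_carrier[OF \<pi>c wc])
    have "\<exists>c. \<pi> *\<^sub>v w = c \<cdot>\<^sub>v w"
    proof (rule eigen[OF \<pi>w])
      fix b assume b: "b \<in> SL_upper m"
      show "\<rho> b *\<^sub>v (\<pi> *\<^sub>v w) = hw_char m \<mu> b \<cdot>\<^sub>v (\<pi> *\<^sub>v w)"
        using commv[OF SL_upperD(1)[OF b] wc] wU[OF b] mult_mat_vec[OF \<pi>c wc] by simp
    qed
    then obtain c where c: "\<pi> *\<^sub>v w = c \<cdot>\<^sub>v w" by auto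
    show "U = {0\<^sub>v d} \<or> U = carrier_vec d"
    \<comment> \<open>If \<open>c = 0\<close>, every vector of \<open>U\<close> is orthogonal to the
      orbit of \<open>w\<close>; otherwise \<open>w\<close> lies in \<open>U\<close>, and every
      vector orthogonal to \<open>U\<close> is orthogonal to that orbit. In both cases
      \<open>sep\<close> concludes.\<close>
    proof (cases "c = 0")
      case True
      have \<pi>w0: "\<pi> *\<^sub>v w = 0\<^sub>v d" unfolding c True using wc by auto
      have "u = 0\<^sub>v d" if u: "u \<in> U" for u
      proof (rule sep)
        show uc: "u \<in> carrier_vec d" using u csubspaceD(1)[OF U] by auto
        fix g assume g: "g \<in> SL m"
        have "cvec u \<bullet> (\<rho> g *\<^sub>v w) = cvec u \<bullet> (\<pi> *\<^sub>v (\<rho> g *\<^sub>v w))"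
          using \<pi>sym[OF uc V.rep_vec[OF g wc]] \<pi>id[OF u] by simp
        also have "\<dots> = 0" unfolding commv[OF g wc] \<pi>w0 using mat_mult_zero_vec[OF \<rho>c[OF g]] uc by simp
        finally show "cvec u \<bullet> (\<rho> g *\<^sub>v w) = 0" .
      qed
      then have "U = {0\<^sub>v d}" using csubspaceD(2)[OF U] by blast
      then show ?thesis ..
    next
      case False
      have "w = inverse c \<cdot>\<^sub>v (\<pi> *\<^sub>v w)" unfolding c using False by (simp add: smult_smult_assoc)
      then have wUU: "w \<in> U" using csubspaceD(4)[OF U \<pi>U[OF wc], of "inverse c"] by simp
      have "x \<in> U" if x: "x \<in> carrier_vec d" for x
      proof -
        define z where "z = x - \<pi> *\<^sub>v x"
        have \<pi>x: "\<pi> *\<^sub>v x \<in> carrier_vec d" by (rule mult_mat_vec_carrier[OF \<pi>c x])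
        have z: "z \<in> carrier_vec d" using x \<pi>x unfolding z_def by simp
        have "\<pi> *\<^sub>v z = \<pi> *\<^sub>v x - \<pi> *\<^sub>v (\<pi> *\<^sub>v x)"
          unfolding z_def by (rule mult_minus_distrib_mat_vec[OF \<pi>c x \<pi>x])
        then have \<pi>z: "\<pi> *\<^sub>v z = 0\<^sub>v d" using \<pi>id[OF \<pi>U[OF x]] \<pi>x by auto
        have "z = 0\<^sub>v d"
        proof (rule sep[OF z])
          fix g assume g: "g \<in> SL m"
          have "cvec z \<bullet> (\<rho> g *\<^sub>v w) = cvec z \<bullet> (\<pi> *\<^sub>v (\<rho> g *\<^sub>v w))"
            using \<pi>id[OF stable[OF g wUU]] by simp
          also have "\<dots> = cvec (0\<^sub>v d) \<bullet> (\<rho> g *\<^sub>v w)"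
            using \<pi>sym[OF z V.rep_vec[OF g wc]] \<pi>z by simp
          also have "\<dots> = 0"
            unfolding scalar_prod_sum[OF V.rep_vec[OF g wc]] by (simp add: cvec_def)
          finally show "cvec z \<bullet> (\<rho> g *\<^sub>v w) = 0" .
        qed
        have "x = \<pi> *\<^sub>v x"
        proof (intro eq_vecI)
          fix i assume "i < dim_vec (\<pi> *\<^sub>v x)"
          then have i: "i < d" using carrier_vecD[OF \<pi>x] by (simp only:)
          have "z $ i = 0" using \<open>z = 0\<^sub>v d\<close> i by simp
          moreover have "z $ i = x $ i - (\<pi> *\<^sub>v x) $ i"
            unfolding z_def by (rule index_minus_vec(1)) (simp only: carrier_vecD[OF \<pi>x] i)
          ultimately show "x $ i = (\<pi> *\<^sub>v x) $ i" by simp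
        qed (simp only: carrier_vecD[OF \<pi>x] carrier_vecD[OF x])
        then show ?thesis using \<pi>U[OF x] by simp
      qed
      then have "U = carrier_vec d" using csubspaceD(1)[OF U] by blast
      then show ?thesis ..
    qed
  qed
  have "is_V m \<mu> d \<rho>" by (rule is_V_intro[OF rat irr wc w0 wU])
  then show thesis
    by (rule that[OF _ J(1)]) (use \<rho>c \<rho>dJ J(4) orbit_generated in auto)
qed

end

section \<open>Tensor powers\<close>

definition boxes :: "nat \<Rightarrow> (nat \<Rightarrow> nat) \<Rightarrow> (nat \<times> nat) set"
  where "boxes c h = (SIGMA d:{..<c}. {..<h d})"

text \<open>The words index the standard basis of the tensor power of $\mathbb{C}^m$ whose factors
  correspond to the boxes of a diagram with columns of heights \<open>h 0, \<dots>, h (c - 1)\<close>.\<close>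

definition words :: "nat \<Rightarrow> nat \<Rightarrow> (nat \<Rightarrow> nat) \<Rightarrow> (nat \<times> nat \<Rightarrow> nat) set"
  where "words m c h = PiE (boxes c h) (\<lambda>_. {..<m})"

definition tensor_dim :: "nat \<Rightarrow> nat \<Rightarrow> (nat \<Rightarrow> nat) \<Rightarrow> nat"
  where "tensor_dim m c h = card (words m c h)"

text \<open>An arbitrary numbering of the words, used to turn tensors into vectors; everything later
  rests on \<open>bij_word_enum\<close> alone.\<close>

definition word_enum :: "nat \<Rightarrow> nat \<Rightarrow> (nat \<Rightarrow> nat) \<Rightarrow> nat \<Rightarrow> nat \<times> nat \<Rightarrow> nat"
  where "word_enum m c h = (SOME e. bij_betw e {..<tensor_dim m c h} (words m c h))"

definition tensor_power :: "nat \<Rightarrow> nat \<Rightarrow> (nat \<Rightarrow> nat) \<Rightarrow> complex mat \<Rightarrow> complex mat"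
  where "tensor_power m c h g = mat (tensor_dim m c h) (tensor_dim m c h)
    (\<lambda>(a, b). \<Prod>s\<in>boxes c h. g $$ (word_enum m c h a s, word_enum m c h b s))"

text \<open>The coordinate at the word \<open>w\<close> of the tensor product over the columns
  \<open>d\<close> of the wedge of the first \<open>h d\<close> columns of \<open>g\<close>.\<close>

definition minors :: "nat \<Rightarrow> (nat \<Rightarrow> nat) \<Rightarrow> complex mat \<Rightarrow> (nat \<times> nat \<Rightarrow> nat) \<Rightarrow> complex"
  where "minors c h g w = (\<Prod>d<c. det (mat (h d) (h d) (\<lambda>(i, j). g $$ (w (d, i), j))))"

definition minor_vec :: "nat \<Rightarrow> nat \<Rightarrow> (nat \<Rightarrow> nat) \<Rightarrow> complex mat \<Rightarrow> complex vec"
  where "minor_vec m c h g = vec (tensor_dim m c h) (\<lambda>a. minors c h g (word_enum m c h a))"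

lemma finite_boxes [simp]: "finite (boxes c h)"
  by (simp add: boxes_def)

lemma finite_words [simp]: "finite (words m c h)"
  unfolding words_def by (intro finite_PiE) auto

lemma bij_word_enum: "bij_betw (word_enum m c h) {..<tensor_dim m c h} (words m c h)"
proof -
  have "\<exists>e. bij_betw e {..<tensor_dim m c h} (words m c h)"
    unfolding tensor_dim_def using ex_bij_betw_nat_finite[OF finite_words] by (simp add: lessThan_atLeast0)
  then show ?thesis unfolding word_enum_def by (rule someI_ex)
qed

lemma word_enum_words: "a < tensor_dim m c h \<Longrightarrow> word_enum m c h a \<in> words m c h"
  using bij_word_enum[of m c h] by (auto simp: bij_betw_def)

lemma words_less: "w \<in> words m c h \<Longrightarrow> s \<in> boxes c h \<Longrightarrow> w s < m"
  by (auto simp: words_def)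

lemma word_enum_less: "a < tensor_dim m c h \<Longrightarrow> s \<in> boxes c h \<Longrightarrow> word_enum m c h a s < m"
  using word_enum_words words_less by blast

lemma sum_word_enum: "(\<Sum>a<tensor_dim m c h. F (word_enum m c h a)) = (\<Sum>w\<in>words m c h. F w)"
  by (rule sum.reindex_bij_betw[OF bij_word_enum])

lemma sum_words_prod:
  fixes F :: "nat \<times> nat \<Rightarrow> nat \<Rightarrow> complex"
  shows "(\<Sum>w\<in>words m c h. \<Prod>s\<in>boxes c h. F s (w s)) = (\<Prod>s\<in>boxes c h. \<Sum>x<m. F s x)"
  unfolding words_def by (rule prod_sum_PiE[symmetric]) auto

section \<open>Minors and the action on tensor powers\<close>

definition column_perms :: "nat \<Rightarrow> (nat \<Rightarrow> nat) \<Rightarrow> (nat \<Rightarrow> nat \<Rightarrow> nat) set"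
  where "column_perms c h = PiE {..<c} (\<lambda>d. {p. p permutes {0..<h d}})"

definition column_sign :: "nat \<Rightarrow> (nat \<Rightarrow> nat \<Rightarrow> nat) \<Rightarrow> complex"
  where "column_sign c P = (\<Prod>d<c. signof (P d))"

lemma column_perms_less:
  "P \<in> column_perms c h \<Longrightarrow> s \<in> boxes c h \<Longrightarrow> P (fst s) (snd s) < h (fst s)"
  by (auto simp: column_perms_def boxes_def PiE_iff permutes_in_image)

lemma minors_expand:
  "minors c h g w = (\<Sum>P\<in>column_perms c h. column_sign c P * (\<Prod>s\<in>boxes c h. g $$ (w s, P (fst s) (snd s))))"
proof -
  have "minors c h g w = (\<Prod>d<c. \<Sum>p\<in>{p. p permutes {0..<h d}}. signof p * (\<Prod>i<h d. g $$ (w (d, i), p i)))"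
    unfolding minors_def
  proof (intro prod.cong refl)
    fix d
    have "det (mat (h d) (h d) (\<lambda>(i, j). g $$ (w (d, i), j))) =
      (\<Sum>p\<in>{p. p permutes {0..<h d}}. signof p * (\<Prod>i = 0..<h d. mat (h d) (h d) (\<lambda>(i, j). g $$ (w (d, i), j)) $$ (i, p i)))"
      by (rule det_def') simp
    also have "\<dots> = (\<Sum>p\<in>{p. p permutes {0..<h d}}. signof p * (\<Prod>i<h d. g $$ (w (d, i), p i)))"
      unfolding lessThan_atLeast0 by (intro sum.cong refl arg_cong2[of _ _ _ _ "(*)"] prod.cong) (auto simp: permutes_in_image)
    finally show "det (mat (h d) (h d) (\<lambda>(i, j). g $$ (w (d, i), j))) =
      (\<Sum>p\<in>{p. p permutes {0..<h d}}. signof p * (\<Prod>i<h d. g $$ (w (d, i), p i)))" .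
  qed
  also have "\<dots> = (\<Sum>P\<in>column_perms c h. \<Prod>d<c. signof (P d) * (\<Prod>i<h d. g $$ (w (d, i), P d i)))"
    unfolding column_perms_def by (rule prod_sum_PiE) (auto simp: finite_permutations)
  also have "\<dots> = (\<Sum>P\<in>column_perms c h. column_sign c P * (\<Prod>s\<in>boxes c h. g $$ (w s, P (fst s) (snd s))))"
  proof (intro sum.cong refl)
    fix P
    have "(\<Prod>d<c. \<Prod>i<h d. g $$ (w (d, i), P d i)) = (\<Prod>(d, i)\<in>boxes c h. g $$ (w (d, i), P d i))"
      unfolding boxes_def by (rule prod.Sigma) auto
    also have "\<dots> = (\<Prod>s\<in>boxes c h. g $$ (w s, P (fst s) (snd s)))" by (intro prod.cong) auto
    finally show "(\<Prod>d<c. signof (P d) * (\<Prod>i<h d. g $$ (w (d, i), P d i))) =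
      column_sign c P * (\<Prod>s\<in>boxes c h. g $$ (w s, P (fst s) (snd s)))"
      unfolding prod.distrib column_sign_def by simp
  qed
  finally show ?thesis .
qed

text \<open>The letters of a word range independently, so the sum factors into one entry of the
  matrix product for each box.\<close>

lemma sum_words_mult:
  fixes g k :: "complex mat"
  assumes g: "g \<in> carrier_mat m m" and k: "k \<in> carrier_mat m m"
    and a: "\<And>s. s \<in> boxes c h \<Longrightarrow> a s < m" and q: "\<And>s. s \<in> boxes c h \<Longrightarrow> q s < m"
  shows "(\<Sum>w\<in>words m c h. (\<Prod>s\<in>boxes c h. g $$ (a s, w s)) * (\<Prod>s\<in>boxes c h. k $$ (w s, q s))) =
    (\<Prod>s\<in>boxes c h. (g * k) $$ (a s, q s))"
proof -
  have "(\<Sum>w\<in>words m c h. (\<Prod>s\<in>boxes c h. g $$ (a s, w s)) * (\<Prod>s\<in>boxes c h. k $$ (w s, q s))) =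
    (\<Prod>s\<in>boxes c h. \<Sum>x<m. g $$ (a s, x) * k $$ (x, q s))"
    unfolding prod.distrib[symmetric] by (rule sum_words_prod[of "\<lambda>s x. g $$ (a s, x) * k $$ (x, q s)"])
  also have "\<dots> = (\<Prod>s\<in>boxes c h. (g * k) $$ (a s, q s))"
    using mult_mat_index[OF g k a q] by (intro prod.cong) auto
  finally show ?thesis .
qed

lemma tensor_power_carrier: "tensor_power m c h g \<in> carrier_mat (tensor_dim m c h) (tensor_dim m c h)"
  by (simp add: tensor_power_def)

text \<open>After expanding the minors over column permutations, \<open>sum_words_mult\<close>
  multiplies by \<open>g\<close> in every box and leaves the signs untouched.\<close>

lemma tensor_power_minors:
  assumes g: "g \<in> carrier_mat m m" and k: "k \<in> carrier_mat m m" and h: "\<And>d. d < c \<Longrightarrow> h d \<le> m"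
  shows "tensor_power m c h g *\<^sub>v minor_vec m c h k = minor_vec m c h (g * k)"
proof (intro eq_vecI)
  fix a assume "a < dim_vec (minor_vec m c h (g * k))"
  then have a: "a < tensor_dim m c h" by (simp add: minor_vec_def)
  let ?a = "word_enum m c h a"
  have mv: "minor_vec m c h k \<in> carrier_vec (tensor_dim m c h)" by (simp add: minor_vec_def)
  have "(tensor_power m c h g *\<^sub>v minor_vec m c h k) $ a =
    (\<Sum>b<tensor_dim m c h. (\<Prod>s\<in>boxes c h. g $$ (?a s, word_enum m c h b s)) * minors c h k (word_enum m c h b))"
    unfolding mult_mat_vec_index[OF tensor_power_carrier mv a]
    using a by (intro sum.cong) (auto simp: tensor_power_def minor_vec_def)
  also have "\<dots> = (\<Sum>w\<in>words m c h. (\<Prod>s\<in>boxes c h. g $$ (?a s, w s)) * minors c h k w)"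
    by (rule sum_word_enum)
  also have "\<dots> = (\<Sum>w\<in>words m c h. \<Sum>P\<in>column_perms c h. column_sign c P *
      ((\<Prod>s\<in>boxes c h. g $$ (?a s, w s)) * (\<Prod>s\<in>boxes c h. k $$ (w s, P (fst s) (snd s)))))"
    unfolding minors_expand sum_distrib_left by (intro sum.cong refl) (simp only: mult_ac)
  also have "\<dots> = (\<Sum>P\<in>column_perms c h. \<Sum>w\<in>words m c h. column_sign c P *
      ((\<Prod>s\<in>boxes c h. g $$ (?a s, w s)) * (\<Prod>s\<in>boxes c h. k $$ (w s, P (fst s) (snd s)))))"
    by (rule sum.swap)
  also have "\<dots> = (\<Sum>P\<in>column_perms c h. column_sign c P * (\<Prod>s\<in>boxes c h. (g * k) $$ (?a s, P (fst s) (snd s))))"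
    unfolding sum_distrib_left[symmetric]
  proof (intro sum.cong refl arg_cong2[of _ _ _ _ "(*)"] sum_words_mult[OF g k])
    fix P s assume P: "P \<in> column_perms c h" and s: "s \<in> boxes c h"
    show "?a s < m" by (rule word_enum_less[OF a s])
    have "h (fst s) \<le> m" using s h by (auto simp: boxes_def)
    then show "P (fst s) (snd s) < m" using column_perms_less[OF P s] by simp
  qed
  also have "\<dots> = minors c h (g * k) ?a" by (rule minors_expand[symmetric])
  finally show "(tensor_power m c h g *\<^sub>v minor_vec m c h k) $ a = minor_vec m c h (g * k) $ a"
    using a by (simp add: minor_vec_def)
qed (simp add: minor_vec_def tensor_power_def)

lemma tensor_power_mult:
  assumes g: "g \<in> carrier_mat m m" and k: "k \<in> carrier_mat m m"
  shows "tensor_power m c h (g * k) = tensor_power m c h g * tensor_power m c h k"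
proof (intro eq_matI)
  fix a b assume "a < dim_row (tensor_power m c h g * tensor_power m c h k)"
    "b < dim_col (tensor_power m c h g * tensor_power m c h k)"
  then have ab: "a < tensor_dim m c h" "b < tensor_dim m c h" by (auto simp: tensor_power_def)
  have "(tensor_power m c h g * tensor_power m c h k) $$ (a, b) =
    (\<Sum>x<tensor_dim m c h. (\<Prod>s\<in>boxes c h. g $$ (word_enum m c h a s, word_enum m c h x s)) *
      (\<Prod>s\<in>boxes c h. k $$ (word_enum m c h x s, word_enum m c h b s)))"
    unfolding mult_mat_index[OF tensor_power_carrier tensor_power_carrier ab]
    using ab by (intro sum.cong) (auto simp: tensor_power_def)
  also have "\<dots> = (\<Sum>w\<in>words m c h. (\<Prod>s\<in>boxes c h. g $$ (word_enum m c h a s, w s)) *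
      (\<Prod>s\<in>boxes c h. k $$ (w s, word_enum m c h b s)))"
    by (rule sum_word_enum)
  also have "\<dots> = (\<Prod>s\<in>boxes c h. (g * k) $$ (word_enum m c h a s, word_enum m c h b s))"
    by (rule sum_words_mult[OF g k]) (use ab word_enum_less in auto)
  finally show "tensor_power m c h (g * k) $$ (a, b) = (tensor_power m c h g * tensor_power m c h k) $$ (a, b)"
    using ab by (simp add: tensor_power_def)
qed (auto simp: tensor_power_def)

lemma tensor_power_one: "tensor_power m c h (1\<^sub>m m) = 1\<^sub>m (tensor_dim m c h)"
proof (intro eq_matI)
  fix a b assume "a < dim_row (1\<^sub>m (tensor_dim m c h))" "b < dim_col (1\<^sub>m (tensor_dim m c h))"
  then have ab: "a < tensor_dim m c h" "b < tensor_dim m c h" by auto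
  have e: "tensor_power m c h (1\<^sub>m m) $$ (a, b) =
    (\<Prod>s\<in>boxes c h. if word_enum m c h a s = word_enum m c h b s then 1 else 0)"
    using ab word_enum_less by (auto simp: tensor_power_def intro!: prod.cong)
  show "tensor_power m c h (1\<^sub>m m) $$ (a, b) = 1\<^sub>m (tensor_dim m c h) $$ (a, b)"
  proof (cases "a = b")
    case False
    then have "word_enum m c h a \<noteq> word_enum m c h b"
      using bij_word_enum[of m c h] ab by (auto simp: bij_betw_def inj_on_def)
    moreover have "word_enum m c h a = word_enum m c h b"
      if "\<forall>s\<in>boxes c h. word_enum m c h a s = word_enum m c h b s"
      using word_enum_words[OF ab(1)] word_enum_words[OF ab(2)] that
      unfolding words_def by (auto intro: PiE_ext)
    ultimately obtain s where "s \<in> boxes c h" "word_enum m c h a s \<noteq> word_enum m c h b s" by blast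
    then have "tensor_power m c h (1\<^sub>m m) $$ (a, b) = 0"
      unfolding e by (intro prod_zero) auto
    then show ?thesis using False ab by simp
  qed (use e ab in simp)
qed (auto simp: tensor_power_def)

lemma tensor_power_dagger:
  assumes g: "g \<in> carrier_mat m m"
  shows "tensor_power m c h (dagger g) = dagger (tensor_power m c h g)"
  using g word_enum_less by (intro eq_matI) (auto simp: tensor_power_def intro!: prod.cong)

lemma tensor_power_rational:
  "rational_rep m (tensor_dim m c h) (tensor_power m c h)"
  unfolding rational_rep_def
proof (intro conjI ballI allI impI)
  fix a b assume ab: "a < tensor_dim m c h" "b < tensor_dim m c h"
  have "(\<lambda>g. \<Prod>s\<in>boxes c h. g $$ (word_enum m c h a s, word_enum m c h b s)) \<in> polynomial_functions m"
    using ab word_enum_less by (intro polynomial_functions_prod polynomial_functions.entry) auto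
  then show "\<exists>p\<in>polynomial_functions m. \<forall>g\<in>SL m. tensor_power m c h g $$ (a, b) = p g"
    using ab by (intro bexI[of _ "\<lambda>g. \<Prod>s\<in>boxes c h. g $$ (word_enum m c h a s, word_enum m c h b s)"])
      (auto simp: tensor_power_def)
qed (auto simp: tensor_power_one tensor_power_carrier tensor_power_mult SL_carrier)

text \<open>By triangularity the first \<open>h d\<close> columns of \<open>g * b\<close> are
  combinations of the first \<open>h d\<close> columns of \<open>g\<close>, with coefficients from
  the leading block of \<open>b\<close>. So each minor is multiplied by a leading minor of
  \<open>b\<close>.\<close>

lemma minors_mult_upper:
  assumes g: "g \<in> carrier_mat m m" and b: "b \<in> carrier_mat m m"
    and up: "\<And>i j. i < m \<Longrightarrow> j < i \<Longrightarrow> b $$ (i, j) = 0"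
    and h: "\<And>d. d < c \<Longrightarrow> h d \<le> m" and w: "\<And>s. s \<in> boxes c h \<Longrightarrow> w s < m"
  shows "minors c h (g * b) w = (\<Prod>d<c. \<Prod>j<h d. b $$ (j, j)) * minors c h g w"
  unfolding minors_def prod.distrib[symmetric]
proof (intro prod.cong refl)
  fix d assume "d \<in> {..<c}"
  then have d: "d < c" by simp
  define G where "G = mat (h d) (h d) (\<lambda>(i, j). g $$ (w (d, i), j))"
  define B where "B = mat (h d) (h d) (\<lambda>(i, j). b $$ (i, j))"
  have GB: "G \<in> carrier_mat (h d) (h d)" "B \<in> carrier_mat (h d) (h d)" by (auto simp: G_def B_def)
  have "mat (h d) (h d) (\<lambda>(i, j). (g * b) $$ (w (d, i), j)) = G * B"
  proof (intro eq_matI)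
    fix i j assume "i < dim_row (G * B)" "j < dim_col (G * B)"
    then have ij: "i < h d" "j < h d" using GB by auto
    have wm: "w (d, i) < m" using w d ij by (auto simp: boxes_def)
    have jm: "j < m" using ij h[OF d] by simp
    have "(g * b) $$ (w (d, i), j) = (\<Sum>l<m. g $$ (w (d, i), l) * b $$ (l, j))"
      by (rule mult_mat_index[OF g b wm jm])
    also have "\<dots> = (\<Sum>l<h d. g $$ (w (d, i), l) * b $$ (l, j))"
      using up ij h[OF d] by (intro sum.mono_neutral_right) auto
    also have "\<dots> = (G * B) $$ (i, j)"
      unfolding mult_mat_index[OF GB ij] using ij by (intro sum.cong) (auto simp: G_def B_def)
    finally show "mat (h d) (h d) (\<lambda>(i, j). (g * b) $$ (w (d, i), j)) $$ (i, j) = (G * B) $$ (i, j)"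
      using ij by simp
  qed (use GB in auto)
  moreover have "det (G * B) = det G * det B" by (rule det_mult[OF GB])
  moreover have "det B = (\<Prod>j<h d. B $$ (j, j))"
    using GB(2) by (rule det_upper) (use up h[OF d] in \<open>auto simp: B_def\<close>)
  moreover have "(\<Prod>j<h d. B $$ (j, j)) = (\<Prod>j<h d. b $$ (j, j))"
    by (intro prod.cong) (auto simp: B_def)
  ultimately show "det (mat (h d) (h d) (\<lambda>(i, j). (g * b) $$ (w (d, i), j))) =
    (\<Prod>j<h d. b $$ (j, j)) * det (mat (h d) (h d) (\<lambda>(i, j). g $$ (w (d, i), j)))"
    by (simp add: G_def)
qed

lemma minors_full_mult:
  assumes g: "g \<in> carrier_mat m m" and b: "b \<in> carrier_mat m m" and db: "det b = 1"
    and w: "\<And>s. s \<in> boxes c (\<lambda>_. m) \<Longrightarrow> w s < m"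
  shows "minors c (\<lambda>_. m) (g * b) w = minors c (\<lambda>_. m) g w"
  unfolding minors_def
proof (intro prod.cong refl)
  fix d assume "d \<in> {..<c}"
  then have d: "d < c" by simp
  define G where "G = mat m m (\<lambda>(i, j). g $$ (w (d, i), j))"
  have G: "G \<in> carrier_mat m m" by (simp add: G_def)
  have "mat m m (\<lambda>(i, j). (g * b) $$ (w (d, i), j)) = G * b"
  proof (intro eq_matI)
    fix i j assume "i < dim_row (G * b)" "j < dim_col (G * b)"
    then have ij: "i < m" "j < m" using G b by auto
    have wm: "w (d, i) < m" using w d ij by (auto simp: boxes_def)
    show "mat m m (\<lambda>(i, j). (g * b) $$ (w (d, i), j)) $$ (i, j) = (G * b) $$ (i, j)"
      using ij mult_mat_index[OF g b wm ij(2)] unfolding mult_mat_index[OF G b ij]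
      by (auto simp: G_def simp del: index_mult_mat(1) intro!: sum.cong)
  qed (use G b in auto)
  then show "det (mat m m (\<lambda>(i, j). (g * b) $$ (w (d, i), j))) = det (mat m m (\<lambda>(i, j). g $$ (w (d, i), j)))"
    using det_mult[OF G b] db by (simp add: G_def)
qed

text \<open>The row lengths of the diagram with column heights \<open>h\<close>, that is, the
  conjugate partition, for rows \<open>i \<ge> 1\<close>.\<close>

definition column_weight :: "nat \<Rightarrow> (nat \<Rightarrow> nat) \<Rightarrow> nat \<Rightarrow> nat"
  where "column_weight c h i = card {d \<in> {..<c}. i \<le> h d}"

lemma hw_char_column_weight:
  assumes "\<And>d. d < c \<Longrightarrow> h d < m"
  shows "(\<Prod>d<c. \<Prod>j<h d. b $$ (j, j)) = hw_char m (column_weight c h) b"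
proof -
  have "(\<Prod>d<c. \<Prod>j<h d. b $$ (j, j)) = (\<Prod>d<c. \<Prod>j<m - 1. if j < h d then b $$ (j, j) else 1)"
  proof (rule prod.cong[OF refl])
    fix d assume "d \<in> {..<c}"
    then have "{j \<in> {..<m - 1}. j < h d} = {..<h d}" using assms[of d] by auto
    then show "(\<Prod>j<h d. b $$ (j, j)) = (\<Prod>j<m - 1. if j < h d then b $$ (j, j) else 1)"
      using prod.inter_filter[of "{..<m - 1}" "\<lambda>j. b $$ (j, j)" "\<lambda>j. j < h d"] by simp
  qed
  also have "\<dots> = (\<Prod>j<m - 1. \<Prod>d<c. if j < h d then b $$ (j, j) else 1)" by (rule prod.swap)
  also have "\<dots> = (\<Prod>j<m - 1. b $$ (j, j) ^ column_weight c h (Suc j))"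
  proof (rule prod.cong[OF refl])
    fix j
    have "(\<Prod>d<c. if j < h d then b $$ (j, j) else 1) = (\<Prod>d\<in>{d \<in> {..<c}. j < h d}. b $$ (j, j))"
      by (rule prod.inter_filter[symmetric]) simp
    then show "(\<Prod>d<c. if j < h d then b $$ (j, j) else 1) = b $$ (j, j) ^ column_weight c h (Suc j)"
      by (simp add: column_weight_def Suc_le_eq)
  qed
  also have "\<dots> = hw_char m (column_weight c h) b"
    unfolding hw_char_def by (simp add: prod.atLeast1_atMost_eq)
  finally show ?thesis .
qed

text \<open>The highest weight vector is \<open>minor_vec\<close> at the unit matrix, a tensor
  product of wedges of initial basis vectors, and its translate by \<open>g\<close> is
  \<open>minor_vec m c h g\<close>.\<close>

lemma exists_weyl_module:
  assumes m: "2 \<le> m" and h: "\<And>d. d < c \<Longrightarrow> h d < m"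
  obtains d \<rho> J where "is_V m (column_weight c h) d \<rho>" "J \<in> carrier_mat (tensor_dim m c h) d"
    "\<forall>g \<in> SL m. \<rho> g \<in> carrier_mat d d \<and> \<rho> g * dagger J = dagger J * tensor_power m c h g"
    "\<forall>g \<in> SL m. J *\<^sub>v (dagger J *\<^sub>v minor_vec m c h g) = minor_vec m c h g"
proof -
  have hm: "h d \<le> m" if "d < c" for d using h[OF that] by simp
  interpret unitary_highest_weight m "tensor_dim m c h" "tensor_power m c h" "column_weight c h" "minor_vec m c h (1\<^sub>m m)"
  proof unfold_locales
    show "tensor_power m c h (dagger g) = dagger (tensor_power m c h g)" if "g \<in> SL m" for g
      by (rule tensor_power_dagger[OF SL_carrier[OF that]])
    show "minor_vec m c h (1\<^sub>m m) \<noteq> 0\<^sub>v (tensor_dim m c h)"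
    proof
      assume z: "minor_vec m c h (1\<^sub>m m) = 0\<^sub>v (tensor_dim m c h)"
      \<comment> \<open>The word writing its row index into each box. The minors at it are
        determinants of unit matrices, so this coordinate of the vector is 1.\<close>
      define w where "w = restrict snd (boxes c h)"
      have "w \<in> words m c h" using h by (fastforce simp: w_def words_def boxes_def)
      then obtain a where a: "a < tensor_dim m c h" "word_enum m c h a = w"
        using bij_word_enum[of m c h] unfolding bij_betw_def by (metis imageE lessThan_iff)
      have "minors c h (1\<^sub>m m) w = 1"
        unfolding minors_def
      proof (intro prod.neutral ballI)
        fix d assume "d \<in> {..<c}"
        then have "mat (h d) (h d) (\<lambda>(i, j). 1\<^sub>m m $$ (w (d, i), j)) = (1\<^sub>m (h d) :: complex mat)"
          using h[of d] by (intro eq_matI) (auto simp: w_def boxes_def)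
        then show "det (mat (h d) (h d) (\<lambda>(i, j). 1\<^sub>m m $$ (w (d, i), j))) = (1 :: complex)" by simp
      qed
      moreover have "minor_vec m c h (1\<^sub>m m) $ a = 0" using z a by simp
      ultimately show False using a by (simp add: minor_vec_def)
    qed
    show "tensor_power m c h b *\<^sub>v minor_vec m c h (1\<^sub>m m) = hw_char m (column_weight c h) b \<cdot>\<^sub>v minor_vec m c h (1\<^sub>m m)"
      if b: "b \<in> SL_upper m" for b
    proof -
      have bc: "b \<in> carrier_mat m m" by (rule SL_carrier[OF SL_upperD(1)[OF b]])
      have "tensor_power m c h b *\<^sub>v minor_vec m c h (1\<^sub>m m) = minor_vec m c h (1\<^sub>m m * b)"
        using tensor_power_minors[OF bc one_carrier_mat hm] bc by simp
      also have "\<dots> = hw_char m (column_weight c h) b \<cdot>\<^sub>v minor_vec m c h (1\<^sub>m m)"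
      proof (intro eq_vecI)
        fix a assume "a < dim_vec (hw_char m (column_weight c h) b \<cdot>\<^sub>v minor_vec m c h (1\<^sub>m m))"
        then have a: "a < tensor_dim m c h" by (simp add: minor_vec_def)
        show "minor_vec m c h (1\<^sub>m m * b) $ a = (hw_char m (column_weight c h) b \<cdot>\<^sub>v minor_vec m c h (1\<^sub>m m)) $ a"
          using minors_mult_upper[OF one_carrier_mat bc SL_upperD(2)[OF b] hm word_enum_less[OF a]]
            hw_char_column_weight[of c h m b] h a by (simp add: minor_vec_def del: left_mult_one_mat)
      qed (simp add: minor_vec_def)
      finally show ?thesis .
    qed
  qed (use tensor_power_rational m in \<open>auto simp: minor_vec_def\<close>)
  obtain d \<rho> J where *: "is_V m (column_weight c h) d \<rho>" "J \<in> carrier_mat (tensor_dim m c h) d"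
    "\<forall>g \<in> SL m. \<rho> g \<in> carrier_mat d d \<and> \<rho> g * dagger J = dagger J * tensor_power m c h g"
    "\<forall>g \<in> SL m. J *\<^sub>v (dagger J *\<^sub>v (tensor_power m c h g *\<^sub>v minor_vec m c h (1\<^sub>m m))) = tensor_power m c h g *\<^sub>v minor_vec m c h (1\<^sub>m m)"
    by (rule exists_irreducible)
  have "tensor_power m c h g *\<^sub>v minor_vec m c h (1\<^sub>m m) = minor_vec m c h g" if "g \<in> SL m" for g
    using tensor_power_minors[OF SL_carrier[OF that] one_carrier_mat hm] SL_carrier[OF that] by simp
  then show thesis by (intro that[OF *(1-3)]) (use *(4) in simp)
qed

section \<open>Invariants from determinants\<close>

lemma prod_lessThan_add: "(\<Prod>k<a + b. G k) = (\<Prod>k<a. G k) * (\<Prod>k<b. G (a + k :: nat))"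
  by (induction b) (simp_all add: mult.assoc)

lemma prod_lessThan_three:
  fixes G :: "nat \<Rightarrow> 'a :: comm_monoid_mult"
  assumes "a + b + c = m"
  shows "(\<Prod>k<m. G k) = (\<Prod>k<a. G k) * (\<Prod>k<b. G (a + k)) * (\<Prod>k<c. G (m - 1 - k))"
proof -
  have "(\<Prod>k<c. G (m - 1 - k)) = (\<Prod>k<c. G (a + b + (c - Suc k)))"
    using assms by (intro prod.cong refl arg_cong[of _ _ G]) auto
  also have "\<dots> = (\<Prod>k<c. G (a + b + k))" by (rule prod.nat_diff_reindex)
  finally show ?thesis unfolding assms[symmetric] prod_lessThan_add by simp
qed

text \<open>The last block of each column is read from the bottom.\<close>

definition merge_words ::
    "nat \<Rightarrow> (nat \<Rightarrow> nat) \<Rightarrow> (nat \<Rightarrow> nat) \<Rightarrow> (nat \<times> nat \<Rightarrow> nat) \<Rightarrow> (nat \<times> nat \<Rightarrow> nat) \<Rightarrow> (nat \<times> nat \<Rightarrow> nat)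
      \<Rightarrow> nat \<times> nat \<Rightarrow> nat"
  where "merge_words m h1 h2 w1 w2 w3 = (\<lambda>(d, k). if k < h1 d then w1 (d, k)
    else if k < h1 d + h2 d then w2 (d, k - h1 d) else w3 (d, m - 1 - k))"

text \<open>Each column of the rectangle is cut into a top block, at most one middle box and a
  bottom block. The bound on \<open>h2\<close> says that the middle boxes form a horizontal
  strip.\<close>

locale three_columns =
  fixes m c :: nat and h1 h2 h3 :: "nat \<Rightarrow> nat"
  assumes m2: "2 \<le> m" and total: "d < c \<Longrightarrow> h1 d + h2 d + h3 d = m"
    and h1: "d < c \<Longrightarrow> h1 d < m" and h2: "d < c \<Longrightarrow> h2 d \<le> 1" and h3: "d < c \<Longrightarrow> h3 d < m"
begin

abbreviation "merge \<equiv> merge_words m h1 h2"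

lemma column_merge:
  assumes "d < c"
  shows "(\<Prod>k<m. F k (merge w1 w2 w3 (d, k))) = (\<Prod>k<h1 d. F k (w1 (d, k))) *
    (\<Prod>k<h2 d. F (h1 d + k) (w2 (d, k))) * (\<Prod>k<h3 d. F (m - 1 - k) (w3 (d, k)))"
proof -
  have "(\<Prod>k<m. F k (merge w1 w2 w3 (d, k))) = (\<Prod>k<h1 d. F k (merge w1 w2 w3 (d, k))) *
    (\<Prod>k<h2 d. F (h1 d + k) (merge w1 w2 w3 (d, h1 d + k))) *
    (\<Prod>k<h3 d. F (m - 1 - k) (merge w1 w2 w3 (d, m - 1 - k)))"
    by (rule prod_lessThan_three[OF total[OF assms]])
  moreover have "(\<Prod>k<h1 d. F k (merge w1 w2 w3 (d, k))) = (\<Prod>k<h1 d. F k (w1 (d, k)))"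
    by (intro prod.cong) (auto simp: merge_words_def)
  moreover have "(\<Prod>k<h2 d. F (h1 d + k) (merge w1 w2 w3 (d, h1 d + k))) = (\<Prod>k<h2 d. F (h1 d + k) (w2 (d, k)))"
    by (intro prod.cong) (auto simp: merge_words_def)
  moreover have "(\<Prod>k<h3 d. F (m - 1 - k) (merge w1 w2 w3 (d, m - 1 - k))) = (\<Prod>k<h3 d. F (m - 1 - k) (w3 (d, k)))"
  proof (rule prod.cong[OF refl])
    fix k assume "k \<in> {..<h3 d}"
    then have "h1 d + h2 d \<le> m - 1 - k" "k < m" using total[OF assms] by auto
    then have "merge w1 w2 w3 (d, m - 1 - k) = w3 (d, k)" by (simp add: merge_words_def)
    then show "F (m - 1 - k) (merge w1 w2 w3 (d, m - 1 - k)) = F (m - 1 - k) (w3 (d, k))" by simp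
  qed
  ultimately show ?thesis by simp
qed

lemma prod_merge:
  fixes F :: "nat \<times> nat \<Rightarrow> nat \<Rightarrow> complex"
  shows "(\<Prod>s\<in>boxes c (\<lambda>_. m). F s (merge w1 w2 w3 s)) = (\<Prod>s\<in>boxes c h1. F s (w1 s)) *
    (\<Prod>s\<in>boxes c h2. F (fst s, h1 (fst s) + snd s) (w2 s)) * (\<Prod>s\<in>boxes c h3. F (fst s, m - 1 - snd s) (w3 s))"
proof -
  have S: "(\<Prod>s\<in>boxes c h. G s) = (\<Prod>d<c. \<Prod>k<h d. G (d, k))" for h and G :: "nat \<times> nat \<Rightarrow> complex"
    unfolding boxes_def by (subst prod.Sigma) (auto intro!: prod.cong)
  have "(\<Prod>d<c. \<Prod>k<m. F (d, k) (merge w1 w2 w3 (d, k))) = (\<Prod>d<c. (\<Prod>k<h1 d. F (d, k) (w1 (d, k))) *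
    (\<Prod>k<h2 d. F (d, h1 d + k) (w2 (d, k))) * (\<Prod>k<h3 d. F (d, m - 1 - k) (w3 (d, k))))"
    by (rule prod.cong[OF refl]) (use column_merge[of _ "\<lambda>k x. F (_, k) x"] in auto)
  then show ?thesis unfolding S prod.distrib by simp
qed

lemma merge_less:
  assumes "\<And>s. s \<in> boxes c h1 \<Longrightarrow> w1 s < m" "\<And>s. s \<in> boxes c h2 \<Longrightarrow> w2 s < m" "\<And>s. s \<in> boxes c h3 \<Longrightarrow> w3 s < m"
    and s: "s \<in> boxes c (\<lambda>_. m)"
  shows "merge w1 w2 w3 s < m"
proof -
  obtain d k where dk: "s = (d, k)" "d < c" "k < m" using s by (auto simp: boxes_def)
  have "m - 1 - k < h3 d" if "\<not> k < h1 d + h2 d" using total[OF dk(2)] dk(3) that by linarith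
  then show ?thesis using dk assms(1-3) by (auto simp: merge_words_def boxes_def)
qed

text \<open>The product over the columns of the determinant form of C^m, evaluated at basis vectors:
  a sign for each column that is a permutation, and 0 as soon as one is not.\<close>

definition det_form :: "(nat \<times> nat \<Rightarrow> nat) \<Rightarrow> complex"
  where "det_form w = minors c (\<lambda>_. m) (1\<^sub>m m) w"

text \<open>For each choice of column permutations the sum over words factors over the three blocks,
  and each factor is a product of matrices. Collecting them gives the full-height minors of
  \<open>g\<close>, which are those of the unit matrix because \<open>det g = 1\<close>.\<close>

lemma det_form_invariant:
  assumes g: "g \<in> SL m"
    and a: "a1 \<in> words m c h1" "a2 \<in> words m c h2" "a3 \<in> words m c h3"
  shows "(\<Sum>w1\<in>words m c h1. \<Sum>w2\<in>words m c h2. \<Sum>w3\<in>words m c h3.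
      (\<Prod>s\<in>boxes c h1. g $$ (a1 s, w1 s)) * (\<Prod>s\<in>boxes c h2. g $$ (a2 s, w2 s)) * (\<Prod>s\<in>boxes c h3. g $$ (a3 s, w3 s)) *
      det_form (merge w1 w2 w3)) = det_form (merge a1 a2 a3)"
proof -
  have gc: "g \<in> carrier_mat m m" and dg: "det g = 1" using g by (auto simp: SL_def)
  let ?I = "1\<^sub>m m :: complex mat"
  \<comment> \<open>\<open>Q1\<close>, \<open>Q2\<close> and \<open>Q3\<close> give the column index
    that \<open>P\<close> assigns to a box of each block; the third block is counted from the
    bottom, as in \<open>merge_words\<close>.\<close>
  define Q1 where "Q1 P s = P (fst s) (snd s)" for P :: "nat \<Rightarrow> nat \<Rightarrow> nat" and s :: "nat \<times> nat"
  define Q2 where "Q2 P s = P (fst s) (h1 (fst s) + snd s)" for P :: "nat \<Rightarrow> nat \<Rightarrow> nat" and s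
  define Q3 where "Q3 P s = P (fst s) (m - 1 - snd s)" for P :: "nat \<Rightarrow> nat \<Rightarrow> nat" and s :: "nat \<times> nat"
  have expand: "minors c (\<lambda>_. m) k (merge w1 w2 w3) = (\<Sum>P\<in>column_perms c (\<lambda>_. m). column_sign c P *
      ((\<Prod>s\<in>boxes c h1. k $$ (w1 s, Q1 P s)) * (\<Prod>s\<in>boxes c h2. k $$ (w2 s, Q2 P s)) * (\<Prod>s\<in>boxes c h3. k $$ (w3 s, Q3 P s))))"
    for k w1 w2 w3
    unfolding minors_expand
  proof (rule sum.cong[OF refl])
    fix P
    show "column_sign c P * (\<Prod>s\<in>boxes c (\<lambda>_. m). k $$ (merge w1 w2 w3 s, P (fst s) (snd s))) = column_sign c P *
      ((\<Prod>s\<in>boxes c h1. k $$ (w1 s, Q1 P s)) * (\<Prod>s\<in>boxes c h2. k $$ (w2 s, Q2 P s)) * (\<Prod>s\<in>boxes c h3. k $$ (w3 s, Q3 P s)))"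
      using prod_merge[of "\<lambda>s x. k $$ (x, P (fst s) (snd s))" w1 w2 w3] by (simp add: Q1_def Q2_def Q3_def)
  qed
  define E1 where "E1 P w = (\<Prod>s\<in>boxes c h1. g $$ (a1 s, w s)) * (\<Prod>s\<in>boxes c h1. ?I $$ (w s, Q1 P s))" for P w
  define E2 where "E2 P w = (\<Prod>s\<in>boxes c h2. g $$ (a2 s, w s)) * (\<Prod>s\<in>boxes c h2. ?I $$ (w s, Q2 P s))" for P w
  define E3 where "E3 P w = (\<Prod>s\<in>boxes c h3. g $$ (a3 s, w s)) * (\<Prod>s\<in>boxes c h3. ?I $$ (w s, Q3 P s))" for P w
  have Q: "Q1 P s < m" if "P \<in> column_perms c (\<lambda>_. m)" "s \<in> boxes c h1" for P s
    using that h1[of "fst s"] column_perms_less[OF that(1), of s] by (auto simp: Q1_def boxes_def)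
  have Q': "Q2 P s < m" if "P \<in> column_perms c (\<lambda>_. m)" "s \<in> boxes c h2" for P s
    using that total[of "fst s"] column_perms_less[OF that(1), of "(fst s, h1 (fst s) + snd s)"]
    by (auto simp: Q2_def boxes_def)
  have Q'': "Q3 P s < m" if "P \<in> column_perms c (\<lambda>_. m)" "s \<in> boxes c h3" for P s
    using that m2 column_perms_less[OF that(1), of "(fst s, m - 1 - snd s)"]
    by (auto simp: Q3_def boxes_def)
  have "(\<Sum>w1\<in>words m c h1. \<Sum>w2\<in>words m c h2. \<Sum>w3\<in>words m c h3.
      (\<Prod>s\<in>boxes c h1. g $$ (a1 s, w1 s)) * (\<Prod>s\<in>boxes c h2. g $$ (a2 s, w2 s)) * (\<Prod>s\<in>boxes c h3. g $$ (a3 s, w3 s)) *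
      det_form (merge w1 w2 w3)) =
    (\<Sum>w1\<in>words m c h1. \<Sum>w2\<in>words m c h2. \<Sum>w3\<in>words m c h3. \<Sum>P\<in>column_perms c (\<lambda>_. m).
      E1 P w1 * E2 P w2 * E3 P w3 * column_sign c P)"
    unfolding det_form_def expand sum_distrib_left E1_def E2_def E3_def
    by (intro sum.cong refl) (simp only: mult_ac)
  also have "\<dots> = (\<Sum>w1\<in>words m c h1. \<Sum>w2\<in>words m c h2. \<Sum>P\<in>column_perms c (\<lambda>_. m). \<Sum>w3\<in>words m c h3.
      E1 P w1 * E2 P w2 * E3 P w3 * column_sign c P)" by (intro sum.cong refl sum.swap)
  also have "\<dots> = (\<Sum>w1\<in>words m c h1. \<Sum>P\<in>column_perms c (\<lambda>_. m). \<Sum>w2\<in>words m c h2. \<Sum>w3\<in>words m c h3.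
      E1 P w1 * E2 P w2 * E3 P w3 * column_sign c P)" by (intro sum.cong refl sum.swap)
  also have "\<dots> = (\<Sum>P\<in>column_perms c (\<lambda>_. m). \<Sum>w1\<in>words m c h1. \<Sum>w2\<in>words m c h2. \<Sum>w3\<in>words m c h3.
      E1 P w1 * E2 P w2 * E3 P w3 * column_sign c P)" by (rule sum.swap)
  also have "\<dots> = (\<Sum>P\<in>column_perms c (\<lambda>_. m). (\<Sum>w1\<in>words m c h1. E1 P w1) * (\<Sum>w2\<in>words m c h2. E2 P w2) *
      (\<Sum>w3\<in>words m c h3. E3 P w3) * column_sign c P)"
    by (intro sum.cong refl sum_product3[symmetric])
  also have "\<dots> = (\<Sum>P\<in>column_perms c (\<lambda>_. m). column_sign c P *
      ((\<Prod>s\<in>boxes c h1. g $$ (a1 s, Q1 P s)) * (\<Prod>s\<in>boxes c h2. g $$ (a2 s, Q2 P s)) * (\<Prod>s\<in>boxes c h3. g $$ (a3 s, Q3 P s))))"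
  proof (rule sum.cong[OF refl])
    fix P assume P: "P \<in> column_perms c (\<lambda>_. m)"
    have g1: "g * ?I = g" using gc by simp
    have "(\<Sum>w1\<in>words m c h1. E1 P w1) = (\<Prod>s\<in>boxes c h1. g $$ (a1 s, Q1 P s))"
      unfolding E1_def using sum_words_mult[OF gc one_carrier_mat words_less[OF a(1)] Q[OF P]] g1 by simp
    moreover have "(\<Sum>w2\<in>words m c h2. E2 P w2) = (\<Prod>s\<in>boxes c h2. g $$ (a2 s, Q2 P s))"
      unfolding E2_def using sum_words_mult[OF gc one_carrier_mat words_less[OF a(2)] Q'[OF P]] g1 by simp
    moreover have "(\<Sum>w3\<in>words m c h3. E3 P w3) = (\<Prod>s\<in>boxes c h3. g $$ (a3 s, Q3 P s))"
      unfolding E3_def using sum_words_mult[OF gc one_carrier_mat words_less[OF a(3)] Q''[OF P]] g1 by simp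
    ultimately show "(\<Sum>w1\<in>words m c h1. E1 P w1) * (\<Sum>w2\<in>words m c h2. E2 P w2) *
      (\<Sum>w3\<in>words m c h3. E3 P w3) * column_sign c P = column_sign c P *
      ((\<Prod>s\<in>boxes c h1. g $$ (a1 s, Q1 P s)) * (\<Prod>s\<in>boxes c h2. g $$ (a2 s, Q2 P s)) * (\<Prod>s\<in>boxes c h3. g $$ (a3 s, Q3 P s)))"
      by (simp only: mult_ac)
  qed
  also have "\<dots> = minors c (\<lambda>_. m) g (merge a1 a2 a3)" by (rule expand[symmetric])
  also have "\<dots> = minors c (\<lambda>_. m) (?I * g) (merge a1 a2 a3)" using gc by simp
  also have "\<dots> = det_form (merge a1 a2 a3)"
    unfolding det_form_def
    by (intro minors_full_mult[OF one_carrier_mat gc dg] merge_less[OF words_less[OF a(1)] words_less[OF a(2)] words_less[OF a(3)]])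
  finally show ?thesis .
qed

end

section \<open>Signs of products of corner minors\<close>

lemma det_zero_row:
  fixes A :: "complex mat"
  assumes A: "A \<in> carrier_mat n n" and i: "i < n" and z: "\<And>j. j < n \<Longrightarrow> A $$ (i, j) = 0"
  shows "det A = 0"
proof -
  have "(\<Prod>k = 0..<n. A $$ (k, p k)) = 0" if "p permutes {0..<n}" for p
  proof (rule prod_zero)
    have "p i < n" using permutes_in_image[OF that, of i] i by simp
    then show "\<exists>k\<in>{0..<n}. A $$ (k, p k) = 0" using z i by (intro bexI[of _ i]) auto
  qed simp
  then show ?thesis unfolding det_def'[OF A] by (intro sum.neutral) auto
qed

text \<open>Reversing rows and columns is conjugation by a permutation matrix whose determinant
  squares to 1.\<close>

lemma det_reverse:
  fixes B :: "nat \<Rightarrow> nat \<Rightarrow> complex"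
  shows "det (mat n n (\<lambda>(i, j). B (n - 1 - i) (n - 1 - j))) = det (mat n n (\<lambda>(i, j). B i j))"
proof -
  let ?J = "antidiag n (\<lambda>_. 1)" and ?M = "mat n n (\<lambda>(i, j). B i j)"
  have M: "?M \<in> carrier_mat n n" by simp
  have "diagm n (\<lambda>i. 1) = 1\<^sub>m n" by (intro eq_matI) (auto simp: diagm_index)
  then have "?J * ?J = 1\<^sub>m n" unfolding antidiag_mult by simp
  then have JJ: "det ?J * det ?J = 1" using det_mult[of ?J n ?J] by simp
  have "mat n n (\<lambda>(i, j). B (n - 1 - i) (n - 1 - j)) = ?J * ?M * ?J"
  proof (intro eq_matI)
    fix i j assume "i < dim_row (?J * ?M * ?J)" "j < dim_col (?J * ?M * ?J)"
    then have ij: "i < n" "j < n" by (auto simp: antidiag_def)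
    have "(?J * ?M * ?J) $$ (i, j) = (?J * ?M) $$ (i, n - 1 - j) * 1"
      by (rule mult_antidiag_index[OF mult_carrier_mat[OF antidiag_carrier M] ij])
    also have "(?J * ?M) $$ (i, n - 1 - j) = 1 * ?M $$ (n - 1 - i, n - 1 - j)"
      using ij by (intro antidiag_mult_index[OF M]) auto
    finally show "mat n n (\<lambda>(i, j). B (n - 1 - i) (n - 1 - j)) $$ (i, j) = (?J * ?M * ?J) $$ (i, j)"
      using ij by simp
  qed (auto simp: antidiag_def)
  then have "det (mat n n (\<lambda>(i, j). B (n - 1 - i) (n - 1 - j))) = det ?J * det ?M * det ?J"
    using det_mult[OF mult_carrier_mat[OF antidiag_carrier M] antidiag_carrier] det_mult[OF antidiag_carrier M] by simp
  also have "\<dots> = det ?J * det ?J * det ?M" by (simp only: mult_ac)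
  finally show ?thesis unfolding JJ by simp
qed

lemma det_of_real: "\<exists>r. det (mat n n (\<lambda>(i, j). complex_of_real (B i j))) = complex_of_real r"
proof -
  interpret comm_ring_hom complex_of_real by unfold_locales auto
  have "mat n n (\<lambda>(i, j). complex_of_real (B i j)) = map_mat complex_of_real (mat n n (\<lambda>(i, j). B i j))"
    by (intro eq_matI) auto
  then have "det (mat n n (\<lambda>(i, j). complex_of_real (B i j))) = complex_of_real (det (mat n n (\<lambda>(i, j). B i j)))"
    by simp
  then show ?thesis by blast
qed

text \<open>If both corner minors are nonzero then the 0-1 matrix of \<open>u\<close> is block triangular.\<close>

lemma corner_minors_product:
  fixes u :: "nat \<Rightarrow> nat"
  assumes m: "a + b + c = m" and b: "b \<le> 1"
  defines "A \<equiv> \<lambda>k l. if u k = l then 1 else 0 :: complex"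
  defines "N \<equiv> det (mat m m (\<lambda>(i, j). A i j)) * det (mat a a (\<lambda>(i, j). A i j)) *
    det (mat c c (\<lambda>(i, j). A (m - 1 - i) (m - 1 - j)))"
  shows "\<exists>q \<ge> 0. N = complex_of_real q" and "(\<And>k. k < m \<Longrightarrow> u k = k) \<Longrightarrow> N = 1"
proof -
  define A1 where "A1 = mat a a (\<lambda>(i, j). A i j)"
  define A2 where "A2 = mat b b (\<lambda>(i, j). A (a + i) (a + j))"
  define A3 where "A3 = mat c c (\<lambda>(i, j). A (a + b + i) (a + b + j))"
  have "mat c c (\<lambda>(i, j). A (m - 1 - i) (m - 1 - j)) = mat c c (\<lambda>(i, j). A (a + b + (c - 1 - i)) (a + b + (c - 1 - j)))"
    using m by (intro eq_matI) (auto intro!: arg_cong2[of _ _ _ _ A])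
  then have rev: "det (mat c c (\<lambda>(i, j). A (m - 1 - i) (m - 1 - j))) = det A3"
    unfolding A3_def using det_reverse[of c "\<lambda>i j. A (a + b + i) (a + b + j)"] by simp
  have N: "N = det (mat m m (\<lambda>(i, j). A i j)) * det A1 * det A3" unfolding N_def rev A1_def ..
  have real: "\<exists>r. det (mat n n (\<lambda>(i, j). A (s + i) (s + j))) = complex_of_real r" for n s
  proof -
    have "(\<lambda>(i, j). A (s + i) (s + j)) = (\<lambda>(i, j). complex_of_real (if u (s + i) = s + j then 1 else 0))"
      by (auto simp: A_def)
    then show ?thesis using det_of_real[of n "\<lambda>i j. if u (s + i) = s + j then 1 else 0"] by simp
  qed
  obtain r1 where r1: "det A1 = complex_of_real r1" using real[of a 0] by (auto simp: A1_def)
  obtain r3 where r3: "det A3 = complex_of_real r3" using real[of c "a + b"] by (auto simp: A3_def)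
  have "\<exists>r2 \<ge> 0. det A2 = complex_of_real r2"
  proof (cases "b = 0")
    case True
    then have "det A2 = 1" by (simp add: A2_def)
    then show ?thesis by (intro exI[of _ 1]) simp
  next
    case False
    then have "b = 1" using b by simp
    then have "det A2 = A2 $$ (0, 0)" by (intro det_single) (simp add: A2_def)
    also have "\<dots> = complex_of_real (if u a = a then 1 else 0)" using \<open>b = 1\<close> by (simp add: A2_def A_def)
    finally show ?thesis by (intro exI[of _ "if u a = a then 1 else 0"]) simp
  qed
  then obtain r2 where r2: "r2 \<ge> 0" "det A2 = complex_of_real r2" by auto
  show "\<exists>q \<ge> 0. N = complex_of_real q"
  proof (cases "det A1 = 0 \<or> det A3 = 0")
    case True
    then show ?thesis unfolding N by (intro exI[of _ 0]) auto
  next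
    case False
    \<comment> \<open>Otherwise a row of \<open>A1\<close> would be zero.\<close>
    have ua: "u i < a" if i: "i < a" for i
    proof (rule ccontr)
      assume "\<not> u i < a"
      then have "det A1 = 0" using i by (intro det_zero_row[of _ a i]) (auto simp: A1_def A_def)
      then show False using False by simp
    qed
    have uc: "u (a + b + i) \<ge> a + b" if i: "i < c" for i
    proof (rule ccontr)
      assume "\<not> u (a + b + i) \<ge> a + b"
      then have "det A3 = 0" using i by (intro det_zero_row[of _ c i]) (auto simp: A3_def A_def)
      then show False using False by simp
    qed
    define C where "C = mat (b + c) a (\<lambda>(i, j). A (a + i) j)"
    define A4 where "A4 = mat (b + c) (b + c) (\<lambda>(i, j). A (a + i) (a + j))"
    have "mat m m (\<lambda>(i, j). A i j) = four_block_mat A1 (0\<^sub>m a (b + c)) C A4"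
      using m ua by (intro eq_matI) (auto simp: A1_def C_def A4_def A_def)
    then have d1: "det (mat m m (\<lambda>(i, j). A i j)) = det A1 * det A4"
      using det_four_block_mat_upper_right_zero[of A1 a "0\<^sub>m a (b + c)" "b + c" C A4]
      by (simp add: A1_def C_def A4_def)
    define B where "B = mat b c (\<lambda>(i, j). A (a + i) (a + b + j))"
    have "A4 = four_block_mat A2 B (0\<^sub>m c b) A3"
    proof (intro eq_matI)
      fix i j assume "i < dim_row (four_block_mat A2 B (0\<^sub>m c b) A3)" "j < dim_col (four_block_mat A2 B (0\<^sub>m c b) A3)"
      then have ij: "i < b + c" "j < b + c" by (auto simp: A2_def A3_def)
      have "A (a + i) (a + j) = 0" if "\<not> i < b" "j < b"
      proof -
        have "a + b + (i - b) = a + i" "i - b < c" using that ij by auto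
        then have "a + b \<le> u (a + i)" using uc[of "i - b"] by simp
        then show ?thesis using that by (simp add: A_def)
      qed
      then show "A4 $$ (i, j) = four_block_mat A2 B (0\<^sub>m c b) A3 $$ (i, j)"
        using ij by (auto simp: A4_def A2_def A3_def B_def)
    qed (auto simp: A4_def A2_def A3_def)
    then have d4: "det A4 = det A2 * det A3"
      using det_four_block_mat_lower_left_zero[of A2 b B c "0\<^sub>m c b" A3]
      by (simp add: A2_def B_def A3_def)
    \<comment> \<open>The full determinant is the product of those of \<open>A1\<close>,
      \<open>A2\<close> and \<open>A3\<close>. The corner minors repeat the outer two, which hence
      occur squared; the middle block has size at most 1, so its determinant is 0 or 1.\<close>
    have "N = complex_of_real (r1\<^sup>2 * r2 * r3\<^sup>2)"
      unfolding N d1 d4 r1 r2(2) r3 by (simp add: power2_eq_square)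
    then show ?thesis using r2(1) by (intro exI[of _ "r1\<^sup>2 * r2 * r3\<^sup>2"]) auto
  qed
  show "N = 1" if id: "\<And>k. k < m \<Longrightarrow> u k = k"
  proof -
    have "mat m m (\<lambda>(i, j). A i j) = 1\<^sub>m m" "A1 = 1\<^sub>m a" "A3 = 1\<^sub>m c"
      using m by (auto simp: A1_def A3_def A_def id intro!: eq_matI)
    then show ?thesis unfolding N by simp
  qed
qed

lemma kronecker_mult:
  assumes A: "A \<in> carrier_mat n n'" and C: "C \<in> carrier_mat n' n''"
    and B: "B \<in> carrier_mat k k'" and E: "E \<in> carrier_mat k' k''"
  shows "kronecker A B * kronecker C E = kronecker (A * C) (B * E)"
proof (intro eq_matI)
  have AB: "kronecker A B \<in> carrier_mat (n * k) (n' * k')" by (rule kronecker_carrier[OF A B])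
  have CE: "kronecker C E \<in> carrier_mat (n' * k') (n'' * k'')" by (rule kronecker_carrier[OF C E])
  have AC: "A * C \<in> carrier_mat n n''" and BE: "B * E \<in> carrier_mat k k''"
    using A C B E by auto
  have P: "kronecker (A * C) (B * E) \<in> carrier_mat (n * k) (n'' * k'')" by (rule kronecker_carrier[OF AC BE])
  show "dim_row (kronecker A B * kronecker C E) = dim_row (kronecker (A * C) (B * E))"
    "dim_col (kronecker A B * kronecker C E) = dim_col (kronecker (A * C) (B * E))"
    using AB CE P by auto
  fix x y assume "x < dim_row (kronecker (A * C) (B * E))" "y < dim_col (kronecker (A * C) (B * E))"
  then have xy: "x < n * k" "y < n'' * k''" using P by auto
  then have "k > 0" "k'' > 0" by (auto intro!: Nat.gr0I)
  then have ij: "x div k < n" "x mod k < k" "y div k'' < n''" "y mod k'' < k''"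
    using xy by (auto simp: less_mult_imp_div_less)
  have xe: "x = (x div k) * k + x mod k" "y = (y div k'') * k'' + y mod k''" by simp_all
  have "(kronecker A B * kronecker C E) $$ (x, y) = (\<Sum>l<n' * k'. kronecker A B $$ (x, l) * kronecker C E $$ (l, y))"
    by (rule mult_mat_index[OF AB CE xy])
  also have "\<dots> = (\<Sum>i<n'. \<Sum>j<k'. (A $$ (x div k, i) * C $$ (i, y div k'')) * (B $$ (x mod k, j) * E $$ (j, y mod k'')))"
    unfolding sum_lessThan_mult
  proof (intro sum.cong refl)
    fix i j assume "i \<in> {..<n'}" "j \<in> {..<k'}"
    then have l: "i < n'" "j < k'" by auto
    have "kronecker A B $$ (x, i * k' + j) = A $$ (x div k, i) * B $$ (x mod k, j)"
      using kronecker_index[OF A B ij(1,2) l] xe(1) by simp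
    moreover have "kronecker C E $$ (i * k' + j, y) = C $$ (i, y div k'') * E $$ (j, y mod k'')"
      using kronecker_index[OF C E l ij(3,4)] xe(2) by simp
    ultimately show "kronecker A B $$ (x, i * k' + j) * kronecker C E $$ (i * k' + j, y) =
      (A $$ (x div k, i) * C $$ (i, y div k'')) * (B $$ (x mod k, j) * E $$ (j, y mod k''))"
      by (simp only: mult_ac)
  qed
  also have "\<dots> = (A * C) $$ (x div k, y div k'') * (B * E) $$ (x mod k, y mod k'')"
    unfolding mult_mat_index[OF A C ij(1,3)] mult_mat_index[OF B E ij(2,4)] by (rule sum_product[symmetric])
  also have "\<dots> = kronecker (A * C) (B * E) $$ (x, y)"
    using kronecker_index[OF AC BE ij(1,2,3,4)] xe by simp
  finally show "(kronecker A B * kronecker C E) $$ (x, y) = kronecker (A * C) (B * E) $$ (x, y)" .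
qed

text \<open>For real \<open>g\<close> the coordinates of \<open>minor_vec\<close> equal their
  conjugates, which lets \<open>triple_invariant\<close> pass from \<open>J\<close> to
  \<open>dagger J\<close>.\<close>

lemma minors_real:
  assumes "\<And>i j. i < m \<Longrightarrow> j < m \<Longrightarrow> g $$ (i, j) \<in> \<real>"
    and h: "\<And>d. d < c \<Longrightarrow> h d \<le> m" and w: "\<And>s. s \<in> boxes c h \<Longrightarrow> w s < m"
  shows "minors c h g w \<in> \<real>"
  unfolding minors_expand column_sign_def
proof (intro sum_in_Reals Reals_mult prod_in_Reals)
  fix P d
  show "signof (P d) \<in> (\<real> :: complex set)" by (simp add: sign_def)
next
  fix P s assume P: "P \<in> column_perms c h" and s: "s \<in> boxes c h"
  have "P (fst s) (snd s) < h (fst s)" "h (fst s) \<le> m"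
    using column_perms_less[OF P s] h s by (auto simp: boxes_def)
  then show "g $$ (w s, P (fst s) (snd s)) \<in> \<real>" using assms(1) w[OF s] by simp
qed

lemma prod_nonneg_real:
  assumes "\<And>d. d \<in> A \<Longrightarrow> \<exists>q \<ge> 0. f d = complex_of_real q"
  shows "\<exists>q \<ge> 0. (\<Prod>d\<in>A. f d) = complex_of_real q"
  using assms
proof (induction A rule: infinite_finite_induct)
  case (insert d A)
  obtain q where q: "q \<ge> 0" "f d = complex_of_real q" using insert.prems[of d] by auto
  obtain q' where "q' \<ge> 0" "(\<Prod>d\<in>A. f d) = complex_of_real q'" using insert.IH insert.prems by auto
  then show ?case using q insert.hyps by (intro exI[of _ "q * q'"]) auto
qed (auto intro: exI[of _ 1])

section \<open>Nonvanishing of the projected determinant tensor\<close>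

context three_columns
begin

text \<open>The matrices are chosen so that every summand is a product over the columns of a full
  determinant and its two corner minors. By \<open>corner_minors_product\<close> no summand is
  negative, and one of them is 1.\<close>

lemma nonvanishing:
  obtains g2 g3 where "g2 \<in> SL m" "g3 \<in> SL m"
    "\<forall>i<m. \<forall>j<m. g2 $$ (i, j) \<in> \<real>" "\<forall>i<m. \<forall>j<m. g3 $$ (i, j) \<in> \<real>"
    "(\<Sum>w1\<in>words m c h1. \<Sum>w2\<in>words m c h2. \<Sum>w3\<in>words m c h3.
      minors c h1 (1\<^sub>m m) w1 * minors c h2 g2 w2 * minors c h3 g3 w3 * det_form (merge w1 w2 w3)) \<noteq> 0"
proof -
  \<comment> \<open>The first column consists of ones, so every minor of height at most 1 equals 1
    whatever the word.\<close>
  define g2 where "g2 = mat m m (\<lambda>(i, j). if j = 0 \<or> i = j then 1 else 0 :: complex)"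
  have "g2 \<in> carrier_mat m m" by (simp add: g2_def)
  then have "det g2 = (\<Prod>i<m. g2 $$ (i, i))" by (rule det_lower) (auto simp: g2_def)
  also have "\<dots> = 1" by (intro prod.neutral) (auto simp: g2_def)
  finally have g2: "g2 \<in> SL m" by (simp add: SL_def g2_def)
  have m0: "m > 0" using m2 by simp
  obtain e :: "nat \<Rightarrow> complex" where e: "\<forall>i. e i * e i = 1" "\<forall>i. i \<noteq> 0 \<longrightarrow> e i = 1" "antidiag m e \<in> SL m"
    "antidiag m (\<lambda>i. e (m - 1 - i)) \<in> SL m"
    "antidiag m e * antidiag m (\<lambda>i. e (m - 1 - i)) = 1\<^sub>m m"
    "antidiag m (\<lambda>i. e (m - 1 - i)) * antidiag m e = 1\<^sub>m m"
    by (rule exists_longest[OF m0])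
  \<comment> \<open>With the reversed matrix, the minors of the third block test against the bottom
    rows.\<close>
  define g3 where "g3 = antidiag m e"
  have er: "e i \<in> \<real>" for i
  proof -
    have "e i = 1 \<or> e i = - 1" using e(1) square_eq_1_iff[of "e i"] by simp
    then show ?thesis by auto
  qed
  define F where "F w1 w2 w3 = minors c h1 (1\<^sub>m m) w1 * minors c h2 g2 w2 * minors c h3 g3 w3 * det_form (merge w1 w2 w3)" for w1 w2 w3
  define N where "N u d = det (mat m m (\<lambda>(i, j). if u i = j then 1 else 0 :: complex)) *
    det (mat (h1 d) (h1 d) (\<lambda>(i, j). if u i = j then 1 else 0)) *
    det (mat (h3 d) (h3 d) (\<lambda>(i, j). if u (m - 1 - i) = m - 1 - j then 1 else 0))" for u d
  have F: "F w1 w2 w3 = (\<Prod>d<c. N (\<lambda>k. merge w1 w2 w3 (d, k)) d)"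
    if w: "w1 \<in> words m c h1" "w2 \<in> words m c h2" "w3 \<in> words m c h3" for w1 w2 w3
    unfolding F_def det_form_def minors_def prod.distrib[symmetric]
  proof (rule prod.cong[OF refl])
    fix d assume "d \<in> {..<c}"
    then have d: "d < c" by simp
    define u where "u k = merge w1 w2 w3 (d, k)" for k
    have um: "u k < m" if "k < m" for k
      unfolding u_def using merge_less[OF words_less[OF w(1)] words_less[OF w(2)] words_less[OF w(3)]] d that
      by (simp add: boxes_def)
    have u1: "w1 (d, k) = u k" if "k < h1 d" for k using that by (simp add: u_def merge_words_def)
    have u3: "w3 (d, k) = u (m - 1 - k)" if "k < h3 d" for k
    proof -
      have "h1 d + h2 d \<le> m - 1 - k" "k < m" using total[OF d] that by auto
      then show ?thesis by (simp add: u_def merge_words_def)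
    qed
    have "mat (h1 d) (h1 d) (\<lambda>(i, j). 1\<^sub>m m $$ (w1 (d, i), j)) =
      (mat (h1 d) (h1 d) (\<lambda>(i, j). if u i = j then 1 else 0) :: complex mat)"
      using u1 um h1[OF d] by (intro eq_matI) auto
    moreover have "mat m m (\<lambda>(i, j). 1\<^sub>m m $$ (merge w1 w2 w3 (d, i), j)) =
      (mat m m (\<lambda>(i, j). if u i = j then 1 else 0) :: complex mat)"
      using um by (intro eq_matI) (auto simp: u_def)
    moreover have "mat (h3 d) (h3 d) (\<lambda>(i, j). g3 $$ (w3 (d, i), j)) =
      mat (h3 d) (h3 d) (\<lambda>(i, j). if u (m - 1 - i) = m - 1 - j then 1 else 0)"
    proof (intro eq_matI)
      fix i j assume "i < dim_row (mat (h3 d) (h3 d) (\<lambda>(i, j). if u (m - 1 - i) = m - 1 - j then 1 else (0 :: complex)))"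
        "j < dim_col (mat (h3 d) (h3 d) (\<lambda>(i, j). if u (m - 1 - i) = m - 1 - j then 1 else (0 :: complex)))"
      then have ij: "i < h3 d" "j < h3 d" by auto
      \<comment> \<open>Only \<open>e 0\<close> can differ from 1, and it sits in column
        \<open>m - 1\<close> of \<open>g3\<close>, which is out of reach because
        \<open>h3 d < m\<close>.\<close>
      have "u (m - 1 - i) < m" using um[of "m - 1 - i"] m2 by simp
      then show "mat (h3 d) (h3 d) (\<lambda>(i, j). g3 $$ (w3 (d, i), j)) $$ (i, j) =
        mat (h3 d) (h3 d) (\<lambda>(i, j). if u (m - 1 - i) = m - 1 - j then 1 else 0) $$ (i, j)"
        using ij u3[OF ij(1)] h3[OF d] e(2) by (auto simp: g3_def antidiag_def)
    qed auto
    moreover have "det (mat (h2 d) (h2 d) (\<lambda>(i, j). g2 $$ (w2 (d, i), j))) = 1"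
    proof (cases "h2 d = 0")
      case False
      then have h21: "h2 d = 1" using h2[OF d] by simp
      have "w2 (d, 0) < m" using words_less[OF w(2), of "(d, 0)"] d h21 by (simp add: boxes_def)
      moreover have "det (mat (h2 d) (h2 d) (\<lambda>(i, j). g2 $$ (w2 (d, i), j))) = mat (h2 d) (h2 d) (\<lambda>(i, j). g2 $$ (w2 (d, i), j)) $$ (0, 0)"
        by (intro det_single) (simp add: h21)
      ultimately show ?thesis using h21 m2 by (simp add: g2_def)
    qed simp
    ultimately show "det (mat (h1 d) (h1 d) (\<lambda>(i, j). 1\<^sub>m m $$ (w1 (d, i), j))) * det (mat (h2 d) (h2 d) (\<lambda>(i, j). g2 $$ (w2 (d, i), j))) *
      det (mat (h3 d) (h3 d) (\<lambda>(i, j). g3 $$ (w3 (d, i), j))) * det (mat m m (\<lambda>(i, j). 1\<^sub>m m $$ (merge w1 w2 w3 (d, i), j))) =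
      N (\<lambda>k. merge w1 w2 w3 (d, k)) d"
      unfolding N_def u_def[symmetric] by (simp add: mult_ac)
  qed
  have nonneg: "\<exists>q \<ge> 0. F w1 w2 w3 = complex_of_real q"
    if w: "w1 \<in> words m c h1" "w2 \<in> words m c h2" "w3 \<in> words m c h3" for w1 w2 w3
    unfolding F[OF w]
  proof (rule prod_nonneg_real)
    fix d assume "d \<in> {..<c}"
    then have d: "d < c" by simp
    show "\<exists>q\<ge>0. N (\<lambda>k. merge w1 w2 w3 (d, k)) d = complex_of_real q"
      unfolding N_def by (rule corner_minors_product(1)[OF total[OF d] h2[OF d]])
  qed
  \<comment> \<open>After merging, these words write its row index into every box, so each column
    becomes the identity permutation and the summand is 1.\<close>
  define s1 where "s1 = restrict snd (boxes c h1)"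
  define s2 where "s2 = restrict (\<lambda>s. h1 (fst s) + snd s) (boxes c h2)"
  define s3 where "s3 = restrict (\<lambda>s. m - 1 - snd s) (boxes c h3)"
  have s: "s1 \<in> words m c h1" "s2 \<in> words m c h2" "s3 \<in> words m c h3"
    using h1 total m2 by (fastforce simp: s1_def s2_def s3_def words_def boxes_def)+
  have "F s1 s2 s3 = 1"
    unfolding F[OF s]
  proof (intro prod.neutral ballI)
    fix d assume "d \<in> {..<c}"
    then have d: "d < c" by simp
    have "merge s1 s2 s3 (d, k) = k" if "k < m" for k
      using d that total[OF d] by (auto simp: merge_words_def s1_def s2_def s3_def boxes_def)
    then show "N (\<lambda>k. merge s1 s2 s3 (d, k)) d = 1"
      unfolding N_def by (intro corner_minors_product(2)[OF total[OF d] h2[OF d]])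
  qed
  let ?W = "words m c h1 \<times> words m c h2 \<times> words m c h3"
  let ?G = "\<lambda>x. F (fst x) (fst (snd x)) (snd (snd x))"
  have "(\<Sum>w1\<in>words m c h1. \<Sum>w2\<in>words m c h2. \<Sum>w3\<in>words m c h3. F w1 w2 w3) = (\<Sum>x\<in>?W. ?G x)"
    by (simp add: sum.cartesian_product')
  moreover have "(\<Sum>x\<in>?W. ?G x) \<noteq> 0"
  proof -
    have nn: "Re (?G x) \<ge> 0" if "x \<in> ?W" for x
      using nonneg[of "fst x" "fst (snd x)" "snd (snd x)"] that by auto
    have "1 = Re (?G (s1, s2, s3))" using \<open>F s1 s2 s3 = 1\<close> by simp
    also have "\<dots> \<le> (\<Sum>x\<in>?W. Re (?G x))" using s nn by (intro member_le_sum) auto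
    also have "\<dots> = Re (\<Sum>x\<in>?W. ?G x)" by simp
    finally have *: "1 \<le> Re (\<Sum>x\<in>?W. ?G x)" .
    show ?thesis
    proof
      assume "(\<Sum>x\<in>?W. ?G x) = 0"
      with * show False by (simp only: zero_complex.sel)
    qed
  qed
  ultimately show thesis
    using that[of g2 g3] g2 e(3) er by (auto simp: F_def g2_def g3_def antidiag_def)
qed

text \<open>The tensor \<open>T\<close> of \<open>det_form\<close> is invariant, and the maps
  \<open>dagger J1\<close>, \<open>dagger J2\<close>, \<open>dagger J3\<close> intertwine, so its
  image \<open>t\<close> is invariant. If \<open>t\<close> were 0, the sum in
  \<open>nonvanishing\<close>, which is a combination of the coordinates of \<open>t\<close>, would
  vanish.\<close>

theorem triple_invariant:
  "has_triple_invariant m (column_weight c h1) (column_weight c h2) (column_weight c h3)"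
proof -
  have h2m: "h2 d < m" if "d < c" for d using h2[OF that] m2 by simp
  obtain d1 \<rho>1 J1 where V1: "is_V m (column_weight c h1) d1 \<rho>1" "J1 \<in> carrier_mat (tensor_dim m c h1) d1"
    "\<forall>g \<in> SL m. \<rho>1 g \<in> carrier_mat d1 d1 \<and> \<rho>1 g * dagger J1 = dagger J1 * tensor_power m c h1 g"
    "\<forall>g \<in> SL m. J1 *\<^sub>v (dagger J1 *\<^sub>v minor_vec m c h1 g) = minor_vec m c h1 g"
    using exists_weyl_module[where m = m and c = c and h = h1, OF m2 h1] by auto
  obtain d2 \<rho>2 J2 where V2: "is_V m (column_weight c h2) d2 \<rho>2" "J2 \<in> carrier_mat (tensor_dim m c h2) d2"
    "\<forall>g \<in> SL m. \<rho>2 g \<in> carrier_mat d2 d2 \<and> \<rho>2 g * dagger J2 = dagger J2 * tensor_power m c h2 g"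
    "\<forall>g \<in> SL m. J2 *\<^sub>v (dagger J2 *\<^sub>v minor_vec m c h2 g) = minor_vec m c h2 g"
    using exists_weyl_module[where m = m and c = c and h = h2, OF m2 h2m] by auto
  obtain d3 \<rho>3 J3 where V3: "is_V m (column_weight c h3) d3 \<rho>3" "J3 \<in> carrier_mat (tensor_dim m c h3) d3"
    "\<forall>g \<in> SL m. \<rho>3 g \<in> carrier_mat d3 d3 \<and> \<rho>3 g * dagger J3 = dagger J3 * tensor_power m c h3 g"
    "\<forall>g \<in> SL m. J3 *\<^sub>v (dagger J3 *\<^sub>v minor_vec m c h3 g) = minor_vec m c h3 g"
    using exists_weyl_module[where m = m and c = c and h = h3, OF m2 h3] by auto
  define D1 where "D1 = tensor_dim m c h1"
  define D2 where "D2 = tensor_dim m c h2"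
  define D3 where "D3 = tensor_dim m c h3"
  define E1 where "E1 = word_enum m c h1"
  define E2 where "E2 = word_enum m c h2"
  define E3 where "E3 = word_enum m c h3"
  have J: "dagger J1 \<in> carrier_mat d1 D1" "dagger J2 \<in> carrier_mat d2 D2" "dagger J3 \<in> carrier_mat d3 D3"
    using V1(2) V2(2) V3(2) by (auto simp: D1_def D2_def D3_def)
  have R: "tensor_power m c h1 g \<in> carrier_mat D1 D1" "tensor_power m c h2 g \<in> carrier_mat D2 D2"
    "tensor_power m c h3 g \<in> carrier_mat D3 D3" for g
    using tensor_power_carrier by (auto simp: D1_def D2_def D3_def)
  define T where "T = vec (D1 * D2 * D3) (\<lambda>x. det_form (merge (E1 (x div D3 div D2)) (E2 (x div D3 mod D2)) (E3 (x mod D3))))"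
  have Tc: "T \<in> carrier_vec (D1 * D2 * D3)" by (simp add: T_def)
  have T: "T $ triple_index D2 D3 i j k = det_form (merge (E1 i) (E2 j) (E3 k))" if "i < D1" "j < D2" "k < D3" for i j k
    using triple_index_less[OF that] that by (simp add: T_def triple_index_def)
  define t where "t = kronecker (kronecker (dagger J1) (dagger J2)) (dagger J3) *\<^sub>v T"
  have JJ: "kronecker (dagger J1) (dagger J2) \<in> carrier_mat (d1 * d2) (D1 * D2)" by (rule kronecker_carrier[OF J(1,2)])
  have JJJ: "kronecker (kronecker (dagger J1) (dagger J2)) (dagger J3) \<in> carrier_mat (d1 * d2 * d3) (D1 * D2 * D3)"
    by (rule kronecker_carrier[OF JJ J(3)])
  have tc: "t \<in> carrier_vec (d1 * d2 * d3)" unfolding t_def by (rule mult_mat_vec_carrier[OF JJJ Tc])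
  have RT: "kronecker (kronecker (tensor_power m c h1 g) (tensor_power m c h2 g)) (tensor_power m c h3 g) *\<^sub>v T = T"
    if g: "g \<in> SL m" for g
  proof (intro eq_vecI)
    have RR: "kronecker (kronecker (tensor_power m c h1 g) (tensor_power m c h2 g)) (tensor_power m c h3 g) \<in> carrier_mat (D1 * D2 * D3) (D1 * D2 * D3)"
      by (intro kronecker_carrier R)
    then show "dim_vec (kronecker (kronecker (tensor_power m c h1 g) (tensor_power m c h2 g)) (tensor_power m c h3 g) *\<^sub>v T) = dim_vec T"
      by (simp add: T_def)
    fix x assume "x < dim_vec T"
    then have "x < D1 * D2 * D3" by (simp add: T_def)
    then obtain i j k where x: "i < D1" "j < D2" "k < D3" "x = triple_index D2 D3 i j k" by (rule triple_index_cases)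
    have "(kronecker (kronecker (tensor_power m c h1 g) (tensor_power m c h2 g)) (tensor_power m c h3 g) *\<^sub>v T) $ x =
      (\<Sum>i'<D1. \<Sum>j'<D2. \<Sum>k'<D3. tensor_power m c h1 g $$ (i, i') * tensor_power m c h2 g $$ (j, j') * tensor_power m c h3 g $$ (k, k') *
        T $ triple_index D2 D3 i' j' k')"
      unfolding x(4) by (rule kronecker3_vec_index[OF R Tc x(1-3)])
    also have "\<dots> = (\<Sum>i'<D1. \<Sum>j'<D2. \<Sum>k'<D3.
      (\<Prod>s\<in>boxes c h1. g $$ (E1 i s, E1 i' s)) * (\<Prod>s\<in>boxes c h2. g $$ (E2 j s, E2 j' s)) * (\<Prod>s\<in>boxes c h3. g $$ (E3 k s, E3 k' s)) *
      det_form (merge (E1 i') (E2 j') (E3 k')))"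
      using x T by (intro sum.cong refl) (simp add: tensor_power_def D1_def D2_def D3_def E1_def E2_def E3_def)
    also have "\<dots> = (\<Sum>w1\<in>words m c h1. \<Sum>w2\<in>words m c h2. \<Sum>w3\<in>words m c h3.
      (\<Prod>s\<in>boxes c h1. g $$ (E1 i s, w1 s)) * (\<Prod>s\<in>boxes c h2. g $$ (E2 j s, w2 s)) * (\<Prod>s\<in>boxes c h3. g $$ (E3 k s, w3 s)) *
      det_form (merge w1 w2 w3))"
      unfolding D1_def D2_def D3_def E1_def E2_def E3_def sum_word_enum[symmetric] ..
    also have "\<dots> = det_form (merge (E1 i) (E2 j) (E3 k))"
      by (rule det_form_invariant[OF g]) (use x word_enum_words in \<open>auto simp: D1_def D2_def D3_def E1_def E2_def E3_def\<close>)
    finally show "(kronecker (kronecker (tensor_power m c h1 g) (tensor_power m c h2 g)) (tensor_power m c h3 g) *\<^sub>v T) $ x = T $ x"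
      using T[OF x(1-3)] x(4) by simp
  qed
  have inv: "kronecker (kronecker (\<rho>1 g) (\<rho>2 g)) (\<rho>3 g) *\<^sub>v t = t" if g: "g \<in> SL m" for g
  proof -
    have r: "\<rho>1 g \<in> carrier_mat d1 d1" "\<rho>2 g \<in> carrier_mat d2 d2" "\<rho>3 g \<in> carrier_mat d3 d3"
      and i: "\<rho>1 g * dagger J1 = dagger J1 * tensor_power m c h1 g" "\<rho>2 g * dagger J2 = dagger J2 * tensor_power m c h2 g"
      "\<rho>3 g * dagger J3 = dagger J3 * tensor_power m c h3 g"
      using V1(3) V2(3) V3(3) g by auto
    have rr: "kronecker (\<rho>1 g) (\<rho>2 g) \<in> carrier_mat (d1 * d2) (d1 * d2)" by (rule kronecker_carrier[OF r(1,2)])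
    have rrr: "kronecker (kronecker (\<rho>1 g) (\<rho>2 g)) (\<rho>3 g) \<in> carrier_mat (d1 * d2 * d3) (d1 * d2 * d3)"
      by (rule kronecker_carrier[OF rr r(3)])
    have RR: "kronecker (tensor_power m c h1 g) (tensor_power m c h2 g) \<in> carrier_mat (D1 * D2) (D1 * D2)"
      by (rule kronecker_carrier[OF R(1,2)])
    have RRR: "kronecker (kronecker (tensor_power m c h1 g) (tensor_power m c h2 g)) (tensor_power m c h3 g) \<in> carrier_mat (D1 * D2 * D3) (D1 * D2 * D3)"
      by (rule kronecker_carrier[OF RR R(3)])
    have "kronecker (kronecker (\<rho>1 g) (\<rho>2 g)) (\<rho>3 g) * kronecker (kronecker (dagger J1) (dagger J2)) (dagger J3) =
      kronecker (kronecker (dagger J1) (dagger J2)) (dagger J3) * kronecker (kronecker (tensor_power m c h1 g) (tensor_power m c h2 g)) (tensor_power m c h3 g)"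
      unfolding kronecker_mult[OF rr JJ r(3) J(3)] kronecker_mult[OF r(1) J(1) r(2) J(2)]
        kronecker_mult[OF JJ RR J(3) R(3)] kronecker_mult[OF J(1) R(1) J(2) R(2)] i ..
    then show ?thesis
      unfolding t_def
      using assoc_mult_mat_vec[OF rrr JJJ Tc] assoc_mult_mat_vec[OF JJJ RRR Tc] RT[OF g] by simp
  qed
  have "t \<noteq> 0\<^sub>v (d1 * d2 * d3)"
  proof
    assume t0: "t = 0\<^sub>v (d1 * d2 * d3)"
    have z: "(\<Sum>a<D1. \<Sum>b<D2. \<Sum>e<D3. dagger J1 $$ (i, a) * dagger J2 $$ (j, b) * dagger J3 $$ (k, e) * T $ triple_index D2 D3 a b e) = 0"
      if "i < d1" "j < d2" "k < d3" for i j k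
    proof -
      have "t $ triple_index d2 d3 i j k = 0" unfolding t0 using triple_index_less[OF that] by simp
      then show ?thesis unfolding t_def kronecker3_vec_index[OF J Tc that] .
    qed
    obtain g2 g3 where g: "g2 \<in> SL m" "g3 \<in> SL m"
      and real: "\<forall>i<m. \<forall>j<m. g2 $$ (i, j) \<in> \<real>" "\<forall>i<m. \<forall>j<m. g3 $$ (i, j) \<in> \<real>"
      and nz: "(\<Sum>w1\<in>words m c h1. \<Sum>w2\<in>words m c h2. \<Sum>w3\<in>words m c h3.
      minors c h1 (1\<^sub>m m) w1 * minors c h2 g2 w2 * minors c h3 g3 w3 * det_form (merge w1 w2 w3)) \<noteq> 0"
      by (rule nonvanishing)
    have real1: "1\<^sub>m m $$ (i, j) \<in> (\<real> :: complex set)" if "i < m" "j < m" for i j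
      using that by simp
    \<comment> \<open>\<open>t\<close> is formed with \<open>dagger J\<close>, while
      \<open>minor_vec\<close> is recovered through \<open>J\<close>. Conjugating the real
      coordinates turns one into the other.\<close>
    have coord: "minors c h g (word_enum m c h a) = (\<Sum>i<d. dagger J $$ (i, a) * cnj ((dagger J *\<^sub>v minor_vec m c h g) $ i))"
      if a: "a < tensor_dim m c h" and Jc: "J \<in> carrier_mat (tensor_dim m c h) d"
        and Jfix: "J *\<^sub>v (dagger J *\<^sub>v minor_vec m c h g) = minor_vec m c h g"
        and re: "\<And>i j. i < m \<Longrightarrow> j < m \<Longrightarrow> g $$ (i, j) \<in> \<real>" and hm: "\<And>d. d < c \<Longrightarrow> h d < m" for h g a J d
    proof -
      have hm': "h d \<le> m" if "d < c" for d using hm[OF that] by simp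
      have dJ: "dagger J \<in> carrier_mat d (tensor_dim m c h)" using Jc by simp
      have x: "dagger J *\<^sub>v minor_vec m c h g \<in> carrier_vec d"
        by (rule mult_mat_vec_carrier[OF dJ]) (simp add: minor_vec_def)
      have "minors c h g (word_enum m c h a) = (J *\<^sub>v (dagger J *\<^sub>v minor_vec m c h g)) $ a"
        unfolding Jfix using a by (simp add: minor_vec_def)
      moreover have "cnj (minors c h g (word_enum m c h a)) = minors c h g (word_enum m c h a)"
        using minors_real[OF re hm' word_enum_less[OF a]] by (simp add: Reals_cnj_iff)
      ultimately have "minors c h g (word_enum m c h a) = cnj ((J *\<^sub>v (dagger J *\<^sub>v minor_vec m c h g)) $ a)"
        by (simp only:)
      also have "\<dots> = (\<Sum>i<d. cnj (J $$ (a, i)) * cnj ((dagger J *\<^sub>v minor_vec m c h g) $ i))"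
        unfolding mult_mat_vec_index[OF Jc x a] by (simp del: index_mult_mat_vec)
      also have "\<dots> = (\<Sum>i<d. dagger J $$ (i, a) * cnj ((dagger J *\<^sub>v minor_vec m c h g) $ i))"
        using Jc a by (intro sum.cong) (auto simp del: index_mult_mat_vec)
      finally show ?thesis .
    qed
    define X1 where "X1 i = cnj ((dagger J1 *\<^sub>v minor_vec m c h1 (1\<^sub>m m)) $ i)" for i
    define X2 where "X2 i = cnj ((dagger J2 *\<^sub>v minor_vec m c h2 g2) $ i)" for i
    define X3 where "X3 i = cnj ((dagger J3 *\<^sub>v minor_vec m c h3 g3) $ i)" for i
    have c1: "minors c h1 (1\<^sub>m m) (E1 a) = (\<Sum>i<d1. dagger J1 $$ (i, a) * X1 i)" if "a < D1" for a
      unfolding E1_def X1_def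
      by (rule coord[where h = h1 and g = "1\<^sub>m m" and a = a and J = J1 and d = d1, OF that[unfolded D1_def] V1(2) bspec[OF V1(4) SL_one] real1 h1])
    have c2: "minors c h2 g2 (E2 a) = (\<Sum>i<d2. dagger J2 $$ (i, a) * X2 i)" if "a < D2" for a
      unfolding E2_def X2_def
      by (rule coord[where h = h2 and g = "g2" and a = a and J = J2 and d = d2, OF that[unfolded D2_def] V2(2) bspec[OF V2(4) g(1)] real(1)[rule_format] h2m])
    have c3: "minors c h3 g3 (E3 a) = (\<Sum>i<d3. dagger J3 $$ (i, a) * X3 i)" if "a < D3" for a
      unfolding E3_def X3_def
      by (rule coord[where h = h3 and g = "g3" and a = a and J = J3 and d = d3, OF that[unfolded D3_def] V3(2) bspec[OF V3(4) g(2)] real(2)[rule_format] h3])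
    define G where "G i j k a b e = (dagger J1 $$ (i, a) * X1 i) * (dagger J2 $$ (j, b) * X2 j) * (dagger J3 $$ (k, e) * X3 k) *
      T $ triple_index D2 D3 a b e" for i j k a b e
    have "(\<Sum>w1\<in>words m c h1. \<Sum>w2\<in>words m c h2. \<Sum>w3\<in>words m c h3.
      minors c h1 (1\<^sub>m m) w1 * minors c h2 g2 w2 * minors c h3 g3 w3 * det_form (merge w1 w2 w3)) =
      (\<Sum>a<D1. \<Sum>b<D2. \<Sum>e<D3. minors c h1 (1\<^sub>m m) (E1 a) * minors c h2 g2 (E2 b) * minors c h3 g3 (E3 e) * det_form (merge (E1 a) (E2 b) (E3 e)))"
      unfolding D1_def D2_def D3_def E1_def E2_def E3_def sum_word_enum[symmetric] ..
    also have "\<dots> = (\<Sum>a<D1. \<Sum>b<D2. \<Sum>e<D3. \<Sum>i<d1. \<Sum>j<d2. \<Sum>k<d3. G i j k a b e)"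
    proof (intro sum.cong refl)
      fix a b e assume "a \<in> {..<D1}" "b \<in> {..<D2}" "e \<in> {..<D3}"
      then have l: "a < D1" "b < D2" "e < D3" by auto
      show "minors c h1 (1\<^sub>m m) (E1 a) * minors c h2 g2 (E2 b) * minors c h3 g3 (E3 e) * det_form (merge (E1 a) (E2 b) (E3 e)) =
        (\<Sum>i<d1. \<Sum>j<d2. \<Sum>k<d3. G i j k a b e)"
        unfolding c1[OF l(1)] c2[OF l(2)] c3[OF l(3)] T[OF l, symmetric] G_def by (rule sum_product3)
    qed
    also have "\<dots> = (\<Sum>i<d1. \<Sum>j<d2. \<Sum>k<d3. \<Sum>a<D1. \<Sum>b<D2. \<Sum>e<D3. G i j k a b e)" by (rule sum3_swap)
    also have "\<dots> = (\<Sum>i<d1. \<Sum>j<d2. \<Sum>k<d3. 0)"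
    proof (rule sum.cong[OF refl], rule sum.cong[OF refl], rule sum.cong[OF refl])
      fix i j k assume "i \<in> {..<d1}" "j \<in> {..<d2}" "k \<in> {..<d3}"
      then have l: "i < d1" "j < d2" "k < d3" by auto
      have "(\<Sum>a<D1. \<Sum>b<D2. \<Sum>e<D3. G i j k a b e) = (X1 i * X2 j * X3 k) *
        (\<Sum>a<D1. \<Sum>b<D2. \<Sum>e<D3. dagger J1 $$ (i, a) * dagger J2 $$ (j, b) * dagger J3 $$ (k, e) * T $ triple_index D2 D3 a b e)"
        unfolding G_def sum_distrib_left by (intro sum.cong refl) (simp only: mult_ac)
      then show "(\<Sum>a<D1. \<Sum>b<D2. \<Sum>e<D3. G i j k a b e) = 0" unfolding z[OF l] by simp
    qed
    finally show False using nz by simp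
  qed
  then have "t \<in> invariants m (d1 * d2 * d3) (\<lambda>g. kronecker (kronecker (\<rho>1 g) (\<rho>2 g)) (\<rho>3 g))"
    and "t \<noteq> 0\<^sub>v (d1 * d2 * d3)"
    using tc inv by (auto simp: invariants_def)
  then have "invariants m (d1 * d2 * d3) (\<lambda>g. kronecker (kronecker (\<rho>1 g) (\<rho>2 g)) (\<rho>3 g)) \<noteq> {0\<^sub>v (d1 * d2 * d3)}"
    by blast
  then show ?thesis unfolding has_triple_invariant_def
    using V1(1) V2(1) V3(1) by (intro exI[of _ d1] exI[of _ \<rho>1] exI[of _ d2] exI[of _ \<rho>2] exI[of _ d3] exI[of _ \<rho>3] conjI)
qed

end

section \<open>The Pieri rule\<close>

text \<open>A weight enters \<open>is_V\<close> only through its entries 1 to \<open>m - 1\<close>.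
  This matters because \<open>column_weight c h\<close> has the value \<open>c\<close> at 0, where
  weights vanish.\<close>

lemma is_V_cong:
  assumes "is_V m \<mu> d \<rho>" "\<And>i. i \<in> {1..m - 1} \<Longrightarrow> \<mu> i = \<mu>' i"
  shows "is_V m \<mu>' d \<rho>"
proof -
  have "(\<Prod>i = 1..m - 1. b $$ (i - 1, i - 1) ^ \<mu> i) = (\<Prod>i = 1..m - 1. b $$ (i - 1, i - 1) ^ \<mu>' i)" for b :: "complex mat"
    using assms(2) by (intro prod.cong) auto
  then show ?thesis using assms(1) unfolding is_V_def has_highest_weight_def by simp
qed

lemma has_triple_invariantE:
  assumes "has_triple_invariant m \<alpha> \<beta> \<gamma>"
  obtains d1 \<rho>1 d2 \<rho>2 d3 \<rho>3 where "is_V m \<alpha> d1 \<rho>1" "is_V m \<beta> d2 \<rho>2" "is_V m \<gamma> d3 \<rho>3"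
    "invariants m (d1 * d2 * d3) (\<lambda>g. kronecker (kronecker (\<rho>1 g) (\<rho>2 g)) (\<rho>3 g)) \<noteq> {0\<^sub>v (d1 * d2 * d3)}"
  using assms unfolding has_triple_invariant_def by (elim exE conjE) (rule that)

lemma has_triple_invariant_cong:
  assumes "has_triple_invariant m \<alpha> \<beta> \<gamma>" "\<And>i. i \<in> {1..m - 1} \<Longrightarrow> \<alpha> i = \<alpha>' i"
    "\<And>i. i \<in> {1..m - 1} \<Longrightarrow> \<beta> i = \<beta>' i" "\<And>i. i \<in> {1..m - 1} \<Longrightarrow> \<gamma> i = \<gamma>' i"
  shows "has_triple_invariant m \<alpha>' \<beta>' \<gamma>'"
proof -
  obtain d1 \<rho>1 d2 \<rho>2 d3 \<rho>3 where V: "is_V m \<alpha> d1 \<rho>1" "is_V m \<beta> d2 \<rho>2" "is_V m \<gamma> d3 \<rho>3"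
    and i: "invariants m (d1 * d2 * d3) (\<lambda>g. kronecker (kronecker (\<rho>1 g) (\<rho>2 g)) (\<rho>3 g)) \<noteq> {0\<^sub>v (d1 * d2 * d3)}"
    by (rule has_triple_invariantE[OF assms(1)])
  show ?thesis unfolding has_triple_invariant_def
    using is_V_cong[OF V(1) assms(2)] is_V_cong[OF V(2) assms(3)] is_V_cong[OF V(3) assms(4)] i
    by (intro exI[of _ d1] exI[of _ \<rho>1] exI[of _ d2] exI[of _ \<rho>2] exI[of _ d3] exI[of _ \<rho>3] conjI)
qed

text \<open>The entries decrease, so those exceeding \<open>x\<close> form an initial segment: the
  usual relation between row lengths and column heights of a partition.\<close>

lemma le_card_weights_iff:
  assumes \<mu>: "\<mu> \<in> weights m" and i: "i \<in> {1..m - 1}"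
  shows "i \<le> card {k \<in> {1..m - 1}. x < \<mu> k} \<longleftrightarrow> x < \<mu> i"
proof
  have mono: "\<mu> l \<le> \<mu> k" if "1 \<le> k" "k \<le> l" "l \<le> m - 1" for k l
    using \<mu> that unfolding weights_def by blast
  show "i \<le> card {k \<in> {1..m - 1}. x < \<mu> k}" if "x < \<mu> i"
  proof -
    have "{1..i} \<subseteq> {k \<in> {1..m - 1}. x < \<mu> k}"
    proof
      fix k assume k: "k \<in> {1..i}"
      then have "\<mu> i \<le> \<mu> k" using mono[of k i] i by auto
      then show "k \<in> {k \<in> {1..m - 1}. x < \<mu> k}" using that k i by auto
    qed
    then have "card {1..i} \<le> card {k \<in> {1..m - 1}. x < \<mu> k}" by (intro card_mono) auto
    then show ?thesis by simp
  qed
  show "x < \<mu> i" if le: "i \<le> card {k \<in> {1..m - 1}. x < \<mu> k}"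
  proof (rule ccontr)
    assume "\<not> x < \<mu> i"
    have "{k \<in> {1..m - 1}. x < \<mu> k} \<subseteq> {1..i - 1}"
    proof
      fix k assume k: "k \<in> {k \<in> {1..m - 1}. x < \<mu> k}"
      then have "\<not> i \<le> k" using mono[of i k] i \<open>\<not> x < \<mu> i\<close> by auto
      then show "k \<in> {1..i - 1}" using k by auto
    qed
    then have "card {k \<in> {1..m - 1}. x < \<mu> k} \<le> card {1..i - 1}" by (intro card_mono) auto
    with le have "i \<le> card {1..i - 1}" by (rule order_trans)
    then show False using i by auto
  qed
qed

lemma sum_card_swap:
  assumes "finite A" "finite B"
  shows "(\<Sum>a\<in>A. card {b \<in> B. P a b}) = (\<Sum>b\<in>B. card {a \<in> A. P a b})"
proof -
  have c: "card {x \<in> X. Q x} = (\<Sum>x\<in>X. if Q x then 1 else 0)" if "finite X" for X and Q :: "'z \<Rightarrow> bool"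
    using sum.inter_filter[OF that, of "\<lambda>_. 1 :: nat" Q] by simp
  have "(\<Sum>a\<in>A. card {b \<in> B. P a b}) = (\<Sum>a\<in>A. \<Sum>b\<in>B. if P a b then 1 else 0)"
    using c[OF assms(2)] by simp
  also have "\<dots> = (\<Sum>b\<in>B. \<Sum>a\<in>A. if P a b then 1 else 0)" by (rule sum.swap)
  also have "\<dots> = (\<Sum>b\<in>B. card {a \<in> A. P a b})" using c[OF assms(1)] by simp
  finally show ?thesis .
qed

lemma weights_le_first:
  assumes "\<mu> \<in> weights m" "i \<in> {1..m - 1}"
  shows "\<mu> i \<le> \<mu> 1"
proof -
  have "\<forall>i j. 1 \<le> i \<and> i \<le> j \<and> j \<le> m - 1 \<longrightarrow> \<mu> j \<le> \<mu> i" using assms(1) unfolding weights_def by blast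
  then show ?thesis using assms(2) by auto
qed

text \<open>\<open>h1\<close> and \<open>h3\<close> are the column heights of \<alpha> and of
  \<gamma> rotated into the opposite corner, and \<open>h2\<close> is the gap. The inequalities of
  \<open>pieri_condition\<close> say that every gap is 0 or 1, and its equation says that the gaps
  add up to \<open>r\<close>.\<close>

lemma has_triple_invariant_of_pieri:
  assumes w: "\<alpha> \<in> weights m" "\<gamma> \<in> weights m" and m: "2 \<le> m" and p: "pieri_condition m \<alpha> r \<gamma>"
  shows "has_triple_invariant m \<alpha> (\<lambda>j. r * fundamental_weight 1 j) \<gamma>"
proof -
  obtain c where c: "\<forall>i\<in>{1..m}. \<alpha> i + \<gamma> (m + 1 - i) \<le> c" "\<forall>i\<in>{1..m - 1}. c \<le> \<alpha> i + \<gamma> (m - i)"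
    "m * c = r + (\<Sum>i = 1..m. \<alpha> i) + (\<Sum>i = 1..m. \<gamma> i)"
    using p unfolding pieri_condition_def by auto
  have z: "\<alpha> m = 0" "\<gamma> m = 0" using weights_at_rank w m by auto
  have \<alpha>c: "\<alpha> i \<le> c" if "i \<in> {1..m - 1}" for i
    using bspec[OF c(1), of 1] weights_le_first[OF w(1) that] m by auto
  have \<gamma>c: "\<gamma> i \<le> c" if "i \<in> {1..m - 1}" for i
    using bspec[OF c(1), of m] weights_le_first[OF w(2) that] m by auto
  define h1 where "h1 d = card {i \<in> {1..m - 1}. d < \<alpha> i}" for d
  define h3 where "h3 d = card {i \<in> {1..m - 1}. c - 1 - d < \<gamma> i}" for d
  define h2 where "h2 d = m - (h1 d + h3 d)" for d
  have card_m: "card {i \<in> {1..m - 1}. P i} < m" for P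
  proof -
    have "card {i \<in> {1..m - 1}. P i} \<le> card {1..m - 1}" by (intro card_mono) auto
    then show ?thesis using m by simp
  qed
  have h1m: "h1 d < m" and h3m: "h3 d < m" for d unfolding h1_def h3_def by (rule card_m)+
  have upper: "h1 d + h3 d \<le> m" if d: "d < c" for d
  proof (rule ccontr)
    assume n: "\<not> h1 d + h3 d \<le> m"
    \<comment> \<open>If the blocks overlapped in column \<open>d\<close>, row \<open>i\<close> of
      \<alpha> and row \<open>j\<close> of the rotated \<gamma> would both cover it, so
      \<open>\<alpha> i + \<gamma> j\<close> would exceed \<open>c\<close>.\<close>
    define i where "i = h1 d"
    define j where "j = m + 1 - i"
    have i: "i \<in> {1..m - 1}" and j: "j \<in> {1..m - 1}" "j \<le> h3 d" using n h1m[of d] h3m[of d] by (auto simp: i_def j_def)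
    have "d < \<alpha> i" using le_card_weights_iff[OF w(1) i, of d] by (simp add: i_def h1_def)
    moreover have "c - 1 - d < \<gamma> j" using le_card_weights_iff[OF w(2) j(1), of "c - 1 - d"] j(2) by (simp add: h3_def)
    moreover have "\<alpha> i + \<gamma> j \<le> c" 
    proof -
      have "i \<in> {1..m}" using i by auto
      then show ?thesis using c(1) by (simp add: j_def)
    qed
    ultimately show False using d by simp
  qed
  have lower: "m \<le> h1 d + h3 d + 1" if d: "d < c" for d
  proof (rule ccontr)
    assume n: "\<not> m \<le> h1 d + h3 d + 1"
    \<comment> \<open>The first row of \<alpha> that misses column \<open>d\<close>. With two free
      boxes in the column, row \<open>j\<close> of \<gamma> misses it as well, so
      \<open>\<alpha> i + \<gamma> j\<close> would be at most \<open>c - 1\<close>.\<close>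
    define i where "i = h1 d + 1"
    define j where "j = m - i"
    have i: "i \<in> {1..m - 1}" and j: "j \<in> {1..m - 1}" "\<not> j \<le> h3 d" using n by (auto simp: i_def j_def)
    have "\<alpha> i \<le> d" using le_card_weights_iff[OF w(1) i, of d] by (simp add: i_def h1_def)
    moreover have "\<gamma> j \<le> c - 1 - d" using le_card_weights_iff[OF w(2) j(1), of "c - 1 - d"] j(2) by (simp add: h3_def)
    moreover have "c \<le> \<alpha> i + \<gamma> j" using bspec[OF c(2) i] by (simp add: j_def)
    ultimately show False using d by simp
  qed
  interpret three_columns m c h1 h2 h3
  proof
    show "h1 d + h2 d + h3 d = m" if "d < c" for d using upper[OF that] by (simp add: h2_def)
    show "h2 d \<le> 1" if "d < c" for d using lower[OF that] by (simp add: h2_def)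
  qed (rule m h1m h3m)+
  have card\<alpha>: "card {d \<in> {..<c}. d < \<alpha> i} = \<alpha> i" if "i \<in> {1..m - 1}" for i
  proof -
    have "{d \<in> {..<c}. d < \<alpha> i} = {..<\<alpha> i}" using \<alpha>c[OF that] by auto
    then show ?thesis by simp
  qed
  have card\<gamma>: "card {d \<in> {..<c}. c - 1 - d < \<gamma> i} = \<gamma> i" if "i \<in> {1..m - 1}" for i
  proof -
    have "{d \<in> {..<c}. c - 1 - d < \<gamma> i} = {c - \<gamma> i..<c}" using \<gamma>c[OF that] by auto
    then show ?thesis using \<gamma>c[OF that] by simp
  qed
  have w1: "column_weight c h1 i = \<alpha> i" if "i \<in> {1..m - 1}" for i
    unfolding column_weight_def h1_def using le_card_weights_iff[OF w(1) that] card\<alpha>[OF that] by simp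
  have w3: "column_weight c h3 i = \<gamma> i" if "i \<in> {1..m - 1}" for i
    unfolding column_weight_def h3_def using le_card_weights_iff[OF w(2) that] card\<gamma>[OF that] by simp
  have split: "(\<Sum>i = 1..m. f i) = (\<Sum>i = 1..m - 1. f i)" if "f m = 0" for f :: "nat \<Rightarrow> nat"
  proof -
    have "{1..m} = insert m {1..m - 1}" using m by auto
    then show ?thesis using that m by simp
  qed
  have "(\<Sum>d<c. h1 d) = (\<Sum>i = 1..m - 1. card {d \<in> {..<c}. d < \<alpha> i})" unfolding h1_def by (rule sum_card_swap) auto
  also have "\<dots> = (\<Sum>i = 1..m - 1. \<alpha> i)" by (rule sum.cong[OF refl card\<alpha>])
  finally have s1: "(\<Sum>d<c. h1 d) = (\<Sum>i = 1..m. \<alpha> i)" using split[of \<alpha>] z by simp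
  have "(\<Sum>d<c. h3 d) = (\<Sum>i = 1..m - 1. card {d \<in> {..<c}. c - 1 - d < \<gamma> i})" unfolding h3_def by (rule sum_card_swap) auto
  also have "\<dots> = (\<Sum>i = 1..m - 1. \<gamma> i)" by (rule sum.cong[OF refl card\<gamma>])
  finally have s3: "(\<Sum>d<c. h3 d) = (\<Sum>i = 1..m. \<gamma> i)" using split[of \<gamma>] z by simp
  have "(\<Sum>d<c. h1 d + h2 d + h3 d) = (\<Sum>d<c. m)" by (rule sum.cong) (use total in auto)
  then have "(\<Sum>d<c. h1 d) + (\<Sum>d<c. h2 d) + (\<Sum>d<c. h3 d) = m * c" by (simp add: sum.distrib mult.commute)
  then have s2: "(\<Sum>d<c. h2 d) = r" using c(3) s1 s3 by simp
  have w2: "column_weight c h2 i = r * fundamental_weight 1 i" if i: "i \<in> {1..m - 1}" for i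
  proof (cases "i = 1")
    case True
    have "column_weight c h2 i = (\<Sum>d<c. if 1 \<le> h2 d then 1 else 0)"
      unfolding column_weight_def True using sum.inter_filter[of "{..<c}" "\<lambda>_. 1 :: nat" "\<lambda>d. 1 \<le> h2 d"] by simp
    also have "\<dots> = (\<Sum>d<c. h2 d)" by (rule sum.cong[OF refl]) (use h2 in fastforce)
    finally show ?thesis using s2 True by (simp add: fundamental_weight_def)
  next
    case False
    then have i1: "1 < i" using i by auto
    have "\<not> i \<le> h2 d" if "d < c" for d using h2[OF that] i1 by simp
    then have "{d \<in> {..<c}. i \<le> h2 d} = {}" by auto
    then have "column_weight c h2 i = 0" by (simp add: column_weight_def)
    then show ?thesis using i1 by (simp add: fundamental_weight_def)
  qed
  show ?thesis by (rule has_triple_invariant_cong[OF triple_invariant w1 w2 w3])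
qed

lemma pieri_of_has_triple_invariant:
  assumes w: "\<alpha> \<in> weights m" "\<gamma> \<in> weights m" and m: "2 \<le> m"
    and inv: "has_triple_invariant m \<alpha> (\<lambda>j. r * fundamental_weight 1 j) \<gamma>"
  shows "pieri_condition m \<alpha> r \<gamma>"
proof -
  obtain d1 \<rho>1 d2 \<rho>2 d3 \<rho>3 where V: "is_V m \<alpha> d1 \<rho>1" "is_V m (\<lambda>j. r * fundamental_weight 1 j) d2 \<rho>2" "is_V m \<gamma> d3 \<rho>3"
    and i: "invariants m (d1 * d2 * d3) (\<lambda>g. kronecker (kronecker (\<rho>1 g) (\<rho>2 g)) (\<rho>3 g)) \<noteq> {0\<^sub>v (d1 * d2 * d3)}"
    by (rule has_triple_invariantE[OF inv])
  have r: "\<rho>1 g \<in> carrier_mat d1 d1" "\<rho>2 g \<in> carrier_mat d2 d2" "\<rho>3 g \<in> carrier_mat d3 d3" if "g \<in> SL m" for g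
    using V that by (auto simp: is_V_def rational_rep_def)
  have "0\<^sub>v (d1 * d2 * d3) \<in> invariants m (d1 * d2 * d3) (\<lambda>g. kronecker (kronecker (\<rho>1 g) (\<rho>2 g)) (\<rho>3 g))"
    unfolding invariants_def
    using mat_mult_zero_vec[OF kronecker_carrier[OF kronecker_carrier[OF r(1,2)] r(3)]] by auto
  then obtain t where t: "t \<in> invariants m (d1 * d2 * d3) (\<lambda>g. kronecker (kronecker (\<rho>1 g) (\<rho>2 g)) (\<rho>3 g))"
    "t \<noteq> 0\<^sub>v (d1 * d2 * d3)" using i by auto
  have tc: "t \<in> carrier_vec (d1 * d2 * d3)" and tg: "\<And>g. g \<in> SL m \<Longrightarrow> kronecker (kronecker (\<rho>1 g) (\<rho>2 g)) (\<rho>3 g) *\<^sub>v t = t"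
    using t(1) by (auto simp: invariants_def)
  obtain x where x: "x < d1 * d2 * d3" "t $ x \<noteq> 0" by (rule nonzero_vec_entry[OF tc t(2)])
  obtain i j k where ijk: "i < d1" "j < d2" "k < d3" "x = triple_index d2 d3 i j k" by (rule triple_index_cases[OF x(1)])
  show ?thesis
  proof (rule pieri_condition_of_invariant[OF V w m, where T = "\<lambda>i j k. t $ triple_index d2 d3 i j k"])
    show "t $ triple_index d2 d3 i j k \<noteq> 0" using x(2) ijk(4) by simp
    fix g i j k assume l: "g \<in> SL m" "i < d1" "j < d2" "k < d3"
    show "(\<Sum>i'<d1. \<Sum>j'<d2. \<Sum>k'<d3. \<rho>1 g $$ (i, i') * \<rho>2 g $$ (j, j') * \<rho>3 g $$ (k, k') * t $ triple_index d2 d3 i' j' k') =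
      t $ triple_index d2 d3 i j k"
      using kronecker3_vec_index[OF r[OF l(1)] tc l(2-4)] tg[OF l(1)] by simp
  qed (use ijk in auto)
qed

theorem has_triple_invariant_iff_pieri:
  assumes "\<alpha> \<in> weights m" "\<gamma> \<in> weights m" "2 \<le> m"
  shows "has_triple_invariant m \<alpha> (\<lambda>j. r * fundamental_weight 1 j) \<gamma> \<longleftrightarrow> pieri_condition m \<alpha> r \<gamma>"
  using has_triple_invariant_of_pieri[OF assms] pieri_of_has_triple_invariant[OF assms] by blast

section \<open>Duality\<close>

text \<open>The coefficients of the fundamental weights that reach position \<open>j\<close>
  telescope. The result is the reversed and negated weight, shifted to be non-negative.\<close>

lemma dual_weight_eq:
  assumes \<mu>: "\<mu> \<in> weights m"
  shows "dual_weight m \<mu> j = (if j \<in> {1..m - 1} then \<mu> 1 - \<mu> (m + 1 - j) else 0)"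
proof (cases "j \<in> {1..m - 1}")
  case True
  have tele: "(\<Sum>i = 1..n. \<mu> i - \<mu> (i + 1)) = \<mu> 1 - \<mu> (n + 1)" for n
  proof (induction n)
    case (Suc n)
    have le: "\<mu> (Suc n + 1) \<le> \<mu> (Suc n)" using weights_step[OF \<mu>, of "Suc n"] by simp
    have "\<mu> (n + 1) \<le> \<mu> 1" for n
    proof (induction n)
      case (Suc n)
      then show ?case using weights_step[OF \<mu>, of "Suc n"] by simp
    qed simp
    from this[of n] show ?case using Suc le by simp
  qed simp
  have "dual_weight m \<mu> j = (\<Sum>i = 1..m - 1. if i \<le> m - j then \<mu> i - \<mu> (i + 1) else 0)"
    unfolding dual_weight_def using True by (intro sum.cong) (auto simp: fundamental_weight_def)
  also have "\<dots> = (\<Sum>i\<in>{i \<in> {1..m - 1}. i \<le> m - j}. \<mu> i - \<mu> (i + 1))"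
    by (rule sum.inter_filter[symmetric]) simp
  also have "{i \<in> {1..m - 1}. i \<le> m - j} = {1..m - j}" using True by auto
  finally have "dual_weight m \<mu> j = \<mu> 1 - \<mu> (m - j + 1)" unfolding tele .
  moreover have "m - j + 1 = m + 1 - j" using True by auto
  ultimately show ?thesis using True by simp
next
  case False
  then have "dual_weight m \<mu> j = (\<Sum>i = 1..m - 1. 0)"
    unfolding dual_weight_def by (intro sum.cong) (auto simp: fundamental_weight_def)
  then show ?thesis using False by auto
qed

section \<open>The inverse transpose automorphism\<close>

lemma adj_SL:
  assumes "g \<in> SL m"
  shows "adj_mat g \<in> SL m" "g * adj_mat g = 1\<^sub>m m" "adj_mat g * g = 1\<^sub>m m"
proof -
  from assms have g: "g \<in> carrier_mat m m" "det g = 1" by (auto simp: SL_def)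
  have a: "adj_mat g \<in> carrier_mat m m" "g * adj_mat g = 1\<^sub>m m" "adj_mat g * g = 1\<^sub>m m"
    using adj_mat[OF g(1)] g(2) by auto
  have "det g * det (adj_mat g) = 1" using det_mult[OF g(1) a(1)] a(2) by simp
  then show "adj_mat g \<in> SL m" "g * adj_mat g = 1\<^sub>m m" "adj_mat g * g = 1\<^sub>m m"
    using g a by (auto simp: SL_def)
qed

lemma adj_unique:
  assumes g: "g \<in> SL m" and h: "h \<in> carrier_mat m m" "g * h = 1\<^sub>m m"
  shows "adj_mat g = h"
proof -
  have c: "g \<in> carrier_mat m m" "adj_mat g \<in> carrier_mat m m" using SL_carrier[OF g] SL_carrier[OF adj_SL(1)[OF g]] by auto
  have "adj_mat g = adj_mat g * (g * h)" using h c by simp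
  also have "\<dots> = adj_mat g * g * h" by (rule assoc_mult_mat[OF c(2,1) h(1), symmetric])
  also have "\<dots> = h" using adj_SL(3)[OF g] h by simp
  finally show ?thesis .
qed

text \<open>The inverse transpose, conjugated by the longest Weyl group element so that it preserves the
  upper triangular matrices.\<close>

definition dual_aut :: "nat \<Rightarrow> complex mat \<Rightarrow> complex mat"
  where "dual_aut m g = mat m m (\<lambda>(i, j). adj_mat g $$ (m - 1 - j, m - 1 - i))"

lemma dual_aut_carrier [simp]: "dual_aut m g \<in> carrier_mat m m"
  by (simp add: dual_aut_def)

lemma dual_aut_mult_index:
  assumes A: "A \<in> carrier_mat m m" "B \<in> carrier_mat m m"
  shows "mat m m (\<lambda>(i, j). A $$ (m - 1 - j, m - 1 - i)) * mat m m (\<lambda>(i, j). B $$ (m - 1 - j, m - 1 - i)) =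
    mat m m (\<lambda>(i, j). (B * A) $$ (m - 1 - j, m - 1 - i) :: complex)"
proof (intro eq_matI)
  fix i j assume "i < dim_row (mat m m (\<lambda>(i, j). (B * A) $$ (m - 1 - j, m - 1 - i)))"
    "j < dim_col (mat m m (\<lambda>(i, j). (B * A) $$ (m - 1 - j, m - 1 - i)))"
  then have ij: "i < m" "j < m" by auto
  have "(mat m m (\<lambda>(i, j). A $$ (m - 1 - j, m - 1 - i)) * mat m m (\<lambda>(i, j). B $$ (m - 1 - j, m - 1 - i))) $$ (i, j) =
    (\<Sum>l<m. A $$ (m - 1 - l, m - 1 - i) * B $$ (m - 1 - j, m - 1 - l))"
    using ij by (subst mult_mat_index[of _ m m _ m]) (auto intro!: sum.cong)
  also have "\<dots> = (\<Sum>l<m. B $$ (m - 1 - j, m - Suc l) * A $$ (m - Suc l, m - 1 - i))"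
    by (intro sum.cong) (auto simp: mult.commute)
  also have "\<dots> = (\<Sum>l<m. B $$ (m - 1 - j, l) * A $$ (l, m - 1 - i))"
    by (rule sum.nat_diff_reindex)
  also have "\<dots> = (B * A) $$ (m - 1 - j, m - 1 - i)"
    using ij by (intro mult_mat_index[OF A(2,1), symmetric]) auto
  finally show "(mat m m (\<lambda>(i, j). A $$ (m - 1 - j, m - 1 - i)) * mat m m (\<lambda>(i, j). B $$ (m - 1 - j, m - 1 - i))) $$ (i, j) =
    mat m m (\<lambda>(i, j). (B * A) $$ (m - 1 - j, m - 1 - i)) $$ (i, j)" using ij by simp
qed auto

lemma reverse_one: "mat m m (\<lambda>(i, j). 1\<^sub>m m $$ (m - 1 - j, m - 1 - i)) = (1\<^sub>m m :: complex mat)"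
  by (intro eq_matI) auto

lemma dual_aut_SL:
  assumes g: "g \<in> SL m"
  shows "dual_aut m g \<in> SL m"
proof -
  have "det (dual_aut m g) = det (transpose_mat (adj_mat g))"
  proof -
    have c: "adj_mat g \<in> carrier_mat m m" by (rule SL_carrier[OF adj_SL(1)[OF g]])
    have "det (dual_aut m g) = det (mat m m (\<lambda>(i, j). adj_mat g $$ (j, i)))"
      unfolding dual_aut_def by (rule det_reverse[of m "\<lambda>i j. adj_mat g $$ (j, i)"])
    also have "mat m m (\<lambda>(i, j). adj_mat g $$ (j, i)) = transpose_mat (adj_mat g)"
      using c by (intro eq_matI) auto
    finally show ?thesis .
  qed
  also have "\<dots> = det (adj_mat g)" by (rule det_transpose[OF SL_carrier[OF adj_SL(1)[OF g]]])
  also have "\<dots> = 1" using adj_SL(1)[OF g] by (simp add: SL_def)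
  finally show ?thesis by (simp add: SL_def)
qed

lemma dual_aut_mult:
  assumes g: "g \<in> SL m" and h: "h \<in> SL m"
  shows "dual_aut m (g * h) = dual_aut m g * dual_aut m h"
proof -
  note c = SL_carrier[OF g] SL_carrier[OF h] SL_carrier[OF adj_SL(1)[OF g]] SL_carrier[OF adj_SL(1)[OF h]]
  have "g * h * (adj_mat h * adj_mat g) = g * (h * (adj_mat h * adj_mat g))"
    by (rule assoc_mult_mat[OF c(1,2) mult_carrier_mat[OF c(4,3)]])
  also have "h * (adj_mat h * adj_mat g) = h * adj_mat h * adj_mat g" by (rule assoc_mult_mat[OF c(2,4,3), symmetric])
  finally have "g * h * (adj_mat h * adj_mat g) = 1\<^sub>m m" using adj_SL(2)[OF g] adj_SL(2)[OF h] c by simp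
  then have "adj_mat (g * h) = adj_mat h * adj_mat g"
    by (rule adj_unique[OF SL_mult[OF g h] mult_carrier_mat[OF c(4,3)]])
  then show ?thesis unfolding dual_aut_def using dual_aut_mult_index[OF c(3,4)] by simp
qed

lemma dual_aut_one: "dual_aut m (1\<^sub>m m) = 1\<^sub>m m"
proof -
  have "adj_mat (1\<^sub>m m :: complex mat) = 1\<^sub>m m" by (rule adj_unique[OF SL_one]) auto
  then show ?thesis unfolding dual_aut_def using reverse_one by simp
qed

lemma dual_aut_involution:
  assumes g: "g \<in> SL m"
  shows "dual_aut m (dual_aut m g) = g"
proof -
  define G where "G = mat m m (\<lambda>(i, j). g $$ (m - 1 - j, m - 1 - i))"
  have "dual_aut m g * G = 1\<^sub>m m"
    unfolding dual_aut_def G_def dual_aut_mult_index[OF SL_carrier[OF adj_SL(1)[OF g]] SL_carrier[OF g]] adj_SL(2)[OF g]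
    by (rule reverse_one)
  then have "adj_mat (dual_aut m g) = G" by (intro adj_unique[OF dual_aut_SL[OF g]]) (simp_all add: G_def)
  then show ?thesis unfolding dual_aut_def[of m "dual_aut m g"] G_def using SL_carrier[OF g] by (intro eq_matI) auto
qed

text \<open>In \<open>adj_mat b * b = 1\<close>, induction along the columns reduces the entry (i,
  j) below the diagonal to the single term \<open>adj_mat b $$ (i, j) * b $$ (j, j)\<close>, and the
  diagonal of \<open>b\<close> has no zero.\<close>

lemma adj_upper:
  assumes b: "b \<in> SL_upper m"
  shows "i < m \<Longrightarrow> j < i \<Longrightarrow> adj_mat b $$ (i, j) = 0" "i < m \<Longrightarrow> adj_mat b $$ (i, i) * b $$ (i, i) = 1"
proof -
  have bS: "b \<in> SL m" by (rule SL_upperD(1)[OF b])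
  note c = SL_carrier[OF bS] SL_carrier[OF adj_SL(1)[OF bS]]
  have "(\<Prod>i<m. b $$ (i, i)) = 1" using det_upper[OF c(1) SL_upperD(2)[OF b]] bS by (simp add: SL_def)
  then have nz: "b $$ (i, i) \<noteq> 0" if "i < m" for i
    using prod_zero[of "{..<m}" "\<lambda>i. b $$ (i, i)"] that by force
  have e: "(\<Sum>l<m. adj_mat b $$ (i, l) * b $$ (l, j)) = (if i = j then 1 else 0)" if "i < m" "j < m" for i j
    using mult_mat_index[OF c(2,1) that] adj_SL(3)[OF bS] that by simp
  have low: "adj_mat b $$ (i, j) = 0" if i: "i < m" and j: "j < i" for i j
    using j
  proof (induction j rule: less_induct)
    case (less j)
    have "(\<Sum>l<m. adj_mat b $$ (i, l) * b $$ (l, j)) = (\<Sum>l<m. if l = j then adj_mat b $$ (i, j) * b $$ (j, j) else 0)"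
    proof (rule sum.cong[OF refl])
      fix l assume "l \<in> {..<m}"
      then show "adj_mat b $$ (i, l) * b $$ (l, j) = (if l = j then adj_mat b $$ (i, j) * b $$ (j, j) else 0)"
        using less SL_upperD(2)[OF b] by (cases l j rule: linorder_cases) auto
    qed
    then have "adj_mat b $$ (i, j) * b $$ (j, j) = 0" using e[of i j] less.prems i by simp
    then show ?case using nz[of j] less.prems i by simp
  qed
  show "i < m \<Longrightarrow> j < i \<Longrightarrow> adj_mat b $$ (i, j) = 0" by (rule low)
  assume i: "i < m"
  have "(\<Sum>l<m. adj_mat b $$ (i, l) * b $$ (l, i)) = (\<Sum>l<m. if l = i then adj_mat b $$ (i, i) * b $$ (i, i) else 0)"
  proof (rule sum.cong[OF refl])
    fix l assume "l \<in> {..<m}"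
    then show "adj_mat b $$ (i, l) * b $$ (l, i) = (if l = i then adj_mat b $$ (i, i) * b $$ (i, i) else 0)"
      using low[OF i, of l] SL_upperD(2)[OF b, of l i] by (cases l i rule: linorder_cases) auto
  qed
  then show "adj_mat b $$ (i, i) * b $$ (i, i) = 1" using e[OF i i] i by simp
qed

lemma dual_aut_upper:
  assumes b: "b \<in> SL_upper m"
  shows "dual_aut m b \<in> SL_upper m"
  using dual_aut_SL[OF SL_upperD(1)[OF b]] adj_upper(1)[OF b] by (auto simp: SL_upper_def dual_aut_def)

lemma dual_weight_weights:
  assumes \<mu>: "\<mu> \<in> weights m"
  shows "dual_weight m \<mu> \<in> weights m"
proof -
  have mono: "\<mu> l \<le> \<mu> k" if "1 \<le> k" "k \<le> l" for k l
    using that(2)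
  proof (induction l rule: dec_induct)
    case (step l)
    then show ?case using weights_step[OF \<mu>, of l] that(1) by simp
  qed simp
  show ?thesis
    unfolding weights_def mem_Collect_eq dual_weight_eq[OF \<mu>]
  proof (intro conjI allI impI)
    fix i j assume ij: "1 \<le> i \<and> i \<le> j \<and> j \<le> m - 1"
    then have "\<mu> (m + 1 - i) \<le> \<mu> (m + 1 - j)" by (intro mono) auto
    then show "(if j \<in> {1..m - 1} then \<mu> 1 - \<mu> (m + 1 - j) else 0) \<le> (if i \<in> {1..m - 1} then \<mu> 1 - \<mu> (m + 1 - i) else 0)"
      using ij by auto
  qed auto
qed

lemma hw_char_dual:
  assumes b: "b \<in> SL_upper m" and \<mu>: "\<mu> \<in> weights m" and m: "2 \<le> m"
  shows "hw_char m \<mu> (dual_aut m b) = hw_char m (dual_weight m \<mu>) b"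
proof -
  have bS: "b \<in> SL m" by (rule SL_upperD(1)[OF b])
  have pd: "(\<Prod>i<m. b $$ (i, i)) = 1" using det_upper[OF SL_carrier[OF bS] SL_upperD(2)[OF b]] bS by (simp add: SL_def)
  have "hw_char m \<mu> (dual_aut m b) = (\<Prod>i<m. dual_aut m b $$ (i, i) ^ \<mu> (Suc i))"
    by (rule hw_char_weight) (use weights_at_rank[OF \<mu>] m in auto)
  also have "\<dots> = (\<Prod>i<m. adj_mat b $$ (m - Suc i, m - Suc i) ^ \<mu> (m - (m - Suc i)))"
    by (intro prod.cong) (auto simp: dual_aut_def)
  also have "\<dots> = (\<Prod>i<m. adj_mat b $$ (i, i) ^ \<mu> (m - i))"
    by (rule prod.nat_diff_reindex[of "\<lambda>i. adj_mat b $$ (i, i) ^ \<mu> (m - i)"])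
  \<comment> \<open>The determinant enters as 1 to the power \<open>\<mu> 1\<close>, so that the
    negative exponents from the inverse become \<open>\<mu> 1 - \<mu> (m - i)\<close>.\<close>
  also have "\<dots> = (\<Prod>i<m. adj_mat b $$ (i, i) ^ \<mu> (m - i)) * (\<Prod>i<m. b $$ (i, i)) ^ \<mu> 1" using pd by simp
  also have "\<dots> = (\<Prod>i<m. b $$ (i, i) ^ dual_weight m \<mu> (Suc i))"
    unfolding prod_power_distrib prod.distrib[symmetric]
  proof (rule prod.cong[OF refl])
    fix i assume "i \<in> {..<m}"
    then have i: "i < m" by simp
    have le: "\<mu> (m - i) \<le> \<mu> 1"
    proof (cases "m - i \<in> {1..m - 1}")
      case False
      then show ?thesis using \<mu> i weights_at_rank[OF \<mu>] m by (auto simp: weights_def)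
    qed (rule weights_le_first[OF \<mu>])
    have dw: "dual_weight m \<mu> (Suc i) = \<mu> 1 - \<mu> (m - i)"
      using dual_weight_eq[OF \<mu>, of "Suc i"] i m by (cases "i = m - 1") auto
    have "adj_mat b $$ (i, i) ^ \<mu> (m - i) * b $$ (i, i) ^ \<mu> 1 =
      (adj_mat b $$ (i, i) * b $$ (i, i)) ^ \<mu> (m - i) * b $$ (i, i) ^ (\<mu> 1 - \<mu> (m - i))"
      using le by (simp add: power_mult_distrib mult.assoc flip: power_add)
    then show "adj_mat b $$ (i, i) ^ \<mu> (m - i) * b $$ (i, i) ^ \<mu> 1 = b $$ (i, i) ^ dual_weight m \<mu> (Suc i)"
      using adj_upper(2)[OF b i] dw by simp
  qed
  also have "\<dots> = hw_char m (dual_weight m \<mu>) b"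
    by (rule hw_char_weight[symmetric]) (use weights_at_rank[OF dual_weight_weights[OF \<mu>]] m in auto)
  finally show ?thesis .
qed

section \<open>Twisting representations by the automorphism\<close>

lemma det_polynomial:
  assumes "\<And>i j. i < n \<Longrightarrow> j < n \<Longrightarrow> q i j \<in> polynomial_functions m"
  shows "(\<lambda>g. det (mat n n (\<lambda>(i, j). q i j g))) \<in> polynomial_functions m"
proof -
  have "(\<lambda>g. \<Sum>p\<in>{p. p permutes {0..<n}}. signof p * (\<Prod>i = 0..<n. q i (p i) g)) \<in> polynomial_functions m"
    by (intro polynomial_functions_sum polynomial_functions.mult polynomial_functions.const polynomial_functions_prod assms)
      (auto simp: permutes_in_image)
  moreover have "det (mat n n (\<lambda>(i, j). q i j g)) = (\<Sum>p\<in>{p. p permutes {0..<n}}. signof p * (\<Prod>i = 0..<n. q i (p i) g))" for g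
    by (subst det_def'[of _ n]) (auto intro!: sum.cong prod.cong simp: permutes_in_image)
  ultimately show ?thesis by simp
qed

text \<open>The inverse is taken as the adjugate, whose entries are cofactors and hence
  polynomial.\<close>

lemma dual_aut_entry_polynomial:
  assumes "i < m" "j < m"
  shows "\<exists>q \<in> polynomial_functions m. \<forall>g \<in> SL m. dual_aut m g $$ (i, j) = q g"
proof -
  define k where "k = m - 1 - i"
  define l where "l = m - 1 - j"
  have kl: "k < m" "l < m" using assms by (auto simp: k_def l_def)
  define q where "q g = (-1) ^ (k + l) * det (mat (m - 1) (m - 1)
    (\<lambda>(i', j'). g $$ (if i' < k then i' else Suc i', if j' < l then j' else Suc j')))" for g :: "complex mat"
  have "q \<in> polynomial_functions m"
    unfolding q_def
    by (rule polynomial_functions.mult[OF polynomial_functions.const det_polynomial[of "m - 1" "\<lambda>i' j' g. g $$ (if i' < k then i' else Suc i', if j' < l then j' else Suc j')"]])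
      (rule polynomial_functions.entry, use kl in auto)
  moreover have "dual_aut m g $$ (i, j) = q g" if "g \<in> SL m" for g
  proof -
    have g: "g \<in> carrier_mat m m" by (rule SL_carrier[OF that])
    have "dual_aut m g $$ (i, j) = adj_mat g $$ (l, k)" using assms by (simp add: dual_aut_def k_def l_def)
    also have "\<dots> = cofactor g k l" using g kl by (simp add: adj_mat_def)
    also have "\<dots> = q g" unfolding cofactor_def mat_delete_def q_def using g by simp
    finally show ?thesis .
  qed
  ultimately show ?thesis by (intro bexI[of _ q]) auto
qed

lemma polynomial_dual_aut:
  assumes "p \<in> polynomial_functions m"
  shows "\<exists>q \<in> polynomial_functions m. \<forall>g \<in> SL m. p (dual_aut m g) = q g"
  using assms
proof (induction rule: polynomial_functions.induct)
  case (const c)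
  show ?case by (intro bexI[of _ "\<lambda>g. c"] polynomial_functions.const) simp
next
  case (entry i j)
  then show ?case by (rule dual_aut_entry_polynomial)
next
  case (add p p')
  obtain q where q: "q \<in> polynomial_functions m" "\<forall>g \<in> SL m. p (dual_aut m g) = q g" using add.IH(1) by auto
  obtain q' where q': "q' \<in> polynomial_functions m" "\<forall>g \<in> SL m. p' (dual_aut m g) = q' g" using add.IH(2) by auto
  show ?case by (intro bexI[of _ "\<lambda>g. q g + q' g"] polynomial_functions.add q(1) q'(1)) (use q(2) q'(2) in simp)
next
  case (mult p p')
  obtain q where q: "q \<in> polynomial_functions m" "\<forall>g \<in> SL m. p (dual_aut m g) = q g" using mult.IH(1) by auto
  obtain q' where q': "q' \<in> polynomial_functions m" "\<forall>g \<in> SL m. p' (dual_aut m g) = q' g" using mult.IH(2) by auto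
  show ?case by (intro bexI[of _ "\<lambda>g. q g * q' g"] polynomial_functions.mult q(1) q'(1)) (use q(2) q'(2) in simp)
qed

text \<open>Twisting by an automorphism that preserves \<open>SL_upper\<close> keeps the invariant
  subspaces and the highest weight vector; only its character changes.\<close>

lemma is_V_dual:
  assumes V: "is_V m \<mu> d \<rho>" and \<mu>: "\<mu> \<in> weights m" and m: "2 \<le> m"
  shows "is_V m (dual_weight m \<mu>) d (\<lambda>g. \<rho> (dual_aut m g))"
proof -
  obtain v where "highest_weight_model m d \<rho> \<mu> v" by (rule is_V_model[OF V m])
  then interpret highest_weight_model m d \<rho> \<mu> v .
  have rat: "rational_rep m d (\<lambda>g. \<rho> (dual_aut m g))"
    unfolding rational_rep_def
  proof (intro conjI ballI allI impI)
    fix i j assume ij: "i < d" "j < d"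
    then have "\<exists>p \<in> polynomial_functions m. \<forall>g \<in> SL m. \<rho> g $$ (i, j) = p g"
      using rational unfolding rational_rep_def by simp
    then obtain p where p: "p \<in> polynomial_functions m" "\<forall>g \<in> SL m. \<rho> g $$ (i, j) = p g" by auto
    obtain q where q: "q \<in> polynomial_functions m" "\<forall>g \<in> SL m. p (dual_aut m g) = q g"
      using polynomial_dual_aut[OF p(1)] by auto
    show "\<exists>p\<in>polynomial_functions m. \<forall>g\<in>SL m. \<rho> (dual_aut m g) $$ (i, j) = p g"
      by (rule bexI[OF _ q(1)]) (use p(2) q(2) dual_aut_SL in auto)
  qed (auto simp: dual_aut_one rep_one dual_aut_mult dual_aut_SL rep_mult rep_carrier)
  have irr: "irreducible_rep m d (\<lambda>g. \<rho> (dual_aut m g))"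
    unfolding irreducible_rep_def
  proof (intro conjI allI impI)
    show "d > 0" using irreducible by (simp add: irreducible_rep_def)
    fix U assume U: "subspace class_ring U (module_vec TYPE(complex) d) \<and> (\<forall>g\<in>SL m. \<forall>u\<in>U. \<rho> (dual_aut m g) *\<^sub>v u \<in> U)"
    have "\<rho> g *\<^sub>v u \<in> U" if "g \<in> SL m" "u \<in> U" for g u
      using U dual_aut_SL[OF that(1)] dual_aut_involution[OF that(1)] that(2) by metis
    then show "U = {0\<^sub>v d} \<or> U = carrier_vec d"
      using stable_subspace[of U] U by (simp add: csubspace_iff)
  qed
  show ?thesis
    by (rule is_V_intro[OF rat irr v_carrier v_nonzero])
      (use v_upper[OF dual_aut_upper] hw_char_dual[OF _ \<mu> m] in simp)
qed

text \<open>\<open>dual_aut\<close> permutes the group, so the twisted action on the triple tensor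
  product has literally the same invariant vectors.\<close>

lemma has_triple_invariant_dual:
  assumes "has_triple_invariant m \<alpha> \<beta> \<gamma>" "\<alpha> \<in> weights m" "\<beta> \<in> weights m" "\<gamma> \<in> weights m" "2 \<le> m"
  shows "has_triple_invariant m (dual_weight m \<alpha>) (dual_weight m \<beta>) (dual_weight m \<gamma>)"
proof -
  obtain d1 \<rho>1 d2 \<rho>2 d3 \<rho>3 where V: "is_V m \<alpha> d1 \<rho>1" "is_V m \<beta> d2 \<rho>2" "is_V m \<gamma> d3 \<rho>3"
    and i: "invariants m (d1 * d2 * d3) (\<lambda>g. kronecker (kronecker (\<rho>1 g) (\<rho>2 g)) (\<rho>3 g)) \<noteq> {0\<^sub>v (d1 * d2 * d3)}"
    by (rule has_triple_invariantE[OF assms(1)])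
  have "invariants m (d1 * d2 * d3) (\<lambda>g. kronecker (kronecker (\<rho>1 (dual_aut m g)) (\<rho>2 (dual_aut m g))) (\<rho>3 (dual_aut m g))) =
    invariants m (d1 * d2 * d3) (\<lambda>g. kronecker (kronecker (\<rho>1 g) (\<rho>2 g)) (\<rho>3 g))"
    unfolding invariants_def using dual_aut_SL[of _ m] dual_aut_involution[of _ m] by (metis (no_types, lifting))
  with i show ?thesis unfolding has_triple_invariant_def
    using is_V_dual[OF V(1) assms(2,5)] is_V_dual[OF V(2) assms(3,5)] is_V_dual[OF V(3) assms(4,5)]
    by (intro exI[of _ d1] exI[of _ "\<lambda>g. \<rho>1 (dual_aut m g)"] exI[of _ d2] exI[of _ "\<lambda>g. \<rho>2 (dual_aut m g)"]
        exI[of _ d3] exI[of _ "\<lambda>g. \<rho>3 (dual_aut m g)"] conjI) simp_all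
qed

lemma dual_weight_involution:
  assumes \<mu>: "\<mu> \<in> weights m"
  shows "dual_weight m (dual_weight m \<mu>) = \<mu>"
proof
  fix j
  show "dual_weight m (dual_weight m \<mu>) j = \<mu> j"
  proof (cases "j \<in> {1..m - 1}")
    case True
    have z: "\<mu> m = 0" using weights_at_rank[OF \<mu>] True by auto
    show ?thesis
    proof (cases "j = 1")
      case True
      then show ?thesis
        using \<open>j \<in> {1..m - 1}\<close> dual_weight_eq[OF dual_weight_weights[OF \<mu>], of 1] dual_weight_eq[OF \<mu>, of 1] dual_weight_eq[OF \<mu>, of m] z
        by simp
    next
      case False
      have "dual_weight m \<mu> (m + 1 - j) = \<mu> 1 - \<mu> j"
        using dual_weight_eq[OF \<mu>, of "m + 1 - j"] True False by auto
      moreover have "dual_weight m \<mu> 1 = \<mu> 1" using dual_weight_eq[OF \<mu>, of 1] True z by auto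
      ultimately show ?thesis
        using dual_weight_eq[OF dual_weight_weights[OF \<mu>], of j] True weights_le_first[OF \<mu> True] by simp
    qed
  next
    case False
    then show ?thesis using dual_weight_eq[OF dual_weight_weights[OF \<mu>], of j] \<mu> by (auto simp: weights_def)
  qed
qed

section \<open>Affine semigroups\<close>

lemma comm_monoid_additive_monoid:
  assumes "0 \<in> S" "\<And>x y. x \<in> S \<Longrightarrow> y \<in> S \<Longrightarrow> x + y \<in> S"
  shows "comm_monoid (additive_monoid S)"
  by unfold_locales (use assms in \<open>auto simp: additive_monoid_def add_ac\<close>)

lemma additive_monoid_simps [simp]:
  "carrier (additive_monoid S) = S" "mult (additive_monoid S) = (+)" "one (additive_monoid S) = 0"
  by (simp_all add: additive_monoid_def)

lemma submonoid_additive_iff: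
  "submonoid H (additive_monoid S) \<longleftrightarrow> H \<subseteq> S \<and> (\<forall>x\<in>H. \<forall>y\<in>H. x + y \<in> H) \<and> 0 \<in> H"
  by (auto simp: submonoid_def)

section \<open>Finite generation by Gordan's lemma\<close>

text \<open>For the new index \<open>i\<close>, the elements with \<open>\<phi> i a \<ge> N\<close>
  already lie above the set \<open>F\<close> found for \<open>I\<close>; each of the finitely many
  slices \<open>\<phi> i a = k < N\<close> is treated by the induction hypothesis.\<close>

lemma dickson:
  fixes \<phi> :: "'i \<Rightarrow> 'a \<Rightarrow> nat"
  assumes "finite I"
  shows "\<exists>F. finite F \<and> F \<subseteq> A \<and> (\<forall>a\<in>A. \<exists>f\<in>F. \<forall>i\<in>I. \<phi> i f \<le> \<phi> i a)"
  using assms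
proof (induction I arbitrary: A rule: finite_induct)
  case empty
  show ?case
  proof (cases "A = {}")
    case False
    then obtain a where "a \<in> A" by auto
    then show ?thesis by (intro exI[of _ "{a}"]) auto
  qed auto
next
  case (insert i I)
  obtain F where F: "finite F" "F \<subseteq> A" "\<forall>a\<in>A. \<exists>f\<in>F. \<forall>i\<in>I. \<phi> i f \<le> \<phi> i a" using insert.IH[of A] by auto
  define N where "N = (\<Sum>f\<in>F. \<phi> i f)"
  have N: "\<phi> i f \<le> N" if "f \<in> F" for f unfolding N_def using F(1) that by (intro member_le_sum) auto
  have "\<forall>k. \<exists>G. finite G \<and> G \<subseteq> {a \<in> A. \<phi> i a = k} \<and> (\<forall>a\<in>{a \<in> A. \<phi> i a = k}. \<exists>f\<in>G. \<forall>i\<in>I. \<phi> i f \<le> \<phi> i a)"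
    using insert.IH by blast
  from choice[OF this] obtain G where G: "\<forall>k. finite (G k) \<and> G k \<subseteq> {a \<in> A. \<phi> i a = k} \<and>
    (\<forall>a\<in>{a \<in> A. \<phi> i a = k}. \<exists>f\<in>G k. \<forall>i\<in>I. \<phi> i f \<le> \<phi> i a)" ..
  have "\<exists>f\<in>F \<union> (\<Union>k<N. G k). \<forall>j\<in>insert i I. \<phi> j f \<le> \<phi> j a" if a: "a \<in> A" for a
  proof (cases "\<phi> i a < N")
    case True
    obtain f where "f \<in> G (\<phi> i a)" "\<forall>j\<in>I. \<phi> j f \<le> \<phi> j a" using G a by blast
    moreover have "\<phi> i f = \<phi> i a" using G \<open>f \<in> G (\<phi> i a)\<close> by auto
    ultimately show ?thesis using True by (intro bexI[of _ f]) auto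
  next
    case False
    obtain f where f: "f \<in> F" "\<forall>j\<in>I. \<phi> j f \<le> \<phi> j a" using F(3) a by blast
    have "\<phi> i f \<le> \<phi> i a" using N[OF f(1)] False by simp
    then show ?thesis using f by (intro bexI[of _ f]) auto
  qed
  then show ?case using F(1,2) G by (intro exI[of _ "F \<union> (\<Union>k<N. G k)"]) auto
qed

text \<open>Gordan's lemma: by Dickson's lemma, finitely many nonzero elements are minimal for the
  values of the functionals, and a minimal element below \<open>x\<close> can be subtracted from \<open>x\<close>.\<close>

lemma finitely_generated_of_functionals:
  fixes S :: "'a :: ab_group_add set" and \<Phi> :: "('a \<Rightarrow> int) set"
  assumes fin: "finite \<Phi>"
    and nonneg: "\<And>\<phi> x. \<phi> \<in> \<Phi> \<Longrightarrow> x \<in> S \<Longrightarrow> 0 \<le> \<phi> x"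
    and diff: "\<And>\<phi> x y. \<phi> \<in> \<Phi> \<Longrightarrow> \<phi> (x - y) = \<phi> x - \<phi> y"
    and closed: "\<And>x y. x \<in> S \<Longrightarrow> y \<in> S \<Longrightarrow> (\<And>\<phi>. \<phi> \<in> \<Phi> \<Longrightarrow> \<phi> x \<le> \<phi> y) \<Longrightarrow> y - x \<in> S"
    and zero: "\<And>x. x \<in> S \<Longrightarrow> (\<And>\<phi>. \<phi> \<in> \<Phi> \<Longrightarrow> \<phi> x = 0) \<Longrightarrow> x = 0"
  shows "\<exists>F. finite F \<and> F \<subseteq> S \<and> (\<forall>H. submonoid H (additive_monoid S) \<and> F \<subseteq> H \<longrightarrow> H = S)"
proof -
  obtain F where F: "finite F" "F \<subseteq> S - {0}" "\<forall>a\<in>S - {0}. \<exists>f\<in>F. \<forall>\<phi>\<in>\<Phi>. nat (\<phi> f) \<le> nat (\<phi> a)"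
    using dickson[OF fin, of "S - {0}" "\<lambda>\<phi> x. nat (\<phi> x)"] by auto
  have "H = S" if H: "submonoid H (additive_monoid S)" "F \<subseteq> H" for H
  proof -
    have Hs: "H \<subseteq> S" "0 \<in> H" "\<And>x y. x \<in> H \<Longrightarrow> y \<in> H \<Longrightarrow> x + y \<in> H"
      using H(1) unfolding submonoid_additive_iff by auto
    have "x \<in> H" if "x \<in> S" for x
      using that
    \<comment> \<open>The total of all functionals drops on subtracting \<open>f\<close>, because
      \<open>f\<close> is nonzero and so some functional is positive on it.\<close>
    proof (induction "\<Sum>\<phi>\<in>\<Phi>. nat (\<phi> x)" arbitrary: x rule: less_induct)
      case less
      show ?case
      proof (cases "x = 0")
        case False
        then obtain f where f: "f \<in> F" "\<forall>\<phi>\<in>\<Phi>. nat (\<phi> f) \<le> nat (\<phi> x)" using F(3) less.prems by auto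
        have fS: "f \<in> S" "f \<noteq> 0" using f(1) F(2) by auto
        have le: "\<phi> f \<le> \<phi> x" if "\<phi> \<in> \<Phi>" for \<phi>
          using f(2) that nonneg[OF that less.prems] by (auto simp: nat_le_iff)
        have S: "x - f \<in> S" by (rule closed[OF fS(1) less.prems le])
        obtain \<psi> where \<psi>: "\<psi> \<in> \<Phi>" "\<psi> f \<noteq> 0" using zero[OF fS(1)] fS(2) by auto
        have "(\<Sum>\<phi>\<in>\<Phi>. nat (\<phi> (x - f))) < (\<Sum>\<phi>\<in>\<Phi>. nat (\<phi> x))"
        proof (rule sum_strict_mono_ex1[OF fin])
          show "\<forall>\<phi>\<in>\<Phi>. nat (\<phi> (x - f)) \<le> nat (\<phi> x)" 
          proof
            fix \<phi> assume "\<phi> \<in> \<Phi>"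
            then show "nat (\<phi> (x - f)) \<le> nat (\<phi> x)"
              using diff[of \<phi> x f] nonneg[of \<phi> f] fS(1) by (intro nat_mono) linarith
          qed
          show "\<exists>\<phi>\<in>\<Phi>. nat (\<phi> (x - f)) < nat (\<phi> x)"
            using \<psi> diff[OF \<psi>(1), of x f] nonneg[OF \<psi>(1) fS(1)] le[OF \<psi>(1)] by (intro bexI[of _ \<psi>]) auto
        qed
        then have "x - f \<in> H" using less.hyps S by blast
        then have "f + (x - f) \<in> H" using Hs(3) f(1) H(2) by blast
        then show ?thesis by simp
      qed (use Hs in simp)
    qed
    then show ?thesis using Hs(1) by blast
  qed
  then show ?thesis using F(1,2) by (intro exI[of _ F]) auto
qed

text \<open>\<open>C\<close> consists of coordinates. In \<open>closed\<close>, differences of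
  coordinates need only be compared when they are non-negative on all of \<open>S\<close>, which
  suits cones cut out by inequalities between pairs of coordinates.\<close>

lemma affine_semigroup_of_functionals:
  fixes S :: "'a :: ab_group_add set" and C :: "('a \<Rightarrow> int) set"
  assumes fin: "finite C"
    and add: "\<And>c x y. c \<in> C \<Longrightarrow> c (x + y) = c x + c y"
    and sep: "\<And>x y. x \<in> S \<Longrightarrow> y \<in> S \<Longrightarrow> (\<And>c. c \<in> C \<Longrightarrow> c x = c y) \<Longrightarrow> x = y"
    and nonneg: "\<And>c x. c \<in> C \<Longrightarrow> x \<in> S \<Longrightarrow> 0 \<le> c x"
    and S0: "0 \<in> S" and Sadd: "\<And>x y. x \<in> S \<Longrightarrow> y \<in> S \<Longrightarrow> x + y \<in> S"
    and closed: "\<And>x y. x \<in> S \<Longrightarrow> y \<in> S \<Longrightarrow> (\<And>c. c \<in> C \<Longrightarrow> c x \<le> c y) \<Longrightarrow>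
      (\<And>c c'. c \<in> C \<Longrightarrow> c' \<in> C \<Longrightarrow> (\<And>z. z \<in> S \<Longrightarrow> c' z \<le> c z) \<Longrightarrow> c x - c' x \<le> c y - c' y) \<Longrightarrow> y - x \<in> S"
  shows "affine_semigroup (additive_monoid S)"
proof -
  have c0: "c 0 = 0" if "c \<in> C" for c using add[OF that, of 0 0] by simp
  have diff: "c (x - y) = c x - c y" if "c \<in> C" for c x y
    using add[OF that, of "x - y" y] by simp
  \<comment> \<open>The functionals for Gordan's lemma: the coordinates and all differences of two
    coordinates that are non-negative on \<open>S\<close>.\<close>
  define \<Phi> where "\<Phi> = C \<union> (\<lambda>(c, c') x. c x - c' x) ` {(c, c') \<in> C \<times> C. \<forall>z\<in>S. c' z \<le> c z}"
  have "finite {(c, c') \<in> C \<times> C. \<forall>z\<in>S. c' z \<le> c z}"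
    by (rule finite_subset[OF _ finite_cartesian_product[OF fin fin]]) auto
  then have "finite \<Phi>" unfolding \<Phi>_def using fin by simp
  then have fg: "\<exists>F. finite F \<and> F \<subseteq> S \<and> (\<forall>H. submonoid H (additive_monoid S) \<and> F \<subseteq> H \<longrightarrow> H = S)"
  proof (rule finitely_generated_of_functionals)
    show "0 \<le> \<phi> x" if "\<phi> \<in> \<Phi>" "x \<in> S" for \<phi> x
      using that nonneg[of \<phi> x] by (auto simp: \<Phi>_def)
    show "\<phi> (x - y) = \<phi> x - \<phi> y" if "\<phi> \<in> \<Phi>" for \<phi> x y
    proof -
      from that consider "\<phi> \<in> C" | c c' where "c \<in> C" "c' \<in> C" "\<phi> = (\<lambda>x. c x - c' x)"
        by (auto simp: \<Phi>_def)
      then show ?thesis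
      proof cases
        case 1
        then show ?thesis by (rule diff)
      next
        case 2
        then show ?thesis using diff[OF 2(1), of x y] diff[OF 2(2), of x y] by simp
      qed
    qed
    show "y - x \<in> S" if "x \<in> S" "y \<in> S" "\<And>\<phi>. \<phi> \<in> \<Phi> \<Longrightarrow> \<phi> x \<le> \<phi> y" for x y
    proof (rule closed[OF that(1,2)])
      show "c x \<le> c y" if "c \<in> C" for c using that \<open>\<And>\<phi>. \<phi> \<in> \<Phi> \<Longrightarrow> \<phi> x \<le> \<phi> y\<close> by (simp add: \<Phi>_def)
      fix c c' assume cc: "c \<in> C" "c' \<in> C" "\<And>z. z \<in> S \<Longrightarrow> c' z \<le> c z"
      have "(\<lambda>x. c x - c' x) \<in> \<Phi>" unfolding \<Phi>_def using cc by (intro UnI2 image_eqI[of _ _ "(c, c')"]) auto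
      from that(3)[OF this] show "c x - c' x \<le> c y - c' y" .
    qed
    show "x = 0" if "x \<in> S" "\<And>\<phi>. \<phi> \<in> \<Phi> \<Longrightarrow> \<phi> x = 0" for x
    proof (rule sep[OF that(1) S0])
      fix c assume "c \<in> C"
      then show "c x = c 0" using that(2)[of c] c0[OF \<open>c \<in> C\<close>] by (simp add: \<Phi>_def)
    qed
  qed
  obtain e where e: "bij_betw e {1..card C} C" using ex_bij_betw_nat_finite_1[OF fin] by auto
  define f where "f x n = (if n \<in> {1..card C} then e n x else 0)" for x n
  have "f \<in> hom (additive_monoid S) (additive_monoid {x :: nat \<Rightarrow> int. \<forall>i. i \<notin> {1..card C} \<longrightarrow> x i = 0})"
  proof -
    have "f (x + y) = f x + f y" for x y
    proof
      fix n
      show "f (x + y) n = (f x + f y) n"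
        using add[of "e n" x y] bij_betwE[OF e] by (auto simp: f_def)
    qed
    then show ?thesis by (simp add: hom_def f_def)
  qed
  moreover have "inj_on f S"
  proof (rule inj_onI)
    fix x y assume xy: "x \<in> S" "y \<in> S" "f x = f y"
    show "x = y"
    proof (rule sep[OF xy(1,2)])
      fix c assume "c \<in> C"
      then obtain n where "n \<in> {1..card C}" "c = e n" using e unfolding bij_betw_def by blast
      then show "c x = c y" using fun_cong[OF xy(3), of n] by (simp add: f_def)
    qed
  qed
  ultimately show ?thesis unfolding affine_semigroup_def additive_monoid_simps
    using comm_monoid_additive_monoid[of S, OF S0 Sadd] fg
    by (intro conjI exI[of _ "card C"] bexI[of _ f])
qed

text \<open>Generators are pushed forward along \<open>\<Phi>\<close>, and the embedding is composed
  with its inverse.\<close>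

lemma affine_semigroup_image:
  fixes \<Phi> :: "'a :: comm_monoid_add \<Rightarrow> 'b :: comm_monoid_add"
  assumes aff: "affine_semigroup (additive_monoid W)"
    and bij: "bij_betw \<Phi> W L" and add: "\<And>x y. x \<in> W \<Longrightarrow> y \<in> W \<Longrightarrow> \<Phi> (x + y) = \<Phi> x + \<Phi> y"
    and zero: "\<Phi> 0 = 0"
  shows "affine_semigroup (additive_monoid L)" "additive_monoid L \<cong> additive_monoid W"
proof -
  interpret W: comm_monoid "additive_monoid W" using aff by (simp add: affine_semigroup_def)
  have W0: "0 \<in> W" and Wadd: "\<And>x y. x \<in> W \<Longrightarrow> y \<in> W \<Longrightarrow> x + y \<in> W"
    using W.one_closed W.m_closed by simp_all
  have im: "\<Phi> ` W = L" and inj: "inj_on \<Phi> W" using bij by (auto simp: bij_betw_def)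
  have L0: "0 \<in> L" using imageI[OF W0, of \<Phi>] im zero by simp
  have Ladd: "x + y \<in> L" if xy: "x \<in> L" "y \<in> L" for x y
  proof -
    obtain u v where "u \<in> W" "v \<in> W" "x = \<Phi> u" "y = \<Phi> v" using xy im by auto
    then show ?thesis using add[of u v] imageI[OF Wadd[of u v], of \<Phi>] im by simp
  qed
  define \<Psi> where "\<Psi> = the_inv_into W \<Phi>"
  have \<Psi>: "\<Psi> (\<Phi> x) = x" if "x \<in> W" for x unfolding \<Psi>_def using the_inv_into_f_f[OF inj that] .
  have \<Psi>bij: "bij_betw \<Psi> L W" unfolding \<Psi>_def by (rule bij_betw_the_inv_into[OF bij])
  have \<Psi>add: "\<Psi> (x + y) = \<Psi> x + \<Psi> y" if xy: "x \<in> L" "y \<in> L" for x y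
  proof -
    obtain u v where uv: "u \<in> W" "v \<in> W" "x = \<Phi> u" "y = \<Phi> v" using xy im by auto
    then show ?thesis using add[OF uv(1,2)] \<Psi>[OF Wadd[OF uv(1,2)]] \<Psi> by simp
  qed
  have "\<Psi> \<in> iso (additive_monoid L) (additive_monoid W)"
    using \<Psi>bij \<Psi>add by (auto simp: iso_def hom_def bij_betw_def)
  then show "additive_monoid L \<cong> additive_monoid W" unfolding is_iso_def by blast
  obtain F where F: "finite F" "F \<subseteq> W" "\<forall>H. submonoid H (additive_monoid W) \<and> F \<subseteq> H \<longrightarrow> H = W"
    using aff unfolding affine_semigroup_def by auto
  have gen: "H = L" if H: "submonoid H (additive_monoid L)" "\<Phi> ` F \<subseteq> H" for H
  proof -
    have Hs: "H \<subseteq> L" "0 \<in> H" "\<And>x y. x \<in> H \<Longrightarrow> y \<in> H \<Longrightarrow> x + y \<in> H"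
      using H(1) unfolding submonoid_additive_iff by auto
    define H' where "H' = {x \<in> W. \<Phi> x \<in> H}"
    have "submonoid H' (additive_monoid W)"
      unfolding submonoid_additive_iff H'_def using Hs W0 Wadd zero add by auto
    moreover have "F \<subseteq> H'" using F(2) H(2) by (auto simp: H'_def)
    ultimately have "H' = W" using F(3) by blast
    then have "L \<subseteq> H" using im by (auto simp: H'_def)
    then show ?thesis using Hs(1) by blast
  qed
  obtain N f where f: "f \<in> hom (additive_monoid W) (additive_monoid {x :: nat \<Rightarrow> int. \<forall>i. i \<notin> {1..N} \<longrightarrow> x i = 0})"
    "inj_on f W"
    using aff unfolding affine_semigroup_def by auto
  have "f \<circ> \<Psi> \<in> hom (additive_monoid L) (additive_monoid {x :: nat \<Rightarrow> int. \<forall>i. i \<notin> {1..N} \<longrightarrow> x i = 0})"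
    using f(1) \<Psi>add bij_betwE[OF \<Psi>bij] by (auto simp: hom_def Pi_iff)
  moreover have "inj_on (f \<circ> \<Psi>) L"
    using f(2) \<Psi>bij by (intro comp_inj_on) (auto simp: bij_betw_def)
  moreover have "finite (\<Phi> ` F)" "\<Phi> ` F \<subseteq> L" using F im by auto
  moreover have "\<forall>H. submonoid H (additive_monoid L) \<and> \<Phi> ` F \<subseteq> H \<longrightarrow> H = L" using gen by blast
  ultimately show "affine_semigroup (additive_monoid L)"
    unfolding affine_semigroup_def additive_monoid_simps using comm_monoid_additive_monoid[of L, OF L0 Ladd]
    by (intro conjI exI[of _ "\<Phi> ` F"] exI[of _ N] bexI[of _ "f \<circ> \<Psi>"])
qed

section \<open>Horizontal strips\<close>

lemma weights_P_subset: "weights_P \<subseteq> weights m" if "2 \<le> m"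
  using that by (auto simp: weights_P_def weights_def fundamental_weight_def)

lemma weights_P_dual_subset: "weights_P_dual m \<subseteq> weights m"
  by (auto simp: weights_P_dual_def weights_def fundamental_weight_def)

lemma dual_weight_weights_P:
  assumes "2 \<le> m"
  shows "dual_weight m (\<lambda>j. r * fundamental_weight 1 j) = (\<lambda>j. r * fundamental_weight (m - 1) j)"
proof -
  have w: "(\<lambda>j. r * fundamental_weight 1 j) \<in> weights m" using weights_P_subset[OF assms] by (auto simp: weights_P_def)
  show ?thesis
    by (rule ext, subst dual_weight_eq[OF w]) (use assms in \<open>auto simp: fundamental_weight_def\<close>)
qed

lemma dual_weight_weights_P_dual:
  assumes "2 \<le> m"
  shows "dual_weight m (\<lambda>j. r * fundamental_weight (m - 1) j) = (\<lambda>j. r * fundamental_weight 1 j)"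
proof -
  have w: "(\<lambda>j. r * fundamental_weight 1 j) \<in> weights m" using weights_P_subset[OF assms] by (auto simp: weights_P_def)
  show ?thesis using dual_weight_involution[OF w] by (simp only: dual_weight_weights_P[OF assms])
qed

text \<open>Weights of \<open>SL\<close> are partitions up to a simultaneous shift of all \<open>m\<close> entries; the shift
  is the witness \<open>c\<close>.\<close>

definition sl_strip :: "nat \<Rightarrow> (nat \<Rightarrow> nat) \<Rightarrow> (nat \<Rightarrow> nat) \<Rightarrow> nat \<Rightarrow> bool"
  where "sl_strip m \<mu> \<nu> r \<longleftrightarrow>
    (\<exists>c :: int. (\<forall>i\<in>{1..m}. int (\<mu> i) \<le> int (\<nu> i) + c) \<and> (\<forall>i\<in>{1..m - 1}. int (\<nu> (i + 1)) + c \<le> int (\<mu> i)) \<and>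
      (\<Sum>i = 1..m. int (\<nu> i)) + int m * c = (\<Sum>i = 1..m. int (\<mu> i)) + int r)"

lemma sum_reverse: "(\<Sum>i = 1..m. f (m + 1 - i)) = (\<Sum>i = 1..m. f i)" for f :: "nat \<Rightarrow> 'a :: comm_monoid_add"
  by (rule sum.reindex_bij_witness[of _ "\<lambda>i. m + 1 - i" "\<lambda>i. m + 1 - i"]) auto

lemma dual_weight_int:
  assumes "\<nu> \<in> weights m" "i \<in> {1..m}"
  shows "int (dual_weight m \<nu> i) = int (\<nu> 1) - int (\<nu> (m + 1 - i))"
proof (cases "i = m")
  case True
  then show ?thesis using assms by (simp add: dual_weight_eq[OF assms(1)])
next
  case False
  show ?thesis
  proof (cases "m + 1 - i = m")
    case True
    then show ?thesis using assms False weights_at_rank[OF assms(1)] by (auto simp: dual_weight_eq[OF assms(1)])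
  next
    case F: False
    have "\<nu> (m + 1 - i) \<le> \<nu> 1" by (rule weights_le_first[OF assms(1)]) (use assms False F in auto)
    then show ?thesis using assms False by (auto simp: dual_weight_eq[OF assms(1)])
  qed
qed

text \<open>Passing to the dual weight replaces \<open>\<nu> i\<close> by
  \<open>\<nu> 1 - \<nu> (m + 1 - i)\<close>, so the rectangle inequalities become interlacing
  inequalities with shift \<open>int c - int (\<nu> 1)\<close>.\<close>

lemma pieri_condition_dual_iff:
  assumes \<nu>: "\<nu> \<in> weights m"
  shows "pieri_condition m (dual_weight m \<nu>) r \<mu> \<longleftrightarrow> sl_strip m \<mu> \<nu> r"
proof -
  note d = dual_weight_int[OF \<nu>]
  have s: "(\<Sum>i = 1..m. int (dual_weight m \<nu> i)) = int m * int (\<nu> 1) - (\<Sum>i = 1..m. int (\<nu> i))"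
  proof -
    have "(\<Sum>i = 1..m. int (dual_weight m \<nu> i)) = (\<Sum>i = 1..m. int (\<nu> 1) - int (\<nu> (m + 1 - i)))"
      using d by (intro sum.cong) auto
    also have "\<dots> = int m * int (\<nu> 1) - (\<Sum>i = 1..m. int (\<nu> (m + 1 - i)))" by (simp add: sum_subtractf)
    finally show ?thesis using sum_reverse[of "\<lambda>i. int (\<nu> i)" m] by simp
  qed
  show ?thesis
  proof
    assume "pieri_condition m (dual_weight m \<nu>) r \<mu>"
    then obtain c where c: "\<forall>i\<in>{1..m}. dual_weight m \<nu> i + \<mu> (m + 1 - i) \<le> c"
      "\<forall>i\<in>{1..m - 1}. c \<le> dual_weight m \<nu> i + \<mu> (m - i)"
      "m * c = r + (\<Sum>i = 1..m. dual_weight m \<nu> i) + (\<Sum>i = 1..m. \<mu> i)"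
      unfolding pieri_condition_def by auto
    have "int (\<mu> i) \<le> int (\<nu> i) + (int c - int (\<nu> 1))" if "i \<in> {1..m}" for i
    proof -
      have i: "m + 1 - i \<in> {1..m}" "m + 1 - (m + 1 - i) = i" using that by auto
      show ?thesis using bspec[OF c(1) i(1)] d[OF i(1)] unfolding i(2) by linarith
    qed
    moreover have "int (\<nu> (i + 1)) + (int c - int (\<nu> 1)) \<le> int (\<mu> i)" if "i \<in> {1..m - 1}" for i
    proof -
      have i: "m - i \<in> {1..m - 1}" "m - i \<in> {1..m}" "m + 1 - (m - i) = i + 1" "m - (m - i) = i" using that by auto
      show ?thesis using bspec[OF c(2) i(1)] d[OF i(2)] unfolding i(3,4) by linarith
    qed
    moreover have "int m * int c = int r + (\<Sum>i = 1..m. int (dual_weight m \<nu> i)) + (\<Sum>i = 1..m. int (\<mu> i))"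
      using arg_cong[OF c(3), of int] by simp
    ultimately show "sl_strip m \<mu> \<nu> r" unfolding sl_strip_def s
      by (intro exI[of _ "int c - int (\<nu> 1)"] conjI ballI) (simp_all add: algebra_simps)
  next
    assume "sl_strip m \<mu> \<nu> r"
    then obtain c where c: "\<forall>i\<in>{1..m}. int (\<mu> i) \<le> int (\<nu> i) + c" "\<forall>i\<in>{1..m - 1}. int (\<nu> (i + 1)) + c \<le> int (\<mu> i)"
      "(\<Sum>i = 1..m. int (\<nu> i)) + int m * c = (\<Sum>i = 1..m. int (\<mu> i)) + int r"
      unfolding sl_strip_def by auto
    \<comment> \<open>The first inequality at \<open>i = 1\<close> makes
      \<open>int (\<nu> 1) + c\<close> non-negative, so \<open>nat\<close> loses nothing.\<close>
    define C where "C = nat (int (\<nu> 1) + c)"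
    show "pieri_condition m (dual_weight m \<nu>) r \<mu>"
    proof (cases "m = 0")
      case True
      then show ?thesis using c(3) by (auto simp: pieri_condition_def)
    next
      case False
      then have "1 \<in> {1..m}" by auto
      from bspec[OF c(1) this] have C: "int C = int (\<nu> 1) + c" by (simp add: C_def)
      have "dual_weight m \<nu> i + \<mu> (m + 1 - i) \<le> C" if "i \<in> {1..m}" for i
      proof -
        have "m + 1 - i \<in> {1..m}" using that by auto
        from bspec[OF c(1) this] show ?thesis using d[OF that] C by linarith
      qed
      moreover have "C \<le> dual_weight m \<nu> i + \<mu> (m - i)" if "i \<in> {1..m - 1}" for i
      proof -
        have i: "m - i \<in> {1..m - 1}" "i \<in> {1..m}" "m - i + 1 = m + 1 - i" using that by auto
        from bspec[OF c(2) i(1)] show ?thesis using d[OF i(2)] C unfolding i(3) by linarith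
      qed
      moreover have "m * C = r + (\<Sum>i = 1..m. dual_weight m \<nu> i) + (\<Sum>i = 1..m. \<mu> i)"
      proof -
        have "int (m * C) = int (r + (\<Sum>i = 1..m. dual_weight m \<nu> i) + (\<Sum>i = 1..m. \<mu> i))"
          using c(3) s by (simp add: C algebra_simps)
        then show ?thesis by (simp only: of_nat_eq_iff)
      qed
      ultimately show ?thesis unfolding pieri_condition_def by blast
    qed
  qed
qed

lemma pieri_condition_sym:
  assumes "pieri_condition m \<alpha> r \<gamma>"
  shows "pieri_condition m \<gamma> r \<alpha>"
proof -
  obtain c where c: "\<forall>i\<in>{1..m}. \<alpha> i + \<gamma> (m + 1 - i) \<le> c" "\<forall>i\<in>{1..m - 1}. c \<le> \<alpha> i + \<gamma> (m - i)"
    "m * c = r + (\<Sum>i = 1..m. \<alpha> i) + (\<Sum>i = 1..m. \<gamma> i)"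
    using assms unfolding pieri_condition_def by auto
  have "\<gamma> i + \<alpha> (m + 1 - i) \<le> c" if "i \<in> {1..m}" for i
  proof -
    have i: "m + 1 - i \<in> {1..m}" "m + 1 - (m + 1 - i) = i" using that by auto
    from bspec[OF c(1) i(1)] show ?thesis unfolding i(2) by simp
  qed
  moreover have "c \<le> \<gamma> i + \<alpha> (m - i)" if "i \<in> {1..m - 1}" for i
  proof -
    have i: "m - i \<in> {1..m - 1}" "m - (m - i) = i" using that by auto
    from bspec[OF c(2) i(1)] show ?thesis unfolding i(2) by simp
  qed
  ultimately show ?thesis unfolding pieri_condition_def using c(3) by (intro exI[of _ c]) auto
qed

lemma has_triple_invariant_iff_strip:
  assumes "\<mu> \<in> weights m" "\<nu> \<in> weights m" "2 \<le> m"
  shows "has_triple_invariant m (dual_weight m \<nu>) (\<lambda>j. r * fundamental_weight 1 j) \<mu> \<longleftrightarrow> sl_strip m \<mu> \<nu> r"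
  using has_triple_invariant_iff_pieri[OF dual_weight_weights[OF assms(2)] assms(1,3)]
    pieri_condition_dual_iff[OF assms(2)] by simp

text \<open>Dualising all three weights leads back to \<omega>_1 and moves the star from \<mu> to
  \<nu>. Compared with \<open>has_triple_invariant_iff_strip\<close>, the starred weight is now the
  smaller one.\<close>

lemma has_triple_invariant_iff_strip_dual:
  assumes \<mu>: "\<mu> \<in> weights m" and \<nu>: "\<nu> \<in> weights m" and m: "2 \<le> m"
  shows "has_triple_invariant m (dual_weight m \<mu>) (\<lambda>j. s * fundamental_weight (m - 1) j) \<nu> \<longleftrightarrow> sl_strip m \<mu> \<nu> s"
proof -
  have P: "(\<lambda>j. s * fundamental_weight 1 j) \<in> weights m" "(\<lambda>j. s * fundamental_weight (m - 1) j) \<in> weights m"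
    using weights_P_subset[OF m] weights_P_dual_subset[of m] by (auto simp: weights_P_def weights_P_dual_def)
  note d = dual_weight_weights[OF \<mu>] dual_weight_weights[OF \<nu>]
  have "has_triple_invariant m (dual_weight m \<mu>) (\<lambda>j. s * fundamental_weight (m - 1) j) \<nu> \<longleftrightarrow>
      has_triple_invariant m \<mu> (\<lambda>j. s * fundamental_weight 1 j) (dual_weight m \<nu>)"
    using has_triple_invariant_dual[OF _ d(1) P(2) \<nu> m] has_triple_invariant_dual[OF _ \<mu> P(1) d(2) m]
    unfolding dual_weight_weights_P[OF m] dual_weight_weights_P_dual[OF m] dual_weight_involution[OF \<mu>]
      dual_weight_involution[OF \<nu>] by blast
  also have "\<dots> \<longleftrightarrow> pieri_condition m \<mu> s (dual_weight m \<nu>)"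
    by (rule has_triple_invariant_iff_pieri[OF \<mu> d(2) m])
  also have "\<dots> \<longleftrightarrow> pieri_condition m (dual_weight m \<nu>) s \<mu>" using pieri_condition_sym by blast
  also have "\<dots> \<longleftrightarrow> sl_strip m \<mu> \<nu> s" by (rule pieri_condition_dual_iff[OF \<nu>])
  finally show ?thesis .
qed

section \<open>Weightings\<close>

lemma GL_weightsD:
  assumes "\<mu> \<in> GL_weights m"
  shows "1 \<le> i \<Longrightarrow> i \<le> j \<Longrightarrow> j \<le> m \<Longrightarrow> \<mu> j \<le> \<mu> i" "i \<notin> {1..m} \<Longrightarrow> \<mu> i = 0"
  using assms unfolding GL_weights_def by blast+

lemma GL_chainsD:
  assumes "\<xi> \<in> GL_chains m a"
  shows "k \<in> {1..a} \<Longrightarrow> \<xi> k \<in> GL_weights m" "k \<notin> {1..a} \<Longrightarrow> \<xi> k = 0"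
    "k \<in> {1..a - 1} \<Longrightarrow> interlaces m (\<xi> k) (\<xi> (k + 1))"
  using assms unfolding GL_chains_def by blast+

lemma GL_chains_add:
  assumes "\<xi> \<in> GL_chains m a" "\<xi>' \<in> GL_chains m a"
  shows "\<xi> + \<xi>' \<in> GL_chains m a"
  using assms unfolding GL_chains_def GL_weights_def interlaces_def by (auto intro!: add_mono)

lemma GL_chains_zero: "0 \<in> GL_chains m a"
  unfolding GL_chains_def GL_weights_def interlaces_def by auto

text \<open>Every inequality defining a chain compares two entries and holds for all chains. The
  hypothesis \<open>mono\<close> therefore has the form offered by \<open>closed\<close> in
  \<open>affine_semigroup_of_functionals\<close>.\<close>

lemma GL_chains_diff:
  assumes \<xi>: "\<xi> \<in> GL_chains m a" and \<xi>': "\<xi>' \<in> GL_chains m a"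
    and mono: "\<And>k l i j. k \<in> {1..a} \<Longrightarrow> l \<in> {1..a} \<Longrightarrow> i \<in> {1..m} \<Longrightarrow> j \<in> {1..m} \<Longrightarrow>
      (\<And>\<zeta>. \<zeta> \<in> GL_chains m a \<Longrightarrow> \<zeta> l j \<le> \<zeta> k i) \<Longrightarrow> \<xi> k i - \<xi> l j \<le> \<xi>' k i - \<xi>' l j"
  shows "\<xi>' - \<xi> \<in> GL_chains m a"
proof -
  have mono': "\<xi>' l j - \<xi> l j \<le> \<xi>' k i - \<xi> k i" if "k \<in> {1..a}" "l \<in> {1..a}" "i \<in> {1..m}" "j \<in> {1..m}"
    "\<And>\<zeta>. \<zeta> \<in> GL_chains m a \<Longrightarrow> \<zeta> l j \<le> \<zeta> k i" for k l i j
    using mono[OF that] by linarith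
  have "\<xi>' k j - \<xi> k j \<le> \<xi>' k i - \<xi> k i" if "k \<in> {1..a}" "1 \<le> i" "i \<le> j" "j \<le> m" for k i j
    by (rule mono') (use that in \<open>auto simp: GL_chains_def GL_weights_def\<close>)
  moreover have "\<xi>' k i - \<xi> k i \<le> \<xi>' (k + 1) i - \<xi> (k + 1) i" if "k \<in> {1..a - 1}" "i \<in> {1..m}" for k i
    by (rule mono') (use that in \<open>auto simp: GL_chains_def interlaces_def\<close>)
  moreover have "\<xi>' (k + 1) (i + 1) - \<xi> (k + 1) (i + 1) \<le> \<xi>' k i - \<xi> k i" if "k \<in> {1..a - 1}" "i \<in> {1..m - 1}" for k i
    by (rule mono') (use that in \<open>auto simp: GL_chains_def interlaces_def\<close>)
  moreover have "\<xi>' k i - \<xi> k i = 0" if "k \<in> {1..a}" "i \<notin> {1..m}" for k i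
    using that \<xi> \<xi>' GL_weightsD(2)[of "\<xi> k" m i] GL_weightsD(2)[of "\<xi>' k" m i] by (simp add: GL_chains_def)
  moreover have "\<xi>' k - \<xi> k = 0" if "k \<notin> {1..a}" for k
    using that \<xi> \<xi>' by (simp add: GL_chains_def)
  ultimately show ?thesis unfolding GL_chains_def GL_weights_def interlaces_def
    by (intro CollectI conjI ballI allI impI) auto
qed

text \<open>By interlacing, the last entries increase along the chain from the value 0 in row 1, and
  the last entry of each row is its smallest.\<close>

lemma GL_chains_nonneg:
  assumes \<xi>: "\<xi> \<in> GL_chains m a" "\<xi> 1 m = 0" and m: "1 \<le> m" and k: "k \<in> {1..a}" and i: "i \<in> {1..m}"
  shows "0 \<le> \<xi> k i"
proof -
  have "1 \<le> k" using k by simp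
  then have "k \<le> a \<longrightarrow> 0 \<le> \<xi> k m"
  proof (induction k rule: dec_induct)
    case base
    then show ?case using \<xi>(2) by simp
  next
    case (step k)
    show ?case
    proof
      assume "Suc k \<le> a"
      then have "interlaces m (\<xi> k) (\<xi> (k + 1))" using \<xi>(1) step(1) by (auto simp: GL_chains_def)
      then have "\<xi> k m \<le> \<xi> (k + 1) m" using m by (auto simp: interlaces_def)
      then show "0 \<le> \<xi> (Suc k) m" using step \<open>Suc k \<le> a\<close> by simp
    qed
  qed
  moreover have "\<xi> k m \<le> \<xi> k i" by (rule GL_weightsD(1)) (use \<xi>(1) k i in \<open>auto simp: GL_chains_def\<close>)
  ultimately show ?thesis using k by auto
qed

lemma GL_chains_eqI:
  assumes "\<xi> \<in> GL_chains m a" "\<xi>' \<in> GL_chains m a" "\<And>k i. k \<in> {1..a} \<Longrightarrow> i \<in> {1..m} \<Longrightarrow> \<xi> k i = \<xi>' k i"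
  shows "\<xi> = \<xi>'"
proof (intro ext)
  fix k i
  show "\<xi> k i = \<xi>' k i"
  proof (cases "k \<in> {1..a}")
    case True
    then show ?thesis using assms GL_weightsD(2)[of "\<xi> k" m i] GL_weightsD(2)[of "\<xi>' k" m i]
      by (cases "i \<in> {1..m}") (auto simp: GL_chains_def)
  next
    case False
    then show ?thesis using assms(1,2) by (simp add: GL_chains_def)
  qed
qed

definition flat :: "nat \<Rightarrow> (nat \<Rightarrow> int) \<Rightarrow> bool"
  where "flat m \<mu> \<longleftrightarrow> (\<forall>i \<in> {1..m - 1}. \<mu> i = \<mu> 1)"

lemma flatD: "flat m \<mu> \<Longrightarrow> i \<in> {1..m - 1} \<Longrightarrow> \<mu> i = \<mu> 1"
  unfolding flat_def by blast

lemma flat_zero: "flat m 0"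
  by (simp add: flat_def)

lemma flat_add:
  assumes "flat m \<mu>" "flat m \<nu>"
  shows "flat m (\<mu> + \<nu>)"
  unfolding flat_def
proof
  fix i assume i: "i \<in> {1..m - 1}"
  show "(\<mu> + \<nu>) i = (\<mu> + \<nu>) 1" by (simp only: plus_fun_apply flatD[OF assms(1) i] flatD[OF assms(2) i])
qed

lemma flat_diff:
  assumes "flat m \<mu>" "flat m \<nu>"
  shows "flat m (\<mu> - \<nu>)"
  unfolding flat_def
proof
  fix i assume i: "i \<in> {1..m - 1}"
  show "(\<mu> - \<nu>) i = (\<mu> - \<nu>) 1" by (simp only: minus_apply flatD[OF assms(1) i] flatD[OF assms(2) i])
qed

lemma admissible_weightings_iff:
  "w \<in> admissible_weightings m a b \<longleftrightarrow> fst w \<in> GL_chains m a \<and> snd w \<in> GL_chains m b \<and>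
    fst w 1 = snd w 1 \<and> fst w 1 m = 0 \<and>
    flat m (fst w a) \<and> flat m (snd w b)"
  by (cases w) (auto simp only: admissible_weightings_def flat_def mem_Collect_eq case_prod_conv fst_conv snd_conv)

lemma admissible_weightings_zero: "0 \<in> admissible_weightings m a b"
  by (auto simp: admissible_weightings_iff GL_chains_zero flat_zero)

lemma admissible_weightings_add:
  assumes "x \<in> admissible_weightings m a b" "y \<in> admissible_weightings m a b"
  shows "x + y \<in> admissible_weightings m a b"
  using assms by (auto simp: admissible_weightings_iff GL_chains_add flat_add)

text \<open>The coordinates are the entries of the two chains. The remaining conditions are linear
  equations and survive subtraction.\<close>

lemma affine_semigroup_admissible_weightings:
  assumes "1 \<le> m"
  shows "affine_semigroup (additive_monoid (admissible_weightings m a b))"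
proof -
  let ?W = "admissible_weightings m a b"
  define A B :: "((nat \<Rightarrow> nat \<Rightarrow> int) \<times> (nat \<Rightarrow> nat \<Rightarrow> int) \<Rightarrow> int) set"
    where "A = (\<lambda>(k, i) x. fst x k i) ` ({1..a} \<times> {1..m})" and "B = (\<lambda>(k, i) x. snd x k i) ` ({1..b} \<times> {1..m})"
  have A: "(\<lambda>x. fst x k i) \<in> A \<union> B" if "k \<in> {1..a}" "i \<in> {1..m}" for k i
    unfolding A_def using that by (intro UnI1 image_eqI[of _ _ "(k, i)"]) auto
  have B: "(\<lambda>x. snd x k i) \<in> A \<union> B" if "k \<in> {1..b}" "i \<in> {1..m}" for k i
    unfolding B_def using that by (intro UnI2 image_eqI[of _ _ "(k, i)"]) auto
  show ?thesis
  proof (rule affine_semigroup_of_functionals[of "A \<union> B"])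
    show "finite (A \<union> B)" by (simp add: A_def B_def)
    show "c (x + y) = c x + c y" if "c \<in> A \<union> B" for c x y using that by (auto simp: A_def B_def)
    show "0 \<le> c x" if "c \<in> A \<union> B" "x \<in> ?W" for c x
      using that GL_chains_nonneg[of "fst x" m a, OF _ _ assms] GL_chains_nonneg[of "snd x" m b, OF _ _ assms]
      by (auto simp: A_def B_def admissible_weightings_iff)
    show "x = y" if "x \<in> ?W" "y \<in> ?W" "\<And>c. c \<in> A \<union> B \<Longrightarrow> c x = c y" for x y
    proof (rule prod_eqI)
      show "fst x = fst y" by (rule GL_chains_eqI[of _ m a]) (use that(1,2) that(3)[OF A] in \<open>auto simp: admissible_weightings_iff\<close>)
      show "snd x = snd y" by (rule GL_chains_eqI[of _ m b]) (use that(1,2) that(3)[OF B] in \<open>auto simp: admissible_weightings_iff\<close>)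
    qed
    show "0 \<in> ?W" by (rule admissible_weightings_zero)
    show "x + y \<in> ?W" if "x \<in> ?W" "y \<in> ?W" for x y using that by (rule admissible_weightings_add)
    fix x y assume x: "x \<in> ?W" and y: "y \<in> ?W"
      and d: "\<And>c c'. c \<in> A \<union> B \<Longrightarrow> c' \<in> A \<union> B \<Longrightarrow> (\<And>z. z \<in> ?W \<Longrightarrow> c' z \<le> c z) \<Longrightarrow> c x - c' x \<le> c y - c' y"
    have "fst y - fst x \<in> GL_chains m a"
    proof (rule GL_chains_diff)
      fix k l i j assume kl: "k \<in> {1..a}" "l \<in> {1..a}" "i \<in> {1..m}" "j \<in> {1..m}"
        and le: "\<And>\<zeta>. \<zeta> \<in> GL_chains m a \<Longrightarrow> \<zeta> l j \<le> \<zeta> k i"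
      show "fst x k i - fst x l j \<le> fst y k i - fst y l j"
        by (rule d[OF A[OF kl(1,3)] A[OF kl(2,4)]]) (rule le, simp add: admissible_weightings_iff)
    qed (use x y in \<open>auto simp: admissible_weightings_iff\<close>)
    moreover have "snd y - snd x \<in> GL_chains m b"
    proof (rule GL_chains_diff)
      fix k l i j assume kl: "k \<in> {1..b}" "l \<in> {1..b}" "i \<in> {1..m}" "j \<in> {1..m}"
        and le: "\<And>\<zeta>. \<zeta> \<in> GL_chains m b \<Longrightarrow> \<zeta> l j \<le> \<zeta> k i"
      show "snd x k i - snd x l j \<le> snd y k i - snd y l j"
        by (rule d[OF B[OF kl(1,3)] B[OF kl(2,4)]]) (rule le, simp add: admissible_weightings_iff)
    qed (use x y in \<open>auto simp: admissible_weightings_iff\<close>)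
    ultimately show "y - x \<in> ?W" using x y unfolding admissible_weightings_iff
      by (elim conjE, intro conjI) (simp_all add: flat_diff)
  qed
qed

text \<open>The rows are numbered from $0$, from top to bottom; row $a - 1$ is the common row.\<close>

definition row :: "nat \<Rightarrow> (nat \<Rightarrow> nat \<Rightarrow> int) \<times> (nat \<Rightarrow> nat \<Rightarrow> int) \<Rightarrow> nat \<Rightarrow> nat \<Rightarrow> int"
  where "row a w p = (if p \<le> a - 1 then fst w (a - p) else snd w (p + 2 - a))"

text \<open>The rows shrink down to row \<open>a - 1\<close> and grow after it. Rows beyond
  \<open>a + b - 2\<close> are unconstrained, so equalities between row chains are claimed only up
  to that index.\<close>

definition row_chains :: "nat \<Rightarrow> nat \<Rightarrow> nat \<Rightarrow> (nat \<Rightarrow> nat \<Rightarrow> int) set"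
  where "row_chains m a b = {\<zeta>. (\<forall>p\<in>{0..a + b - 2}. \<zeta> p \<in> GL_weights m) \<and>
    (\<forall>p\<in>{1..a + b - 2}. if p < a then interlaces m (\<zeta> p) (\<zeta> (p - 1)) else interlaces m (\<zeta> (p - 1)) (\<zeta> p)) \<and>
    \<zeta> (a - 1) m = 0 \<and> flat m (\<zeta> 0) \<and> flat m (\<zeta> (a + b - 2))}"

lemma row_row_chains:
  assumes w: "w \<in> admissible_weightings m a b" and ab: "2 \<le> a" "2 \<le> b"
  shows "row a w \<in> row_chains m a b"
proof -
  from w have \<xi>: "fst w \<in> GL_chains m a" and \<eta>: "snd w \<in> GL_chains m b" and e: "fst w 1 = snd w 1" "fst w 1 m = 0"
    and f: "flat m (fst w a)" "flat m (snd w b)"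
    unfolding admissible_weightings_iff by blast+
  \<comment> \<open>At \<open>p = a - 1\<close> both \<open>a - p\<close> and
    \<open>p + 2 - a\<close> equal 1, so either chain may supply the common row.\<close>
  have r: "row a w p = snd w (p + 2 - a)" if "a - 1 \<le> p" for p
  proof (cases "p = a - 1")
    case True
    then have "a - p = 1" "p + 2 - a = 1" "p \<le> a - 1" using ab by linarith+
    then show ?thesis using e(1) by (simp only: row_def if_True)
  next
    case False
    then have "\<not> p \<le> a - 1" using that by linarith
    then show ?thesis by (simp only: row_def if_False)
  qed
  have 1: "row a w p \<in> GL_weights m" if "p \<le> a + b - 2" for p
  proof (cases "p \<le> a - 1")
    case True
    then have "a - p \<in> {1..a}" unfolding atLeastAtMost_iff using ab by linarith
    then show ?thesis using True GL_chainsD(1)[OF \<xi>] by (simp add: row_def)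
  next
    case False
    then have "p + 2 - a \<in> {1..b}" unfolding atLeastAtMost_iff using ab that by linarith
    then have "snd w (p + 2 - a) \<in> GL_weights m" by (rule GL_chainsD(1)[OF \<eta>])
    then show ?thesis unfolding row_def using False by simp
  qed
  have 2: "interlaces m (row a w p) (row a w (p - 1))" if "1 \<le> p" "p < a" for p
  proof -
    have "interlaces m (fst w (a - p)) (fst w (a - p + 1))"
      by (rule GL_chainsD(3)[OF \<xi>]) (use that in auto)
    moreover have "a - p + 1 = a - (p - 1)" "p \<le> a - 1" "p - 1 \<le> a - 1" using that by linarith+
    ultimately show ?thesis by (simp only: row_def if_True)
  qed
  have 3: "interlaces m (row a w (p - 1)) (row a w p)" if "a \<le> p" "p \<le> a + b - 2" for p
  proof -
    have i: "p + 1 - a \<in> {1..b - 1}" "p + 1 - a + 1 = p + 2 - a" "p - 1 + 2 - a = p + 1 - a" "a - 1 \<le> p" "a - 1 \<le> p - 1"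
      using that ab unfolding atLeastAtMost_iff by linarith+
    show ?thesis using GL_chainsD(3)[OF \<eta> i(1)] unfolding r[OF i(4)] r[OF i(5)] i(2,3) .
  qed
  have 4: "row a w (a - 1) m = 0" "row a w 0 = fst w a" "row a w (a + b - 2) = snd w b"
  proof -
    have i: "a - (a - 1) = 1" "a + b - 2 + 2 - a = b" "a - 1 \<le> a + b - 2" using ab by linarith+
    show "row a w (a - 1) m = 0" unfolding row_def i(1) using e(2) by simp
    show "row a w 0 = fst w a" by (simp add: row_def)
    show "row a w (a + b - 2) = snd w b" using r[OF i(3)] unfolding i(2) .
  qed
  show ?thesis unfolding row_chains_def mem_Collect_eq 4(2,3)
  proof (intro conjI ballI)
    fix p assume p: "p \<in> {1..a + b - 2}"
    show "if p < a then interlaces m (row a w p) (row a w (p - 1)) else interlaces m (row a w (p - 1)) (row a w p)"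
    proof (cases "p < a")
      case True
      then show ?thesis using 2[of p] p by simp
    next
      case False
      then show ?thesis using 3[of p] p by simp
    qed
  next
    show "row a w p \<in> GL_weights m" if "p \<in> {0..a + b - 2}" for p using 1[of p] that by simp
  qed (rule 4(1) f)+
qed

lemma row_inject:
  assumes w: "w \<in> admissible_weightings m a b" "w' \<in> admissible_weightings m a b" and ab: "2 \<le> a" "2 \<le> b"
    and eq: "\<And>p. p \<le> a + b - 2 \<Longrightarrow> row a w p = row a w' p"
  shows "w = w'"
proof (rule prod_eqI)
  show f: "fst w = fst w'"
  proof
    fix k
    show "fst w k = fst w' k"
    proof (cases "k \<in> {1..a}")
      case True
      then have "a - k \<le> a + b - 2" "a - k \<le> a - 1" "a - (a - k) = k" using ab unfolding atLeastAtMost_iff by linarith+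
      then show ?thesis using eq[of "a - k"] by (simp only: row_def if_True)
    qed (use w in \<open>simp add: admissible_weightings_iff GL_chains_def\<close>)
  qed
  show "snd w = snd w'"
  proof
    fix k
    consider "k \<notin> {1..b}" | "k = 1" | "k \<in> {2..b}" by fastforce
    then show "snd w k = snd w' k"
    proof cases
      case 1
      then show ?thesis using w by (simp add: admissible_weightings_iff GL_chains_def)
    next
      case 2
      then show ?thesis using w f by (simp add: admissible_weightings_iff)
    next
      case 3
      then have "k + a - 2 \<le> a + b - 2" "\<not> k + a - 2 \<le> a - 1" "k + a - 2 + 2 - a = k" using ab by auto
      then show ?thesis using eq[of "k + a - 2"] by (simp add: row_def)
    qed
  qed
qed

lemma row_chainsD:
  assumes "\<zeta> \<in> row_chains m a b"
  shows "p \<le> a + b - 2 \<Longrightarrow> \<zeta> p \<in> GL_weights m"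
    "p \<in> {1..a + b - 2} \<Longrightarrow> p < a \<Longrightarrow> interlaces m (\<zeta> p) (\<zeta> (p - 1))"
    "p \<in> {1..a + b - 2} \<Longrightarrow> \<not> p < a \<Longrightarrow> interlaces m (\<zeta> (p - 1)) (\<zeta> p)"
    "\<zeta> (a - 1) m = 0" "flat m (\<zeta> 0)" "flat m (\<zeta> (a + b - 2))"
proof -
  have *: "\<forall>p\<in>{0..a + b - 2}. \<zeta> p \<in> GL_weights m"
    "\<forall>p\<in>{1..a + b - 2}. if p < a then interlaces m (\<zeta> p) (\<zeta> (p - 1)) else interlaces m (\<zeta> (p - 1)) (\<zeta> p)"
    using assms unfolding row_chains_def by blast+
  show "p \<le> a + b - 2 \<Longrightarrow> \<zeta> p \<in> GL_weights m" using *(1) by simp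
  show "p \<in> {1..a + b - 2} \<Longrightarrow> p < a \<Longrightarrow> interlaces m (\<zeta> p) (\<zeta> (p - 1))"
    using bspec[OF *(2), of p] by simp
  show "p \<in> {1..a + b - 2} \<Longrightarrow> \<not> p < a \<Longrightarrow> interlaces m (\<zeta> (p - 1)) (\<zeta> p)"
    using bspec[OF *(2), of p] by simp
  show "\<zeta> (a - 1) m = 0" "flat m (\<zeta> 0)" "flat m (\<zeta> (a + b - 2))"
    using assms unfolding row_chains_def by blast+
qed

lemma GL_chainsI:
  assumes "\<And>k. k \<in> {1..a} \<Longrightarrow> \<xi> k \<in> GL_weights m" "\<And>k. k \<notin> {1..a} \<Longrightarrow> \<xi> k = 0"
    "\<And>k. k \<in> {1..a - 1} \<Longrightarrow> interlaces m (\<xi> k) (\<xi> (k + 1))"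
  shows "\<xi> \<in> GL_chains m a"
  unfolding GL_chains_def using assms by blast

lemma row_chains_obtain:
  assumes \<zeta>: "\<zeta> \<in> row_chains m a b" and ab: "2 \<le> a" "2 \<le> b"
  shows "\<exists>w \<in> admissible_weightings m a b. \<forall>p \<le> a + b - 2. row a w p = \<zeta> p"
proof -
  define \<xi> where "\<xi> k = (if k \<in> {1..a} then \<zeta> (a - k) else 0)" for k
  define \<eta> where "\<eta> k = (if k \<in> {1..b} then \<zeta> (k + a - 2) else 0)" for k
  note D = row_chainsD[OF \<zeta>]
  have \<xi>: "\<xi> k = \<zeta> (a - k)" if "1 \<le> k" "k \<le> a" for k using that by (simp add: \<xi>_def)
  have \<eta>: "\<eta> k = \<zeta> (k + a - 2)" if "1 \<le> k" "k \<le> b" for k using that by (simp add: \<eta>_def)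
  have "\<xi> \<in> GL_chains m a"
  proof (rule GL_chainsI)
    fix k assume k: "k \<in> {1..a}"
    then have "a - k \<le> a + b - 2" using ab unfolding atLeastAtMost_iff by linarith
    then show "\<xi> k \<in> GL_weights m" using \<xi>[of k] k D(1) by simp
  next
    fix k assume "k \<in> {1..a - 1}"
    then have "a - k \<in> {1..a + b - 2}" "a - k < a" "a - k - 1 = a - (k + 1)" and k: "1 \<le> k" "k \<le> a" "1 \<le> k + 1" "k + 1 \<le> a"
      using ab unfolding atLeastAtMost_iff by linarith+
    then show "interlaces m (\<xi> k) (\<xi> (k + 1))" using D(2)[of "a - k"] unfolding \<xi>[OF k(1,2)] \<xi>[OF k(3,4)] by simp
  qed (unfold \<xi>_def, rule if_not_P)
  moreover have "\<eta> \<in> GL_chains m b"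
  proof (rule GL_chainsI)
    fix k assume k: "k \<in> {1..b}"
    then have "k + a - 2 \<le> a + b - 2" unfolding atLeastAtMost_iff by linarith
    then show "\<eta> k \<in> GL_weights m" using \<eta>[of k] k D(1) by simp
  next
    fix k assume "k \<in> {1..b - 1}"
    then have "k + 1 + a - 2 \<in> {1..a + b - 2}" "\<not> k + 1 + a - 2 < a" and e: "k + 1 + a - 2 - 1 = k + a - 2"
      and k: "1 \<le> k" "k \<le> b" "1 \<le> k + 1" "k + 1 \<le> b"
      using ab unfolding atLeastAtMost_iff by linarith+
    then show "interlaces m (\<eta> k) (\<eta> (k + 1))"
      using D(3)[of "k + 1 + a - 2"] unfolding \<eta>[OF k(1,2)] \<eta>[OF k(3,4)] e by blast
  qed (unfold \<eta>_def, rule if_not_P)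
  moreover have "\<xi> 1 = \<zeta> (a - 1)" "\<eta> 1 = \<zeta> (a - 1)" "\<xi> a = \<zeta> 0" "\<eta> b = \<zeta> (a + b - 2)"
    using \<xi>[of 1] \<xi>[of a] \<eta>[of 1] \<eta>[of b] ab by (simp_all add: add.commute)
  ultimately have "(\<xi>, \<eta>) \<in> admissible_weightings m a b" using D(4,5,6) by (simp add: admissible_weightings_iff)
  moreover have "row a (\<xi>, \<eta>) p = \<zeta> p" if p: "p \<le> a + b - 2" for p
  proof (cases "p \<le> a - 1")
    case True
    then have "1 \<le> a - p" "a - p \<le> a" "a - (a - p) = p" using ab by linarith+
    then show ?thesis using True \<xi>[of "a - p"] by (simp add: row_def)
  next
    case False
    then have "1 \<le> p + 2 - a" "p + 2 - a \<le> b" "p + 2 - a + a - 2 = p" using ab p by linarith+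
    then show ?thesis using False \<eta>[of "p + 2 - a"] unfolding row_def by simp
  qed
  ultimately show ?thesis by blast
qed

text \<open>The restriction of a GL weight to SL: subtracting the last entry removes the power of
  the determinant.\<close>

definition sl_part :: "nat \<Rightarrow> (nat \<Rightarrow> int) \<Rightarrow> nat \<Rightarrow> nat"
  where "sl_part m \<mu> j = (if j \<in> {1..m - 1} then nat (\<mu> j - \<mu> m) else 0)"

lemma sl_part_int:
  assumes "\<mu> \<in> GL_weights m" "i \<in> {1..m}"
  shows "int (sl_part m \<mu> i) = \<mu> i - \<mu> m"
proof (cases "i = m")
  case False
  then show ?thesis using assms GL_weightsD(1)[OF assms(1), of i m] by (auto simp: sl_part_def)
qed (use assms in \<open>auto simp: sl_part_def\<close>)

lemma sl_part_weights:
  assumes "\<mu> \<in> GL_weights m"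
  shows "sl_part m \<mu> \<in> weights m"
proof -
  have "\<mu> j \<le> \<mu> i" if "1 \<le> i" "i \<le> j" "j \<le> m - 1" for i j
    by (rule GL_weightsD(1)[OF assms that(1,2)]) (use that in simp)
  then show ?thesis unfolding weights_def sl_part_def by (auto intro!: nat_mono)
qed

lemma sl_part_add:
  assumes "\<mu> \<in> GL_weights m" "\<nu> \<in> GL_weights m"
  shows "sl_part m (\<mu> + \<nu>) = sl_part m \<mu> + sl_part m \<nu>"
proof
  fix j
  show "sl_part m (\<mu> + \<nu>) j = (sl_part m \<mu> + sl_part m \<nu>) j"
  proof (cases "j \<in> {1..m - 1}")
    case True
    then have "j \<le> m" "1 \<le> j" by auto
    then have "\<mu> m \<le> \<mu> j" "\<nu> m \<le> \<nu> j" using GL_weightsD(1)[OF assms(1), of j m] GL_weightsD(1)[OF assms(2), of j m] by auto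
    then have "nat (\<mu> j + \<nu> j - (\<mu> m + \<nu> m)) = nat (\<mu> j - \<mu> m) + nat (\<nu> j - \<nu> m)" by linarith
    then show ?thesis using True by (simp add: sl_part_def)
  next
    case False
    then show ?thesis unfolding plus_fun_apply sl_part_def by (simp only: if_False add_0)
  qed
qed

lemma sum_sl_part:
  assumes "\<mu> \<in> GL_weights m"
  shows "(\<Sum>i = 1..m. int (sl_part m \<mu> i)) = (\<Sum>i = 1..m. \<mu> i) - int m * \<mu> m"
proof -
  have "(\<Sum>i = 1..m. int (sl_part m \<mu> i)) = (\<Sum>i = 1..m. \<mu> i - \<mu> m)"
    using sl_part_int[OF assms] by (intro sum.cong) auto
  then show ?thesis by (simp add: sum_subtractf)
qed

lemma GL_weights_eqI:
  assumes "\<mu> \<in> GL_weights m" "\<nu> \<in> GL_weights m" "sl_part m \<mu> = sl_part m \<nu>" "\<mu> m = \<nu> m"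
  shows "\<mu> = \<nu>"
proof
  fix i
  show "\<mu> i = \<nu> i"
    using sl_part_int[OF assms(1), of i] sl_part_int[OF assms(2), of i] assms(3,4)
      GL_weightsD(2)[OF assms(1), of i] GL_weightsD(2)[OF assms(2), of i] by (cases "i \<in> {1..m}") auto
qed

lemma sum_le_of_interlaces:
  assumes "interlaces m \<mu> \<nu>"
  shows "(\<Sum>i = 1..m. \<mu> i) \<le> (\<Sum>i = 1..m. \<nu> i)"
  using assms by (intro sum_mono) (auto simp: interlaces_def)

lemma sl_strip_of_interlaces:
  assumes i: "interlaces m \<mu> \<nu>" and \<mu>: "\<mu> \<in> GL_weights m" and \<nu>: "\<nu> \<in> GL_weights m"
  shows "sl_strip m (sl_part m \<mu>) (sl_part m \<nu>) (nat ((\<Sum>i = 1..m. \<nu> i) - (\<Sum>i = 1..m. \<mu> i)))"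
  unfolding sl_strip_def
\<comment> \<open>The shift restores the difference of the last entries that \<open>sl_part\<close>
  subtracts.\<close>
proof (intro exI[of _ "\<nu> m - \<mu> m"] conjI ballI)
  fix k assume k: "k \<in> {1..m}"
  show "int (sl_part m \<mu> k) \<le> int (sl_part m \<nu> k) + (\<nu> m - \<mu> m)"
    using i k sl_part_int[OF \<mu> k] sl_part_int[OF \<nu> k] by (auto simp: interlaces_def)
next
  fix k assume k: "k \<in> {1..m - 1}"
  then have k': "k \<in> {1..m}" "k + 1 \<in> {1..m}" by auto
  have "\<nu> (k + 1) \<le> \<mu> k" using i k by (auto simp: interlaces_def)
  then show "int (sl_part m \<nu> (k + 1)) + (\<nu> m - \<mu> m) \<le> int (sl_part m \<mu> k)"
    using sl_part_int[OF \<mu> k'(1)] sl_part_int[OF \<nu> k'(2)] by linarith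
next
  show "(\<Sum>i = 1..m. int (sl_part m \<nu> i)) + int m * (\<nu> m - \<mu> m) = (\<Sum>i = 1..m. int (sl_part m \<mu> i)) +
      int (nat ((\<Sum>i = 1..m. \<nu> i) - (\<Sum>i = 1..m. \<mu> i)))"
    unfolding sum_sl_part[OF \<mu>] sum_sl_part[OF \<nu>] using sum_le_of_interlaces[OF i] by (simp add: algebra_simps)
qed

section \<open>The correspondence between diagrams and tuples of triples\<close>

lemma sl_part_flat:
  assumes "flat m \<mu>"
  shows "sl_part m \<mu> = (\<lambda>j. nat (\<mu> 1 - \<mu> m) * fundamental_weight (m - 1) j)"
proof
  fix j
  show "sl_part m \<mu> j = nat (\<mu> 1 - \<mu> m) * fundamental_weight (m - 1) j"
  proof (cases "j \<in> {1..m - 1}")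
    case True
    from flatD[OF assms this] show ?thesis using True by (simp add: sl_part_def fundamental_weight_def)
  qed (auto simp: sl_part_def fundamental_weight_def)
qed

text \<open>The size of the horizontal strip between rows \<open>i - 1\<close> and \<open>i\<close>;
  the absolute value covers both the shrinking and the growing part.\<close>

definition step_size :: "nat \<Rightarrow> (nat \<Rightarrow> nat \<Rightarrow> int) \<Rightarrow> nat \<Rightarrow> nat"
  where "step_size m \<zeta> i = nat \<bar>(\<Sum>j = 1..m. \<zeta> i j) - (\<Sum>j = 1..m. \<zeta> (i - 1) j)\<bar>"

text \<open>Triple \<open>i\<close> joins rows \<open>i - 1\<close> and \<open>i\<close>. The upper
  row enters dualised, as the gluing condition of \<open>L_ab\<close> demands.\<close>

definition triples :: "nat \<Rightarrow> nat \<Rightarrow> nat \<Rightarrow> (nat \<Rightarrow> nat \<Rightarrow> int) \<Rightarrow> nat \<Rightarrow> weight_triple"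
  where "triples m a b \<zeta> i = (if i \<in> {1..a + b - 2} then
    (dual_weight m (sl_part m (\<zeta> (i - 1))),
     \<lambda>j. step_size m \<zeta> i * fundamental_weight (if i < a then 1 else m - 1) j,
     sl_part m (\<zeta> i)) else 0)"

lemma triples_inside:
  "i \<in> {1..a + b - 2} \<Longrightarrow> triples m a b \<zeta> i = (dual_weight m (sl_part m (\<zeta> (i - 1))),
    \<lambda>j. step_size m \<zeta> i * fundamental_weight (if i < a then 1 else m - 1) j, sl_part m (\<zeta> i))"
  unfolding triples_def by (rule if_P)

lemma triples_outside: "i \<notin> {1..a + b - 2} \<Longrightarrow> triples m a b \<zeta> i = 0"
  unfolding triples_def by (rule if_not_P)

text \<open>Since the first index lies below \<open>a\<close> and the last index
  \<open>a + b - 2\<close> is at least \<open>a\<close>, the special conditions at the two ends can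
  be stated independently of each other.\<close>

lemma L_factor_eq:
  assumes "2 \<le> a" "2 \<le> b" "i \<in> {1..a + b - 2}"
  shows "L_factor m a b i = L3 m (if i = 1 then weights_P else weights m)
    (if i < a then weights_P else weights_P_dual m) (if i = a + b - 2 then weights_P_dual m else weights m)"
  using assms by (auto simp: L_factor_def)

context
  fixes m a b :: nat
  assumes m: "2 \<le> m" and ab: "2 \<le> a" "2 \<le> b"
begin

lemma triples_L_ab:
  assumes \<zeta>: "\<zeta> \<in> row_chains m a b"
  shows "triples m a b \<zeta> \<in> L_ab m a b"
proof -
  note D = row_chainsD[OF \<zeta>]
  have w: "sl_part m (\<zeta> p) \<in> weights m" if "p \<le> a + b - 2" for p by (rule sl_part_weights[OF D(1)[OF that]])
  have "triples m a b \<zeta> i \<in> L_factor m a b i" if i: "i \<in> {1..a + b - 2}" for i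
  proof -
    have i': "i - 1 \<le> a + b - 2" "i \<le> a + b - 2" using i by auto
    \<comment> \<open>The top row is flat, so its \<open>sl_part\<close> is a multiple of
      \<omega>_{m-1}, and its dual is a multiple of \<omega>_1.\<close>
    have 1: "dual_weight m (sl_part m (\<zeta> (i - 1))) \<in> (if i = 1 then weights_P else weights m)"
    proof (cases "i = 1")
      case True
      have "dual_weight m (sl_part m (\<zeta> 0)) \<in> weights_P"
        unfolding sl_part_flat[OF D(5)] dual_weight_weights_P_dual[OF m] by (auto simp: weights_P_def)
      then show ?thesis using True by simp
    qed (use dual_weight_weights[OF w[OF i'(1)]] in simp)
    have 2: "(\<lambda>j. step_size m \<zeta> i * fundamental_weight (if i < a then 1 else m - 1) j) \<in>
        (if i < a then weights_P else weights_P_dual m)"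
      by (auto simp: weights_P_def weights_P_dual_def)
    have 3: "sl_part m (\<zeta> i) \<in> (if i = a + b - 2 then weights_P_dual m else weights m)"
    proof (cases "i = a + b - 2")
      case True
      have "sl_part m (\<zeta> (a + b - 2)) \<in> weights_P_dual m"
        unfolding sl_part_flat[OF D(6)] by (auto simp: weights_P_dual_def)
      then show ?thesis using True by simp
    qed (use w[OF i'(2)] in simp)
    have 4: "has_triple_invariant m (dual_weight m (sl_part m (\<zeta> (i - 1))))
        (\<lambda>j. step_size m \<zeta> i * fundamental_weight (if i < a then 1 else m - 1) j) (sl_part m (\<zeta> i))"
    proof (cases "i < a")
      case True
      note il = D(2)[OF i True]
      have s: "step_size m \<zeta> i = nat ((\<Sum>j = 1..m. \<zeta> (i - 1) j) - (\<Sum>j = 1..m. \<zeta> i j))"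
        using sum_le_of_interlaces[OF il] by (simp add: step_size_def)
      have "sl_strip m (sl_part m (\<zeta> i)) (sl_part m (\<zeta> (i - 1))) (step_size m \<zeta> i)"
        unfolding s by (rule sl_strip_of_interlaces[OF il D(1)[OF i'(2)] D(1)[OF i'(1)]])
      then show ?thesis using has_triple_invariant_iff_strip[OF w[OF i'(2)] w[OF i'(1)] m] True by simp
    next
      case False
      note il = D(3)[OF i False]
      have s: "step_size m \<zeta> i = nat ((\<Sum>j = 1..m. \<zeta> i j) - (\<Sum>j = 1..m. \<zeta> (i - 1) j))"
        using sum_le_of_interlaces[OF il] by (simp add: step_size_def)
      have "sl_strip m (sl_part m (\<zeta> (i - 1))) (sl_part m (\<zeta> i)) (step_size m \<zeta> i)"
        unfolding s by (rule sl_strip_of_interlaces[OF il D(1)[OF i'(1)] D(1)[OF i'(2)]])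
      then show ?thesis using has_triple_invariant_iff_strip_dual[OF w[OF i'(1)] w[OF i'(2)] m] False by simp
    qed
    show ?thesis using 1 2 3 4 i unfolding L_factor_eq[OF ab i] L3_def triples_def by simp
  qed
  moreover have "snd (snd (triples m a b \<zeta> i)) = dual_weight m (fst (triples m a b \<zeta> (i + 1)))"
    if "i \<in> {1..a + b - 3}" for i
  proof -
    have "i \<in> {1..a + b - 2}" "i + 1 \<in> {1..a + b - 2}" using that by auto
    then show ?thesis using dual_weight_involution[OF w[of i]] by (simp add: triples_def)
  qed
  ultimately show ?thesis unfolding L_ab_def by (auto simp: triples_def)
qed

text \<open>The triples give the \<open>sl_part\<close> of every row and, through the step sizes,
  the differences of consecutive row sums. The sum of a row exceeds that of its
  \<open>sl_part\<close> by \<open>m\<close> times the last entry, so normalising row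
  \<open>a - 1\<close> fixes all last entries.\<close>

lemma triples_inject:
  assumes \<zeta>: "\<zeta> \<in> row_chains m a b" and \<zeta>': "\<zeta>' \<in> row_chains m a b"
    and eq: "triples m a b \<zeta> = triples m a b \<zeta>'" and p: "p \<le> a + b - 2"
  shows "\<zeta> p = \<zeta>' p"
proof -
  note D = row_chainsD[OF \<zeta>] and D' = row_chainsD[OF \<zeta>']
  have eq': "dual_weight m (sl_part m (\<zeta> (i - 1))) = dual_weight m (sl_part m (\<zeta>' (i - 1)))"
    "(\<lambda>j. step_size m \<zeta> i * fundamental_weight (if i < a then 1 else m - 1) j) =
     (\<lambda>j. step_size m \<zeta>' i * fundamental_weight (if i < a then 1 else m - 1) j)"
    "sl_part m (\<zeta> i) = sl_part m (\<zeta>' i)" if "i \<in> {1..a + b - 2}" for i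
    using fun_cong[OF eq, of i] that by (simp_all add: triples_def)
  have sl: "sl_part m (\<zeta> p) = sl_part m (\<zeta>' p)" if "p \<le> a + b - 2" for p
  proof (cases "p = 0")
    case True
    have "1 \<in> {1..a + b - 2}" using ab by auto
    from eq'(1)[OF this] have "dual_weight m (dual_weight m (sl_part m (\<zeta> p))) = dual_weight m (dual_weight m (sl_part m (\<zeta>' p)))"
      using True by simp
    then show ?thesis using dual_weight_involution[OF sl_part_weights[OF D(1)[OF that]]]
        dual_weight_involution[OF sl_part_weights[OF D'(1)[OF that]]] by simp
  next
    case False
    then show ?thesis using eq'(3)[of p] that by simp
  qed
  have st: "step_size m \<zeta> i = step_size m \<zeta>' i" if "i \<in> {1..a + b - 2}" for i
    using fun_cong[OF eq'(2)[OF that], of 1] m by (auto simp: fundamental_weight_def split: if_splits)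
  define S where "S \<xi> p = (\<Sum>j = 1..m. \<xi> p j)" for \<xi> :: "nat \<Rightarrow> nat \<Rightarrow> int" and p
  have d: "S \<zeta> i - S \<zeta> (i - 1) = S \<zeta>' i - S \<zeta>' (i - 1)" if i: "i \<in> {1..a + b - 2}" for i
  proof (cases "i < a")
    case True
    show ?thesis using st[OF i] sum_le_of_interlaces[OF D(2)[OF i True]] sum_le_of_interlaces[OF D'(2)[OF i True]]
      by (simp add: step_size_def S_def)
  next
    case False
    show ?thesis using st[OF i] sum_le_of_interlaces[OF D(3)[OF i False]] sum_le_of_interlaces[OF D'(3)[OF i False]]
      by (simp add: step_size_def S_def)
  qed
  have sm: "S \<zeta> p - int m * \<zeta> p m = S \<zeta>' p - int m * \<zeta>' p m" if "p \<le> a + b - 2" for p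
    using sum_sl_part[OF D(1)[OF that]] sum_sl_part[OF D'(1)[OF that]] sl[OF that] by (simp add: S_def)
  \<comment> \<open>The row sums of the two chains differ by a constant, which is then evaluated at
    row \<open>a - 1\<close>.\<close>
  have diff0: "p \<le> a + b - 2 \<longrightarrow> S \<zeta> p - S \<zeta>' p = S \<zeta> 0 - S \<zeta>' 0" for p
  proof (induction p)
    case (Suc p)
    then show ?case using d[of "Suc p"] by auto
  qed simp
  have "a - 1 \<le> a + b - 2" using ab by auto
  then have "S \<zeta> (a - 1) = S \<zeta>' (a - 1)" using sm[of "a - 1"] D(4) D'(4) by simp
  then have "S \<zeta> p = S \<zeta>' p" using diff0[of p] diff0[of "a - 1"] p \<open>a - 1 \<le> a + b - 2\<close> by linarith
  then have "int m * \<zeta> p m = int m * \<zeta>' p m" using sm[OF p] by linarith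
  then have "\<zeta> p m = \<zeta>' p m" using m by simp
  then show ?thesis by (intro GL_weights_eqI[OF D(1)[OF p] D'(1)[OF p] sl[OF p]])
qed

text \<open>Each strip condition supplies a shift between neighbouring weights; adding up these
  shifts, starting from the common row, places all weights as rows of one diagram.\<close>

lemma triples_surj:
  assumes t: "t \<in> L_ab m a b"
  shows "\<exists>\<zeta> \<in> row_chains m a b. triples m a b \<zeta> = t"
proof -
  let ?n = "a + b - 2"
  have n: "1 \<in> {1..?n}" using ab by auto
  define f where "f i = (if i < a then 1 else m - 1)" for i
  have t3: "t i \<in> L3 m (if i = 1 then weights_P else weights m)
    (if i < a then weights_P else weights_P_dual m) (if i = ?n then weights_P_dual m else weights m)"
    if "i \<in> {1..?n}" for i
  proof -
    have "t i \<in> L_factor m a b i" using t that unfolding L_ab_def by blast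
    then show ?thesis unfolding L_factor_eq[OF ab that] .
  qed
  have t0: "t i = 0" if "i \<notin> {1..?n}" for i using t that unfolding L_ab_def by blast
  have glue: "snd (snd (t i)) = dual_weight m (fst (t (i + 1)))" if "i \<in> {1..a + b - 3}" for i
    using t that unfolding L_ab_def by blast
  have t1: "fst (t i) \<in> weights m" and t2: "\<exists>r. fst (snd (t i)) = (\<lambda>j. r * fundamental_weight (f i) j)"
    and tw3: "snd (snd (t i)) \<in> weights m"
    and ti: "has_triple_invariant m (fst (t i)) (fst (snd (t i))) (snd (snd (t i)))"
    if "i \<in> {1..?n}" for i
  proof -
    obtain u v w where tt: "t i = (u, v, w)" by (cases "t i")
    from t3[OF that] have "u \<in> (if i = 1 then weights_P else weights m)" "v \<in> (if i < a then weights_P else weights_P_dual m)"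
      "w \<in> (if i = ?n then weights_P_dual m else weights m)" "has_triple_invariant m u v w"
      unfolding tt L3_def by simp_all
    then show "fst (t i) \<in> weights m" "\<exists>r. fst (snd (t i)) = (\<lambda>j. r * fundamental_weight (f i) j)"
      "snd (snd (t i)) \<in> weights m" "has_triple_invariant m (fst (t i)) (fst (snd (t i))) (snd (snd (t i)))"
      using weights_P_subset[OF m] weights_P_dual_subset[of m] unfolding tt f_def
      by (auto simp: weights_P_def weights_P_dual_def split: if_splits)
  qed
  have "\<forall>i\<in>{1..?n}. \<exists>r. fst (snd (t i)) = (\<lambda>j. r * fundamental_weight (f i) j)" using t2 by blast
  from bchoice[OF this] obtain r where r: "\<forall>i\<in>{1..?n}. fst (snd (t i)) = (\<lambda>j. r i * fundamental_weight (f i) j)" ..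
  \<comment> \<open>The gluing condition makes row \<open>p\<close> both the third weight of triple
    \<open>p\<close> and the dual of the first weight of triple \<open>p + 1\<close>; row 0 has only
    the latter description.\<close>
  define \<nu> where "\<nu> p = (if p = 0 then dual_weight m (fst (t 1)) else snd (snd (t p)))" for p
  have \<nu>: "\<nu> p \<in> weights m" if "p \<le> ?n" for p
    using tw3[of p] dual_weight_weights[OF t1[OF n]] that by (simp add: \<nu>_def)
  have fst_t: "fst (t i) = dual_weight m (\<nu> (i - 1))" if i: "i \<in> {1..?n}" for i
  proof (cases "i = 1")
    case True
    then show ?thesis using dual_weight_involution[OF t1[OF n]] by (simp add: \<nu>_def)
  next
    case False
    then have "i - 1 \<in> {1..a + b - 3}" "i - 1 + 1 = i" "i - 1 \<noteq> 0" using i by auto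
    then show ?thesis using glue[of "i - 1"] dual_weight_involution[OF t1[OF i]] by (simp add: \<nu>_def)
  qed
  have t_eq: "t i = (dual_weight m (\<nu> (i - 1)), \<lambda>j. r i * fundamental_weight (f i) j, \<nu> i)" if "i \<in> {1..?n}" for i
    using fst_t[OF that] bspec[OF r that] that by (simp add: \<nu>_def prod_eq_iff)
  have strip: "sl_strip m (if i < a then \<nu> i else \<nu> (i - 1)) (if i < a then \<nu> (i - 1) else \<nu> i) (r i)"
    if i: "i \<in> {1..?n}" for i
  proof -
    have inv: "has_triple_invariant m (dual_weight m (\<nu> (i - 1))) (\<lambda>j. r i * fundamental_weight (f i) j) (\<nu> i)"
      using ti[OF i] unfolding t_eq[OF i] by simp
    have w: "\<nu> (i - 1) \<in> weights m" "\<nu> i \<in> weights m" using \<nu> i by auto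
    show ?thesis
    proof (cases "i < a")
      case True
      then show ?thesis using inv has_triple_invariant_iff_strip[OF w(2,1) m] by (simp add: f_def)
    next
      case False
      then show ?thesis using inv has_triple_invariant_iff_strip_dual[OF w m] by (simp add: f_def)
    qed
  qed
  then have "\<forall>i\<in>{1..?n}. \<exists>c :: int.
    (\<forall>k\<in>{1..m}. int ((if i < a then \<nu> i else \<nu> (i - 1)) k) \<le> int ((if i < a then \<nu> (i - 1) else \<nu> i) k) + c) \<and>
    (\<forall>k\<in>{1..m - 1}. int ((if i < a then \<nu> (i - 1) else \<nu> i) (k + 1)) + c \<le> int ((if i < a then \<nu> i else \<nu> (i - 1)) k)) \<and>
    (\<Sum>k = 1..m. int ((if i < a then \<nu> (i - 1) else \<nu> i) k)) + int m * c =
    (\<Sum>k = 1..m. int ((if i < a then \<nu> i else \<nu> (i - 1)) k)) + int (r i)"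
    unfolding sl_strip_def by blast
  from bchoice[OF this] obtain c where c: "\<forall>i\<in>{1..?n}.
    (\<forall>k\<in>{1..m}. int ((if i < a then \<nu> i else \<nu> (i - 1)) k) \<le> int ((if i < a then \<nu> (i - 1) else \<nu> i) k) + c i) \<and>
    (\<forall>k\<in>{1..m - 1}. int ((if i < a then \<nu> (i - 1) else \<nu> i) (k + 1)) + c i \<le> int ((if i < a then \<nu> i else \<nu> (i - 1)) k)) \<and>
    (\<Sum>k = 1..m. int ((if i < a then \<nu> (i - 1) else \<nu> i) k)) + int m * c i =
    (\<Sum>k = 1..m. int ((if i < a then \<nu> i else \<nu> (i - 1)) k)) + int (r i)" ..
  \<comment> \<open>The shift of row \<open>p\<close>. Rows grow away from row \<open>a - 1\<close>
    in both directions, so the shifts add up outwards, and the empty sum at \<open>a - 1\<close>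
    gives last entry 0 there.\<close>
  define z where "z p = (if p \<le> a - 1 then \<Sum>i = p + 1..a - 1. c i else \<Sum>i = a..p. c i)" for p
  have z1: "z (p - 1) = z p + c p" if "1 \<le> p" "p < a" for p
  proof -
    have "{p..a - 1} = insert p {p + 1..a - 1}" using that by auto
    moreover have "p \<le> a - 1" "p - 1 \<le> a - 1" "p - 1 + 1 = p" using that by linarith+
    ultimately show ?thesis by (simp add: z_def)
  qed
  have z2: "z p = z (p - 1) + c p" if "\<not> p < a" for p
  proof (cases "p = a")
    case True
    then show ?thesis using ab by (simp add: z_def)
  next
    case False
    then have "{a..p} = insert p {a..p - 1}" "p \<notin> {a..p - 1}" "\<not> p - 1 \<le> a - 1" "\<not> p \<le> a - 1" using that ab by auto
    then show ?thesis by (simp add: z_def)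
  qed
  define \<zeta> where "\<zeta> p k = (if k \<in> {1..m} then int (\<nu> p k) + z p else 0)" for p k
  have \<nu>m: "\<nu> p m = 0" if "p \<le> ?n" for p using weights_at_rank[OF \<nu>[OF that]] m by simp
  have GL: "\<zeta> p \<in> GL_weights m" if p: "p \<le> ?n" for p
  proof -
    have "\<nu> p l \<le> \<nu> p k" if "1 \<le> k" "k \<le> l" "l \<le> m" for k l
    proof (cases "l = m")
      case True
      then show ?thesis using \<nu>m[OF p] by simp
    next
      case False
      then show ?thesis using \<nu>[OF p] that unfolding weights_def by simp
    qed
    then show ?thesis unfolding GL_weights_def \<zeta>_def by auto
  qed
  have il1: "interlaces m (\<zeta> p) (\<zeta> (p - 1))" if p: "p \<in> {1..?n}" and pa: "p < a" for p
    using bspec[OF c p] z1[of p] p pa by (auto simp: interlaces_def \<zeta>_def algebra_simps)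
  have il2: "interlaces m (\<zeta> (p - 1)) (\<zeta> p)" if p: "p \<in> {1..?n}" and pa: "\<not> p < a" for p
    using bspec[OF c p] z2[of p] p pa by (auto simp: interlaces_def \<zeta>_def algebra_simps)
  have sl: "sl_part m (\<zeta> p) = \<nu> p" if p: "p \<le> ?n" for p
  proof
    fix k
    show "sl_part m (\<zeta> p) k = \<nu> p k"
    proof (cases "k \<in> {1..m - 1}")
      case True
      then show ?thesis using \<nu>m[OF p] m by (auto simp: sl_part_def \<zeta>_def)
    next
      case False
      then show ?thesis using \<nu>[OF p] unfolding weights_def sl_part_def by auto
    qed
  qed
  have S: "(\<Sum>k = 1..m. \<zeta> p k) = (\<Sum>k = 1..m. int (\<nu> p k)) + int m * z p" for p
    by (simp add: \<zeta>_def sum.distrib)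
  have st: "step_size m \<zeta> i = r i" if i: "i \<in> {1..?n}" for i
  proof (cases "i < a")
    case True
    have "(\<Sum>k = 1..m. int (\<nu> (i - 1) k)) + int m * c i = (\<Sum>k = 1..m. int (\<nu> i k)) + int (r i)"
      using bspec[OF c i] True by simp
    moreover have "z (i - 1) = z i + c i" using z1[of i] True i by simp
    ultimately show ?thesis unfolding step_size_def S by (simp add: distrib_left)
  next
    case False
    have "(\<Sum>k = 1..m. int (\<nu> i k)) + int m * c i = (\<Sum>k = 1..m. int (\<nu> (i - 1) k)) + int (r i)"
      using bspec[OF c i] False by simp
    moreover have "z i = z (i - 1) + c i" by (rule z2[OF False])
    ultimately show ?thesis unfolding step_size_def S by (simp add: distrib_left)
  qed
  have flat: "flat m (\<zeta> p)" if "\<nu> p \<in> weights_P_dual m" for p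
    using that by (auto simp: weights_P_dual_def fundamental_weight_def \<zeta>_def flat_def)
  have "fst (t 1) \<in> weights_P" using t3[OF n] unfolding L3_def by auto
  then have \<nu>0: "\<nu> 0 \<in> weights_P_dual m"
    using dual_weight_weights_P[OF m] by (auto simp: \<nu>_def weights_P_def weights_P_dual_def)
  have "?n \<in> {1..?n}" using ab by auto
  from t3[OF this] have "snd (snd (t ?n)) \<in> weights_P_dual m" unfolding L3_def by auto
  then have \<nu>n: "\<nu> ?n \<in> weights_P_dual m" using ab by (simp add: \<nu>_def)
  have "\<zeta> (a - 1) m = 0" using \<nu>m[of "a - 1"] ab by (simp add: \<zeta>_def z_def)
  then have "\<zeta> \<in> row_chains m a b"
    unfolding row_chains_def using GL il1 il2 flat[OF \<nu>0] flat[OF \<nu>n] by auto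
  moreover have "triples m a b \<zeta> = t"
  proof
    fix i
    show "triples m a b \<zeta> i = t i"
    proof (cases "i \<in> {1..?n}")
      case True
      then have "i - 1 \<le> ?n" "i \<le> ?n" by auto
      then show ?thesis using True t_eq[OF True] sl st[OF True] by (simp add: triples_def f_def)
    next
      case False
      then show ?thesis using t0[OF False] triples_outside by simp
    qed
  qed
  ultimately show ?thesis by blast
qed

lemma triples_add:
  assumes \<zeta>: "\<zeta> \<in> row_chains m a b" and \<zeta>': "\<zeta>' \<in> row_chains m a b"
  shows "triples m a b (\<zeta> + \<zeta>') = triples m a b \<zeta> + triples m a b \<zeta>'"
proof
  fix i
  note D = row_chainsD[OF \<zeta>] and D' = row_chainsD[OF \<zeta>']
  show "triples m a b (\<zeta> + \<zeta>') i = (triples m a b \<zeta> + triples m a b \<zeta>') i"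
  proof (cases "i \<in> {1..a + b - 2}")
    case i: True
    then have i': "i - 1 \<le> a + b - 2" "i \<le> a + b - 2" by auto
    have sl: "sl_part m (\<zeta> p + \<zeta>' p) = sl_part m (\<zeta> p) + sl_part m (\<zeta>' p)" if "p \<le> a + b - 2" for p
      by (rule sl_part_add[OF D(1)[OF that] D'(1)[OF that]])
    have dual: "dual_weight m (sl_part m (\<zeta> (i - 1)) + sl_part m (\<zeta>' (i - 1))) =
      dual_weight m (sl_part m (\<zeta> (i - 1))) + dual_weight m (sl_part m (\<zeta>' (i - 1)))"
      by (rule dual_weight_add[OF sl_part_weights[OF D(1)[OF i'(1)]] sl_part_weights[OF D'(1)[OF i'(1)]]])
    \<comment> \<open>The sign of the difference of row sums at step \<open>i\<close> is the same
      for all row chains, so the absolute value is additive here.\<close>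
    have st: "step_size m (\<zeta> + \<zeta>') i = step_size m \<zeta> i + step_size m \<zeta>' i"
    proof (cases "i < a")
      case True
      show ?thesis using sum_le_of_interlaces[OF D(2)[OF i True]] sum_le_of_interlaces[OF D'(2)[OF i True]]
        by (simp add: step_size_def sum.distrib)
    next
      case False
      show ?thesis using sum_le_of_interlaces[OF D(3)[OF i False]] sum_le_of_interlaces[OF D'(3)[OF i False]]
        by (simp add: step_size_def sum.distrib)
    qed
    have mid: "(\<lambda>j. (k + l) * fundamental_weight d j) =
      (\<lambda>j. k * fundamental_weight d j) + (\<lambda>j. l * fundamental_weight d j)" for k l d
      by (rule ext) (simp add: add_mult_distrib)
    show ?thesis
      unfolding plus_fun_apply[of "triples m a b \<zeta>"] plus_fun_apply[of \<zeta>] triples_inside[OF i] st sl[OF i'(1)] sl[OF i'(2)] dual mid by (simp only: add_Pair)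
  next
    case False
    then show ?thesis by (simp add: triples_outside)
  qed
qed

end

theorem proposition6p5:
  fixes m a b :: nat
  assumes "m \<ge> 2" and "a \<ge> 2" and "b \<ge> 2"
  shows "affine_semigroup (additive_monoid (L_ab m a b)) \<and>
         affine_semigroup (additive_monoid (admissible_weightings m a b)) \<and>
         additive_monoid (L_ab m a b) \<cong> additive_monoid (admissible_weightings m a b)"
proof -
  let ?W = "admissible_weightings m a b"
  let ?\<Phi> = "\<lambda>w. triples m a b (row a w)"
  have row: "row a w \<in> row_chains m a b" if "w \<in> ?W" for w by (rule row_row_chains[OF that assms(2,3)])
  have add: "?\<Phi> (x + y) = ?\<Phi> x + ?\<Phi> y" if "x \<in> ?W" "y \<in> ?W" for x y
  proof -
    have "row a (x + y) = row a x + row a y" by (auto simp: row_def)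
    then show ?thesis using triples_add[OF assms row[OF that(1)] row[OF that(2)]] by simp
  qed
  have zero: "?\<Phi> 0 = 0"
    using add[OF admissible_weightings_zero admissible_weightings_zero] by simp
  have bij: "bij_betw ?\<Phi> ?W (L_ab m a b)"
  proof (intro bij_betw_imageI inj_onI equalityI subsetI)
    fix x y assume xy: "x \<in> ?W" "y \<in> ?W" "?\<Phi> x = ?\<Phi> y"
    show "x = y"
      by (rule row_inject[OF xy(1,2) assms(2,3)]) (rule triples_inject[OF assms row[OF xy(1)] row[OF xy(2)] xy(3)])
  next
    fix t assume "t \<in> ?\<Phi> ` ?W"
    then obtain w where "w \<in> ?W" "t = ?\<Phi> w" by blast
    then show "t \<in> L_ab m a b" using triples_L_ab[OF assms row] by simp
  next
    fix t assume "t \<in> L_ab m a b"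
    then obtain \<zeta> where \<zeta>: "\<zeta> \<in> row_chains m a b" "triples m a b \<zeta> = t" using triples_surj[OF assms] by blast
    obtain w where w: "w \<in> ?W" "\<forall>p \<le> a + b - 2. row a w p = \<zeta> p" using row_chains_obtain[OF \<zeta>(1) assms(2,3)] by blast
    \<comment> \<open>\<open>row a w\<close> and \<open>\<zeta>\<close> agree only up to
      \<open>a + b - 2\<close>, but \<open>triples\<close> reads no further rows.\<close>
    have "?\<Phi> w = triples m a b \<zeta>"
    proof
      fix i
      show "?\<Phi> w i = triples m a b \<zeta> i" using w(2) by (auto simp: triples_def step_size_def)
    qed
    then have "t = ?\<Phi> w" using \<zeta>(2) by simp
    then show "t \<in> ?\<Phi> ` ?W" using w(1) by (rule image_eqI)
  qed
  have aff: "affine_semigroup (additive_monoid ?W)"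
    by (rule affine_semigroup_admissible_weightings) (use assms(1) in simp)
  show ?thesis using affine_semigroup_image[OF aff bij add zero] aff by blast
qed

end
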